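(* Let $(S,\mathfrak m)$ be a complete regular local ring of dimension $2$. Suppose that $R=S/(f_1\cdots f_n)$ is reduced, where $f_1,\dots,f_n$ are prime elements of $S$ with $f_i\notin\mathfrak m^2$ for every $i$. Then for any permutation $\omega$ of $\{1,\dots,n\}$, the module $S^{\omega}$ is a basic cluster tilting object in $\mathrm{MCM}(R)$.
   Context: $\mathrm{MCM}(R)$ denotes the category of (finitely generated) maximal Cohen-Macaulay $R$-modules. $\mathrm{add}(M)$ consists of the direct summands of finite direct sums of copies of $M$. A module $M\in\mathrm{MCM}(R)$ is cluster tilting if $$\mathrm{add}(M)=\{X\in\mathrm{MCM}(R)\mid \mathrm{Ext}^1_R(X,M)=0\}=\{X\in\mathrm{MCM}(R)\mid \mathrm{Ext}^1_R(M,X)=0\}.$$ An object of $\mathrm{MCM}(R)$ is basic if any indecomposable direct summand occurs only once (i.e. its indecomposable direct summands are pairwise non-isomorphic). For a permutation $\omega$ of $\{1,\dots,n\}$, set $S^{\omega}_i=S/\big(\prod_{j=1}^i f_{\omega(j)}\big)$, an $R$-module, and $S^{\omega}=\bigoplus_{i=1}^n S^{\omega}_i$. *)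

theory Defs
  imports
    "HOL-Algebra.Algebra"
    "HOL-Library.Extended_Nat"
    "HOL-Combinatorics.Permutations"
begin

section \<open>Commutative rings\<close>

definition local_ring :: "('a, 'r) ring_scheme \<Rightarrow> bool" where
  "local_ring R \<longleftrightarrow> cring R \<and> (\<exists>!I. maximalideal I R)"

text \<open>Only meaningful for local rings.\<close>
definition max_ideal :: "('a, 'r) ring_scheme \<Rightarrow> 'a set" where
  "max_ideal R = (THE I. maximalideal I R)"

definition ideal_pow :: "('a, 'r) ring_scheme \<Rightarrow> 'a set \<Rightarrow> nat \<Rightarrow> 'a set" where
  "ideal_pow R I k = I [^]\<^bsub>ideals_set R\<^esub> k"

definition krull_dim :: "('a, 'r) ring_scheme \<Rightarrow> enat" where
  "krull_dim R = Sup {enat l | l. \<exists>P :: nat \<Rightarrow> 'a set.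
     (\<forall>i\<le>l. primeideal (P i) R) \<and> (\<forall>i<l. P i \<subset> P (Suc i))}"

definition regular_local_ring :: "('a, 'r) ring_scheme \<Rightarrow> bool" where
  "regular_local_ring R \<longleftrightarrow> local_ring R \<and> noetherian_ring R \<and>
     (\<exists>A. A \<subseteq> carrier R \<and> finite A \<and> enat (card A) = krull_dim R \<and>
        max_ideal R = Idl\<^bsub>R\<^esub> A)"

text \<open>The canonical map from \<open>R\<close> to the inverse limit of the \<open>R/\<mm>\<^sup>i\<close> is bijective; an element of
  the limit is given by a compatible sequence of representatives.\<close>
definition complete_local_ring :: "('a, 'r) ring_scheme \<Rightarrow> bool" where
  "complete_local_ring R \<longleftrightarrow> local_ring R \<and>
     (\<forall>x :: nat \<Rightarrow> 'a.
        (\<forall>i. x i \<in> carrier R \<and> x (Suc i) \<ominus>\<^bsub>R\<^esub> x i \<in> ideal_pow R (max_ideal R) i) \<longrightarrow>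
        (\<exists>!y. y \<in> carrier R \<and> (\<forall>i. y \<ominus>\<^bsub>R\<^esub> x i \<in> ideal_pow R (max_ideal R) i)))"

definition reduced_ring :: "('a, 'r) ring_scheme \<Rightarrow> bool" where
  "reduced_ring R \<longleftrightarrow> cring R \<and>
     (\<forall>x\<in>carrier R. \<forall>k::nat. x [^]\<^bsub>R\<^esub> k = \<zero>\<^bsub>R\<^esub> \<longrightarrow> x = \<zero>\<^bsub>R\<^esub>)"


section \<open>Modules\<close>

text \<open>The record type of modules extends that of rings, but the locale \<open>module\<close> does not constrain
  the fields \<open>mult\<close> and \<open>one\<close>; they are never used below and are set to \<open>undefined\<close>.
  A submodule \<open>N\<close> of \<open>M\<close>, regarded as a module, is \<open>M\<lparr>carrier := N\<rparr>\<close>.\<close>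

definition zero_module :: "('a, 'b) module \<Rightarrow> bool" where
  "zero_module M \<longleftrightarrow> carrier M = {\<zero>\<^bsub>M\<^esub>}"

definition module_span :: "('a, 'r) ring_scheme \<Rightarrow> ('a, 'b) module \<Rightarrow> 'b set \<Rightarrow> 'b set" where
  "module_span R M A = \<Inter>{N. submodule N R M \<and> A \<subseteq> N}"

definition fin_gen :: "('a, 'r) ring_scheme \<Rightarrow> ('a, 'b) module \<Rightarrow> bool" where
  "fin_gen R M \<longleftrightarrow> (\<exists>A \<subseteq> carrier M. finite A \<and> module_span R M A = carrier M)"

text \<open>Homomorphisms are extensional, so that equality of homomorphisms is equality of functions.\<close>
definition mod_hom :: "('a, 'r) ring_scheme \<Rightarrow> ('a, 'b) module \<Rightarrow> ('a, 'c) module \<Rightarrow> ('b \<Rightarrow> 'c) set"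
  where
  "mod_hom R M N = {h \<in> carrier M \<rightarrow>\<^sub>E carrier N.
     (\<forall>x\<in>carrier M. \<forall>y\<in>carrier M. h (x \<oplus>\<^bsub>M\<^esub> y) = h x \<oplus>\<^bsub>N\<^esub> h y) \<and>
     (\<forall>r\<in>carrier R. \<forall>x\<in>carrier M. h (r \<odot>\<^bsub>M\<^esub> x) = r \<odot>\<^bsub>N\<^esub> h x)}"

definition mod_iso :: "('a, 'r) ring_scheme \<Rightarrow> ('a, 'b) module \<Rightarrow> ('a, 'c) module \<Rightarrow> bool" where
  "mod_iso R M N \<longleftrightarrow> (\<exists>h\<in>mod_hom R M N. bij_betw h (carrier M) (carrier N))"

definition mod_ker :: "('a, 'b) module \<Rightarrow> ('a, 'c) module \<Rightarrow> ('b \<Rightarrow> 'c) \<Rightarrow> 'b set" where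
  "mod_ker M N h = {x \<in> carrier M. h x = \<zero>\<^bsub>N\<^esub>}"

definition hom_module :: "('a, 'r) ring_scheme \<Rightarrow> ('a, 'b) module \<Rightarrow> ('a, 'c) module
    \<Rightarrow> ('a, 'b \<Rightarrow> 'c) module" where
  "hom_module R M N = \<lparr>carrier = mod_hom R M N,
     monoid.mult = undefined, monoid.one = undefined,
     ring.zero = (\<lambda>x\<in>carrier M. \<zero>\<^bsub>N\<^esub>),
     ring.add = (\<lambda>g h. \<lambda>x\<in>carrier M. g x \<oplus>\<^bsub>N\<^esub> h x),
     module.smult = (\<lambda>r h. \<lambda>x\<in>carrier M. r \<odot>\<^bsub>N\<^esub> h x)\<rparr>"

definition quot_module :: "('a, 'b) module \<Rightarrow> 'b set \<Rightarrow> ('a, 'b set) module" where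
  "quot_module M N = \<lparr>carrier = a_rcosets\<^bsub>M\<^esub> N,
     monoid.mult = undefined, monoid.one = undefined,
     ring.zero = N, ring.add = set_add M,
     module.smult = (\<lambda>r A. \<Union>x\<in>A. N +>\<^bsub>M\<^esub> (r \<odot>\<^bsub>M\<^esub> x))\<rparr>"

definition direct_sum :: "'i set \<Rightarrow> ('i \<Rightarrow> ('a, 'b) module) \<Rightarrow> ('a, 'i \<Rightarrow> 'b) module" where
  "direct_sum I M = \<lparr>
     carrier = {u \<in> (\<Pi>\<^sub>E i\<in>I. carrier (M i)). finite {i \<in> I. u i \<noteq> \<zero>\<^bsub>M i\<^esub>}},
     monoid.mult = undefined, monoid.one = undefined,
     ring.zero = (\<lambda>i\<in>I. \<zero>\<^bsub>M i\<^esub>),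
     ring.add = (\<lambda>u v. \<lambda>i\<in>I. u i \<oplus>\<^bsub>M i\<^esub> v i),
     module.smult = (\<lambda>r u. \<lambda>i\<in>I. r \<odot>\<^bsub>M i\<^esub> u i)\<rparr>"

definition regular_module :: "('a, 'r) ring_scheme \<Rightarrow> ('a, 'a) module" where
  "regular_module R = \<lparr>carrier = carrier R,
     monoid.mult = undefined, monoid.one = undefined,
     ring.zero = \<zero>\<^bsub>R\<^esub>, ring.add = ring.add R, module.smult = monoid.mult R\<rparr>"

definition internal_direct_sum ::
    "('a, 'r) ring_scheme \<Rightarrow> ('a, 'b) module \<Rightarrow> 'b set \<Rightarrow> 'b set \<Rightarrow> bool" where
  "internal_direct_sum R M A B \<longleftrightarrow> submodule A R M \<and> submodule B R M \<and>
     A <+>\<^bsub>M\<^esub> B = carrier M \<and> A \<inter> B = {\<zero>\<^bsub>M\<^esub>}"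

definition indecomposable :: "('a, 'r) ring_scheme \<Rightarrow> ('a, 'b) module \<Rightarrow> bool" where
  "indecomposable R M \<longleftrightarrow> \<not> zero_module M \<and>
     (\<forall>A B. internal_direct_sum R M A B \<longrightarrow> A = {\<zero>\<^bsub>M\<^esub>} \<or> B = {\<zero>\<^bsub>M\<^esub>})"

text \<open>No indecomposable module occurs twice in \<open>M\<close>: if \<open>M = A \<oplus> B \<oplus> L\<close> with \<open>A\<close> and \<open>B\<close>
  indecomposable, then \<open>A\<close> and \<open>B\<close> are not isomorphic. Here \<open>N\<close> is \<open>A \<oplus> B\<close>.\<close>
definition basic_module :: "('a, 'r) ring_scheme \<Rightarrow> ('a, 'b) module \<Rightarrow> bool" where
  "basic_module R M \<longleftrightarrow>
     (\<forall>N L A B. internal_direct_sum R M N L \<longrightarrow>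
        internal_direct_sum R (M\<lparr>carrier := N\<rparr>) A B \<longrightarrow>
        indecomposable R (M\<lparr>carrier := A\<rparr>) \<longrightarrow> indecomposable R (M\<lparr>carrier := B\<rparr>) \<longrightarrow>
        \<not> mod_iso R (M\<lparr>carrier := A\<rparr>) (M\<lparr>carrier := B\<rparr>))"

text \<open>Modules (with elements in an arbitrary type) isomorphic to a direct summand of some \<open>M\<^sup>k\<close>;
  \<open>k = 0\<close> is allowed, so zero modules belong to it.\<close>
definition add_cat ::
    "('a, 'r) ring_scheme \<Rightarrow> ('a, 'b) module \<Rightarrow> ('a, 'x) module set" where
  "add_cat R M = {Y. module R Y \<and>
     (\<exists>(k::nat) A B. internal_direct_sum R (direct_sum {..<k} (\<lambda>_. M)) A B \<and>
        mod_iso R Y ((direct_sum {..<k} (\<lambda>_. M))\<lparr>carrier := A\<rparr>))}"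


section \<open>Depth and maximal Cohen-Macaulay modules\<close>

definition seq_submodule :: "('a, 'r) ring_scheme \<Rightarrow> ('a, 'b) module \<Rightarrow> 'a list \<Rightarrow> 'b set" where
  "seq_submodule R M xs = module_span R M {x \<odot>\<^bsub>M\<^esub> v | x v. x \<in> set xs \<and> v \<in> carrier M}"

text \<open>Multiplication by the next element is injective on \<open>M/(x\<^sub>1,\<dots>,x\<^sub>i)M\<close>, and
  \<open>M/(x\<^sub>1,\<dots>,x\<^sub>d)M\<close> is nonzero.\<close>
definition regular_seq :: "('a, 'r) ring_scheme \<Rightarrow> ('a, 'b) module \<Rightarrow> 'a list \<Rightarrow> bool" where
  "regular_seq R M xs \<longleftrightarrow> set xs \<subseteq> carrier R \<and>
     (\<forall>i<length xs. \<forall>v\<in>carrier M.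
        (xs ! i) \<odot>\<^bsub>M\<^esub> v \<in> seq_submodule R M (take i xs) \<longrightarrow> v \<in> seq_submodule R M (take i xs)) \<and>
     seq_submodule R M xs \<noteq> carrier M"

definition depth :: "('a, 'r) ring_scheme \<Rightarrow> ('a, 'b) module \<Rightarrow> enat" where
  "depth R M = Sup {enat (length xs) | xs. set xs \<subseteq> max_ideal R \<and> regular_seq R M xs}"

text \<open>For a noetherian local ring \<open>R\<close>. The zero module has depth infinity by the usual convention
  (but supremum \<open>0\<close> above) and is maximal Cohen-Macaulay.\<close>
definition MCM :: "('a, 'r) ring_scheme \<Rightarrow> ('a, 'b) module set" where
  "MCM R = {M. module R M \<and> fin_gen R M \<and> (zero_module M \<or> depth R M = krull_dim R)}"


section \<open>The first Ext module\<close>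

definition free_module :: "('a, 'r) ring_scheme \<Rightarrow> 'b set \<Rightarrow> ('a, 'b \<Rightarrow> 'a) module" where
  "free_module R A = direct_sum A (\<lambda>_. regular_module R)"

text \<open>The map from the free module on a subset \<open>A\<close> of \<open>M\<close> to \<open>M\<close> extending the inclusion.\<close>
definition free_eval ::
    "('a, 'r) ring_scheme \<Rightarrow> ('a, 'b) module \<Rightarrow> 'b set \<Rightarrow> ('b \<Rightarrow> 'a) \<Rightarrow> 'b" where
  "free_eval R M A = (\<lambda>u\<in>carrier (free_module R A).
     \<Oplus>\<^bsub>M\<^esub>a\<in>{a \<in> A. u a \<noteq> \<zero>\<^bsub>R\<^esub>}. u a \<odot>\<^bsub>M\<^esub> a)"

text \<open>The beginning \<open>F\<^sub>2 \<rightarrow> F\<^sub>1 \<rightarrow> F\<^sub>0 \<rightarrow> Y \<rightarrow> 0\<close> of the standard free resolution of \<open>Y\<close>: \<open>F\<^sub>0\<close> is free on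
  the elements of \<open>Y\<close>, and each further term is free on the elements of the preceding kernel
  (\<open>syz\<^sub>0\<close> in \<open>F\<^sub>0\<close>, \<open>syz\<^sub>1\<close> in \<open>F\<^sub>1\<close>).\<close>

definition res0 :: "('a, 'r) ring_scheme \<Rightarrow> ('a, 'x) module \<Rightarrow> ('a, 'x \<Rightarrow> 'a) module" where
  "res0 R Y = free_module R (carrier Y)"

definition syz0 :: "('a, 'r) ring_scheme \<Rightarrow> ('a, 'x) module \<Rightarrow> ('x \<Rightarrow> 'a) set" where
  "syz0 R Y = mod_ker (res0 R Y) Y (free_eval R Y (carrier Y))"

definition res1 :: "('a, 'r) ring_scheme \<Rightarrow> ('a, 'x) module \<Rightarrow> ('a, ('x \<Rightarrow> 'a) \<Rightarrow> 'a) module" where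
  "res1 R Y = free_module R (syz0 R Y)"

definition diff1 :: "('a, 'r) ring_scheme \<Rightarrow> ('a, 'x) module \<Rightarrow> (('x \<Rightarrow> 'a) \<Rightarrow> 'a) \<Rightarrow> 'x \<Rightarrow> 'a" where
  "diff1 R Y = free_eval R (res0 R Y) (syz0 R Y)"

definition syz1 :: "('a, 'r) ring_scheme \<Rightarrow> ('a, 'x) module \<Rightarrow> (('x \<Rightarrow> 'a) \<Rightarrow> 'a) set" where
  "syz1 R Y = mod_ker (res1 R Y) (res0 R Y) (diff1 R Y)"

definition res2 :: "('a, 'r) ring_scheme \<Rightarrow> ('a, 'x) module
    \<Rightarrow> ('a, (('x \<Rightarrow> 'a) \<Rightarrow> 'a) \<Rightarrow> 'a) module" where
  "res2 R Y = free_module R (syz1 R Y)"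

definition diff2 :: "('a, 'r) ring_scheme \<Rightarrow> ('a, 'x) module
    \<Rightarrow> ((('x \<Rightarrow> 'a) \<Rightarrow> 'a) \<Rightarrow> 'a) \<Rightarrow> ('x \<Rightarrow> 'a) \<Rightarrow> 'a" where
  "diff2 R Y = free_eval R (res1 R Y) (syz1 R Y)"

text \<open>Cohomology of \<open>Hom(F\<^sub>0,M) \<rightarrow> Hom(F\<^sub>1,M) \<rightarrow> Hom(F\<^sub>2,M)\<close> in the middle.\<close>

definition ext1_cocycles :: "('a, 'r) ring_scheme \<Rightarrow> ('a, 'x) module \<Rightarrow> ('a, 'm) module
    \<Rightarrow> ((('x \<Rightarrow> 'a) \<Rightarrow> 'a) \<Rightarrow> 'm) set" where
  "ext1_cocycles R Y M = mod_ker (hom_module R (res1 R Y) M) (hom_module R (res2 R Y) M)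
     (\<lambda>h. compose (carrier (res2 R Y)) h (diff2 R Y))"

definition ext1_coboundaries :: "('a, 'r) ring_scheme \<Rightarrow> ('a, 'x) module \<Rightarrow> ('a, 'm) module
    \<Rightarrow> ((('x \<Rightarrow> 'a) \<Rightarrow> 'a) \<Rightarrow> 'm) set" where
  "ext1_coboundaries R Y M =
     (\<lambda>g. compose (carrier (res1 R Y)) g (diff1 R Y)) ` mod_hom R (res0 R Y) M"

definition Ext1 :: "('a, 'r) ring_scheme \<Rightarrow> ('a, 'x) module \<Rightarrow> ('a, 'm) module
    \<Rightarrow> ('a, ((('x \<Rightarrow> 'a) \<Rightarrow> 'a) \<Rightarrow> 'm) set) module" where
  "Ext1 R Y M =
     quot_module ((hom_module R (res1 R Y) M)\<lparr>carrier := ext1_cocycles R Y M\<rparr>)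
       (ext1_coboundaries R Y M)"


section \<open>Cluster tilting\<close>

text \<open>The test modules \<open>Y\<close> have their elements in the type \<open>'x\<close>. A statement with \<open>'x\<close> a type variable
  speaks about test modules of every type, in particular about quotients of the \<open>R\<^sup>k\<close>, which
  represent all finitely generated modules.\<close>
definition cluster_tilting ::
    "'x itself \<Rightarrow> ('a, 'r) ring_scheme \<Rightarrow> ('a, 'm) module \<Rightarrow> bool" where
  "cluster_tilting (_ :: 'x itself) R M \<longleftrightarrow> M \<in> MCM R \<and>
     (add_cat R M :: ('a, 'x) module set) = {Y \<in> MCM R. zero_module (Ext1 R Y M)} \<and>
     (add_cat R M :: ('a, 'x) module set) = {Y \<in> MCM R. zero_module (Ext1 R M Y)}"


section \<open>The modules \<open>S\<^sup>\<omega>\<close>\<close>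

text \<open>\<open>S/J\<close> as a module over \<open>S/I\<close>, for ideals \<open>I \<subseteq> J\<close> of \<open>S\<close>: the scalars are cosets of \<open>I\<close>, and
  \<open>(I + s) \<cdot> (J + t) = J + st\<close>.\<close>
definition coset_module :: "('a, 's) ring_scheme \<Rightarrow> 'a set \<Rightarrow> ('a set, 'a set) module" where
  "coset_module S J = \<lparr>carrier = carrier (S Quot J),
     monoid.mult = undefined, monoid.one = undefined,
     ring.zero = ring.zero (S Quot J), ring.add = ring.add (S Quot J),
     module.smult = rcoset_mult S J\<rparr>"

definition S_perm_i :: "('a, 's) ring_scheme \<Rightarrow> (nat \<Rightarrow> 'a) \<Rightarrow> (nat \<Rightarrow> nat) \<Rightarrow> nat
    \<Rightarrow> ('a set, 'a set) module" where
  "S_perm_i S f w i = coset_module S (PIdl\<^bsub>S\<^esub> (\<Otimes>\<^bsub>S\<^esub>j\<in>{1..i}. f (w j)))"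

definition S_perm :: "('a, 's) ring_scheme \<Rightarrow> nat \<Rightarrow> (nat \<Rightarrow> 'a) \<Rightarrow> (nat \<Rightarrow> nat)
    \<Rightarrow> ('a set, nat \<Rightarrow> 'a set) module" where
  "S_perm S n f w = direct_sum {1..n} (S_perm_i S f w)"

end

theory Submission
 imports Defs
begin

text \<open>Write \<open>g\<^sub>i\<close> for the product of the first \<open>i\<close> prime elements in the order given by the permutation,
 \<open>F = g\<^sub>n\<close>, \<open>R = S/F\<close> and \<open>T\<close> for the sum of the \<open>S/g\<^sub>i\<close>. The proof works with modules over \<open>S\<close> killed by \<open>F\<close>
 and only uses explicit linear algebra over \<open>S\<close>. Its central notion is that of a diagonal basis
 (\<open>diag\<close>): a finite generating family \<open>x\<close> with degrees \<open>d\<close> whose relations are exactly the \<open>v\<close> with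
 \<open>g\<^bsub>d i\<^esub> | v i\<close>. Having one means being isomorphic to a direct sum of modules \<open>S/g\<^sub>i\<close>, and such a sum is a
 summand of a power of \<open>T\<close> (\<open>diag_add_cat\<close>).

 Over such a module \<open>M\<close> the first Ext module can be computed: a homomorphism on the relations of the
 basis is given by its values on the \<open>g\<^bsub>d i\<^esub>\<close>, which must be killed by \<open>F/g\<^bsub>d i\<^esub>\<close> and extends exactly if
 they are multiples of \<open>g\<^bsub>d i\<^esub>\<close>. Hence \<open>Ext\<^sup>1(T, Y) = 0\<close> is the annihilator condition \<open>annc\<close> on \<open>Y\<close>:
 whatever is killed by \<open>F/g\<^sub>i\<close> is a multiple of \<open>g\<^sub>i\<close>. As no prime occurs twice in \<open>F\<close>, \<open>T\<close> satisfies
 it, and it passes to sums, summands and isomorphic modules.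

 So the theorem reduces to two statements about a maximal Cohen-Macaulay module \<open>M\<close>, that is, a
 finitely generated one on which some element of the maximal ideal is regular. If \<open>M\<close> satisfies the
 annihilator condition, then it has a diagonal basis (\<open>ann_condition_imp_diag\<close>), and if
 \<open>Ext\<^sup>1(M, S/g\<^sub>i) = 0\<close> for all \<open>i\<close>, then it has one, too (\<open>ext_vanish_imp_diag\<close>). Both are proved by
 induction on \<open>n\<close>. As the \<open>f\<^sub>j\<close> are not in the square of the maximal ideal, each \<open>S/f\<^sub>j\<close> is a discrete
 valuation ring, over which torsion-free modules are free (\<open>free_over_branch\<close>); this starts the
 inductions and is used in each step. For the first statement one takes a diagonal basis of \<open>f\<^sub>n M\<close>,
 improves it by exchanging elements, and lifts it along multiplication with \<open>f\<^sub>n\<close>. For the second one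
 takes a diagonal basis of the annihilator of \<open>g\<^bsub>n-1\<^esub>\<close> in \<open>M\<close>. If the \<open>g\<^bsub>n-1\<^esub> y\<^sub>j\<close> form a basis of \<open>g\<^bsub>n-1\<^esub> M\<close>
 over \<open>S/f\<^sub>n\<close>, then the vanishing of \<open>Ext\<^sup>1(M, S/g\<^bsub>n-1\<^esub>)\<close> provides functionals which are dual to the
 \<open>f\<^sub>n y\<^sub>j\<close> modulo the maximal ideal. So the \<open>f\<^sub>n y\<^sub>j\<close> can be exchanged into the diagonal basis, and there
 they are replaced by the \<open>y\<^sub>j\<close>.

 That \<open>T\<close> is basic holds since endomorphisms of \<open>T\<close> are given by matrices over \<open>S\<close> that are triangular
 modulo the maximal ideal: a homomorphism from \<open>S/g\<^sub>j\<close> to \<open>S/g\<^sub>l\<close> with \<open>j < l\<close> maps into the multiples of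
 \<open>f\<^bsub>j+1\<^esub>\<dots>f\<^sub>l\<close>. If a summand \<open>A \<oplus> B\<close> of \<open>T\<close> had isomorphic parts, then the projections onto \<open>A\<close> and \<open>B\<close> would
 have the forms \<open>b a\<close> and \<open>a b\<close>, hence the same diagonal modulo the maximal ideal; their product is
 zero, so this diagonal vanishes, and an idempotent with strictly triangular matrix modulo the
 maximal ideal is zero by Nakayama's lemma.

 It remains to see that the hypotheses lead to this situation. A regular local ring of dimension two is
 a domain (\<open>domain_if_dim_two\<close>), an element outside the square of its maximal ideal is one of two
 generators of this ideal (\<open>second_generator\<close>), and as \<open>R\<close> is reduced no \<open>f\<^sub>i\<close> divides another one
 (\<open>reduced_imp_coprime\<close>). For \<open>n = 0\<close> the ring \<open>R\<close> is zero and all modules vanish (\<open>zero_ring_case\<close>).\<close>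

section \<open>Divisibility by products of the prime elements\<close>

declare divides_mult_imp_divides [simp del] domain.divides_imp_divides_mult [simp del]

lemma (in cring) dvdI: "c \<in> carrier R ==> b = a \<otimes> c ==> a divides b"
 unfolding factor_def by blast

lemma (in cring) dvdE:
 assumes "a divides b" obtains c where "c \<in> carrier R" "b = a \<otimes> c"
 using assms unfolding factor_def by blast

lemma (in cring) dvd_add:
 assumes "a \<in> carrier R" "a divides b" "a divides c" shows "a divides (b \<oplus> c)"
proof -
 obtain u v where "u \<in> carrier R" "b = a \<otimes> u" "v \<in> carrier R" "c = a \<otimes> v" using assms by (meson dvdE)
 thus ?thesis using assms(1) by (intro dvdI[of "u \<oplus> v"]) (auto simp: r_distr)
qed

lemma (in cring) dvd_mult:
 assumes "a \<in> carrier R" "r \<in> carrier R" "a divides b" shows "a divides (r \<otimes> b)"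
proof -
 obtain u where "u \<in> carrier R" "b = a \<otimes> u" using assms by (meson dvdE)
 thus ?thesis using assms by (intro dvdI[of "r \<otimes> u"]) (auto simp: m_lcomm)
qed

lemma (in cring) dvd_mult2:
 assumes "a \<in> carrier R" "b \<in> carrier R" "r \<in> carrier R" "a divides b" shows "a divides (b \<otimes> r)"
 using dvd_mult[of a r b] assms m_comm by auto

lemma (in cring) dvd_uminus:
 assumes "a \<in> carrier R" "a divides b" shows "a divides (\<ominus> b)"
proof -
 obtain u where "u \<in> carrier R" "b = a \<otimes> u" using assms by (meson dvdE)
 thus ?thesis using assms by (intro dvdI[of "\<ominus> u"]) (auto simp: r_minus)
qed

lemma (in cring) dvd_diff:
 assumes "a \<in> carrier R" "a divides b" "a divides c" shows "a divides (b \<ominus> c)"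
 using dvd_add[of a b "\<ominus> c"] dvd_uminus assms by (simp add: a_minus_def)

lemma (in cring) dvd_zero: "a \<in> carrier R ==> a divides \<zero>"
 by (rule dvdI[of \<zero>]) auto

lemma (in cring) dvd_refl: "a \<in> carrier R ==> a divides a"
 by (rule dvdI[of \<one>]) auto

lemma (in cring) dvd_trans:
 assumes "a \<in> carrier R" "a divides b" "b divides c" shows "a divides c"
proof -
 obtain u v where "u \<in> carrier R" "b = a \<otimes> u" "v \<in> carrier R" "c = b \<otimes> v" using assms by (meson dvdE)
 thus ?thesis using assms(1) by (intro dvdI[of "u \<otimes> v"]) (auto simp: m_assoc)
qed

lemma (in cring) PIdl_iff_dvd: "a \<in> carrier R ==> x \<in> PIdl a \<longleftrightarrow> a divides x"
 unfolding cgenideal_def factor_def using m_comm by auto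

text \<open>A local domain with maximal ideal \<open>m\<close> generated by \<open>f j\<close> and \<open>p j\<close>, for each of the prime elements
 \<open>f j\<close>. The assumption \<open>valuation\<close> says that \<open>S/f j\<close> is a discrete valuation ring with uniformizer
 \<open>p j\<close>. Everything that is needed about regular local rings of dimension two is in these assumptions.\<close>
locale branches = domain S for S (structure) +
 fixes m :: "'a set" and f :: "nat => 'a" and p :: "nat => 'a" and N :: nat
 assumes m_ideal: "ideal m S"
  and one_notin_m: "\<one> \<notin> m"
  and unit_outside: "x \<in> carrier S ==> x \<notin> m ==> x \<in> Units S"
  and f_m: "j \<in> {1..N} ==> f j \<in> m"
  and p_m: "j \<in> {1..N} ==> p j \<in> m"
  and f_nz: "j \<in> {1..N} ==> f j \<noteq> \<zero>"
  and f_prime: "j \<in> {1..N} ==> a \<in> carrier S ==> b \<in> carrier S ==> f j divides a \<otimes> b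
          ==> f j divides a \<or> f j divides b"
  and m_gen: "j \<in> {1..N} ==> x \<in> m ==> \<exists>a\<in>carrier S. \<exists>b\<in>carrier S. x = f j \<otimes> a \<oplus> p j \<otimes> b"
  and valuation: "j \<in> {1..N} ==> c \<in> carrier S ==> \<not> f j divides c ==>
           \<exists>u\<in>Units S. \<exists>e::nat. f j divides (c \<ominus> u \<otimes> p j [^] e)"
  and f_coprime: "i \<in> {1..N} ==> j \<in> {1..N} ==> i \<noteq> j ==> \<not> f i divides f j"
begin

declare divides_imp_divides_mult [simp del]

abbreviation coords where "coords I \<equiv> I \<rightarrow> carrier S"

lemma f_closed [simp, intro]: "j \<in> {1..N} ==> f j \<in> carrier S"
 using f_m ideal.Icarr[OF m_ideal] by blast

lemma p_closed [simp, intro]: "j \<in> {1..N} ==> p j \<in> carrier S"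
 using p_m ideal.Icarr[OF m_ideal] by blast

lemma m_carr: "x \<in> m ==> x \<in> carrier S"
 using ideal.Icarr[OF m_ideal] by blast

lemma m_add: "x \<in> m ==> y \<in> m ==> x \<oplus> y \<in> m"
 using additive_subgroup.a_closed[OF ideal.axioms(1)[OF m_ideal]] .

lemma m_mult: "r \<in> carrier S ==> x \<in> m ==> r \<otimes> x \<in> m"
 using ideal.I_l_closed[OF m_ideal] by blast

lemma m_mult2: "r \<in> carrier S ==> x \<in> m ==> x \<otimes> r \<in> m"
 using ideal.I_r_closed[OF m_ideal] by blast

lemma m_zero: "\<zero> \<in> m"
 using additive_subgroup.zero_closed[OF ideal.axioms(1)[OF m_ideal]] .

lemma m_uminus: "x \<in> m ==> \<ominus> x \<in> m"
 using additive_subgroup.a_inv_closed[OF ideal.axioms(1)[OF m_ideal]] .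

lemma m_diff: "x \<in> m ==> y \<in> m ==> x \<ominus> y \<in> m"
 unfolding a_minus_def by (intro m_add m_uminus)

lemma m_dvd: "x \<in> m ==> x divides y ==> y \<in> m"
 by (erule dvdE) (auto intro: m_mult2)

lemma m_finsum: "finite I ==> (\<And>i. i \<in> I ==> h i \<in> m) ==> (\<Oplus>i\<in>I. h i) \<in> m"
proof (induction I rule: finite_induct)
 case empty thus ?case by (simp add: m_zero)
next
 case (insert i I)
 thus ?case by (subst finsum_insert) (auto intro!: m_add m_carr)
qed

lemma unit_notin_m: "u \<in> Units S ==> u \<notin> m"
 using m_mult2[of "inv u" u] one_notin_m by auto

lemma unit_iff: "x \<in> carrier S ==> x \<in> Units S \<longleftrightarrow> x \<notin> m"
 using unit_outside unit_notin_m by blast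

lemma m_prime: "a \<in> carrier S ==> b \<in> carrier S ==> a \<otimes> b \<in> m ==> a \<in> m \<or> b \<in> m"
 using unit_iff Units_m_closed by (metis m_closed)

lemma one_plus_m: "x \<in> m ==> \<one> \<oplus> x \<notin> m"
proof
 assume x: "x \<in> m" "\<one> \<oplus> x \<in> m"
 have "(\<one> \<oplus> x) \<ominus> x \<in> m" using x m_diff by blast
 also have "(\<one> \<oplus> x) \<ominus> x = \<one>" using x(1) m_carr by algebra
 finally show False using one_notin_m by blast
qed

lemma one_minus_m: "x \<in> m ==> \<one> \<ominus> x \<notin> m"
 using one_plus_m[of "\<ominus> x"] m_uminus by (simp add: a_minus_def)

text \<open>The product of the primes with index greater than \<open>i\<close> up to \<open>n\<close>, so that \<open>gp 0 i\<close> is the element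
 \<open>g\<^sub>i\<close> and \<open>gp i n\<close> is the cofactor \<open>g\<^sub>n/g\<^sub>i\<close>.\<close>
definition gp :: "nat => nat => 'a" where "gp i n = (\<Otimes>j\<in>{i<..n}. f j)"

lemma gp_closed [simp, intro]: "n \<le> N ==> gp i n \<in> carrier S"
 unfolding gp_def by (rule finprod_closed) auto

lemma gp_refl [simp]: "n \<le> i ==> gp i n = \<one>"
 unfolding gp_def by simp

lemma gp_Suc: "i \<le> n ==> Suc n \<le> N ==> gp i (Suc n) = gp i n \<otimes> f (Suc n)"
proof -
 assume a: "i \<le> n" "Suc n \<le> N"
 have e: "{i<..Suc n} = insert (Suc n) {i<..n}" using a by auto
 have c: "gp i n \<in> carrier S" "f (Suc n) \<in> carrier S" "f \<in> {i<..n} \<rightarrow> carrier S"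
  using a by (auto intro!: f_closed)
 have "gp i (Suc n) = f (Suc n) \<otimes> gp i n"
  unfolding gp_def e by (rule finprod_insert) (use c in auto)
 thus ?thesis using c by (simp add: m_comm)
qed

lemma gp_mult: "i \<le> j ==> j \<le> n ==> n \<le> N ==> gp i j \<otimes> gp j n = gp i n"
proof (induction n)
 case (Suc n)
 show ?case
 proof (cases "j = Suc n")
  case False
  hence "gp i j \<otimes> gp j (Suc n) = gp i j \<otimes> gp j n \<otimes> f (Suc n)"
   using Suc.prems by (simp add: gp_Suc m_assoc)
  thus ?thesis using Suc False by (simp add: gp_Suc)
 qed (use Suc in simp)
qed simp

lemma gp_nz: "n \<le> N ==> gp i n \<noteq> \<zero>"
proof (induction n)
 case (Suc n) thus ?case
  by (cases "i \<le> n") (auto simp: gp_Suc integral_iff f_nz)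
qed simp

lemma gp_m: "i < n ==> n \<le> N ==> gp i n \<in> m"
 by (cases n) (auto simp: gp_Suc intro!: m_mult f_m)

lemma dvd_cancel: "a \<in> carrier S ==> b \<in> carrier S ==> c \<in> carrier S ==> c \<noteq> \<zero> ==>
  c \<otimes> a divides c \<otimes> b \<longleftrightarrow> a divides b"
 using mult_divides[of a b c] divides_mult[of a c b] by blast

lemma m_not_dvd_one: "x \<in> m ==> \<not> x divides \<one>"
 using m_dvd one_notin_m by blast

lemma f_dvd_gp: "j \<in> {1..N} ==> n \<le> N ==> f j divides gp i n ==> i < j \<and> j \<le> n"
proof (induction n)
 case 0 thus ?case using m_not_dvd_one[OF f_m, of j] by simp
next
 case (Suc n)
 show ?case
 proof (cases "i \<le> n")
  case True
  hence "f j divides gp i n \<or> f j divides f (Suc n)" using Suc f_prime by (simp add: gp_Suc)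
  thus ?thesis using Suc f_coprime[of j "Suc n"] True by fastforce
 next
  case False thus ?thesis using m_not_dvd_one[OF f_m, of j] Suc.prems by simp
 qed
qed

text \<open>A prime \<open>f j\<close> that divides \<open>t \<otimes> s\<close> but not \<open>t\<close> divides \<open>s\<close>; cancel the factors of \<open>gp i n\<close> one by
 one.\<close>
lemma coprime_cancel:
 assumes "n \<le> N" "t \<in> carrier S" "\<And>j. i < j ==> j \<le> n ==> \<not> f j divides t"
  "s \<in> carrier S" "gp i n divides t \<otimes> s"
 shows "gp i n divides s"
 using assms
proof (induction n arbitrary: s)
 case 0
 have "s = gp i 0 \<otimes> s" using 0 by simp
 thus ?case using dvdI 0 by blast
next
 case (Suc n)
 show ?case
 proof (cases "i \<le> n")
  case True
  have fc: "f (Suc n) \<in> carrier S" "gp i n \<in> carrier S" using Suc.prems by auto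
  have "f (Suc n) divides gp i (Suc n)" using True fc Suc.prems by (simp add: gp_Suc dvd_mult dvd_refl)
  hence "f (Suc n) divides t \<otimes> s" using dvd_trans[OF fc(1)] Suc.prems by blast
  hence "f (Suc n) divides s" using f_prime[of "Suc n"] Suc.prems True by force
  then obtain r where r: "r \<in> carrier S" "s = f (Suc n) \<otimes> r" by (erule dvdE)
  have "f (Suc n) \<otimes> gp i n divides f (Suc n) \<otimes> (t \<otimes> r)"
   using Suc.prems True fc r by (simp add: gp_Suc m_ac)
  hence "gp i n divides t \<otimes> r"
   using dvd_cancel[of "gp i n" "t \<otimes> r" "f (Suc n)"] f_nz[of "Suc n"] Suc.prems fc r by simp
  hence "gp i n divides r" using Suc.IH[of r] Suc.prems r by simp
  thus ?thesis using dvd_cancel[of "gp i n" r "f (Suc n)"] fc r True Suc.prems f_nz[of "Suc n"]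
   by (simp add: gp_Suc m_comm)
 next
  case False
  have "s = gp i (Suc n) \<otimes> s" using Suc.prems False by simp
  thus ?thesis using dvdI Suc.prems by blast
 qed
qed

text \<open>This is the annihilator condition for \<open>S/g\<^sub>j\<close>: a class \<open>s\<close> killed by \<open>g\<^sub>n/g\<^sub>i\<close> is zero if \<open>j \<le> i\<close>,
 because \<open>g\<^sub>j\<close> and \<open>g\<^sub>n/g\<^sub>i\<close> then have no common factor, and a multiple of \<open>g\<^sub>i\<close> if \<open>i < j\<close>.\<close>
lemma ann_cond_arith:
 assumes "i \<le> n" "j \<le> n" "n \<le> N" "s \<in> carrier S" "gp 0 j divides gp i n \<otimes> s"
 shows "gp 0 j divides s \<or> (i < j \<and> gp 0 i divides s)"
proof (cases "i < j")
 case False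
 have "gp 0 j divides s"
 proof (rule coprime_cancel[of j "gp i n" 0 s])
  fix k assume "0 < k" "k \<le> j"
  thus "\<not> f k divides gp i n" using f_dvd_gp[of k n i] assms False by force
 qed (use assms in auto)
 thus ?thesis by blast
next
 case True
 have c: "gp 0 i \<in> carrier S" "gp i j \<in> carrier S" "gp j n \<in> carrier S" using assms True by auto
 have "gp i j \<otimes> gp 0 i = gp 0 j" "gp i n \<otimes> s = gp i j \<otimes> (gp j n \<otimes> s)"
  using assms(1-4) True c gp_mult[of 0 i j] gp_mult[of i j n] m_comm[of "gp i j" "gp 0 i"]
   m_assoc[of "gp i j" "gp j n" s] by simp_all
 hence "gp i j \<otimes> gp 0 i divides gp i j \<otimes> (gp j n \<otimes> s)" using assms(5) by simp
 hence "gp 0 i divides gp j n \<otimes> s"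
  using dvd_cancel[of "gp 0 i" "gp j n \<otimes> s" "gp i j"] c assms gp_nz[of j i] by simp
 hence "gp 0 i divides s"
 proof (intro coprime_cancel[of i "gp j n" 0 s])
  fix k assume "0 < k" "k \<le> i"
  thus "\<not> f k divides gp j n" using f_dvd_gp[of k n j] assms True by force
 qed (use assms in auto)
 thus ?thesis using True by blast
qed

lemma gp_dvd_gp: "i \<le> j ==> j \<le> N ==> gp 0 i divides gp 0 j"
 using gp_mult[of 0 i j] by (intro dvdI[of "gp i j"]) auto

lemma gp_dvd_gp_iff:
 assumes "i \<le> N" "j \<le> N" shows "gp 0 i divides gp 0 j \<longleftrightarrow> i \<le> j"
proof
 assume d: "gp 0 i divides gp 0 j"
 show "i \<le> j"
 proof (rule ccontr)
  assume n: "\<not> i \<le> j"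
  obtain k where k: "i = Suc k" using n by (cases i) auto
  have "f i divides gp 0 i" using k assms dvd_mult[of "f i" "gp 0 k" "f i"] by (simp add: gp_Suc dvd_refl)
  hence "f i divides gp 0 j" using d dvd_trans[of "f i"] n assms by auto
  thus False using f_dvd_gp[of i j 0] n assms by auto
 qed
qed (use assms gp_dvd_gp in auto)

end

section \<open>Linear combinations and generating families\<close>

text \<open>Families are indexed by sets so that basis elements can be exchanged without renumbering.\<close>
definition lin :: "('a, 'b) module => 'i set => ('i => 'b) => ('i => 'a) => 'b" where
 "lin M I x v = (\<Oplus>\<^bsub>M\<^esub>i\<in>I. v i \<odot>\<^bsub>M\<^esub> x i)"

definition gens :: "('a, 'r) ring_scheme => ('a, 'b) module => 'i set => ('i => 'b) => bool" where
 "gens R M I x \<longleftrightarrow> finite I \<and> x \<in> I \<rightarrow> carrier M \<and>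
   (\<forall>y\<in>carrier M. \<exists>v\<in>I \<rightarrow> carrier R. y = lin M I x v)"

text \<open>The library's locale for modules allows arbitrary extensions of the module record; here it is
 specialized to the record type that the definitions of direct sums and of Ext use.\<close>
locale rmod = module R M for R :: "('a, 'r) ring_scheme" (structure) and M :: "('a, 'b) module" (structure)

context rmod
begin

lemma smult_comm:
 "a \<in> carrier R ==> b \<in> carrier R ==> x \<in> carrier M ==> a \<odot>\<^bsub>M\<^esub> (b \<odot>\<^bsub>M\<^esub> x) = b \<odot>\<^bsub>M\<^esub> (a \<odot>\<^bsub>M\<^esub> x)"
 by (metis R.m_comm smult_assoc1)

lemma smult_l_diff:
 "a \<in> carrier R ==> b \<in> carrier R ==> x \<in> carrier M ==>
  (a \<ominus> b) \<odot>\<^bsub>M\<^esub> x = a \<odot>\<^bsub>M\<^esub> x \<ominus>\<^bsub>M\<^esub> b \<odot>\<^bsub>M\<^esub> x"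
 by (simp add: a_minus_def smult_l_distr smult_l_minus M.minus_eq)

lemma smult_r_diff:
 "a \<in> carrier R ==> y \<in> carrier M ==> x \<in> carrier M ==>
  a \<odot>\<^bsub>M\<^esub> (x \<ominus>\<^bsub>M\<^esub> y) = a \<odot>\<^bsub>M\<^esub> x \<ominus>\<^bsub>M\<^esub> a \<odot>\<^bsub>M\<^esub> y"
 by (simp add: M.minus_eq smult_r_distr smult_r_minus)

lemma diff_zero_iff: "x \<in> carrier M ==> y \<in> carrier M ==> x \<ominus>\<^bsub>M\<^esub> y = \<zero>\<^bsub>M\<^esub> \<longleftrightarrow> x = y"
 by (metis M.add.inv_closed M.add.inv_unique' M.minus_equality M.minus_eq M.minus_minus M.r_neg)

lemma diff_add_cancel: "x \<in> carrier M ==> y \<in> carrier M ==> (x \<ominus>\<^bsub>M\<^esub> y) \<oplus>\<^bsub>M\<^esub> y = x"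
 by (simp add: M.minus_eq M.a_assoc M.l_neg)

lemma add_diff_cancel: "x \<in> carrier M ==> y \<in> carrier M ==> (x \<oplus>\<^bsub>M\<^esub> y) \<ominus>\<^bsub>M\<^esub> y = x"
 by (simp add: M.minus_eq M.a_assoc M.r_neg)

lemma lin_in: "x \<in> I \<rightarrow> carrier M ==> v \<in> I \<rightarrow> carrier R ==> (\<lambda>i. v i \<odot>\<^bsub>M\<^esub> x i) \<in> I \<rightarrow> carrier M"
 by auto

lemma lin_closed [intro, simp]: "x \<in> I \<rightarrow> carrier M ==> v \<in> I \<rightarrow> carrier R ==> lin M I x v \<in> carrier M"
 unfolding lin_def by (intro M.finsum_closed lin_in)

lemma lin_empty [simp]: "lin M {} x v = \<zero>\<^bsub>M\<^esub>"
 unfolding lin_def by simp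

lemma lin_insert:
 "finite I ==> i \<notin> I ==> x \<in> insert i I \<rightarrow> carrier M ==> v \<in> insert i I \<rightarrow> carrier R ==>
  lin M (insert i I) x v = v i \<odot>\<^bsub>M\<^esub> x i \<oplus>\<^bsub>M\<^esub> lin M I x v"
 unfolding lin_def by (rule M.finsum_insert) auto

lemma lin_split:
 "finite I ==> i \<in> I ==> x \<in> I \<rightarrow> carrier M ==> v \<in> I \<rightarrow> carrier R ==>
  lin M I x v = v i \<odot>\<^bsub>M\<^esub> x i \<oplus>\<^bsub>M\<^esub> lin M (I - {i}) x v"
 using lin_insert[of "I - {i}" i x v] by (simp add: insert_absorb)

lemma lin_cong:
 "x \<in> I \<rightarrow> carrier M ==> v \<in> I \<rightarrow> carrier R ==> (\<And>i. i \<in> I ==> w i \<odot>\<^bsub>M\<^esub> y i = v i \<odot>\<^bsub>M\<^esub> x i) ==>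
  lin M I y w = lin M I x v"
 unfolding lin_def by (intro M.finsum_cong' refl) auto

lemma lin_zero:
 "(\<And>i. i \<in> I ==> v i \<odot>\<^bsub>M\<^esub> x i = \<zero>\<^bsub>M\<^esub>) ==> lin M I x v = \<zero>\<^bsub>M\<^esub>"
 unfolding lin_def by (subst M.finsum_cong'[where g = "\<lambda>_. \<zero>\<^bsub>M\<^esub>"]) auto

lemma lin_add:
 "x \<in> I \<rightarrow> carrier M ==> v \<in> I \<rightarrow> carrier R ==> w \<in> I \<rightarrow> carrier R ==>
  lin M I x (\<lambda>i. v i \<oplus> w i) = lin M I x v \<oplus>\<^bsub>M\<^esub> lin M I x w"
 unfolding lin_def
 by (subst M.finsum_cong'[OF refl, where g = "\<lambda>i. v i \<odot>\<^bsub>M\<^esub> x i \<oplus>\<^bsub>M\<^esub> w i \<odot>\<^bsub>M\<^esub> x i"])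
  (auto simp: Pi_iff smult_l_distr intro!: M.finsum_addf)

lemma lin_add_right:
 "x \<in> I \<rightarrow> carrier M ==> y \<in> I \<rightarrow> carrier M ==> v \<in> I \<rightarrow> carrier R ==>
  lin M I (\<lambda>i. x i \<oplus>\<^bsub>M\<^esub> y i) v = lin M I x v \<oplus>\<^bsub>M\<^esub> lin M I y v"
 unfolding lin_def
 by (subst M.finsum_cong'[OF refl, where g = "\<lambda>i. v i \<odot>\<^bsub>M\<^esub> x i \<oplus>\<^bsub>M\<^esub> v i \<odot>\<^bsub>M\<^esub> y i"])
  (auto simp: Pi_iff smult_r_distr intro!: M.finsum_addf)

lemma lin_smult:
 "finite I ==> x \<in> I \<rightarrow> carrier M ==> v \<in> I \<rightarrow> carrier R ==> r \<in> carrier R ==>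
  lin M I x (\<lambda>i. r \<otimes> v i) = r \<odot>\<^bsub>M\<^esub> lin M I x v"
 unfolding lin_def
 by (subst finsum_smult_ldistr) (auto intro!: M.finsum_cong' simp: Pi_iff smult_assoc1)

lemma lin_smult_right:
 "finite I ==> x \<in> I \<rightarrow> carrier M ==> v \<in> I \<rightarrow> carrier R ==> r \<in> carrier R ==>
  lin M I (\<lambda>i. r \<odot>\<^bsub>M\<^esub> x i) v = r \<odot>\<^bsub>M\<^esub> lin M I x v"
 unfolding lin_def
 by (subst finsum_smult_ldistr) (auto intro!: M.finsum_cong' simp: Pi_iff smult_comm)

lemma lin_diff:
 assumes "finite I" "x \<in> I \<rightarrow> carrier M" "v \<in> I \<rightarrow> carrier R" "w \<in> I \<rightarrow> carrier R"
 shows "lin M I x (\<lambda>i. v i \<ominus> w i) = lin M I x v \<ominus>\<^bsub>M\<^esub> lin M I x w"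
proof -
 have "lin M I x (\<lambda>i. v i \<oplus> (\<ominus> \<one>) \<otimes> w i) = lin M I x v \<oplus>\<^bsub>M\<^esub> (\<ominus> \<one>) \<odot>\<^bsub>M\<^esub> lin M I x w"
  using assms by (subst lin_add) (auto simp: lin_smult[symmetric] Pi_iff)
 moreover have "lin M I x (\<lambda>i. v i \<ominus> w i) = lin M I x (\<lambda>i. v i \<oplus> (\<ominus> \<one>) \<otimes> w i)"
  using assms(2-) by (intro lin_cong) (auto simp: Pi_iff a_minus_def R.l_minus)
 ultimately show ?thesis using assms by (simp add: M.minus_eq smult_l_minus)
qed

lemma lin_delta:
 "finite I ==> i \<in> I ==> x \<in> I \<rightarrow> carrier M ==> r \<in> carrier R ==>
  lin M I x (\<lambda>j. if j = i then r else \<zero>) = r \<odot>\<^bsub>M\<^esub> x i"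
proof -
 assume a: "finite I" "i \<in> I" "x \<in> I \<rightarrow> carrier M" "r \<in> carrier R"
 have "lin M (I - {i}) x (\<lambda>j. if j = i then r else \<zero>) = \<zero>\<^bsub>M\<^esub>" using a by (intro lin_zero) (auto simp: Pi_iff)
 moreover have "r \<odot>\<^bsub>M\<^esub> x i \<in> carrier M" using a by auto
 ultimately show ?thesis using a by (subst lin_split[of I i]) auto
qed

lemma lin_extend:
 assumes "finite I" "J \<subseteq> I" "x \<in> I \<rightarrow> carrier M" "v \<in> J \<rightarrow> carrier R"
 shows "lin M I x (\<lambda>i. if i \<in> J then v i else \<zero>) = lin M J x v"
proof -
 have "lin M I x (\<lambda>i. if i \<in> J then v i else \<zero>) = lin M J x (\<lambda>i. if i \<in> J then v i else \<zero>)"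
  unfolding lin_def using assms by (intro M.add.finprod_mono_neutral_cong_right) (auto simp: Pi_iff subset_iff)
 also have "\<dots> = lin M J x v" using assms by (intro lin_cong) auto
 finally show ?thesis .
qed

lemma lin_union:
 assumes "finite I" "finite J" "I \<inter> J = {}" "x \<in> I \<union> J \<rightarrow> carrier M" "v \<in> I \<union> J \<rightarrow> carrier R"
 shows "lin M (I \<union> J) x v = lin M I x v \<oplus>\<^bsub>M\<^esub> lin M J x v"
 unfolding lin_def using assms by (intro M.finsum_Un_disjoint) auto

lemma lin_reindex:
 assumes "inj_on h J" "x \<in> h ` J \<rightarrow> carrier M" "v \<in> h ` J \<rightarrow> carrier R"
 shows "lin M (h ` J) x v = lin M J (\<lambda>j. x (h j)) (\<lambda>j. v (h j))"
 unfolding lin_def using assms by (intro M.finsum_reindex) auto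

lemma lin_lin:
 assumes "finite I" "finite J" "y \<in> J \<rightarrow> carrier M" "w \<in> I \<rightarrow> J \<rightarrow> carrier R" "v \<in> I \<rightarrow> carrier R"
 shows "lin M I (\<lambda>i. lin M J y (w i)) v = lin M J y (\<lambda>j. \<Oplus>i\<in>I. v i \<otimes> w i j)"
 using assms(1,4,5)
proof (induction I)
 case empty thus ?case by (simp, intro lin_zero[symmetric]) (use assms in \<open>auto simp: Pi_iff\<close>)
next
 case (insert i I)
 have "lin M (insert i I) (\<lambda>i. lin M J y (w i)) v
   = v i \<odot>\<^bsub>M\<^esub> lin M J y (w i) \<oplus>\<^bsub>M\<^esub> lin M J y (\<lambda>j. \<Oplus>i\<in>I. v i \<otimes> w i j)"
  using insert assms by (subst lin_insert) (auto simp: Pi_iff intro!: lin_closed)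
 also have "\<dots> = lin M J y (\<lambda>j. v i \<otimes> w i j \<oplus> (\<Oplus>i\<in>I. v i \<otimes> w i j))"
  using insert assms
  by (subst lin_add) (auto simp: lin_smult Pi_iff intro!: R.finsum_closed)
 also have "\<dots> = lin M J y (\<lambda>j. \<Oplus>i\<in>insert i I. v i \<otimes> w i j)"
  using insert assms
  by (intro lin_cong) (auto simp: Pi_iff intro!: R.finsum_closed)
 finally show ?case .
qed

lemma lin_submodule:
 assumes "submodule N R M" "finite I" "x \<in> I \<rightarrow> N" "v \<in> I \<rightarrow> carrier R"
 shows "lin M I x v \<in> N"
 using assms(2-4)
proof (induction I)
 case empty show ?case using submodule.axioms(1)[OF assms(1)] by (auto dest: subgroup.one_closed)
next
 case (insert i I)
 thus ?case using submoduleE[OF assms(1)] by (subst lin_insert) (auto simp: Pi_iff subset_iff)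
qed

lemma lin_carrier_update:
 assumes "submodule N R M" "finite I" "x \<in> I \<rightarrow> N" "v \<in> I \<rightarrow> carrier R"
 shows "lin (M\<lparr>carrier := N\<rparr>) I x v = lin M I x v"
proof -
 interpret N: rmod R "M\<lparr>carrier := N\<rparr>"
  using submodule.submodule_is_module[OF assms(1)] module_axioms by (intro rmod.intro)
 show ?thesis using assms(2-4)
 proof (induction I)
  case empty thus ?case using lin_empty N.lin_empty by simp
 next
  case (insert i I)
  have "N \<subseteq> carrier M" by (rule submoduleE(1)[OF assms(1)])
  hence x: "x \<in> insert i I \<rightarrow> carrier M" "x \<in> insert i I \<rightarrow> carrier (M\<lparr>carrier := N\<rparr>)" using insert by auto
  show ?case
   using lin_insert[OF insert(1,2) x(1) insert.prems(2)] N.lin_insert[OF insert(1,2) x(2) insert.prems(2)]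
    insert by (simp add: Pi_iff)
 qed
qed

text \<open>The linear combinations of the family form a submodule that contains it, and every such submodule
 contains them.\<close>
lemma span_eq_lin:
 assumes "finite I" "x \<in> I \<rightarrow> carrier M"
 shows "module_span R M (x ` I) = {lin M I x v | v. v \<in> I \<rightarrow> carrier R}"
proof
 have "submodule {lin M I x v | v. v \<in> I \<rightarrow> carrier R} R M"
 proof (rule submoduleI)
  show "\<zero>\<^bsub>M\<^esub> \<in> {lin M I x v | v. v \<in> I \<rightarrow> carrier R}"
   using lin_zero[of I "\<lambda>_. \<zero>" x] assms by (auto simp: Pi_iff intro!: exI[of _ "\<lambda>_. \<zero>"])
 next
  fix a assume "a \<in> {lin M I x v | v. v \<in> I \<rightarrow> carrier R}"
  then obtain v where v: "v \<in> I \<rightarrow> carrier R" "a = lin M I x v" by auto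
  have "\<ominus>\<^bsub>M\<^esub> a = lin M I x (\<lambda>i. (\<ominus> \<one>) \<otimes> v i)"
   using v assms by (subst lin_smult) (auto simp: smult_l_minus)
  thus "\<ominus>\<^bsub>M\<^esub> a \<in> {lin M I x v | v. v \<in> I \<rightarrow> carrier R}" using v by (auto intro!: exI[of _ "\<lambda>i. (\<ominus> \<one>) \<otimes> v i"])
 next
  fix a b assume "a \<in> {lin M I x v | v. v \<in> I \<rightarrow> carrier R}" "b \<in> {lin M I x v | v. v \<in> I \<rightarrow> carrier R}"
  then obtain v w where v: "v \<in> I \<rightarrow> carrier R" "a = lin M I x v" "w \<in> I \<rightarrow> carrier R" "b = lin M I x w" by auto
  thus "a \<oplus>\<^bsub>M\<^esub> b \<in> {lin M I x v | v. v \<in> I \<rightarrow> carrier R}"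
   using assms lin_add[of x I v w] by (auto intro!: exI[of _ "\<lambda>i. v i \<oplus> w i"])
 next
  fix r a assume "r \<in> carrier R" "a \<in> {lin M I x v | v. v \<in> I \<rightarrow> carrier R}"
  then obtain v where v: "v \<in> I \<rightarrow> carrier R" "a = lin M I x v" "r \<in> carrier R" by auto
  thus "r \<odot>\<^bsub>M\<^esub> a \<in> {lin M I x v | v. v \<in> I \<rightarrow> carrier R}"
   using assms lin_smult[of I x v r] by (auto intro!: exI[of _ "\<lambda>i. r \<otimes> v i"])
 qed (use assms in auto)
 moreover have "x ` I \<subseteq> {lin M I x v | v. v \<in> I \<rightarrow> carrier R}"
 proof
  fix y assume "y \<in> x ` I"
  then obtain i where "i \<in> I" "y = x i" by auto
  hence "y = lin M I x (\<lambda>j. if j = i then \<one> else \<zero>)"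
   using assms lin_delta[of I i x \<one>] by (auto simp: Pi_iff)
  thus "y \<in> {lin M I x v | v. v \<in> I \<rightarrow> carrier R}" by (auto intro!: exI[of _ "\<lambda>j. if j = i then \<one> else \<zero>"])
 qed
 ultimately show "module_span R M (x ` I) \<subseteq> {lin M I x v | v. v \<in> I \<rightarrow> carrier R}"
  unfolding module_span_def by blast
next
 show "{lin M I x v | v. v \<in> I \<rightarrow> carrier R} \<subseteq> module_span R M (x ` I)"
  unfolding module_span_def using assms by (auto intro!: lin_submodule)
qed

lemma span_submodule: "A \<subseteq> carrier M ==> submodule (module_span R M A) R M"
proof (rule submoduleI)
 assume A: "A \<subseteq> carrier M"
 show "module_span R M A \<subseteq> carrier M"
  unfolding module_span_def using A carrier_is_submodule by blast
qed (auto simp: module_span_def dest: submoduleE submodule.axioms(1)[THEN subgroup.one_closed])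

lemma gens_iff_span:
 "finite I ==> x \<in> I \<rightarrow> carrier M ==> gens R M I x \<longleftrightarrow> module_span R M (x ` I) = carrier M"
 unfolding gens_def by (auto simp: span_eq_lin)

lemma gens_image: "gens R M I x ==> gens R M (x ` I) (\<lambda>a. a)"
 using gens_iff_span[of I x] gens_iff_span[of "x ` I" "\<lambda>a. a"] unfolding gens_def by (auto simp: image_iff)

lemma fin_gen_iff: "fin_gen R M \<longleftrightarrow> (\<exists>(I :: nat set) x. gens R M I x)"
proof
 assume "fin_gen R M"
 then obtain A where A: "A \<subseteq> carrier M" "finite A" "module_span R M A = carrier M" unfolding fin_gen_def by blast
 obtain h where "bij_betw h {..<card A} A" using bij_betw_from_nat_into_finite A(2) by blast
 hence "h ` {..<card A} = A" by (simp add: bij_betw_def)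
 hence "gens R M {..<card A} h" using A by (subst gens_iff_span) auto
 thus "\<exists>(I :: nat set) x. gens R M I x" by blast
next
 assume "\<exists>(I :: nat set) x. gens R M I x"
 then obtain I :: "nat set" and x where "gens R M I x" by blast
 thus "fin_gen R M" unfolding fin_gen_def using gens_iff_span[of I x]
  by (intro exI[of _ "x ` I"]) (auto simp: gens_def)
qed

lemma gensD: "gens R M I x ==> y \<in> carrier M ==> \<exists>v\<in>I \<rightarrow> carrier R. y = lin M I x v"
 unfolding gens_def by blast

lemma image_smult_submodule: "r \<in> carrier R ==> submodule ((\<lambda>x. r \<odot>\<^bsub>M\<^esub> x) ` carrier M) R M"
proof (rule submoduleI, goal_cases)
 case 2 thus ?case by (auto intro!: image_eqI[of _ _ "\<zero>\<^bsub>M\<^esub>"])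
next
 case (3 a) thus ?case by (auto simp flip: smult_r_minus)
next
 case (4 a b) thus ?case by (auto simp flip: smult_r_distr)
next
 case (5 a b) thus ?case by (auto simp: smult_comm[of a])
qed auto

lemma ann_submodule: "r \<in> carrier R ==> submodule {x \<in> carrier M. r \<odot>\<^bsub>M\<^esub> x = \<zero>\<^bsub>M\<^esub>} R M"
 by (rule submoduleI) (auto simp: smult_r_minus smult_r_distr smult_comm[of r])

end

section \<open>Nakayama's lemma, one branch, and diagonal bases\<close>

context branches
begin

text \<open>The elimination proof: \<open>\<one> \<ominus> v j\<close> is a unit, so the equation for \<open>x j\<close> can be solved for \<open>x j\<close> and
 substituted into the others, which keeps their form and leaves a smaller index set.\<close>
lemma nakayama:
 fixes M :: "('a, 'x) module"
 assumes M: "module S M" and K: "submodule K S M" and "finite I" "x \<in> I \<rightarrow> carrier M"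
  and "\<And>i. i \<in> I ==> \<exists>k\<in>K. \<exists>v\<in>I \<rightarrow> m. x i = k \<oplus>\<^bsub>M\<^esub> lin M I x v"
 shows "x ` I \<subseteq> K"
proof -
 interpret M: rmod S M using M by (rule rmod.intro)
 note NE = M.submoduleE[OF K]
 have mS: "v \<in> I \<rightarrow> m ==> v \<in> coords I" for v :: "'i => 'a" and I using m_carr by auto
 show ?thesis using assms(3-5)
 proof (induction I)
  case (insert j J)
  obtain k v where k: "k \<in> K" and v: "v \<in> insert j J \<rightarrow> m"
   and xj: "x j = k \<oplus>\<^bsub>M\<^esub> lin M (insert j J) x v" using insert.prems(2)[of j] by blast
  define L where "L = lin M J x v"
  have c: "k \<in> carrier M" "x j \<in> carrier M" "L \<in> carrier M" "v j \<in> carrier S"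
   using NE(1) k insert v mS[OF v] by (auto simp: L_def Pi_iff)
  have "x j = k \<oplus>\<^bsub>M\<^esub> (v j \<odot>\<^bsub>M\<^esub> x j \<oplus>\<^bsub>M\<^esub> L)"
   using xj M.lin_insert[OF insert(1,2) insert.prems(1) mS[OF v]] by (simp add: L_def)
  also have "\<dots> = (k \<oplus>\<^bsub>M\<^esub> L) \<oplus>\<^bsub>M\<^esub> v j \<odot>\<^bsub>M\<^esub> x j" using c by (simp add: M.M.a_ac)
  finally have xj2: "x j = (k \<oplus>\<^bsub>M\<^esub> L) \<oplus>\<^bsub>M\<^esub> v j \<odot>\<^bsub>M\<^esub> x j" .
  have "(\<one> \<ominus> v j) \<odot>\<^bsub>M\<^esub> x j = x j \<ominus>\<^bsub>M\<^esub> v j \<odot>\<^bsub>M\<^esub> x j" using c by (simp add: M.smult_l_diff)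
  also have "\<dots> = k \<oplus>\<^bsub>M\<^esub> L" by (subst xj2, subst M.add_diff_cancel) (use c in auto)
  finally have e: "(\<one> \<ominus> v j) \<odot>\<^bsub>M\<^esub> x j = k \<oplus>\<^bsub>M\<^esub> L" .
  have U: "\<one> \<ominus> v j \<in> Units S" using one_minus_m[of "v j"] v unit_outside c by auto
  define u where "u = inv (\<one> \<ominus> v j)"
  have u: "u \<in> carrier S" "u \<otimes> (\<one> \<ominus> v j) = \<one>" using U by (auto simp: u_def)
  \<comment> \<open>The equation for \<open>x j\<close>, solved for \<open>x j\<close>.\<close>
  define k' v' where "k' = u \<odot>\<^bsub>M\<^esub> k" and "v' = (\<lambda>i. u \<otimes> v i)"
  have v': "v' \<in> J \<rightarrow> m" using v u by (auto simp: v'_def intro: m_mult)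
  have k': "k' \<in> K" using k u NE by (auto simp: k'_def)
  have "x j = u \<odot>\<^bsub>M\<^esub> ((\<one> \<ominus> v j) \<odot>\<^bsub>M\<^esub> x j)" using u c by (simp flip: M.smult_assoc1)
  also have "\<dots> = k' \<oplus>\<^bsub>M\<^esub> lin M J x v'"
   using u c insert mS[OF v] by (simp add: e k'_def v'_def M.smult_r_distr L_def M.lin_smult)
  finally have xj3: "x j = k' \<oplus>\<^bsub>M\<^esub> lin M J x v'" .
  have xJ: "x \<in> J \<rightarrow> carrier M" using insert by auto
  have "\<exists>k\<in>K. \<exists>v\<in>J \<rightarrow> m. x i = k \<oplus>\<^bsub>M\<^esub> lin M J x v" if i: "i \<in> J" for i
  proof -
   obtain l w where l: "l \<in> K" and w: "w \<in> insert j J \<rightarrow> m"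
    and xi: "x i = l \<oplus>\<^bsub>M\<^esub> lin M (insert j J) x w" using insert.prems(2)[of i] i by blast
   have wc: "w j \<in> carrier S" "w \<in> J \<rightarrow> m" using w m_carr by auto
   have lc: "l \<in> carrier M" "k' \<in> carrier M" "lin M J x w \<in> carrier M" "lin M J x v' \<in> carrier M"
    using l k' NE(1) xJ mS[OF wc(2)] mS[OF v'] wc by auto
   have "x i = l \<oplus>\<^bsub>M\<^esub> (w j \<odot>\<^bsub>M\<^esub> x j \<oplus>\<^bsub>M\<^esub> lin M J x w)"
    using xi M.lin_insert[OF insert(1,2) insert.prems(1) mS[OF w]] by simp
   also have "w j \<odot>\<^bsub>M\<^esub> x j = w j \<odot>\<^bsub>M\<^esub> k' \<oplus>\<^bsub>M\<^esub> lin M J x (\<lambda>i. w j \<otimes> v' i)"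
    by (subst xj3, subst M.smult_r_distr, use lc wc in simp_all, subst M.lin_smult)
      (use xJ mS[OF v'] wc insert in auto)
   also have "l \<oplus>\<^bsub>M\<^esub> (w j \<odot>\<^bsub>M\<^esub> k' \<oplus>\<^bsub>M\<^esub> lin M J x (\<lambda>i. w j \<otimes> v' i) \<oplus>\<^bsub>M\<^esub> lin M J x w)
     = (l \<oplus>\<^bsub>M\<^esub> w j \<odot>\<^bsub>M\<^esub> k') \<oplus>\<^bsub>M\<^esub> (lin M J x (\<lambda>i. w j \<otimes> v' i) \<oplus>\<^bsub>M\<^esub> lin M J x w)"
    using lc wc mS[OF v'] xJ by (subst M.M.a_assoc | auto simp: Pi_iff M.M.a_assoc)+
   also have "lin M J x (\<lambda>i. w j \<otimes> v' i) \<oplus>\<^bsub>M\<^esub> lin M J x w = lin M J x (\<lambda>i. w j \<otimes> v' i \<oplus> w i)"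
    using wc mS[OF v'] mS[OF wc(2)] xJ by (intro M.lin_add[symmetric]) auto
   finally show ?thesis using l k' NE wc v' m_carr
    by (intro bexI[of _ "l \<oplus>\<^bsub>M\<^esub> w j \<odot>\<^bsub>M\<^esub> k'"] bexI[of _ "\<lambda>i. w j \<otimes> v' i \<oplus> w i"])
      (auto intro!: m_add m_mult)
  qed
  hence J: "x ` J \<subseteq> K" by (rule insert.IH[OF xJ])
  hence "lin M J x v' \<in> K" using M.lin_submodule[OF K insert(1), of x v'] mS[OF v'] by (auto simp: Pi_iff image_subset_iff)
  hence "x j \<in> K" using xj3 k' NE by auto
  thus ?case using J by auto
 qed simp
qed

lemma gens_subset_submodule:
 fixes M :: "('a, 'x) module"
 assumes "module S M" "gens S M I x" "submodule K S M" "x ` I \<subseteq> K"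
 shows "K = carrier M"
proof -
 interpret M: rmod S M using assms(1) by (rule rmod.intro)
 show ?thesis
 proof (rule antisym[OF M.submoduleE(1)[OF assms(3)]], rule)
  fix y assume "y \<in> carrier M"
  then obtain v where "v \<in> coords I" "y = lin M I x v" "finite I" using assms(2) by (auto simp: gens_def)
  thus "y \<in> K" using M.lin_submodule[OF assms(3), of I x v] assms(4) by (auto simp: Pi_iff image_subset_iff)
 qed
qed

text \<open>The form of Nakayama's lemma for the quotient by \<open>K\<close> on which \<open>r\<close> acts surjectively.\<close>
lemma nakayama_mult:
 fixes M :: "('a, 'x) module"
 assumes M: "module S M" and K: "submodule K S M" and g: "gens S M I x" and r: "r \<in> m"
  and "\<And>y. y \<in> carrier M ==> \<exists>k\<in>K. \<exists>z\<in>carrier M. y = k \<oplus>\<^bsub>M\<^esub> r \<odot>\<^bsub>M\<^esub> z"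
 shows "K = carrier M"
proof -
 interpret M: rmod S M using M by (rule rmod.intro)
 have I: "finite I" "x \<in> I \<rightarrow> carrier M" using g by (auto simp: gens_def)
 have "x ` I \<subseteq> K"
 proof (rule nakayama[OF M K I])
  fix i assume "i \<in> I"
  then obtain k z where k: "k \<in> K" "z \<in> carrier M" "x i = k \<oplus>\<^bsub>M\<^esub> r \<odot>\<^bsub>M\<^esub> z" using assms(5)[of "x i"] I by blast
  obtain v where v: "v \<in> coords I" "z = lin M I x v" using M.gensD[OF g k(2)] by blast
  have "x i = k \<oplus>\<^bsub>M\<^esub> lin M I x (\<lambda>i. r \<otimes> v i)" using k v I r m_carr by (simp add: M.lin_smult)
  thus "\<exists>k\<in>K. \<exists>v\<in>I \<rightarrow> m. x i = k \<oplus>\<^bsub>M\<^esub> lin M I x v"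
   using k v r by (intro bexI[of _ k] bexI[of _ "\<lambda>i. r \<otimes> v i"]) (auto intro: m_mult2)
 qed
 thus ?thesis by (rule gens_subset_submodule[OF M g K])
qed

lemma dvd_kills:
 fixes M :: "('a, 'x) module"
 assumes "module S M" "a \<in> carrier S" "a divides c" "y \<in> carrier M" "a \<odot>\<^bsub>M\<^esub> y = \<zero>\<^bsub>M\<^esub>"
 shows "c \<odot>\<^bsub>M\<^esub> y = \<zero>\<^bsub>M\<^esub>"
proof -
 interpret M: rmod S M using assms(1) by (rule rmod.intro)
 obtain r where r: "r \<in> carrier S" "c = a \<otimes> r" using assms(3) by (rule dvdE)
 have "c \<odot>\<^bsub>M\<^esub> y = r \<odot>\<^bsub>M\<^esub> (a \<odot>\<^bsub>M\<^esub> y)"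
  unfolding r(2) m_comm[OF assms(2) r(1)] using assms(2,4) r(1) by (intro M.smult_assoc1)
 thus ?thesis using r(1) assms(5) by simp
qed

lemma cong_smult:
 fixes M :: "('a, 'x) module"
 assumes "module S M" "a \<in> carrier S" "b \<in> carrier S" "c \<in> carrier S" "a divides (b \<ominus> c)"
  "y \<in> carrier M" "a \<odot>\<^bsub>M\<^esub> y = \<zero>\<^bsub>M\<^esub>"
 shows "b \<odot>\<^bsub>M\<^esub> y = c \<odot>\<^bsub>M\<^esub> y"
proof -
 interpret M: rmod S M using assms(1) by (rule rmod.intro)
 have "(b \<ominus> c) \<odot>\<^bsub>M\<^esub> y = \<zero>\<^bsub>M\<^esub>" by (rule dvd_kills[OF assms(1,2,5,6,7)])
 thus ?thesis using assms(3,4,6) by (simp add: M.smult_l_diff M.diff_zero_iff)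
qed

text \<open>Modulo \<open>f j\<close> the regular element \<open>t\<close> is zero or a unit times a positive power of \<open>p j\<close>, so it kills
 whatever \<open>f j\<close> and \<open>p j\<close> kill. This is how the Cohen-Macaulay property enters: submodules killed by
 \<open>f j\<close> are torsion-free over \<open>S/f j\<close>.\<close>
lemma p_regular:
 fixes M :: "('a, 'x) module"
 assumes M: "module S M" and j: "j \<in> {1..N}" and t: "t \<in> m"
  and reg: "\<And>y. y \<in> carrier M ==> t \<odot>\<^bsub>M\<^esub> y = \<zero>\<^bsub>M\<^esub> ==> y = \<zero>\<^bsub>M\<^esub>"
  and y: "y \<in> carrier M" "f j \<odot>\<^bsub>M\<^esub> y = \<zero>\<^bsub>M\<^esub>" "p j \<odot>\<^bsub>M\<^esub> y = \<zero>\<^bsub>M\<^esub>"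
 shows "y = \<zero>\<^bsub>M\<^esub>"
proof (rule reg[OF y(1)])
 interpret M: rmod S M using M by (rule rmod.intro)
 have tS: "t \<in> carrier S" using t m_carr by blast
 show "t \<odot>\<^bsub>M\<^esub> y = \<zero>\<^bsub>M\<^esub>"
 proof (cases "f j divides t")
  case True thus ?thesis using dvd_kills[OF M _ True y(1,2)] j by auto
 next
  case False
  obtain u and e :: nat where u: "u \<in> Units S" "f j divides (t \<ominus> u \<otimes> p j [^] e)"
   using valuation[OF j tS False] by blast
  have uS: "u \<in> carrier S" using u by auto
  have e: "e \<noteq> 0"
  proof
   assume "e = 0"
   hence "f j divides (t \<ominus> u)" using u uS by simp
   hence "t \<ominus> u \<in> m" using m_dvd f_m j by blast
   hence "t \<ominus> (t \<ominus> u) \<in> m" using t m_diff by blast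
   moreover have "t \<ominus> (t \<ominus> u) = u" using tS uS by algebra
   ultimately show False using u unit_notin_m by simp
  qed
  have "p j divides (u \<otimes> p j [^] e)"
   using e j uS by (cases e) (auto intro!: dvd_mult dvd_refl)
  hence "(u \<otimes> p j [^] e) \<odot>\<^bsub>M\<^esub> y = \<zero>\<^bsub>M\<^esub>" using dvd_kills[OF M _ _ y(1,3)] j by auto
  moreover have "t \<odot>\<^bsub>M\<^esub> y = (u \<otimes> p j [^] e) \<odot>\<^bsub>M\<^esub> y"
   using cong_smult[OF M _ tS _ u(2) y(1,2)] j uS by auto
  ultimately show ?thesis by simp
 qed
qed

text \<open>A nontrivial relation over the discrete valuation ring \<open>S/f j\<close> can be divided by the largest power
 of the uniformizer that divides all coefficients, as the module is torsion-free. Then some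
 coefficient is a unit.\<close>
lemma unit_relation:
 fixes M :: "('a, 'x) module"
 assumes M: "module S M" and j: "j \<in> {1..N}" and I: "finite I" "x \<in> I \<rightarrow> carrier M"
  and fx: "\<And>i. i \<in> I ==> f j \<odot>\<^bsub>M\<^esub> x i = \<zero>\<^bsub>M\<^esub>"
  and reg: "\<And>y. y \<in> carrier M ==> f j \<odot>\<^bsub>M\<^esub> y = \<zero>\<^bsub>M\<^esub> ==> p j \<odot>\<^bsub>M\<^esub> y = \<zero>\<^bsub>M\<^esub> ==> y = \<zero>\<^bsub>M\<^esub>"
  and v: "v \<in> coords I" "lin M I x v = \<zero>\<^bsub>M\<^esub>" and i0: "i0 \<in> I" "\<not> f j divides v i0"
 shows "\<exists>w\<in> coords I. lin M I x w = \<zero>\<^bsub>M\<^esub> \<and> (\<exists>i\<in>I. w i \<in> Units S)"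
proof -
 interpret M: rmod S M using M by (rule rmod.intro)
 define P where "P i \<longleftrightarrow> i \<in> I \<and> \<not> f j divides v i" for i
 have "\<forall>i. P i --> (\<exists>ue. fst ue \<in> Units S \<and> f j divides (v i \<ominus> fst ue \<otimes> p j [^] (snd ue :: nat)))"
 proof (intro allI impI)
  fix i assume "P i"
  then obtain u and e :: nat where "u \<in> Units S" "f j divides (v i \<ominus> u \<otimes> p j [^] e)"
   using valuation[OF j, of "v i"] v by (auto simp: P_def Pi_iff)
  thus "\<exists>ue. fst ue \<in> Units S \<and> f j divides (v i \<ominus> fst ue \<otimes> p j [^] (snd ue :: nat))"
   by (intro exI[of _ "(u, e)"]) simp
 qed
 then obtain ue where ue: "\<And>i. P i ==> fst (ue i) \<in> Units S"
  "\<And>i. P i ==> f j divides (v i \<ominus> fst (ue i) \<otimes> p j [^] (snd (ue i) :: nat))" by metis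
 have "P i0" using i0 by (simp add: P_def)
 then obtain i1 where i1: "P i1" "\<And>i. P i ==> snd (ue i1) \<le> snd (ue i)"
  using ex_has_least_nat[of P i0 "\<lambda>i. snd (ue i)"] by blast
 define e where "e = snd (ue i1)"
 \<comment> \<open>The coefficients after division by the least power \<open>p j [^] e\<close>. Coefficients divisible by
   \<open>f j\<close>, which act as zero, are dropped.\<close>
 define w where "w i = (if P i then fst (ue i) \<otimes> p j [^] (snd (ue i) - e) else \<zero>)" for i
 have pe: "p j [^] k \<in> carrier S" for k :: nat using j by auto
 have w: "w \<in> coords I" using Units_closed[OF ue(1)] pe by (auto simp: w_def)
 have eq: "(p j [^] e \<otimes> w i) \<odot>\<^bsub>M\<^esub> x i = v i \<odot>\<^bsub>M\<^esub> x i" if i: "i \<in> I" for i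
 proof (rule cong_smult[OF M _ _ _ _ _ fx[OF i], symmetric])
  show "f j divides (v i \<ominus> p j [^] e \<otimes> w i)"
  proof (cases "P i")
   case True
   have "p j [^] e \<otimes> w i = fst (ue i) \<otimes> (p j [^] e \<otimes> p j [^] (snd (ue i) - e))"
    using True Units_closed[OF ue(1)[OF True]] pe by (simp add: w_def m_lcomm)
   also have "p j [^] e \<otimes> p j [^] (snd (ue i) - e) = p j [^] snd (ue i)"
    using i1(2)[OF True] j by (simp add: nat_pow_mult e_def)
   finally show ?thesis using ue(2)[OF True] by simp
  next
   case False thus ?thesis using i v pe by (auto simp: w_def P_def a_minus_def Pi_iff)
  qed
 qed (use i I v w j pe in auto)
 have "lin M I x (\<lambda>i. p j [^] e \<otimes> w i) = lin M I x v" using I v eq by (intro M.lin_cong) auto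
 hence z: "p j [^] e \<odot>\<^bsub>M\<^esub> lin M I x w = \<zero>\<^bsub>M\<^esub>" using I w pe v by (simp add: M.lin_smult)
 have fl: "f j \<odot>\<^bsub>M\<^esub> lin M I x w = \<zero>\<^bsub>M\<^esub>"
 proof -
  have "f j \<odot>\<^bsub>M\<^esub> lin M I x w = lin M I (\<lambda>i. f j \<odot>\<^bsub>M\<^esub> x i) w" using I w j by (simp add: M.lin_smult_right)
  also have "\<dots> = \<zero>\<^bsub>M\<^esub>" using fx w by (intro M.lin_zero) (auto simp: Pi_iff)
  finally show ?thesis .
 qed
 have "y \<in> carrier M ==> f j \<odot>\<^bsub>M\<^esub> y = \<zero>\<^bsub>M\<^esub> ==> p j [^] k \<odot>\<^bsub>M\<^esub> y = \<zero>\<^bsub>M\<^esub> ==> y = \<zero>\<^bsub>M\<^esub>" for y and k :: nat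
 proof (induction k arbitrary: y)
  case (Suc k)
  have "f j \<odot>\<^bsub>M\<^esub> (p j \<odot>\<^bsub>M\<^esub> y) = \<zero>\<^bsub>M\<^esub>"
   using M.smult_comm[OF f_closed[OF j] p_closed[OF j] Suc.prems(1)] p_closed[OF j] Suc.prems(2) by simp
  moreover have "p j [^] k \<odot>\<^bsub>M\<^esub> (p j \<odot>\<^bsub>M\<^esub> y) = \<zero>\<^bsub>M\<^esub>"
   using M.smult_assoc1[OF pe p_closed[OF j] Suc.prems(1), of k] Suc.prems(3) by simp
  ultimately have "p j \<odot>\<^bsub>M\<^esub> y = \<zero>\<^bsub>M\<^esub>" using Suc j by simp
  thus ?case using reg Suc by blast
 qed auto
 hence "lin M I x w = \<zero>\<^bsub>M\<^esub>" using z fl I w by blast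
 moreover have "w i1 \<in> Units S" "i1 \<in> I" using i1 ue(1)[OF i1(1)] Units_closed[OF ue(1)[OF i1(1)]]
  by (simp_all add: w_def e_def, simp add: P_def)
 ultimately show ?thesis using w by blast
qed

text \<open>Finitely generated torsion-free modules over a discrete valuation ring are free: in a generating
 family of minimal size a nontrivial relation would, by the preceding lemma, make one of the
 generators superfluous.\<close>
lemma free_over_branch:
 fixes M :: "('a, 'x) module"
 assumes M: "module S M" and j: "j \<in> {1..N}" and g: "gens S M (I :: nat set) x"
  and fX: "\<And>y. y \<in> carrier M ==> f j \<odot>\<^bsub>M\<^esub> y = \<zero>\<^bsub>M\<^esub>"
  and reg: "\<And>y. y \<in> carrier M ==> p j \<odot>\<^bsub>M\<^esub> y = \<zero>\<^bsub>M\<^esub> ==> y = \<zero>\<^bsub>M\<^esub>"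
 shows "\<exists>(J :: nat set) y. gens S M J y \<and>
   (\<forall>v\<in> coords J. lin M J y v = \<zero>\<^bsub>M\<^esub> --> (\<forall>i\<in>J. f j divides v i))"
proof -
 interpret M: rmod S M using M by (rule rmod.intro)
 define P where "P k \<longleftrightarrow> (\<exists>(J :: nat set) y. gens S M J y \<and> card J = k)" for k
 have "P (card I)" using g by (auto simp: P_def)
 then obtain k where k: "P k" "\<And>l. l < k ==> \<not> P l" using exists_least_iff[of P] by blast
 obtain J :: "nat set" and y where J: "gens S M J y" "card J = k" using k(1) by (auto simp: P_def)
 have Jf: "finite J" "y \<in> J \<rightarrow> carrier M" using J by (auto simp: gens_def)
 have "f j divides v i" if v: "v \<in> coords J" "lin M J y v = \<zero>\<^bsub>M\<^esub>" and i: "i \<in> J" for v i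
 proof (rule ccontr)
  assume "\<not> f j divides v i"
  then obtain w i0 where w: "w \<in> coords J" "lin M J y w = \<zero>\<^bsub>M\<^esub>" and i0: "i0 \<in> J" "w i0 \<in> Units S"
   using unit_relation[OF M j Jf fX reg v i] Jf by (metis PiE)
  have "gens S M (J - {i0}) y"
   unfolding gens_def
  proof (intro conjI ballI)
   fix z assume "z \<in> carrier M"
   then obtain c where c: "c \<in> coords J" "z = lin M J y c" using M.gensD[OF J(1)] by blast
   define r where "r = c i0 \<otimes> inv (w i0)"
   have r: "r \<in> carrier S" "c i0 = r \<otimes> w i0" using c i0 Units_closed[OF i0(2)] by (auto simp: r_def m_assoc Pi_iff)
   define c' where "c' = (\<lambda>i. c i \<ominus> r \<otimes> w i)"
   have c': "c' \<in> coords J" using c r w by (auto simp: c'_def Pi_iff)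
   have "lin M J y c' = lin M J y c \<ominus>\<^bsub>M\<^esub> r \<odot>\<^bsub>M\<^esub> lin M J y w"
    unfolding c'_def using Jf c r(1) w(1) by (subst M.lin_diff) (auto simp: M.lin_smult Pi_iff)
   hence "lin M J y c' = z" using w r c Jf by (simp add: M.M.minus_eq)
   moreover have "c' i0 = \<zero>" using r c i0 w by (simp add: c'_def Pi_iff a_minus_def r_neg)
   ultimately have "z = \<zero> \<odot>\<^bsub>M\<^esub> y i0 \<oplus>\<^bsub>M\<^esub> lin M (J - {i0}) y c'"
    using M.lin_split[OF Jf(1) i0(1) Jf(2) c'] by simp
   moreover have "lin M (J - {i0}) y c' \<in> carrier M" using Jf c' by (intro M.lin_closed) auto
   ultimately have "z = lin M (J - {i0}) y c'" using Jf i0 by (auto simp: Pi_iff)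
   thus "\<exists>v\<in>J - {i0} \<rightarrow> carrier S. z = lin M (J - {i0}) y v" using c' by auto
  qed (use Jf in auto)
  moreover have "card (J - {i0}) < k" using J(2) Jf(1) i0(1) by (metis card_Diff1_less)
  ultimately show False using k(2) unfolding P_def by blast
 qed
 thus ?thesis using J(1) by blast
qed

text \<open>The family \<open>x\<close> exhibits \<open>M\<close> as the direct sum of the cyclic modules \<open>S/g\<^bsub>d i\<^esub>\<close>.\<close>
definition diag :: "nat => ('a, 'x) module => 'i set => ('i => 'x) => ('i => nat) => bool" where
 "diag n M I x d \<longleftrightarrow> gens S M I x \<and> d \<in> I \<rightarrow> {1..n} \<and>
   (\<forall>i\<in>I. gp 0 (d i) \<odot>\<^bsub>M\<^esub> x i = \<zero>\<^bsub>M\<^esub>) \<and>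
   (\<forall>v\<in> coords I. lin M I x v = \<zero>\<^bsub>M\<^esub> --> (\<forall>i\<in>I. gp 0 (d i) divides v i))"

lemma diagD:
 assumes "diag n M I x d"
 shows "gens S M I x" "finite I" "x \<in> I \<rightarrow> carrier M" "d \<in> I \<rightarrow> {1..n}"
  "i \<in> I ==> gp 0 (d i) \<odot>\<^bsub>M\<^esub> x i = \<zero>\<^bsub>M\<^esub>"
  "v \<in> coords I ==> lin M I x v = \<zero>\<^bsub>M\<^esub> ==> i \<in> I ==> gp 0 (d i) divides v i"
 using assms unfolding diag_def gens_def by blast+

text \<open>As in linear algebra, the coefficient of \<open>x i0\<close> in \<open>y\<close> is a unit, so each of the two families can be
 expressed by the other one. The new family has the same relations because \<open>g\<^bsub>d i0\<^esub>\<close> still kills the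
 new element.\<close>
lemma exchange:
 fixes M :: "('a, 'x) module"
 assumes M: "module S M" and n: "n \<le> N" and D: "diag n M I x d" and i0: "i0 \<in> I"
  and v: "v \<in> coords I" "v i0 \<notin> m" and y: "y = lin M I x v" "gp 0 (d i0) \<odot>\<^bsub>M\<^esub> y = \<zero>\<^bsub>M\<^esub>"
 shows "diag n M I (x(i0 := y)) d"
proof -
 interpret M: rmod S M using M by (rule rmod.intro)
 note I = diagD(2,3)[OF D]
 define L where "L w = lin M (I - {i0}) x w" for w
 have Lx: "lin M (I - {i0}) (x(i0 := y)) w = L w" if "w \<in> coords I" for w
  unfolding L_def using I that by (intro M.lin_cong) auto
 have Lc: "L w \<in> carrier M" if "w \<in> coords I" for w
  unfolding L_def using I that by (intro M.lin_closed) auto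
 have yc: "y \<in> carrier M" using y I v by simp
 have x0: "x i0 \<in> carrier M" "v i0 \<in> carrier S" using I i0 v by auto
 have xy: "x(i0 := y) \<in> I \<rightarrow> carrier M" using I yc by auto
 have sx: "lin M I x w = w i0 \<odot>\<^bsub>M\<^esub> x i0 \<oplus>\<^bsub>M\<^esub> L w" if "w \<in> coords I" for w
  unfolding L_def using M.lin_split[OF I(1) i0 I(2) that] .
 have sy: "lin M I (x(i0 := y)) w = w i0 \<odot>\<^bsub>M\<^esub> y \<oplus>\<^bsub>M\<^esub> L w" if "w \<in> coords I" for w
  using M.lin_split[OF I(1) i0 xy that] Lx[OF that] by simp
 have Lcomb: "L (\<lambda>i. r \<otimes> v i \<oplus> w i) = r \<odot>\<^bsub>M\<^esub> L v \<oplus>\<^bsub>M\<^esub> L w" if "r \<in> carrier S" "w \<in> coords I" for r w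
  unfolding L_def using I that v by (subst M.lin_add) (auto simp: M.lin_smult Pi_iff)
 have U: "v i0 \<in> Units S" using v unit_outside x0 by blast
 \<comment> \<open>switching between the two families\<close>
 have sw: "lin M I (x(i0 := y)) w = lin M I x (\<lambda>i. if i = i0 then w i0 \<otimes> v i0 else w i0 \<otimes> v i \<oplus> w i)"
  (is "_ = lin M I x ?w") if w: "w \<in> coords I" for w
 proof -
  have w0: "w i0 \<in> carrier S" using w i0 by auto
  have wc: "?w \<in> coords I" using w v i0 by (auto simp: Pi_iff)
  have "L ?w = L (\<lambda>i. w i0 \<otimes> v i \<oplus> w i)" unfolding L_def using I w v w0 by (intro M.lin_cong) (auto simp: Pi_iff)
  hence "lin M I x ?w = (w i0 \<otimes> v i0) \<odot>\<^bsub>M\<^esub> x i0 \<oplus>\<^bsub>M\<^esub> (w i0 \<odot>\<^bsub>M\<^esub> L v \<oplus>\<^bsub>M\<^esub> L w)"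
   using sx[OF wc] Lcomb[OF w0 w] by simp
  also have "\<dots> = w i0 \<odot>\<^bsub>M\<^esub> (v i0 \<odot>\<^bsub>M\<^esub> x i0 \<oplus>\<^bsub>M\<^esub> L v) \<oplus>\<^bsub>M\<^esub> L w"
   using w0 x0 Lc v w by (simp add: M.smult_assoc1 M.smult_r_distr M.M.a_assoc)
  also have "\<dots> = lin M I (x(i0 := y)) w" using sx[OF v(1)] sy[OF w] y by simp
  finally show ?thesis by simp
 qed
 show ?thesis unfolding diag_def
 proof (intro conjI ballI impI)
  show "gens S M I (x(i0 := y))" unfolding gens_def
  proof (intro conjI ballI)
   fix z assume "z \<in> carrier M"
   then obtain c where c: "c \<in> coords I" "z = lin M I x c" using M.gensD[OF diagD(1)[OF D]] by blast
   define r where "r = c i0 \<otimes> inv (v i0)"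
   have r: "r \<in> carrier S" "r \<otimes> v i0 = c i0" using c i0 U x0 by (auto simp: r_def m_assoc Pi_iff)
   define w where "w i = (if i = i0 then r else c i \<ominus> r \<otimes> v i)" for i
   have w: "w \<in> coords I" using c r v by (auto simp: w_def Pi_iff)
   have "lin M I (x(i0 := y)) w = lin M I x c"
    unfolding sw[OF w]
   proof (rule M.lin_cong[OF I(2) c(1)])
    fix i assume i: "i \<in> I"
    have "r \<otimes> v i \<oplus> (c i \<ominus> r \<otimes> v i) = c i"
     using r(1) v c i by (auto simp: Pi_iff a_minus_def a_lcomm[of "r \<otimes> v i"] r_neg)
    thus "(if i = i0 then w i0 \<otimes> v i0 else w i0 \<otimes> v i \<oplus> w i) \<odot>\<^bsub>M\<^esub> x i = c i \<odot>\<^bsub>M\<^esub> x i"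
     using r by (auto simp: w_def)
   qed
   thus "\<exists>v\<in> coords I. z = lin M I (x(i0 := y)) v" using w c(2) by (metis (no_types, lifting))
  qed (use I xy in auto)
 next
  fix i assume "i \<in> I" thus "gp 0 (d i) \<odot>\<^bsub>M\<^esub> (x(i0 := y)) i = \<zero>\<^bsub>M\<^esub>" using diagD(5)[OF D] y by auto
 next
  fix w i assume w: "w \<in> coords I" and z: "lin M I (x(i0 := y)) w = \<zero>\<^bsub>M\<^esub>" and i: "i \<in> I"
  have w0: "w i0 \<in> carrier S" using w i0 by auto
  have g0: "gp 0 (d i0) \<in> carrier S" using diagD(4)[OF D] i0 n by (intro gp_closed) (auto simp: Pi_iff)
  have "gp 0 (d i0) divides (if i0 = i0 then w i0 \<otimes> v i0 else w i0 \<otimes> v i0 \<oplus> w i0)"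
   using z w v i0 by (intro diagD(6)[OF D, of "\<lambda>i. if i = i0 then w i0 \<otimes> v i0 else w i0 \<otimes> v i \<oplus> w i"])
    (auto simp: sw Pi_iff)
  hence "gp 0 (d i0) divides (w i0 \<otimes> v i0)" by simp
  hence "gp 0 (d i0) divides (w i0 \<otimes> v i0 \<otimes> inv (v i0))"
   using w0 x0 U by (intro dvd_mult2[OF g0, where b = "w i0 \<otimes> v i0"]) auto
  hence d0: "gp 0 (d i0) divides w i0" using w0 x0 U by (simp add: m_assoc)
  have "w i0 \<odot>\<^bsub>M\<^esub> y = \<zero>\<^bsub>M\<^esub>" using dvd_kills[OF M g0 d0 yc y(2)] .
  hence "L w = \<zero>\<^bsub>M\<^esub>" using z sy[OF w] Lc[OF w] by simp
  moreover have "L (w(i0 := \<zero>)) = L w" unfolding L_def using I w by (intro M.lin_cong) auto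
  moreover have wz: "w(i0 := \<zero>) \<in> coords I" using w by auto
  ultimately have "lin M I x (w(i0 := \<zero>)) = \<zero>\<^bsub>M\<^esub>" using sx[OF wz] x0 by simp
  hence "gp 0 (d i) divides (w(i0 := \<zero>)) i" using diagD(6)[OF D wz _ i] by blast
  thus "gp 0 (d i) divides w i" using d0 by (cases "i = i0") auto
 qed (use diagD(4)[OF D] in auto)
qed

end

section \<open>The annihilator condition yields a diagonal basis\<close>

context branches
begin

text \<open>The annihilator condition, which turns out to be the vanishing of \<open>Ext\<^sup>1(T, M)\<close>.\<close>
definition annc :: "nat => ('a, 'x) module => bool" where
 "annc n M \<longleftrightarrow> (\<forall>i\<in>{1..n}. \<forall>x\<in>carrier M. gp i n \<odot>\<^bsub>M\<^esub> x = \<zero>\<^bsub>M\<^esub> --> (\<exists>y\<in>carrier M. x = gp 0 i \<odot>\<^bsub>M\<^esub> y))"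

text \<open>Let \<open>x\<close> lift a diagonal basis of \<open>f\<^bsub>n+1\<^esub> M\<close> along multiplication with \<open>f\<^bsub>n+1\<^esub>\<close>. A lift that is killed by
 the same \<open>g\<^bsub>d i\<^esub>\<close> keeps its degree, and the others, all of degree \<open>n\<close>, get the degree \<open>n + 1\<close>. The
 family generates \<open>M\<close> by Nakayama's lemma: \<open>M\<close> is generated by it together with the kernel of \<open>f\<^bsub>n+1\<^esub>\<close>,
 which is contained in \<open>g\<^sub>n M\<close>. Multiplying a relation with \<open>f\<^bsub>n+1\<^esub>\<close> shows that its coefficients are
 divisible by the \<open>g\<^bsub>d i\<^esub>\<close>; what is left is a relation between the \<open>g\<^sub>n x i\<close>, to which \<open>indep\<close> applies.\<close>
lemma diag_lift:
 fixes M :: "('a, 'x) module"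
 assumes M: "module S M" and n: "n \<ge> 1" "Suc n \<le> N" and g0: "gens S M I0 x0"
  and kill: "\<And>y. y \<in> carrier M ==> f (Suc n) \<odot>\<^bsub>M\<^esub> y = \<zero>\<^bsub>M\<^esub> ==> \<exists>z\<in>carrier M. y = gp 0 n \<odot>\<^bsub>M\<^esub> z"
  and D: "diag n (M\<lparr>carrier := (\<lambda>x. f (Suc n) \<odot>\<^bsub>M\<^esub> x) ` carrier M\<rparr>) I b d"
  and x: "x \<in> I \<rightarrow> carrier M" "\<And>i. i \<in> I ==> f (Suc n) \<odot>\<^bsub>M\<^esub> x i = b i"
  and Bad: "Bad \<subseteq> I" "\<And>i. i \<in> Bad ==> d i = n"
  and good: "\<And>i. i \<in> I ==> i \<notin> Bad ==> gp 0 (d i) \<odot>\<^bsub>M\<^esub> x i = \<zero>\<^bsub>M\<^esub>"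
  and indep: "\<And>w i. w \<in> coords Bad ==> lin M Bad (\<lambda>i. gp 0 n \<odot>\<^bsub>M\<^esub> x i) w = \<zero>\<^bsub>M\<^esub> ==> i \<in> Bad
    ==> f (Suc n) divides w i"
 shows "diag (Suc n) M I x (\<lambda>i. if i \<in> Bad then Suc n else d i)"
proof -
 interpret M: rmod S M using M by (rule rmod.intro)
 let ?F = "f (Suc n)" and ?g = "gp 0 n"
 have F: "?F \<in> carrier S" "?g \<in> carrier S" "gp 0 (Suc n) = ?g \<otimes> ?F" using n by (auto simp: gp_Suc)
 let ?K = "(\<lambda>x. ?F \<odot>\<^bsub>M\<^esub> x) ` carrier M"
 have K: "submodule ?K S M" using F by (intro M.image_smult_submodule)
 note I = diagD(2)[OF D]
 have b: "b \<in> I \<rightarrow> ?K" using diagD(3)[OF D] by simp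
 have linK: "lin (M\<lparr>carrier := ?K\<rparr>) I b v = lin M I b v" if "v \<in> coords I" for v
  using M.lin_carrier_update[OF K I b that] .
 have Flin: "?F \<odot>\<^bsub>M\<^esub> lin M I x v = lin M I b v" if "v \<in> coords I" for v
 proof -
  have "lin M I b v = lin M I (\<lambda>i. ?F \<odot>\<^bsub>M\<^esub> x i) v" using x that F by (intro M.lin_cong) auto
  thus ?thesis using M.lin_smult_right[OF I x(1) that F(1)] by simp
 qed
 show ?thesis unfolding diag_def
 proof (intro conjI ballI impI)
  have "module_span S M (x ` I) = carrier M"
  proof (rule nakayama_mult[OF M _ g0])
   show "submodule (module_span S M (x ` I)) S M"
    using M.span_submodule[of "x ` I"] x by auto
   show "?g \<in> m" using n by (intro gp_m) auto
   fix y assume y: "y \<in> carrier M"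
   hence "?F \<odot>\<^bsub>M\<^esub> y \<in> carrier (M\<lparr>carrier := ?K\<rparr>)" by simp
   then obtain v where v: "v \<in> coords I" "?F \<odot>\<^bsub>M\<^esub> y = lin (M\<lparr>carrier := ?K\<rparr>) I b v"
    using diagD(1)[OF D] unfolding gens_def by blast
   have lx: "lin M I x v \<in> carrier M" using x v by auto
   have lb: "lin M I b v \<in> carrier M" using Flin[OF v(1)] lx F by (metis M.smult_closed)
   have "?F \<odot>\<^bsub>M\<^esub> (y \<ominus>\<^bsub>M\<^esub> lin M I x v) = \<zero>\<^bsub>M\<^esub>"
    using v y lx lb F linK[OF v(1)] Flin[OF v(1)] by (simp add: M.smult_r_diff M.diff_zero_iff)
   then obtain z where z: "z \<in> carrier M" "y \<ominus>\<^bsub>M\<^esub> lin M I x v = ?g \<odot>\<^bsub>M\<^esub> z" using kill[of "y \<ominus>\<^bsub>M\<^esub> lin M I x v"] y lx by auto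
   have "y = lin M I x v \<oplus>\<^bsub>M\<^esub> ?g \<odot>\<^bsub>M\<^esub> z"
    using M.diff_add_cancel[OF y lx] z F lx by (simp add: M.M.a_comm)
   moreover have "lin M I x v \<in> module_span S M (x ` I)" using M.span_eq_lin[OF I x(1)] v by auto
   ultimately show "\<exists>k\<in>module_span S M (x ` I). \<exists>z\<in>carrier M. y = k \<oplus>\<^bsub>M\<^esub> ?g \<odot>\<^bsub>M\<^esub> z" using z by blast
  qed
  thus "gens S M I x" using M.gens_iff_span[OF I x(1)] by blast
 next
  show "(\<lambda>i. if i \<in> Bad then Suc n else d i) \<in> I \<rightarrow> {1..Suc n}" using diagD(4)[OF D] by (auto simp: Pi_iff intro: le_SucI)
 next
  fix i assume i: "i \<in> I"
  show "gp 0 (if i \<in> Bad then Suc n else d i) \<odot>\<^bsub>M\<^esub> x i = \<zero>\<^bsub>M\<^esub>"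
  proof (cases "i \<in> Bad")
   case True
   have "?g \<odot>\<^bsub>M\<^esub> b i = \<zero>\<^bsub>M\<^esub>" using diagD(5)[OF D i] Bad(2)[OF True] by simp
   thus ?thesis using True F x i by (auto simp: M.smult_assoc1 Pi_iff)
  qed (use good i in auto)
 next
  fix v i assume v: "v \<in> coords I" and z: "lin M I x v = \<zero>\<^bsub>M\<^esub>" and i: "i \<in> I"
  have "lin (M\<lparr>carrier := ?K\<rparr>) I b v = \<zero>\<^bsub>M\<lparr>carrier := ?K\<rparr>\<^esub>" using Flin[OF v] z linK[OF v] F by simp
  hence dv: "gp 0 (d i) divides v i" if "i \<in> I" for i using diagD(6)[OF D v] that by blast
  show "gp 0 (if i \<in> Bad then Suc n else d i) divides v i"
  proof (cases "i \<in> Bad")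
   case True
   have "\<forall>i\<in>Bad. \<exists>w\<in>carrier S. v i = ?g \<otimes> w" using dv Bad by (metis dvdE subsetD)
   then obtain w where w: "\<And>i. i \<in> Bad ==> w i \<in> carrier S \<and> v i = ?g \<otimes> w i" by metis
   have fB: "finite Bad" using Bad(1) I finite_subset by blast
   have "lin M I x v = lin M I x (\<lambda>i. if i \<in> Bad then v i else \<zero>)"
   proof (rule M.lin_cong)
    fix i assume i: "i \<in> I"
    show "v i \<odot>\<^bsub>M\<^esub> x i = (if i \<in> Bad then v i else \<zero>) \<odot>\<^bsub>M\<^esub> x i"
    proof (cases "i \<in> Bad")
     case False
     have "gp 0 (d i) \<in> carrier S" using diagD(4)[OF D] i n by (intro gp_closed) (auto simp: Pi_iff)
     hence "v i \<odot>\<^bsub>M\<^esub> x i = \<zero>\<^bsub>M\<^esub>" using dvd_kills[OF M _ dv[OF i] _ good[OF i False]] x i by auto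
     thus ?thesis using False M.smult_l_null[of "x i"] x(1) i by (auto simp: Pi_iff)
    qed simp
   qed (use x v in auto)
   also have "\<dots> = lin M Bad x v" using I Bad x v by (intro M.lin_extend) auto
   also have "\<dots> = lin M Bad (\<lambda>i. ?g \<odot>\<^bsub>M\<^esub> x i) w"
    using w Bad x F by (intro M.lin_cong) (auto simp: M.smult_comm[of "w _"] M.smult_assoc1 Pi_iff subset_iff)
   finally have "?F divides w i" using indep[of w i] w z True by auto
   hence "?g \<otimes> ?F divides ?g \<otimes> w i" by (intro divides_mult) (use F in auto)
   thus ?thesis using True w F by simp
  qed (use dv i in auto)
 qed
qed

text \<open>The condition passes from \<open>M\<close> to \<open>f\<^bsub>n+1\<^esub> M\<close>, which is killed by \<open>g\<^sub>n\<close>. Its diagonal bases are modified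
 by exchanges until \<open>diag_lift\<close> applies to a choice of lifts.\<close>
theorem ann_condition_imp_diag:
 fixes M :: "('a, 'x) module"
 assumes "module S M" "n \<le> N" "gens S M (I0 :: nat set) x0" "t \<in> m"
  and "\<And>y. y \<in> carrier M ==> t \<odot>\<^bsub>M\<^esub> y = \<zero>\<^bsub>M\<^esub> ==> y = \<zero>\<^bsub>M\<^esub>"
  and "\<And>y. y \<in> carrier M ==> gp 0 n \<odot>\<^bsub>M\<^esub> y = \<zero>\<^bsub>M\<^esub>"
  and "annc n M"
 shows "\<exists>(I :: nat set) x d. diag n M I x d"
 using assms
proof (induction n arbitrary: M I0 x0)
 case (0 M)
 interpret M: rmod S M using 0 by (intro rmod.intro)
 have "carrier M = {\<zero>\<^bsub>M\<^esub>}" using 0(6) by auto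
 hence "diag 0 M ({} :: nat set) (\<lambda>_. \<zero>\<^bsub>M\<^esub>) (\<lambda>_. 0)" by (auto simp: diag_def gens_def)
 thus ?case by blast
next
 case (Suc n M I0 x0)
 interpret M: rmod S M using Suc by (intro rmod.intro)
 have n: "Suc n \<in> {1..N}" using Suc by auto
 note reg = p_regular[OF Suc.prems(1) n Suc.prems(4,5)]
 let ?F = "f (Suc n)" and ?g = "gp 0 n"
 have F: "?F \<in> carrier S" "?g \<in> carrier S" "gp 0 (Suc n) = ?g \<otimes> ?F" using n by (auto simp: gp_Suc)
 show ?case
 proof (cases "n = 0")
  case True
  have kF: "?F \<odot>\<^bsub>M\<^esub> y = \<zero>\<^bsub>M\<^esub>" if "y \<in> carrier M" for y using Suc.prems(6)[OF that] F True by simp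
  obtain J :: "nat set" and y where J: "gens S M J y"
    "\<And>v i. v\<in> coords J ==> lin M J y v = \<zero>\<^bsub>M\<^esub> ==> i \<in> J ==> ?F divides v i"
   using free_over_branch[OF Suc.prems(1) n Suc.prems(3) kF] reg kF by blast
  have "diag (Suc n) M J y (\<lambda>_. 1)"
   unfolding diag_def using J kF F True by (auto simp: gens_def)
  thus ?thesis by blast
 next
  case False
  let ?K = "(\<lambda>x. ?F \<odot>\<^bsub>M\<^esub> x) ` carrier M"
  let ?Mf = "M\<lparr>carrier := ?K\<rparr>"
  have K: "submodule ?K S M" using F by (intro M.image_smult_submodule)
  have Mf: "module S ?Mf" by (rule submodule.submodule_is_module[OF K Suc.prems(1)])
  interpret Mf: rmod S ?Mf using Mf by (rule rmod.intro)
  have I0: "finite I0" "x0 \<in> I0 \<rightarrow> carrier M" using Suc.prems(3) by (auto simp: gens_def)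
  have ex: "\<exists>(I :: nat set) x d. diag n ?Mf I x d"
  proof (rule Suc.IH[OF Mf _ _ Suc.prems(4)])
   show "gens S ?Mf I0 (\<lambda>i. ?F \<odot>\<^bsub>M\<^esub> x0 i)" unfolding gens_def
   proof (intro conjI ballI)
    fix y assume "y \<in> carrier ?Mf"
    then obtain z where z: "z \<in> carrier M" "y = ?F \<odot>\<^bsub>M\<^esub> z" by auto
    then obtain v where v: "v \<in> coords I0" "z = lin M I0 x0 v" using M.gensD[OF Suc.prems(3)] by blast
    have "y = lin M I0 (\<lambda>i. ?F \<odot>\<^bsub>M\<^esub> x0 i) v" using z v I0 F by (simp add: M.lin_smult_right)
    also have "\<dots> = lin ?Mf I0 (\<lambda>i. ?F \<odot>\<^bsub>M\<^esub> x0 i) v"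
     using I0 v by (intro M.lin_carrier_update[OF K, symmetric]) auto
    finally show "\<exists>v\<in> coords I0. y = lin ?Mf I0 (\<lambda>i. ?F \<odot>\<^bsub>M\<^esub> x0 i) v" using v by blast
   qed (use I0 in auto)
   show "y = \<zero>\<^bsub>?Mf\<^esub>" if "y \<in> carrier ?Mf" "t \<odot>\<^bsub>?Mf\<^esub> y = \<zero>\<^bsub>?Mf\<^esub>" for y
    using Suc.prems(5)[of y] that F by auto
   show "gp 0 n \<odot>\<^bsub>?Mf\<^esub> y = \<zero>\<^bsub>?Mf\<^esub>" if "y \<in> carrier ?Mf" for y
    using that Suc.prems(6) F by (auto simp: M.smult_assoc1)
   show "annc n ?Mf" unfolding annc_def
   proof (intro ballI impI)
    fix i y assume i: "i \<in> {1..n}" and y: "y \<in> carrier ?Mf" "gp i n \<odot>\<^bsub>?Mf\<^esub> y = \<zero>\<^bsub>?Mf\<^esub>"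
    then obtain z where z: "z \<in> carrier M" "y = ?F \<odot>\<^bsub>M\<^esub> z" by auto
    have gi: "gp i n \<in> carrier S" "gp 0 i \<in> carrier S" "gp i (Suc n) = gp i n \<otimes> ?F" using i n by (auto simp: gp_Suc)
    have "gp i (Suc n) \<odot>\<^bsub>M\<^esub> z = \<zero>\<^bsub>M\<^esub>" using gi z y F by (simp add: M.smult_assoc1)
    then obtain w where w: "w \<in> carrier M" "z = gp 0 i \<odot>\<^bsub>M\<^esub> w" using Suc.prems(7) i z unfolding annc_def by fastforce
    have "y = gp 0 i \<odot>\<^bsub>M\<^esub> (?F \<odot>\<^bsub>M\<^esub> w)" unfolding z(2) w(2) by (rule M.smult_comm) (use w gi F in auto)
    thus "\<exists>z\<in>carrier ?Mf. y = gp 0 i \<odot>\<^bsub>?Mf\<^esub> z" using w by auto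
   qed
  qed (use Suc.prems in auto)
  then obtain I :: "nat set" and d where "\<exists>b. diag n ?Mf I b d" by blast
  \<comment> \<open>An index is bad if the basis element \<open>b i\<close> has no lift that is killed by the same \<open>g\<^bsub>d i\<^esub>\<close>.
    Among the diagonal bases with fixed degrees take one with the least number of bad indices.\<close>
  define bad where "bad b i \<longleftrightarrow> i \<in> I \<and> \<not> (\<exists>y\<in>carrier M. ?F \<odot>\<^bsub>M\<^esub> y = b i \<and> gp 0 (d i) \<odot>\<^bsub>M\<^esub> y = \<zero>\<^bsub>M\<^esub>)" for b i
  obtain b where D: "diag n ?Mf I b d"
   and least: "\<And>b'. diag n ?Mf I b' d ==> card {i. bad b i} \<le> card {i. bad b' i}"
   using \<open>\<exists>b. diag n ?Mf I b d\<close> ex_has_least_nat[of "\<lambda>b. diag n ?Mf I b d" _ "\<lambda>b. card {i. bad b i}"] by blast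
  note I = diagD(2)[OF D]
  have b: "b \<in> I \<rightarrow> ?K" using diagD(3)[OF D] by simp
  hence bM: "b \<in> I \<rightarrow> carrier M" using M.submoduleE(1)[OF K] by blast
  have din: "d i \<in> {1..n}" if "i \<in> I" for i using diagD(4)[OF D] that by auto
  have gd: "gp 0 (d i) \<in> carrier S" if "i \<in> I" for i using din[OF that] n by (intro gp_closed) auto
  have linK: "lin ?Mf I b v = lin M I b v" if "v \<in> coords I" for v
   using M.lin_carrier_update[OF K I b that] .
  \<comment> \<open>An element with a good lift and unit coefficient at a bad index could be exchanged into the
    basis.\<close>
  have no_improve: False
   if i0: "bad b i0" and y: "y \<in> carrier M" "gp 0 (d i0) \<odot>\<^bsub>M\<^esub> y = \<zero>\<^bsub>M\<^esub>"
    and v: "v \<in> coords I" "v i0 \<notin> m" "?F \<odot>\<^bsub>M\<^esub> y = lin M I b v" for i0 y v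
  proof -
   have i0I: "i0 \<in> I" using i0 by (simp add: bad_def)
   have "gp 0 (d i0) \<odot>\<^bsub>M\<^esub> (?F \<odot>\<^bsub>M\<^esub> y) = \<zero>\<^bsub>M\<^esub>"
    using M.smult_comm[OF gd[OF i0I] F(1) y(1)] y(2) F by simp
   hence D': "diag n ?Mf I (b(i0 := ?F \<odot>\<^bsub>M\<^esub> y)) d"
    using n v linK by (intro exchange[OF Mf _ D i0I v(1,2)]) auto
   have "{i. bad (b(i0 := ?F \<odot>\<^bsub>M\<^esub> y)) i} \<subseteq> {i. bad b i} - {i0}" using y by (auto simp: bad_def)
   moreover have "finite {i. bad b i}" using I by (rule rev_finite_subset) (auto simp: bad_def)
   ultimately have "card {i. bad (b(i0 := ?F \<odot>\<^bsub>M\<^esub> y)) i} < card {i. bad b i}"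
    using i0 by (intro psubset_card_mono) auto
   thus False using least[OF D'] by simp
  qed
  have kill: "\<exists>z\<in>carrier M. y = ?g \<odot>\<^bsub>M\<^esub> z" if "y \<in> carrier M" "?F \<odot>\<^bsub>M\<^esub> y = \<zero>\<^bsub>M\<^esub>" for y
  proof -
   have "gp n (Suc n) = ?F" using n by (simp add: gp_Suc)
   moreover have "n \<in> {1..Suc n}" using False by simp
   ultimately show ?thesis using Suc.prems(7) that unfolding annc_def by metis
  qed
  \<comment> \<open>Bad elements have top degree: otherwise \<open>g\<^bsub>d\<^esub> x = g\<^sub>n z\<close> for a lift \<open>x\<close>, and \<open>x - (g\<^sub>n/g\<^bsub>d\<^esub>) z\<close> is
    killed by \<open>g\<^bsub>d\<^esub>\<close>. It lifts \<open>b i0\<close> up to a combination with coefficients in \<open>m\<close>.\<close>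
  have bad_n: "d i0 = n" if i0: "bad b i0" for i0
  proof (rule ccontr)
   assume "d i0 \<noteq> n"
   have i0I: "i0 \<in> I" using i0 by (simp add: bad_def)
   have dl: "d i0 < n" using din[OF i0I] \<open>d i0 \<noteq> n\<close> by simp
   obtain x where x: "x \<in> carrier M" "b i0 = ?F \<odot>\<^bsub>M\<^esub> x" using b i0I by auto
   let ?gd = "gp 0 (d i0)" and ?h = "gp (d i0) n"
   have h: "?h \<in> carrier S" "?gd \<otimes> ?h = ?g" using n dl by (auto simp: gp_mult)
   have "?F \<odot>\<^bsub>M\<^esub> (?gd \<odot>\<^bsub>M\<^esub> x) = ?gd \<odot>\<^bsub>M\<^esub> b i0" unfolding x(2) by (rule M.smult_comm[OF F(1) gd[OF i0I] x(1)])
   also have "\<dots> = \<zero>\<^bsub>M\<^esub>" using diagD(5)[OF D i0I] by simp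
   finally obtain z where z: "z \<in> carrier M" "?gd \<odot>\<^bsub>M\<^esub> x = ?g \<odot>\<^bsub>M\<^esub> z" using kill[of "?gd \<odot>\<^bsub>M\<^esub> x"] gd[OF i0I] x by auto
   define y where "y = x \<ominus>\<^bsub>M\<^esub> ?h \<odot>\<^bsub>M\<^esub> z"
   have y: "y \<in> carrier M" using x z h by (simp add: y_def)
   have gy: "?gd \<odot>\<^bsub>M\<^esub> y = \<zero>\<^bsub>M\<^esub>"
    using gd[OF i0I] x z h F by (simp add: y_def M.smult_r_diff M.diff_zero_iff flip: M.smult_assoc1)
   have "?F \<odot>\<^bsub>M\<^esub> z \<in> carrier ?Mf" using z by simp
   then obtain c where c: "c \<in> coords I" "?F \<odot>\<^bsub>M\<^esub> z = lin M I b c"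
    using Mf.gensD[OF diagD(1)[OF D]] linK by metis
   define v where "v i = (if i = i0 then \<one> else \<zero>) \<ominus> ?h \<otimes> c i" for i
   have v: "v \<in> coords I" using c h by (auto simp: v_def Pi_iff)
   have "lin M I b v = lin M I b (\<lambda>i. if i = i0 then \<one> else \<zero>) \<ominus>\<^bsub>M\<^esub> lin M I b (\<lambda>i. ?h \<otimes> c i)"
    unfolding v_def using I bM c h by (intro M.lin_diff) (auto simp: Pi_iff)
   also have "\<dots> = b i0 \<ominus>\<^bsub>M\<^esub> ?h \<odot>\<^bsub>M\<^esub> (?F \<odot>\<^bsub>M\<^esub> z)"
    using I bM c h i0I by (simp add: M.lin_delta M.lin_smult Pi_iff)
   also have "\<dots> = ?F \<odot>\<^bsub>M\<^esub> y"
    using x z h F M.smult_comm[OF h(1) F(1) z(1)] by (simp add: y_def M.smult_r_diff)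
   finally have "?F \<odot>\<^bsub>M\<^esub> y = lin M I b v" by simp
   moreover have "v i0 \<notin> m" unfolding v_def
    using one_minus_m[of "?h \<otimes> c i0"] gp_m[OF dl] n c i0I by (auto intro!: m_mult2 simp: Pi_iff)
   ultimately show False using no_improve[OF i0 y gy v] by blast
  qed
  define Bad where "Bad = {i. bad b i}"
  have "\<forall>i\<in>I. \<exists>y\<in>carrier M. ?F \<odot>\<^bsub>M\<^esub> y = b i \<and> (i \<notin> Bad --> gp 0 (d i) \<odot>\<^bsub>M\<^esub> y = \<zero>\<^bsub>M\<^esub>)"
  proof
   fix i assume i: "i \<in> I"
   show "\<exists>y\<in>carrier M. ?F \<odot>\<^bsub>M\<^esub> y = b i \<and> (i \<notin> Bad --> gp 0 (d i) \<odot>\<^bsub>M\<^esub> y = \<zero>\<^bsub>M\<^esub>)"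
   proof (cases "i \<in> Bad")
    case True
    have "b i \<in> ?K" using b i by blast
    thus ?thesis using True by auto
   next
    case False
    thus ?thesis using i unfolding Bad_def bad_def by blast
   qed
  qed
  then obtain x where x: "\<And>i. i \<in> I ==> x i \<in> carrier M \<and> ?F \<odot>\<^bsub>M\<^esub> x i = b i
    \<and> (i \<notin> Bad --> gp 0 (d i) \<odot>\<^bsub>M\<^esub> x i = \<zero>\<^bsub>M\<^esub>)" by metis
  have BI: "Bad \<subseteq> I" by (auto simp: Bad_def bad_def)
  have fB: "finite Bad" using BI I finite_subset by blast
  have "diag (Suc n) M I x (\<lambda>i. if i \<in> Bad then Suc n else d i)"
  proof (rule diag_lift[OF Suc.prems(1) _ _ Suc.prems(3) kill D])
   fix w i assume w: "w \<in> coords Bad" and z: "lin M Bad (\<lambda>i. ?g \<odot>\<^bsub>M\<^esub> x i) w = \<zero>\<^bsub>M\<^esub>" and i: "i \<in> Bad"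
   show "?F divides w i"
   proof (rule ccontr)
    assume nd: "\<not> ?F divides w i"
    have xB: "(\<lambda>i. ?g \<odot>\<^bsub>M\<^esub> x i) \<in> Bad \<rightarrow> carrier M" "x \<in> Bad \<rightarrow> carrier M" using x BI F by auto
    have FgB: "?F \<odot>\<^bsub>M\<^esub> (?g \<odot>\<^bsub>M\<^esub> x i) = \<zero>\<^bsub>M\<^esub>" if "i \<in> Bad" for i
    proof -
     have xi: "x i \<in> carrier M" using x that BI by auto
     have "?F \<odot>\<^bsub>M\<^esub> (?g \<odot>\<^bsub>M\<^esub> x i) = gp 0 (Suc n) \<odot>\<^bsub>M\<^esub> x i"
      unfolding F(3) M.smult_assoc1[OF F(2,1) xi] by (rule M.smult_comm[OF F(1,2) xi])
     thus ?thesis using Suc.prems(6) x that BI by auto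
    qed
    \<comment> \<open>A relation between the \<open>g\<^sub>n x i\<close> of the bad indices with a unit coefficient gives an
      element killed by \<open>g\<^sub>n\<close> that lifts a combination of the bad basis elements, contrary to
      \<open>no_improve\<close>.\<close>
    obtain w' i1 where w': "w' \<in> coords Bad" "lin M Bad (\<lambda>i. ?g \<odot>\<^bsub>M\<^esub> x i) w' = \<zero>\<^bsub>M\<^esub>"
     and i1: "i1 \<in> Bad" "w' i1 \<in> Units S"
     using unit_relation[OF Suc.prems(1) n fB xB(1) FgB reg w z i nd] by blast
    let ?y = "lin M Bad x w'"
    have y: "?y \<in> carrier M" using xB w' by auto
    have "?g \<odot>\<^bsub>M\<^esub> ?y = \<zero>\<^bsub>M\<^esub>" using w' M.lin_smult_right[OF fB xB(2) w'(1) F(2)] by simp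
    hence gy: "gp 0 (d i1) \<odot>\<^bsub>M\<^esub> ?y = \<zero>\<^bsub>M\<^esub>" using bad_n i1 by (simp add: Bad_def)
    define v where "v i = (if i \<in> Bad then w' i else \<zero>)" for i
    have v: "v \<in> coords I" using w' by (auto simp: v_def)
    have "?F \<odot>\<^bsub>M\<^esub> ?y = lin M Bad (\<lambda>i. ?F \<odot>\<^bsub>M\<^esub> x i) w'" using M.lin_smult_right[OF fB xB(2) w'(1) F(1)] by simp
    also have "\<dots> = lin M Bad b w'" using x BI w' bM by (intro M.lin_cong) auto
    also have "\<dots> = lin M I b v" unfolding v_def using I BI bM w' by (intro M.lin_extend[symmetric]) auto
    finally have "?F \<odot>\<^bsub>M\<^esub> ?y = lin M I b v" .
    moreover have "v i1 \<notin> m" using i1 unit_notin_m by (simp add: v_def)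
    ultimately show False using no_improve[OF _ y gy v] i1 by (simp add: Bad_def)
   qed
  qed (use x BI bad_n n False in \<open>auto simp: Bad_def\<close>)
  thus ?thesis by blast
 qed
qed

end

section \<open>Extension problems for relations\<close>

text \<open>The relations of the family \<open>x\<close>, as extensional functions so that they are determined by their
 values on \<open>I\<close>.\<close>
definition rel :: "('a, 'r) ring_scheme => ('a, 'b) module => 'i set => ('i => 'b) => ('i => 'a) set" where
 "rel R M I x = {v \<in> I \<rightarrow>\<^sub>E carrier R. lin M I x v = \<zero>\<^bsub>M\<^esub>}"

definition rel_hom :: "('a, 'r) ring_scheme => ('a, 'b) module => 'i set => ('i => 'b) => ('a, 'c) module
  => (('i => 'a) => 'c) => bool" where
 "rel_hom R M I x Y \<phi> \<longleftrightarrow> (\<forall>v\<in>rel R M I x. \<phi> v \<in> carrier Y) \<and>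
   (\<forall>v\<in>rel R M I x. \<forall>w\<in>rel R M I x. \<phi> (\<lambda>i\<in>I. v i \<oplus>\<^bsub>R\<^esub> w i) = \<phi> v \<oplus>\<^bsub>Y\<^esub> \<phi> w) \<and>
   (\<forall>r\<in>carrier R. \<forall>v\<in>rel R M I x. \<phi> (\<lambda>i\<in>I. r \<otimes>\<^bsub>R\<^esub> v i) = r \<odot>\<^bsub>Y\<^esub> \<phi> v)"

definition unit_vec :: "('a, 'r) ring_scheme => 'i set => 'a => 'i => 'i => 'a" where
 "unit_vec R I r i = (\<lambda>j\<in>I. if j = i then r else \<zero>\<^bsub>R\<^esub>)"

text \<open>For a module \<open>M\<close> over \<open>R/F\<close> with generators \<open>x\<close>, the relations over the quotient ring are the
 relations over \<open>R\<close> modulo the \<open>F e\<^sub>i\<close>. So the condition on \<open>unit_vec R I F i\<close> singles out the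
 homomorphisms on the former, and the property says that all of them extend to the free module, which
 is the vanishing of \<open>Ext\<^sup>1\<close> over \<open>R/F\<close>. Stated like this it only refers to modules over \<open>R\<close>.\<close>
definition ext_vanish :: "('a, 'r) ring_scheme => 'a => ('a, 'b) module => 'i set => ('i => 'b) => ('a, 'c) module
  => bool" where
 "ext_vanish R F M I x Y \<longleftrightarrow> (\<forall>\<phi>. rel_hom R M I x Y \<phi> --> (\<forall>i\<in>I. \<phi> (unit_vec R I F i) = \<zero>\<^bsub>Y\<^esub>) -->
   (\<exists>c\<in>I \<rightarrow> carrier Y. \<forall>v\<in>rel R M I x. \<phi> v = lin Y I c v))"

context rmod
begin

lemma relD: "v \<in> rel R M I x ==> v \<in> I \<rightarrow> carrier R" "v \<in> rel R M I x ==> v \<in> extensional I"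
 "v \<in> rel R M I x ==> lin M I x v = \<zero>\<^bsub>M\<^esub>"
 unfolding rel_def PiE_def by auto

lemma lin_restrict:
 "x \<in> I \<rightarrow> carrier M ==> v \<in> I \<rightarrow> carrier R ==> lin M I x (\<lambda>i\<in>I. v i) = lin M I x v"
 by (intro lin_cong) auto

lemma relI: "x \<in> I \<rightarrow> carrier M ==> v \<in> I \<rightarrow> carrier R ==> lin M I x v = \<zero>\<^bsub>M\<^esub> ==> (\<lambda>i\<in>I. v i) \<in> rel R M I x"
 unfolding rel_def by (auto simp: lin_restrict)

lemma rel_add:
 "x \<in> I \<rightarrow> carrier M ==> v \<in> rel R M I x ==> w \<in> rel R M I x ==> (\<lambda>i\<in>I. v i \<oplus> w i) \<in> rel R M I x"
 using relD[of v I x] relD[of w I x] by (intro relI) (auto simp: lin_add)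

lemma rel_smult:
 "finite I ==> x \<in> I \<rightarrow> carrier M ==> v \<in> rel R M I x ==> r \<in> carrier R ==> (\<lambda>i\<in>I. r \<otimes> v i) \<in> rel R M I x"
 using relD[of v I x] by (intro relI) (auto simp: lin_smult)

lemma unit_vec_rel:
 "finite I ==> x \<in> I \<rightarrow> carrier M ==> i \<in> I ==> r \<in> carrier R ==> r \<odot>\<^bsub>M\<^esub> x i = \<zero>\<^bsub>M\<^esub> ==>
  unit_vec R I r i \<in> rel R M I x"
 unfolding unit_vec_def by (intro relI) (auto simp: lin_delta)

text \<open>If each \<open>r i\<close> kills its generator, then the \<open>r i e\<^sub>i\<close> are relations, and a homomorphism is linear on
 them.\<close>
lemma rel_hom_expand:
 assumes Y: "module R Y" and \<phi>: "rel_hom R M I x Y \<phi>" and I: "finite I" "x \<in> I \<rightarrow> carrier M"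
  and r: "r \<in> I \<rightarrow> carrier R" "\<And>i. i \<in> I ==> r i \<odot>\<^bsub>M\<^esub> x i = \<zero>\<^bsub>M\<^esub>" and w: "w \<in> I \<rightarrow> carrier R"
 shows "\<phi> (\<lambda>i\<in>I. w i \<otimes> r i) = lin Y I (\<lambda>i. \<phi> (unit_vec R I (r i) i)) w"
proof -
 interpret Y: rmod R Y using Y by (rule rmod.intro)
 have u: "unit_vec R I (r i) i \<in> rel R M I x" if "i \<in> I" for i
  using I r that by (intro unit_vec_rel) auto
 have \<phi>c: "\<phi> v \<in> carrier Y" if "v \<in> rel R M I x" for v using \<phi> that by (auto simp: rel_hom_def)
 have add: "\<phi> (\<lambda>i\<in>I. v i \<oplus> w i) = \<phi> v \<oplus>\<^bsub>Y\<^esub> \<phi> w" if "v \<in> rel R M I x" "w \<in> rel R M I x" for v w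
  using \<phi> that by (auto simp: rel_hom_def)
 have sm: "\<phi> (\<lambda>i\<in>I. a \<otimes> v i) = a \<odot>\<^bsub>Y\<^esub> \<phi> v" if "v \<in> rel R M I x" "a \<in> carrier R" for v a
  using \<phi> that by (auto simp: rel_hom_def)
 have "\<phi> (\<lambda>i\<in>I. if i \<in> J then w i \<otimes> r i else \<zero>) = lin Y J (\<lambda>i. \<phi> (unit_vec R I (r i) i)) w"
  if J: "finite J" "J \<subseteq> I" for J
  using J
 proof (induction J)
  case empty
  have z: "(\<lambda>i\<in>I. \<zero>) \<in> rel R M I x" using I by (intro relI lin_zero) (auto simp: Pi_iff)
  have "\<phi> (\<lambda>i\<in>I. \<zero> \<otimes> (\<lambda>i\<in>I. \<zero>) i) = \<zero>\<^bsub>Y\<^esub>" using sm[OF z, of \<zero>] \<phi>c[OF z] by simp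
  moreover have "(\<lambda>i\<in>I. \<zero> \<otimes> (\<lambda>i\<in>I. \<zero>) i) = (\<lambda>i\<in>I. \<zero>)" by auto
  ultimately show ?case by (simp add: restrict_def)
 next
  case (insert k J)
  have k: "k \<in> I" "J \<subseteq> I" "w k \<in> carrier R" using insert w by auto
  have J1: "(\<lambda>i\<in>I. if i \<in> J then w i \<otimes> r i else \<zero>) \<in> rel R M I x"
  proof (intro relI lin_zero)
   fix i assume "i \<in> I"
   thus "(if i \<in> J then w i \<otimes> r i else \<zero>) \<odot>\<^bsub>M\<^esub> x i = \<zero>\<^bsub>M\<^esub>"
    using I w r by (auto simp: smult_assoc1 Pi_iff)
  qed (use I w r in \<open>auto simp: Pi_iff\<close>)
  have J2: "(\<lambda>i\<in>I. w k \<otimes> unit_vec R I (r k) k i) \<in> rel R M I x" using I u k by (intro rel_smult) auto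
  let ?a = "\<lambda>i\<in>I. w k \<otimes> unit_vec R I (r k) k i" and ?b = "\<lambda>i\<in>I. if i \<in> J then w i \<otimes> r i else \<zero>"
  have "(\<lambda>i\<in>I. if i \<in> insert k J then w i \<otimes> r i else \<zero>) = (\<lambda>i\<in>I. ?a i \<oplus> ?b i)"
   using insert w r by (auto simp: unit_vec_def Pi_iff fun_eq_iff restrict_def)
  hence "\<phi> (\<lambda>i\<in>I. if i \<in> insert k J then w i \<otimes> r i else \<zero>) = \<phi> (\<lambda>i\<in>I. ?a i \<oplus> ?b i)" by (rule arg_cong)
  also have "\<dots> = \<phi> ?a \<oplus>\<^bsub>Y\<^esub> \<phi> ?b" by (rule add[OF J2 J1])
  also have "\<phi> ?a = w k \<odot>\<^bsub>Y\<^esub> \<phi> (unit_vec R I (r k) k)" by (rule sm[OF u[OF k(1)] k(3)])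
  also have "\<phi> ?b = lin Y J (\<lambda>i. \<phi> (unit_vec R I (r i) i)) w" by (rule insert.IH[OF k(2)])
  also have "w k \<odot>\<^bsub>Y\<^esub> \<phi> (unit_vec R I (r k) k) \<oplus>\<^bsub>Y\<^esub> lin Y J (\<lambda>i. \<phi> (unit_vec R I (r i) i)) w
    = lin Y (insert k J) (\<lambda>i. \<phi> (unit_vec R I (r i) i)) w"
  proof (rule Y.lin_insert[symmetric])
   show "(\<lambda>i. \<phi> (unit_vec R I (r i) i)) \<in> insert k J \<rightarrow> carrier Y" using insert.prems u \<phi>c by auto
   show "w \<in> insert k J \<rightarrow> carrier R" using insert.prems w by auto
  qed (use insert in auto)
  finally show ?case .
 qed
 from this[OF I(1) order_refl] show ?thesis by (simp cong: restrict_cong)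
qed

lemma rel_hom_multiple:
 assumes "module R Y" "rel_hom R M I x Y \<phi>" "finite I" "x \<in> I \<rightarrow> carrier M"
  and "r \<in> carrier R" "\<And>i. i \<in> I ==> r \<odot>\<^bsub>M\<^esub> x i = \<zero>\<^bsub>M\<^esub>" "w \<in> I \<rightarrow> carrier R"
  and "\<And>i. i \<in> I ==> \<phi> (unit_vec R I r i) = \<zero>\<^bsub>Y\<^esub>"
 shows "\<phi> (\<lambda>i\<in>I. r \<otimes> w i) = \<zero>\<^bsub>Y\<^esub>"
proof -
 interpret Y: rmod R Y using assms(1) by (rule rmod.intro)
 have "(\<lambda>i\<in>I. r \<otimes> w i) = (\<lambda>i\<in>I. w i \<otimes> r)" using assms(5,7) by (intro restrict_ext) (auto simp: m_comm Pi_iff)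
 hence "\<phi> (\<lambda>i\<in>I. r \<otimes> w i) = lin Y I (\<lambda>i. \<phi> (unit_vec R I r i)) w"
  using rel_hom_expand[OF assms(1-4), of "\<lambda>_. r" w] assms by simp
 also have "\<dots> = \<zero>\<^bsub>Y\<^esub>" using assms(7,8) by (intro Y.lin_zero) (auto simp: Pi_iff)
 finally show ?thesis .
qed

end

text \<open>The cyclic module \<open>S/g\<close> over \<open>S\<close> itself.\<close>
definition cyc :: "('a, 's) ring_scheme => 'a => ('a, 'a set) module" where
 "cyc S g = \<lparr>carrier = carrier (S Quot (PIdl\<^bsub>S\<^esub> g)), monoid.mult = undefined, monoid.one = undefined,
   ring.zero = \<zero>\<^bsub>S Quot (PIdl\<^bsub>S\<^esub> g)\<^esub>, ring.add = ring.add (S Quot (PIdl\<^bsub>S\<^esub> g)),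
   module.smult = (\<lambda>s. rcoset_mult S (PIdl\<^bsub>S\<^esub> g) (PIdl\<^bsub>S\<^esub> g +>\<^bsub>S\<^esub> s))\<rparr>"

context cring
begin

abbreviation cos :: "'a => 'a => 'a set" where "cos g s \<equiv> PIdl g +> s"

lemma cyc_facts:
 assumes g: "g \<in> carrier R"
 shows cyc_carrier: "carrier (cyc R g) = cos g ` carrier R"
  and cos_closed [simp]: "s \<in> carrier R ==> cos g s \<in> carrier (cyc R g)"
  and cos_zero: "\<zero>\<^bsub>cyc R g\<^esub> = cos g \<zero>"
  and cos_add [simp]: "s \<in> carrier R ==> t \<in> carrier R ==> cos g s \<oplus>\<^bsub>cyc R g\<^esub> cos g t = cos g (s \<oplus> t)"
  and cos_smult [simp]: "s \<in> carrier R ==> t \<in> carrier R ==> s \<odot>\<^bsub>cyc R g\<^esub> cos g t = cos g (s \<otimes> t)"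
  and cos_eq_iff: "s \<in> carrier R ==> t \<in> carrier R ==> cos g s = cos g t \<longleftrightarrow> g divides (s \<ominus> t)"
proof -
 have id: "ideal (PIdl g) R" using g by (rule cgenideal_ideal)
 interpret I: ideal "PIdl g" R by fact
 interpret Q: cring "R Quot PIdl g" by (rule I.quotient_is_cring[OF is_cring])
 interpret h: ring_hom_ring R "R Quot PIdl g" "cos g" by (rule I.rcos_ring_hom_ring)
 have car: "carrier (R Quot PIdl g) = cos g ` carrier R"
  unfolding FactRing_def using A_RCOSETS_def'[of R "PIdl g"] by auto
 show 1: "carrier (cyc R g) = cos g ` carrier R" by (simp add: cyc_def car)
 show "s \<in> carrier R ==> cos g s \<in> carrier (cyc R g)" by (simp add: 1)
 show 2: "\<zero>\<^bsub>cyc R g\<^esub> = cos g \<zero>" by (simp add: cyc_def)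
 show 3: "cos g s \<oplus>\<^bsub>cyc R g\<^esub> cos g t = cos g (s \<oplus> t)" if "s \<in> carrier R" "t \<in> carrier R" for s t
  using that by (simp add: cyc_def)
 show 4: "s \<odot>\<^bsub>cyc R g\<^esub> cos g t = cos g (s \<otimes> t)" if "s \<in> carrier R" "t \<in> carrier R" for s t
  using that I.rcoset_mult_add[of s t] by (simp add: cyc_def)
 show "cos g s = cos g t \<longleftrightarrow> g divides (s \<ominus> t)" if "s \<in> carrier R" "t \<in> carrier R"
  using quotient_eq_iff_same_a_r_cos[OF id that] PIdl_iff_dvd[OF g] by simp
qed

lemma cyc_module:
 assumes g: "g \<in> carrier R" shows "module R (cyc R g)"
proof (rule moduleI)
 show "abelian_group (cyc R g)"
 proof (rule abelian_groupI)
  fix x assume "x \<in> carrier (cyc R g)"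
  then obtain s where "s \<in> carrier R" "x = cos g s" by (auto simp: cyc_carrier[OF g])
  thus "\<exists>y\<in>carrier (cyc R g). y \<oplus>\<^bsub>cyc R g\<^esub> x = \<zero>\<^bsub>cyc R g\<^esub>"
   using g by (intro bexI[of _ "cos g (\<ominus> s)"]) (simp_all add: l_neg cos_zero)
 qed (auto simp: cyc_carrier[OF g] cos_zero[OF g] g a_ac)
qed (use is_cring g in \<open>auto simp: cyc_carrier[OF g] m_assoc l_distr r_distr\<close>)

end

section \<open>Vanishing extensions yield a diagonal basis\<close>

context branches
begin

abbreviation NN :: "nat => ('a, 'a set) module" where "NN i \<equiv> cyc S (gp 0 i)"

text \<open>The module \<open>g\<^sub>n M\<close> is killed by \<open>f\<^bsub>n+1\<^esub>\<close> and torsion-free over \<open>S/f\<^bsub>n+1\<^esub>\<close>, hence free; the \<open>y j\<close> are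
 preimages of a basis under multiplication with \<open>g\<^sub>n\<close>.\<close>
lemma ext_step_setup:
 fixes M :: "('a, 'x) module"
 assumes M: "module S M" and n: "n \<ge> 1" "Suc n \<le> N" and g0: "gens S M (I0 :: nat set) x0"
  and t: "t \<in> m" and reg: "\<And>y. y \<in> carrier M ==> t \<odot>\<^bsub>M\<^esub> y = \<zero>\<^bsub>M\<^esub> ==> y = \<zero>\<^bsub>M\<^esub>"
  and kill: "\<And>y. y \<in> carrier M ==> gp 0 (Suc n) \<odot>\<^bsub>M\<^esub> y = \<zero>\<^bsub>M\<^esub>"
 shows "\<exists>(J :: nat set) y. finite J \<and> y \<in> J \<rightarrow> carrier M \<and>
   (\<forall>x\<in>carrier M. \<exists>s\<in> coords J. gp 0 n \<odot>\<^bsub>M\<^esub> (x \<ominus>\<^bsub>M\<^esub> lin M J y s) = \<zero>\<^bsub>M\<^esub>) \<and>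
   (\<forall>s\<in> coords J. gp 0 n \<odot>\<^bsub>M\<^esub> lin M J y s = \<zero>\<^bsub>M\<^esub> --> (\<forall>j\<in>J. f (Suc n) divides s j))"
proof -
 interpret M: rmod S M using M by (rule rmod.intro)
 let ?F = "f (Suc n)" and ?g = "gp 0 n"
 have nN: "Suc n \<in> {1..N}" using n by simp
 have F: "?F \<in> carrier S" "?g \<in> carrier S" "gp 0 (Suc n) = ?g \<otimes> ?F" using n by (auto simp: gp_Suc)
 have I0: "finite I0" "x0 \<in> I0 \<rightarrow> carrier M" using g0 by (auto simp: gens_def)
 let ?K = "(\<lambda>x. ?g \<odot>\<^bsub>M\<^esub> x) ` carrier M" and ?Q = "M\<lparr>carrier := (\<lambda>x. ?g \<odot>\<^bsub>M\<^esub> x) ` carrier M\<rparr>"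
 have K: "submodule ?K S M" using F by (intro M.image_smult_submodule)
 have Q: "module S ?Q" by (rule submodule.submodule_is_module[OF K M])
 have gQ: "gens S ?Q I0 (\<lambda>i. ?g \<odot>\<^bsub>M\<^esub> x0 i)" unfolding gens_def
 proof (intro conjI ballI)
  fix y assume "y \<in> carrier ?Q"
  then obtain z where z: "z \<in> carrier M" "y = ?g \<odot>\<^bsub>M\<^esub> z" by auto
  then obtain v where v: "v \<in> coords I0" "z = lin M I0 x0 v" using M.gensD[OF g0] by blast
  have "y = lin M I0 (\<lambda>i. ?g \<odot>\<^bsub>M\<^esub> x0 i) v" using z v I0 F by (simp add: M.lin_smult_right)
  also have "\<dots> = lin ?Q I0 (\<lambda>i. ?g \<odot>\<^bsub>M\<^esub> x0 i) v"
   using I0 v by (intro M.lin_carrier_update[OF K, symmetric]) auto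
  finally show "\<exists>v\<in> coords I0. y = lin ?Q I0 (\<lambda>i. ?g \<odot>\<^bsub>M\<^esub> x0 i) v" using v by blast
 qed (use I0 in auto)
 have FQ: "?F \<odot>\<^bsub>M\<^esub> (?g \<odot>\<^bsub>M\<^esub> z) = \<zero>\<^bsub>M\<^esub>" if "z \<in> carrier M" for z
  unfolding M.smult_comm[OF F(1,2) that] M.smult_assoc1[OF F(2,1) that, symmetric] F(3)[symmetric]
  by (rule kill[OF that])
 have FQ': "?F \<odot>\<^bsub>?Q\<^esub> x = \<zero>\<^bsub>?Q\<^esub>" if "x \<in> carrier ?Q" for x using FQ that by auto
 have pQ: "x = \<zero>\<^bsub>?Q\<^esub>" if x: "x \<in> carrier ?Q" "p (Suc n) \<odot>\<^bsub>?Q\<^esub> x = \<zero>\<^bsub>?Q\<^esub>" for x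
 proof -
  have "x \<in> carrier M" using x(1) M.submoduleE(1)[OF K] by auto
  thus ?thesis using p_regular[OF M nN t reg, of x] FQ'[OF x(1)] x(2) by simp
 qed
 obtain J :: "nat set" and c where J: "gens S ?Q J c"
   "\<And>v i. v\<in> coords J ==> lin ?Q J c v = \<zero>\<^bsub>?Q\<^esub> ==> i \<in> J ==> ?F divides v i"
  using free_over_branch[OF Q nN gQ FQ' pQ] by blast
 have Jc: "finite J" "c \<in> J \<rightarrow> ?K" using J(1) by (auto simp: gens_def)
 have "\<forall>j\<in>J. \<exists>y\<in>carrier M. c j = ?g \<odot>\<^bsub>M\<^esub> y" using Jc by blast
 then obtain y where y: "\<And>j. j \<in> J ==> y j \<in> carrier M \<and> c j = ?g \<odot>\<^bsub>M\<^esub> y j" by metis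
 have yJ: "y \<in> J \<rightarrow> carrier M" using y by auto
 have gl: "?g \<odot>\<^bsub>M\<^esub> lin M J y s = lin ?Q J c s" if s: "s \<in> coords J" for s
 proof -
  have "lin ?Q J c s = lin M J c s" by (rule M.lin_carrier_update[OF K Jc s])
  also have "\<dots> = lin M J (\<lambda>j. ?g \<odot>\<^bsub>M\<^esub> y j) s" using y s F by (intro M.lin_cong) auto
  finally show ?thesis using M.lin_smult_right[OF Jc(1) yJ s F(2)] by simp
 qed
 have a: "\<exists>s\<in> coords J. ?g \<odot>\<^bsub>M\<^esub> (x \<ominus>\<^bsub>M\<^esub> lin M J y s) = \<zero>\<^bsub>M\<^esub>" if x: "x \<in> carrier M" for x
 proof -
  have "?g \<odot>\<^bsub>M\<^esub> x \<in> carrier ?Q" using x by simp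
  then obtain s where s: "s \<in> coords J" "?g \<odot>\<^bsub>M\<^esub> x = lin ?Q J c s" using J(1) unfolding gens_def by blast
  have l: "lin M J y s \<in> carrier M" using s yJ by auto
  have "?g \<odot>\<^bsub>M\<^esub> (x \<ominus>\<^bsub>M\<^esub> lin M J y s) = ?g \<odot>\<^bsub>M\<^esub> x \<ominus>\<^bsub>M\<^esub> ?g \<odot>\<^bsub>M\<^esub> lin M J y s"
   using x l F by (simp add: M.smult_r_diff)
  also have "?g \<odot>\<^bsub>M\<^esub> x = ?g \<odot>\<^bsub>M\<^esub> lin M J y s" using gl[OF s(1)] s(2) by simp
  also have "?g \<odot>\<^bsub>M\<^esub> lin M J y s \<ominus>\<^bsub>M\<^esub> ?g \<odot>\<^bsub>M\<^esub> lin M J y s = \<zero>\<^bsub>M\<^esub>"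
   using l F by (simp add: M.diff_zero_iff)
  finally show ?thesis using s by blast
 qed
 have b: "?F divides s j" if "s \<in> coords J" "?g \<odot>\<^bsub>M\<^esub> lin M J y s = \<zero>\<^bsub>M\<^esub>" "j \<in> J" for s j
  using J(2)[OF that(1) _ that(3)] gl[OF that(1)] that(2) by simp
 show ?thesis
  by (rule exI[of _ J], rule exI[of _ y], intro conjI ballI impI; (rule Jc yJ a b)?; assumption?)
qed

end

text \<open>The induction step for Ext: \<open>K\<close> is the annihilator of \<open>g\<^sub>n\<close> in \<open>M\<close>, and \<open>M/K\<close> is free over \<open>S/f\<^bsub>n+1\<^esub>\<close>
 with basis \<open>y\<close>. The elements \<open>z j = f\<^bsub>n+1\<^esub> y j\<close> are in \<open>K\<close>.\<close>
locale ext_step = branches S m f p N for S :: "('a, 's) ring_scheme" (structure) and m f p N +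
 fixes M :: "('a, 'x) module" and n :: nat and J :: "nat set" and y :: "nat => 'x" and I0 :: "nat set" and x0 :: "nat => 'x"
 assumes M_module: "module S M" and n1: "n \<ge> 1" and nN: "Suc n \<le> N" and g0: "gens S M I0 x0"
  and kill: "\<And>y. y \<in> carrier M ==> gp 0 (Suc n) \<odot>\<^bsub>M\<^esub> y = \<zero>\<^bsub>M\<^esub>"
  and finJ: "finite J" and yJ: "y \<in> J \<rightarrow> carrier M"
  and approx: "x \<in> carrier M ==> \<exists>s\<in> coords J. gp 0 n \<odot>\<^bsub>M\<^esub> (x \<ominus>\<^bsub>M\<^esub> lin M J y s) = \<zero>\<^bsub>M\<^esub>"
  and indep: "s \<in> coords J ==> gp 0 n \<odot>\<^bsub>M\<^esub> lin M J y s = \<zero>\<^bsub>M\<^esub> ==> j \<in> J ==> f (Suc n) divides s j"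
begin

sublocale M: rmod S M using M_module by (rule rmod.intro)

abbreviation F where "F \<equiv> f (Suc n)"
abbreviation g where "g \<equiv> gp 0 n"

definition K where "K = {x \<in> carrier M. g \<odot>\<^bsub>M\<^esub> x = \<zero>\<^bsub>M\<^esub>}"
abbreviation M2 where "M2 \<equiv> M\<lparr>carrier := K\<rparr>"
definition z where "z j = F \<odot>\<^bsub>M\<^esub> y j"

lemma Fg [simp, intro]: "F \<in> carrier S" "g \<in> carrier S"
 using n1 nN by auto

lemma G: "gp 0 (Suc n) = g \<otimes> F" "F \<otimes> g = g \<otimes> F" using nN by (simp_all add: gp_Suc m_comm)

lemma F_nz: "F \<noteq> \<zero>" using f_nz nN by simp

lemma F_not_one: "\<not> F divides \<one>" using m_not_dvd_one[OF f_m] nN by simp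

lemma K_sub: "submodule K S M" unfolding K_def by (rule M.ann_submodule) simp

lemma K_carrier: "K \<subseteq> carrier M" unfolding K_def by blast

lemma M2_module: "module S M2" by (rule submodule.submodule_is_module[OF K_sub M_module])

sublocale M2: rmod S M2 using M2_module by (rule rmod.intro)

lemma yc: "j \<in> J ==> y j \<in> carrier M" using yJ by auto

lemma zK: "j \<in> J ==> z j \<in> K"
 using kill[of "y j"] yc[of j] M.smult_assoc1[of g F "y j"] by (simp add: K_def z_def G)

lemma linK: "finite I ==> x \<in> I \<rightarrow> K ==> v \<in> coords I ==> lin M2 I x v = lin M I x v"
 by (rule M.lin_carrier_update[OF K_sub])

lemma indepK: "s \<in> coords J ==> lin M J y s \<in> K ==> j \<in> J ==> F divides s j"
 using indep by (simp add: K_def)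

lemma y_notin_K: "j \<in> J ==> y j \<notin> K"
proof
 assume j: "j \<in> J" "y j \<in> K"
 have "lin M J y (\<lambda>i. if i = j then \<one> else \<zero>) = y j" using j finJ yJ yc by (subst M.lin_delta) auto
 hence "F divides (if j = j then \<one> else \<zero>)" using j by (intro indepK[of "\<lambda>i. if i = j then \<one> else \<zero>"]) auto
 thus False using F_not_one by simp
qed

lemma inj_y: "inj_on y J"
proof (rule inj_onI, rule ccontr)
 fix i j assume ij: "i \<in> J" "j \<in> J" "y i = y j" "i \<noteq> j"
 let ?s = "\<lambda>k. (if k = i then \<one> else \<zero>) \<ominus> (if k = j then \<one> else \<zero>)"
 have "lin M J y ?s = \<zero>\<^bsub>M\<^esub>"
  using ij finJ yJ yc by (subst M.lin_diff) (auto simp: M.lin_delta M.diff_zero_iff)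
 moreover have "\<zero>\<^bsub>M\<^esub> \<in> K" by (simp add: K_def)
 ultimately have "F divides ?s i" using ij by (intro indepK) auto
 thus False using F_not_one ij by (simp add: a_minus_def)
qed

lemma M_eq_sum: "x \<in> carrier M ==> \<exists>s\<in> coords J. \<exists>k\<in>K. x = k \<oplus>\<^bsub>M\<^esub> lin M J y s"
proof -
 assume x: "x \<in> carrier M"
 then obtain s where s: "s \<in> coords J" "g \<odot>\<^bsub>M\<^esub> (x \<ominus>\<^bsub>M\<^esub> lin M J y s) = \<zero>\<^bsub>M\<^esub>" using approx by blast
 have l: "lin M J y s \<in> carrier M" using s yJ by auto
 have "x = (x \<ominus>\<^bsub>M\<^esub> lin M J y s) \<oplus>\<^bsub>M\<^esub> lin M J y s" using M.diff_add_cancel[OF x l] by simp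
 moreover have "x \<ominus>\<^bsub>M\<^esub> lin M J y s \<in> K" using s x l by (simp add: K_def)
 ultimately show ?thesis using s by blast
qed

text \<open>Subtracting combinations of the \<open>y j\<close> from the generators of \<open>M\<close> and adding the \<open>z j\<close> gives
 generators of the annihilator: the coefficients of the \<open>y j\<close> in an element of it are multiples of
 \<open>f\<^bsub>n+1\<^esub>\<close>.\<close>
lemma M2_fin_gen: "\<exists>(I :: nat set) w. gens S M2 I w"
proof -
 have I0: "finite I0" "x0 \<in> I0 \<rightarrow> carrier M" using g0 by (auto simp: gens_def)
 have "\<forall>i\<in>I0. \<exists>k\<in>K. \<exists>s\<in> coords J. x0 i = k \<oplus>\<^bsub>M\<^esub> lin M J y s"
  using M_eq_sum I0 by blast
 then obtain w s where w: "\<And>i. i \<in> I0 ==> w i \<in> K \<and> s i \<in> coords J \<and> x0 i = w i \<oplus>\<^bsub>M\<^esub> lin M J y (s i)" by metis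
 let ?A = "w ` I0 \<union> z ` J"
 have AK: "?A \<subseteq> K" using w zK by auto
 have sA: "submodule (module_span S M2 ?A) S M2" using AK by (intro M2.span_submodule) simp
 have incl: "?A \<subseteq> module_span S M2 ?A" unfolding module_span_def by blast
 have "x \<in> module_span S M2 ?A" if x: "x \<in> K" for x
 proof -
  have xM: "x \<in> carrier M" using x K_carrier by blast
  obtain v where v: "v \<in> coords I0" "x = lin M I0 x0 v" using M.gensD[OF g0 xM] by blast
  have wM: "w \<in> I0 \<rightarrow> K" "w \<in> I0 \<rightarrow> carrier M" using w K_carrier by auto
  have ls: "(\<lambda>i. lin M J y (s i)) \<in> I0 \<rightarrow> carrier M" "s \<in> I0 \<rightarrow> J \<rightarrow> carrier S" using w yJ by auto
  define s' where "s' = (\<lambda>j. \<Oplus>i\<in>I0. v i \<otimes> s i j)"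
  have s': "s' \<in> coords J" unfolding s'_def using ls v by (auto intro!: finsum_closed simp: Pi_iff)
  have "x = lin M I0 (\<lambda>i. w i \<oplus>\<^bsub>M\<^esub> lin M J y (s i)) v" unfolding v(2) using w v ls wM
   by (intro M.lin_cong) (auto simp: Pi_iff)
  also have "\<dots> = lin M I0 w v \<oplus>\<^bsub>M\<^esub> lin M J y s'"
   using wM ls v M.lin_lin[OF I0(1) finJ yJ ls(2) v(1)] by (subst M.lin_add_right) (auto simp: s'_def)
  finally have x2: "x = lin M I0 w v \<oplus>\<^bsub>M\<^esub> lin M J y s'" .
  have lw: "lin M I0 w v \<in> K" by (rule M.lin_submodule[OF K_sub I0(1) wM(1) v(1)])
  have ly: "lin M J y s' \<in> carrier M" using yJ s' by auto
  have "x \<ominus>\<^bsub>M\<^esub> lin M I0 w v \<in> K"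
   using x lw M.submoduleE(3,5)[OF K_sub] by (simp add: M.M.minus_eq)
  moreover have "x \<ominus>\<^bsub>M\<^esub> lin M I0 w v = lin M J y s'"
   unfolding x2 using lw ly K_carrier M.add_diff_cancel[of "lin M J y s'" "lin M I0 w v"]
   by (auto simp: M.M.a_comm)
  ultimately have "\<And>j. j \<in> J ==> F divides s' j" using indepK[OF s'] by simp
  hence "\<forall>j\<in>J. \<exists>r. r \<in> carrier S \<and> s' j = F \<otimes> r" by (auto simp: factor_def)
  then obtain r where r: "\<And>j. j \<in> J ==> r j \<in> carrier S \<and> s' j = F \<otimes> r j" by metis
  have "lin M J y s' = lin M J z r"
   using r yc by (intro M.lin_cong) (auto simp: z_def M.smult_assoc1 M.smult_comm[of "r _" F])
  hence x3: "x = lin M2 I0 w v \<oplus>\<^bsub>M2\<^esub> lin M2 J z r"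
   using x2 linK[OF I0(1) wM(1) v(1)] linK[OF finJ, of z r] zK r by auto
  have "lin M2 I0 w v \<in> module_span S M2 ?A" "lin M2 J z r \<in> module_span S M2 ?A"
   using incl I0 finJ v r by (auto intro!: M2.lin_submodule[OF sA])
  thus ?thesis using x3 M2.submoduleE(5)[OF sA] by metis
 qed
 hence "module_span S M2 ?A = carrier M2" using M2.submoduleE(1)[OF sA] by auto
 hence "fin_gen S M2" unfolding fin_gen_def using AK I0 finJ by (intro exI[of _ ?A]) auto
 thus ?thesis using M2.fin_gen_iff by blast
qed

end

lemma ext_vanishD:
 assumes "ext_vanish R F M I x Y" "rel_hom R M I x Y \<phi>" "\<And>i. i \<in> I ==> \<phi> (unit_vec R I F i) = \<zero>\<^bsub>Y\<^esub>"
 obtains c where "c \<in> I \<rightarrow> carrier Y" "\<And>v. v \<in> rel R M I x ==> \<phi> v = lin Y I c v"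
 using assms unfolding ext_vanish_def by meson

text \<open>Generators \<open>A2\<close> of \<open>K\<close> and the \<open>y j\<close> together generate \<open>M\<close>. A relation between them has coefficients
 at the \<open>y j\<close> which are divisible by \<open>f\<^bsub>n+1\<^esub>\<close>; the quotients are \<open>quo\<close>, and replacing \<open>f\<^bsub>n+1\<^esub> y j = z j\<close>
 by the expression \<open>wz j\<close> in \<open>A2\<close> turns it into a relation \<open>red\<close> of \<open>A2\<close>.\<close>
locale ext_gens = ext_step S m f p N M n J y I0 x0
 for S :: "('a, 's) ring_scheme" (structure) and m f p N and M :: "('a, 'x) module" and n J y I0 x0 +
 fixes A2 :: "'x set" and wz :: "nat => 'x => 'a"
 assumes A2: "gens S M2 A2 (\<lambda>a. a)"
  and wz: "j \<in> J ==> wz j \<in> coords A2" "j \<in> J ==> z j = lin M2 A2 (\<lambda>a. a) (wz j)"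
begin

lemma A2K: "finite A2" "A2 \<subseteq> K" "A2 \<subseteq> carrier M"
 using A2 K_carrier by (auto simp: gens_def)

lemma gA2: "a \<in> A2 ==> g \<odot>\<^bsub>M\<^esub> a = \<zero>\<^bsub>M\<^esub>" using A2K by (auto simp: K_def)

abbreviation A where "A \<equiv> A2 \<union> y ` J"
abbreviation (input) idf :: "'x => 'x" where "idf \<equiv> (\<lambda>a. a)"

lemma A: "finite A" "A \<subseteq> carrier M" "A2 \<inter> y ` J = {}"
 using A2K finJ yJ y_notin_K by auto

lemma linA:
 assumes "v \<in> coords A"
 shows "lin M A idf v = lin M A2 idf v \<oplus>\<^bsub>M\<^esub> lin M J y (\<lambda>j. v (y j))"
proof -
 have "lin M A idf v = lin M A2 idf v \<oplus>\<^bsub>M\<^esub> lin M (y ` J) idf v"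
  using A A2K finJ assms by (intro M.lin_union) auto
 also have "lin M (y ` J) idf v = lin M J y (\<lambda>j. v (y j))"
  using M.lin_reindex[OF inj_y, of idf v] yJ assms by (auto simp: Pi_iff)
 finally show ?thesis .
qed

lemma linA2: "v \<in> coords A2 ==> lin M2 A2 idf v = lin M A2 idf v"
 using A2K by (intro linK) auto

lemma linA2_K: "v \<in> coords A2 ==> lin M A2 idf v \<in> K"
 using A2K by (intro M.lin_submodule[OF K_sub]) auto

lemma A_gens: "gens S M A idf"
 unfolding gens_def
proof (intro conjI ballI)
 fix x assume "x \<in> carrier M"
 then obtain s k where s: "s \<in> coords J" "k \<in> K" "x = k \<oplus>\<^bsub>M\<^esub> lin M J y s" using M_eq_sum by blast
 obtain v where v: "v \<in> coords A2" "k = lin M2 A2 idf v" using M2.gensD[OF A2, of k] s(2) by auto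
 define u where "u a = (if a \<in> A2 then v a else s (the_inv_into J y a))" for a
 have yA2: "y j \<notin> A2" if "j \<in> J" for j using A that by blast
 have u: "u \<in> coords A" using v s yA2 by (auto simp: u_def the_inv_into_f_f[OF inj_y])
 have "lin M A2 idf u = lin M A2 idf v" using v A2K by (intro M.lin_cong) (auto simp: u_def)
 moreover have "lin M J y (\<lambda>j. u (y j)) = lin M J y s"
  using s yJ yA2 by (intro M.lin_cong) (auto simp: u_def the_inv_into_f_f[OF inj_y])
 ultimately have "x = lin M A idf u" using linA[OF u] s v linA2 by simp
 thus "\<exists>v\<in> coords A. x = lin M A idf v" using u by blast
qed (use A in auto)

definition quo :: "('x => 'a) => nat => 'a" where
 "quo v j = (THE s. s \<in> carrier S \<and> v (y j) = F \<otimes> s)"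

lemma quo_eq: "s \<in> carrier S ==> v (y j) = F \<otimes> s ==> quo v j = s"
 unfolding quo_def using m_lcancel[OF F_nz Fg(1)] by (intro the_equality) auto

lemma quo:
 assumes "v \<in> rel S M A idf" "j \<in> J"
 shows "quo v j \<in> carrier S" "v (y j) = F \<otimes> quo v j"
proof -
 have v: "v \<in> coords A" "lin M A idf v = \<zero>\<^bsub>M\<^esub>" using assms(1) by (auto simp: rel_def)
 have c: "lin M A2 idf v \<in> K" "(\<lambda>j. v (y j)) \<in> coords J" using v linA2_K[of v] by auto
 have lc: "lin M J y (\<lambda>j. v (y j)) \<in> carrier M" using c yJ by auto
 have "lin M J y (\<lambda>j. v (y j)) \<oplus>\<^bsub>M\<^esub> lin M A2 idf v = \<zero>\<^bsub>M\<^esub>"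
  using linA[OF v(1)] v(2) c(1) lc K_carrier M.M.a_comm[of "lin M J y (\<lambda>j. v (y j))" "lin M A2 idf v"] by auto
 hence "\<ominus>\<^bsub>M\<^esub> lin M A2 idf v = lin M J y (\<lambda>j. v (y j))"
  using c(1) lc K_carrier by (intro M.M.minus_equality) auto
 hence "lin M J y (\<lambda>j. v (y j)) = \<ominus>\<^bsub>M\<^esub> lin M A2 idf v" by simp
 hence "lin M J y (\<lambda>j. v (y j)) \<in> K" using M.submoduleE(3)[OF K_sub] c by simp
 hence "F divides v (y j)" using indepK[OF c(2)] assms(2) by blast
 then obtain s where "s \<in> carrier S" "v (y j) = F \<otimes> s" by (rule dvdE)
 thus "quo v j \<in> carrier S" "v (y j) = F \<otimes> quo v j" using quo_eq by auto
qed

lemma idfA: "idf \<in> A \<rightarrow> carrier M" "idf \<in> A2 \<rightarrow> carrier M2" using A(2) A2K by auto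

lemma quo_add: "v \<in> rel S M A idf ==> w \<in> rel S M A idf ==> j \<in> J ==>
  quo (\<lambda>a\<in>A. v a \<oplus> w a) j = quo v j \<oplus> quo w j"
 using quo[of v j] quo[of w j] by (intro quo_eq) (auto simp: r_distr)

lemma quo_smult: "v \<in> rel S M A idf ==> r \<in> carrier S ==> j \<in> J ==>
  quo (\<lambda>a\<in>A. r \<otimes> v a) j = r \<otimes> quo v j"
 using quo[of v j] by (intro quo_eq) (auto simp: m_lcomm)

definition red :: "('x => 'a) => 'x => 'a" where
 "red v = (\<lambda>a\<in>A2. v a \<oplus> (\<Oplus>j\<in>J. quo v j \<otimes> wz j a))"

lemma sum_wz_closed: "s \<in> coords J ==> a \<in> A2 ==> (\<Oplus>j\<in>J. s j \<otimes> wz j a) \<in> carrier S"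
 using wz(1) by (intro finsum_closed) (auto simp: Pi_iff)

lemma lin_sum_wz:
 assumes "s \<in> coords J"
 shows "lin M2 A2 idf (\<lambda>a. \<Oplus>j\<in>J. s j \<otimes> wz j a) = lin M J z s"
proof -
 have "lin M2 A2 idf (\<lambda>a. \<Oplus>j\<in>J. s j \<otimes> wz j a) = lin M2 J (\<lambda>j. lin M2 A2 idf (wz j)) s"
  using A2K finJ wz assms by (intro M2.lin_lin[symmetric]) auto
 also have "\<dots> = lin M2 J z s" using wz(2) zK assms by (intro M2.lin_cong) (auto simp flip: wz(2))
 also have "\<dots> = lin M J z s" using finJ zK assms by (intro linK) auto
 finally show ?thesis .
qed

lemma red_rel: assumes v: "v \<in> rel S M A idf" shows "red v \<in> rel S M2 A2 idf"
proof -
 have v': "v \<in> coords A" "lin M A idf v = \<zero>\<^bsub>M\<^esub>" using v by (auto simp: rel_def)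
 have s: "quo v \<in> coords J" using quo[OF v] by auto
 have "lin M2 A2 idf (\<lambda>a. v a \<oplus> (\<Oplus>j\<in>J. quo v j \<otimes> wz j a))
   = lin M2 A2 idf v \<oplus>\<^bsub>M2\<^esub> lin M2 A2 idf (\<lambda>a. \<Oplus>j\<in>J. quo v j \<otimes> wz j a)"
  using v' sum_wz_closed[OF s] idfA by (intro M2.lin_add) auto
 also have "\<dots> = lin M A2 idf v \<oplus>\<^bsub>M\<^esub> lin M J z (quo v)"
  using linA2[of v] v' lin_sum_wz[OF s] by simp
 also have "lin M J z (quo v) = lin M J y (\<lambda>j. v (y j))"
 proof (rule M.lin_cong[OF yJ])
  fix j assume j: "j \<in> J"
  show "quo v j \<odot>\<^bsub>M\<^esub> z j = v (y j) \<odot>\<^bsub>M\<^esub> y j"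
   using quo[OF v j] yc[OF j] m_comm[of F "quo v j"] by (simp add: z_def M.smult_assoc1)
 qed (use v' in auto)
 finally have "lin M2 A2 idf (\<lambda>a. v a \<oplus> (\<Oplus>j\<in>J. quo v j \<otimes> wz j a)) = \<zero>\<^bsub>M2\<^esub>"
  using linA[OF v'(1)] v' by simp
 thus ?thesis unfolding red_def using v' sum_wz_closed[OF s] idfA by (intro M2.relI) auto
qed

lemma red_add:
 assumes v: "v \<in> rel S M A idf" and w: "w \<in> rel S M A idf"
 shows "red (\<lambda>a\<in>A. v a \<oplus> w a) = (\<lambda>a\<in>A2. red v a \<oplus> red w a)"
proof (unfold red_def, rule restrict_ext)
 fix a assume a: "a \<in> A2"
 have c: "v a \<in> carrier S" "w a \<in> carrier S" using v w a by (auto simp: rel_def)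
 have s: "quo v \<in> coords J" "quo w \<in> coords J" using quo[OF v] quo[OF w] by auto
 have wzc: "wz j a \<in> carrier S" if "j \<in> J" for j using wz(1) that a by auto
 have "(\<Oplus>j\<in>J. quo (\<lambda>a\<in>A. v a \<oplus> w a) j \<otimes> wz j a) = (\<Oplus>j\<in>J. quo v j \<otimes> wz j a \<oplus> quo w j \<otimes> wz j a)"
  using s wzc by (intro finsum_cong') (auto simp: quo_add[OF v w] l_distr Pi_iff)
 also have "\<dots> = (\<Oplus>j\<in>J. quo v j \<otimes> wz j a) \<oplus> (\<Oplus>j\<in>J. quo w j \<otimes> wz j a)"
  using s wzc by (intro finsum_addf) (auto simp: Pi_iff)
 finally show "(\<lambda>a\<in>A. v a \<oplus> w a) a \<oplus> (\<Oplus>j\<in>J. quo (\<lambda>a\<in>A. v a \<oplus> w a) j \<otimes> wz j a)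
   = (\<lambda>a\<in>A2. v a \<oplus> (\<Oplus>j\<in>J. quo v j \<otimes> wz j a)) a \<oplus> (\<lambda>a\<in>A2. w a \<oplus> (\<Oplus>j\<in>J. quo w j \<otimes> wz j a)) a"
  using a c sum_wz_closed[OF s(1) a] sum_wz_closed[OF s(2) a] by (simp add: a_ac)
qed

lemma red_smult:
 assumes v: "v \<in> rel S M A idf" and r: "r \<in> carrier S"
 shows "red (\<lambda>a\<in>A. r \<otimes> v a) = (\<lambda>a\<in>A2. r \<otimes> red v a)"
proof (unfold red_def, rule restrict_ext)
 fix a assume a: "a \<in> A2"
 have c: "v a \<in> carrier S" using v a by (auto simp: rel_def)
 have s: "quo v \<in> coords J" using quo[OF v] by auto
 have wzc: "wz j a \<in> carrier S" if "j \<in> J" for j using wz(1) that a by auto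
 have "(\<Oplus>j\<in>J. quo (\<lambda>a\<in>A. r \<otimes> v a) j \<otimes> wz j a) = (\<Oplus>j\<in>J. r \<otimes> (quo v j \<otimes> wz j a))"
  using s wzc r by (intro finsum_cong') (auto simp: quo_smult[OF v r] m_assoc Pi_iff)
 also have "\<dots> = r \<otimes> (\<Oplus>j\<in>J. quo v j \<otimes> wz j a)"
  using s wzc r finJ by (intro finsum_rdistr[symmetric]) (auto simp: Pi_iff)
 finally show "(\<lambda>a\<in>A. r \<otimes> v a) a \<oplus> (\<Oplus>j\<in>J. quo (\<lambda>a\<in>A. r \<otimes> v a) j \<otimes> wz j a)
   = r \<otimes> (\<lambda>a\<in>A2. v a \<oplus> (\<Oplus>j\<in>J. quo v j \<otimes> wz j a)) a"
  using a c r sum_wz_closed[OF s a] by (simp add: r_distr)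
qed

text \<open>Relations of \<open>A2\<close> are those relations of the larger family with \<open>quo = 0\<close>.\<close>
lemma rel_embed:
 assumes v: "v \<in> rel S M2 A2 idf"
 defines "v' \<equiv> (\<lambda>a\<in>A. if a \<in> A2 then v a else \<zero>)"
 shows "v' \<in> rel S M A idf" "j \<in> J ==> quo v' j = \<zero>" "red v' = v"
  "module S Y ==> c \<in> A \<rightarrow> carrier Y ==> lin Y A c v' = lin Y A2 c v"
proof -
 have vc: "v \<in> coords A2" "v \<in> extensional A2" "lin M2 A2 idf v = \<zero>\<^bsub>M\<^esub>" using v by (auto simp: rel_def PiE_def)
 have yA2: "y j \<notin> A2" if "j \<in> J" for j using A that by blast
 have lv': "lin Y A c v' = lin Y A2 c v" if Y: "module S Y" and c: "c \<in> A \<rightarrow> carrier Y"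
  for Y :: "('a, 'y) module" and c
 proof -
  interpret Y: rmod S Y using Y by (rule rmod.intro)
  have "lin Y A c v' = lin Y A c (\<lambda>a. if a \<in> A2 then v a else \<zero>)"
   unfolding v'_def using c vc by (intro Y.lin_restrict) auto
  also have "\<dots> = lin Y A2 c v" using A c vc by (intro Y.lin_extend) auto
  finally show ?thesis .
 qed
 thus "module S Y ==> c \<in> A \<rightarrow> carrier Y ==> lin Y A c v' = lin Y A2 c v" by blast
 have "lin M A idf v' = \<zero>\<^bsub>M\<^esub>" using lv'[OF M_module idfA(1)] linA2[OF vc(1)] vc(3) by simp
 thus 1: "v' \<in> rel S M A idf" using vc by (auto simp: rel_def v'_def)
 show s: "quo v' j = \<zero>" if "j \<in> J" for j using that yA2 by (intro quo_eq) (auto simp: v'_def)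
 have "red v' a = v a" for a
 proof (cases "a \<in> A2")
  case True
  have "(\<Oplus>j\<in>J. quo v' j \<otimes> wz j a) = (\<Oplus>j\<in>J. \<zero>)"
   using s wz(1) True by (intro finsum_cong') (auto simp: Pi_iff)
  thus ?thesis using True vc by (auto simp: red_def v'_def Pi_iff)
 qed (use vc in \<open>auto simp: red_def extensional_def\<close>)
 thus "red v' = v" by blast
qed

lemma unit_A2:
 assumes a: "a \<in> A2" and j: "j \<in> J" and r: "r \<in> carrier S"
 shows "quo (unit_vec S A r a) j = \<zero>"
 using assms A by (intro quo_eq) (auto simp: unit_vec_def)

lemma unit_y:
 assumes l: "l \<in> J" and j: "j \<in> J" and r: "r \<in> carrier S"
 shows "quo (unit_vec S A (F \<otimes> r) (y l)) j = (if j = l then r else \<zero>)"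
 using assms inj_y by (intro quo_eq) (auto simp: unit_vec_def inj_on_def)

lemma delta_sum:
 assumes "l \<in> J" "r \<in> carrier S" "a \<in> A2"
 shows "(\<Oplus>j\<in>J. (if j = l then r else \<zero>) \<otimes> wz j a) = r \<otimes> wz l a"
proof -
 have wzc: "wz j a \<in> carrier S" if "j \<in> J" for j using wz(1) that assms by auto
 have "(\<Oplus>j\<in>J. (if j = l then r else \<zero>) \<otimes> wz j a) = (\<Oplus>j\<in>J. if l = j then r \<otimes> wz j a else \<zero>)"
  using wzc assms by (intro finsum_cong') auto
 thus ?thesis using wzc assms finJ by (subst (asm) add.finprod_singleton) auto
qed

text \<open>Composing with \<open>red\<close> turns an extension problem for \<open>K\<close> into one for \<open>M\<close>, whose solution restricts
 to a solution of the given one. So the induction hypothesis applies to \<open>K\<close>.\<close>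
lemma ext_vanish_down:
 assumes Y: "module S Y" and E: "ext_vanish S (gp 0 (Suc n)) M A idf Y"
 shows "ext_vanish S (gp 0 n) M2 A2 idf Y"
 unfolding ext_vanish_def
proof (intro allI impI)
 interpret Y: rmod S Y using Y by (rule rmod.intro)
 fix \<phi> assume \<phi>: "rel_hom S M2 A2 idf Y \<phi>" and z0: "\<forall>i\<in>A2. \<phi> (unit_vec S A2 g i) = \<zero>\<^bsub>Y\<^esub>"
 have Gc: "gp 0 (Suc n) \<in> carrier S" using nN by auto
 have rh: "rel_hom S M A idf Y (\<lambda>v. \<phi> (red v))"
  using \<phi> red_rel unfolding rel_hom_def by (simp add: red_add red_smult)
 have rz: "\<phi> (red (unit_vec S A (gp 0 (Suc n)) a)) = \<zero>\<^bsub>Y\<^esub>" if a: "a \<in> A" for a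
 proof (cases "a \<in> A2")
  case True
  have u: "unit_vec S A2 g a \<in> rel S M2 A2 idf"
   using True A2K idfA gA2 by (intro M2.unit_vec_rel) auto
  have "red (unit_vec S A (gp 0 (Suc n)) a) = (\<lambda>b\<in>A2. F \<otimes> unit_vec S A2 g a b)"
   unfolding red_def
  proof (rule restrict_ext)
   fix b assume b: "b \<in> A2"
   have "(\<Oplus>j\<in>J. quo (unit_vec S A (gp 0 (Suc n)) a) j \<otimes> wz j b) = (\<Oplus>j\<in>J. \<zero>)"
    using unit_A2[OF True _ Gc] wz(1) b by (intro finsum_cong') (auto simp: Pi_iff)
   thus "unit_vec S A (gp 0 (Suc n)) a b \<oplus> (\<Oplus>j\<in>J. quo (unit_vec S A (gp 0 (Suc n)) a) j \<otimes> wz j b)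
     = F \<otimes> unit_vec S A2 g a b" using b by (auto simp: unit_vec_def G)
  qed
  hence "\<phi> (red (unit_vec S A (gp 0 (Suc n)) a)) = F \<odot>\<^bsub>Y\<^esub> \<phi> (unit_vec S A2 g a)"
   using \<phi> u unfolding rel_hom_def by simp
  thus ?thesis using z0 True by simp
 next
  case False
  then obtain l where l: "l \<in> J" "a = y l" using a by auto
  have "red (unit_vec S A (gp 0 (Suc n)) a) = (\<lambda>b\<in>A2. g \<otimes> wz l b)"
   unfolding red_def
  proof (rule restrict_ext)
   fix b assume b: "b \<in> A2"
   have ba: "b \<noteq> a" using b False by blast
   have "(\<Oplus>j\<in>J. quo (unit_vec S A (gp 0 (Suc n)) a) j \<otimes> wz j b) = (\<Oplus>j\<in>J. (if j = l then g else \<zero>) \<otimes> wz j b)"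
    using unit_y[OF l(1) _ Fg(2)] wz(1) b m_comm[of F g] by (intro finsum_cong') (auto simp: Pi_iff G l(2))
   thus "unit_vec S A (gp 0 (Suc n)) a b \<oplus> (\<Oplus>j\<in>J. quo (unit_vec S A (gp 0 (Suc n)) a) j \<otimes> wz j b)
     = g \<otimes> wz l b" using b ba delta_sum[OF l(1) Fg(2) b] wz(1)[OF l(1)] by (auto simp: unit_vec_def Pi_iff)
  qed
  moreover have "\<phi> (\<lambda>b\<in>A2. g \<otimes> wz l b) = \<zero>\<^bsub>Y\<^esub>"
   using A2K idfA gA2 z0 wz(1)[OF l(1)] by (intro M2.rel_hom_multiple[OF Y \<phi>]) auto
  ultimately show ?thesis by simp
 qed
 obtain c where c: "c \<in> A \<rightarrow> carrier Y" "\<And>v. v \<in> rel S M A idf ==> \<phi> (red v) = lin Y A c v"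
  using ext_vanishD[OF E rh rz] by blast
 have "\<phi> v = lin Y A2 c v" if "v \<in> rel S M2 A2 idf" for v
  using c(2)[OF rel_embed(1)[OF that]] rel_embed(3)[OF that] rel_embed(4)[OF that Y c(1)] by simp
 thus "\<exists>c\<in>A2 \<rightarrow> carrier Y. \<forall>v\<in>rel S M2 A2 idf. \<phi> v = lin Y A2 c v" using c(1) by blast
qed

text \<open>Solving the extension problem for \<open>M\<close> given by the coefficient \<open>quo\<close> at \<open>l\<close> modulo \<open>g\<^sub>n\<close>. The
 solution assigns values \<open>c\<close> in \<open>S/g\<^sub>n\<close> to the generators. On relations of \<open>A2\<close> the coefficient is
 zero, so the values on \<open>A2\<close> define a homomorphism on \<open>K\<close>.\<close>
lemma dual_functional:
 assumes E: "ext_vanish S (gp 0 (Suc n)) M A idf (NN n)" and l: "l \<in> J"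
 shows "\<exists>\<psi>. (\<forall>x\<in>K. \<psi> x \<in> carrier (NN n)) \<and>
   (\<forall>(I :: nat set) x v. finite I --> x \<in> I \<rightarrow> K --> v \<in> coords I -->
    \<psi> (lin M2 I x v) = lin (NN n) I (\<lambda>i. \<psi> (x i)) v) \<and>
   (\<forall>j\<in>J. \<exists>s\<in>carrier S. \<psi> (z j) = cos g s \<and> (s \<in> m \<longleftrightarrow> j \<noteq> l))"
proof -
 have Y: "module S (NN n)" by (rule cyc_module) simp
 interpret Y: rmod S "NN n" using Y by (rule rmod.intro)
 have cos0: "cos g \<zero> = \<zero>\<^bsub>NN n\<^esub>" by (simp add: cos_zero)
 have rh: "rel_hom S M A idf (NN n) (\<lambda>v. cos g (quo v l))"
  unfolding rel_hom_def using quo(1)[OF _ l] l by (auto simp: quo_add quo_smult)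
 have rz: "cos g (quo (unit_vec S A (gp 0 (Suc n)) a) l) = \<zero>\<^bsub>NN n\<^esub>" if a: "a \<in> A" for a
 proof (cases "a \<in> A2")
  case True
  thus ?thesis using unit_A2[OF True l, of "gp 0 (Suc n)"] nN cos0 by simp
 next
  case False
  then obtain k where k: "k \<in> J" "a = y k" using a by auto
  have "gp 0 (Suc n) = F \<otimes> g" using G by simp
  hence "quo (unit_vec S A (gp 0 (Suc n)) a) l = (if l = k then g else \<zero>)"
   using unit_y[OF k(1) l Fg(2)] k(2) by simp
  moreover have "cos g g = cos g \<zero>" by (subst cos_eq_iff) (auto simp: a_minus_def dvd_refl)
  ultimately show ?thesis using cos0 by simp
 qed
 obtain c where c: "c \<in> A \<rightarrow> carrier (NN n)"
   "\<And>v. v \<in> rel S M A idf ==> cos g (quo v l) = lin (NN n) A c v"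
  using ext_vanishD[OF E rh rz] by blast
 have cA2: "c \<in> A2 \<rightarrow> carrier (NN n)" using c by auto
 have z0: "lin (NN n) A2 c v = \<zero>\<^bsub>NN n\<^esub>" if v: "v \<in> coords A2" "lin M2 A2 idf v = \<zero>\<^bsub>M\<^esub>" for v
 proof -
  have r: "(\<lambda>a\<in>A2. v a) \<in> rel S M2 A2 idf" using v idfA by (intro M2.relI) auto
  have "lin (NN n) A2 c (\<lambda>a\<in>A2. v a) = cos g \<zero>"
   using c(2)[OF rel_embed(1)[OF r]] rel_embed(2)[OF r l] rel_embed(4)[OF r Y c(1)] by simp
  thus ?thesis using Y.lin_restrict[OF cA2 v(1)] cos0 by simp
 qed
 have "\<forall>x\<in>K. \<exists>v. v \<in> coords A2 \<and> x = lin M2 A2 idf v"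
 proof
  fix x assume "x \<in> K"
  thus "\<exists>v. v \<in> coords A2 \<and> x = lin M2 A2 idf v" using M2.gensD[OF A2, of x] by auto
 qed
 then obtain co where co: "\<And>x. x \<in> K ==> co x \<in> coords A2 \<and> x = lin M2 A2 idf (co x)" by metis
 define \<psi> where "\<psi> x = lin (NN n) A2 c (co x)" for x
 have \<psi>: "\<psi> (lin M2 A2 idf v) = lin (NN n) A2 c v" if v: "v \<in> coords A2" for v
 proof -
  let ?x = "lin M2 A2 idf v"
  have x: "?x \<in> K" using linA2_K[OF v] linA2[OF v] by simp
  have co': "co ?x \<in> coords A2" "lin M2 A2 idf (co ?x) = ?x" using co[OF x] by auto
  have "lin M2 A2 idf (\<lambda>a. co ?x a \<ominus> v a) = \<zero>\<^bsub>M\<^esub>"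
   using co' v idfA A2K M2.diff_zero_iff[of ?x ?x] x by (subst M2.lin_diff) auto
  hence "lin (NN n) A2 c (\<lambda>a. co ?x a \<ominus> v a) = \<zero>\<^bsub>NN n\<^esub>" using co' v by (intro z0) auto
  thus ?thesis unfolding \<psi>_def using cA2 co'(1) v A2K
   by (subst (asm) Y.lin_diff) (auto simp: Y.diff_zero_iff)
 qed
 have 1: "\<psi> x \<in> carrier (NN n)" if "x \<in> K" for x
  unfolding \<psi>_def using co[OF that] cA2 by auto
 have 2: "\<psi> (lin M2 I x v) = lin (NN n) I (\<lambda>i. \<psi> (x i)) v"
  if I: "finite I" "x \<in> I \<rightarrow> K" "v \<in> coords I" for I :: "nat set" and x v
 proof -
  have cx: "(\<lambda>i. co (x i)) \<in> I \<rightarrow> A2 \<rightarrow> carrier S" using co I by auto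
  have "lin M2 I x v = lin M2 I (\<lambda>i. lin M2 A2 idf (co (x i))) v"
  proof (rule M2.lin_cong[symmetric])
   fix i assume "i \<in> I"
   hence "x i \<in> K" using I by auto
   thus "v i \<odot>\<^bsub>M2\<^esub> lin M2 A2 idf (co (x i)) = v i \<odot>\<^bsub>M2\<^esub> x i" using co by metis
  qed (use I in auto)
  also have "\<dots> = lin M2 A2 idf (\<lambda>a. \<Oplus>i\<in>I. v i \<otimes> co (x i) a)"
   using I A2K idfA cx by (intro M2.lin_lin) auto
  finally have "\<psi> (lin M2 I x v) = lin (NN n) A2 c (\<lambda>a. \<Oplus>i\<in>I. v i \<otimes> co (x i) a)"
   using \<psi>[of "\<lambda>a. \<Oplus>i\<in>I. v i \<otimes> co (x i) a"] I cx by (auto intro!: finsum_closed simp: Pi_iff)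
  also have "\<dots> = lin (NN n) I (\<lambda>i. lin (NN n) A2 c (co (x i))) v"
   using I A2K cA2 cx by (intro Y.lin_lin[symmetric]) auto
  finally show ?thesis by (simp add: \<psi>_def)
 qed
 have 3: "\<exists>s\<in>carrier S. \<psi> (z j) = cos g s \<and> (s \<in> m \<longleftrightarrow> j \<noteq> l)" if j: "j \<in> J" for j
 proof -
  \<comment> \<open>The relation that expresses \<open>f\<^bsub>n+1\<^esub> y j = z j\<close> by the generators; the extension evaluated at
    it computes \<open>\<psi> (z j)\<close> modulo \<open>m\<close>.\<close>
  define v where "v a = (if a \<in> A2 then wz j a else if a = y j then \<ominus> F else \<zero>)" for a
  have yA2: "y i \<notin> A2" if "i \<in> J" for i using A that by blast
  have v: "v \<in> coords A" using wz(1)[OF j] by (auto simp: v_def)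
  have lA2: "lin Q A2 x v = lin Q A2 x (wz j)" if "module S Q" "x \<in> A2 \<rightarrow> carrier Q"
   for Q :: "('a, 'q) module" and x
  proof -
   interpret Q: rmod S Q using that(1) by (rule rmod.intro)
   show ?thesis using that(2) wz(1)[OF j] by (intro Q.lin_cong) (auto simp: v_def)
  qed
  have lJ: "lin Q J x (\<lambda>i. v (y i)) = (\<ominus> F) \<odot>\<^bsub>Q\<^esub> x j" if "module S Q" "x \<in> J \<rightarrow> carrier Q"
   for Q :: "('a, 'q) module" and x
  proof -
   interpret Q: rmod S Q using that(1) by (rule rmod.intro)
   have "lin Q J x (\<lambda>i. v (y i)) = lin Q J x (\<lambda>i. if i = j then \<ominus> F else \<zero>)"
    using that(2) yA2 inj_y j by (intro Q.lin_cong) (auto simp: v_def inj_on_def)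
   thus ?thesis using Q.lin_delta[OF finJ j that(2), of "\<ominus> F"] by simp
  qed
  have idfM: "idf \<in> A2 \<rightarrow> carrier M" using A2K by auto
  have "lin M A idf v = z j \<oplus>\<^bsub>M\<^esub> (\<ominus> F) \<odot>\<^bsub>M\<^esub> y j"
   using linA[OF v] lA2[OF M_module idfM] lJ[OF M_module yJ] wz(2)[OF j] linA2[OF wz(1)[OF j]] by simp
  hence "lin M A idf v = \<zero>\<^bsub>M\<^esub>" using yc[OF j] by (simp add: z_def M.smult_l_minus M.M.r_neg)
  hence r: "(\<lambda>a\<in>A. v a) \<in> rel S M A idf" using v idfA by (intro M.relI) auto
  have "quo (\<lambda>a\<in>A. v a) l = \<ominus> (if j = l then \<one> else \<zero>)"
   using l yA2 inj_y j by (intro quo_eq) (auto simp: v_def inj_on_def r_minus)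
  hence "cos g (\<ominus> (if j = l then \<one> else \<zero>)) = lin (NN n) A c v"
   using c(2)[OF r] Y.lin_restrict[OF c(1) v] by simp
  also have "\<dots> = lin (NN n) A2 c v \<oplus>\<^bsub>NN n\<^esub> lin (NN n) (y ` J) c v"
   using A A2K finJ c(1) v by (intro Y.lin_union) auto
  also have "lin (NN n) (y ` J) c v = lin (NN n) J (\<lambda>i. c (y i)) (\<lambda>i. v (y i))"
   using inj_y c(1) v by (intro Y.lin_reindex) auto
  also have "\<dots> = (\<ominus> F) \<odot>\<^bsub>NN n\<^esub> c (y j)" using c(1) by (intro lJ[OF Y]) auto
  also have "lin (NN n) A2 c v = \<psi> (z j)"
   using lA2[OF Y cA2] wz[OF j] \<psi>[OF wz(1)[OF j]] by simp
  finally have e: "cos g (\<ominus> (if j = l then \<one> else \<zero>)) = \<psi> (z j) \<oplus>\<^bsub>NN n\<^esub> (\<ominus> F) \<odot>\<^bsub>NN n\<^esub> c (y j)" .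
  have "c (y j) \<in> carrier (NN n)" using c(1) j by (intro funcset_mem[OF c(1)]) auto
  then obtain t where t: "t \<in> carrier S" "c (y j) = cos g t" using cyc_carrier[OF Fg(2)] by auto
  obtain q where q: "q \<in> carrier S" "\<psi> (z j) = cos g q" using 1[OF zK[OF j]] cyc_carrier[OF Fg(2)] by auto
  have "cos g (\<ominus> (if j = l then \<one> else \<zero>)) = cos g (q \<oplus> (\<ominus> F) \<otimes> t)" using e t q by simp
  hence "g divides (\<ominus> (if j = l then \<one> else \<zero>) \<ominus> (q \<oplus> (\<ominus> F) \<otimes> t))"
   using cos_eq_iff[OF Fg(2)] q t by (simp split: if_splits)
  hence d: "\<ominus> (if j = l then \<one> else \<zero>) \<ominus> (q \<oplus> (\<ominus> F) \<otimes> t) \<in> m"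
   using m_dvd[OF gp_m[of 0 n]] n1 nN by auto
  have Ft: "F \<otimes> t \<in> m" using f_m[of "Suc n"] nN t by (intro m_mult2) auto
  define o1 where "o1 = (if j = l then \<one> else \<zero>)"
  have o1: "o1 \<in> carrier S" "o1 \<in> m \<longleftrightarrow> j \<noteq> l" using one_notin_m m_zero by (auto simp: o1_def)
  have d': "\<ominus> o1 \<ominus> (q \<oplus> (\<ominus> F) \<otimes> t) \<in> m" using d by (simp add: o1_def)
  have "q = F \<otimes> t \<ominus> (\<ominus> o1 \<ominus> (q \<oplus> (\<ominus> F) \<otimes> t)) \<ominus> o1"
   using q(1) t(1) o1(1) Fg(1) by algebra
  moreover have "o1 = F \<otimes> t \<ominus> (\<ominus> o1 \<ominus> (q \<oplus> (\<ominus> F) \<otimes> t)) \<ominus> q"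
   using q(1) t(1) o1(1) Fg(1) by algebra
  ultimately have "q \<in> m \<longleftrightarrow> o1 \<in> m" using m_diff[OF m_diff[OF Ft d']] by metis
  thus ?thesis using q o1 by blast
 qed
 show ?thesis
  by (intro exI[of _ \<psi>] conjI ballI allI impI, erule 1, rule 2, assumption+, erule 3)
qed

end

context branches
begin

lemma cos_in_cos_m:
 assumes "1 \<le> i" "i \<le> N" "s \<in> carrier S"
 shows "cos (gp 0 i) s \<in> cos (gp 0 i) ` m \<longleftrightarrow> s \<in> m"
proof
 assume "cos (gp 0 i) s \<in> cos (gp 0 i) ` m"
 then obtain t where t: "t \<in> m" "cos (gp 0 i) s = cos (gp 0 i) t" by auto
 have "gp 0 i divides (s \<ominus> t)" using t assms m_carr cos_eq_iff[of "gp 0 i" s t] by auto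
 hence "s \<ominus> t \<in> m" using m_dvd[OF gp_m[of 0 i]] assms by auto
 hence "(s \<ominus> t) \<oplus> t \<in> m" using t m_add by blast
 moreover have "(s \<ominus> t) \<oplus> t = s" using assms(3) m_carr[OF t(1)] by algebra
 ultimately show "s \<in> m" by simp
qed auto

lemma cos_m_submodule:
 assumes "i \<le> N" shows "submodule (cos (gp 0 i) ` m) S (NN i)"
proof -
 have g: "gp 0 i \<in> carrier S" using assms by simp
 interpret Y: rmod S "NN i" using cyc_module[OF g] by (rule rmod.intro)
 show ?thesis
 proof (rule Y.submoduleI)
  fix a assume "a \<in> cos (gp 0 i) ` m"
  then obtain s where s: "s \<in> m" "a = cos (gp 0 i) s" by auto
  have "\<ominus>\<^bsub>NN i\<^esub> a = cos (gp 0 i) (\<ominus> s)"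
   using s m_carr g by (intro Y.M.minus_equality) (auto simp: l_neg cos_zero)
  thus "\<ominus>\<^bsub>NN i\<^esub> a \<in> cos (gp 0 i) ` m" using s m_uminus by auto
 qed (use m_carr g m_zero m_add m_mult in \<open>auto simp: cos_zero\<close>)
qed

end

context ext_step
begin

text \<open>One element \<open>z l\<close> after the other is exchanged into the diagonal basis. The functional dual to \<open>z l\<close>
 finds the position: it is a unit at some basis element that has a unit coefficient in \<open>z l\<close>.\<close>
lemma exchange_z:
 assumes D: "diag n M2 (I :: nat set) x d"
  and dual: "\<And>l. l \<in> J ==> \<exists>\<psi>. (\<forall>x\<in>K. \<psi> x \<in> carrier (NN n)) \<and>
    (\<forall>(I :: nat set) x v. finite I --> x \<in> I \<rightarrow> K --> v \<in> coords I -->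
     \<psi> (lin M2 I x v) = lin (NN n) I (\<lambda>i. \<psi> (x i)) v) \<and>
    (\<forall>j\<in>J. \<exists>s\<in>carrier S. \<psi> (z j) = cos g s \<and> (s \<in> m \<longleftrightarrow> j \<noteq> l))"
  and J': "J' \<subseteq> J"
 shows "\<exists>x k. diag n M2 I x d \<and> inj_on k J' \<and> k \<in> J' \<rightarrow> I \<and> (\<forall>j\<in>J'. x (k j) = z j \<and> d (k j) = n)"
proof -
 have Y: "module S (NN n)" by (rule cyc_module) simp
 interpret Y: rmod S "NN n" using Y by (rule rmod.intro)
 have "finite J'" using J' finJ finite_subset by blast
 thus ?thesis using J'
 proof (induction J')
  case empty thus ?case using D by (intro exI[of _ x]) auto
 next
  case (insert l J')
  obtain x k where D: "diag n M2 I x d" and k: "inj_on k J'" "k \<in> J' \<rightarrow> I"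
   and xk: "\<And>j. j \<in> J' ==> x (k j) = z j \<and> d (k j) = n" using insert by auto
  have l: "l \<in> J" using insert by auto
  obtain \<psi> where \<psi>: "\<And>x. x \<in> K ==> \<psi> x \<in> carrier (NN n)"
   and \<psi>lin: "\<And>(I :: nat set) x v. finite I ==> x \<in> I \<rightarrow> K ==> v \<in> coords I ==>
     \<psi> (lin M2 I x v) = lin (NN n) I (\<lambda>i. \<psi> (x i)) v"
   and \<psi>z: "\<And>j. j \<in> J ==> \<exists>s\<in>carrier S. \<psi> (z j) = cos g s \<and> (s \<in> m \<longleftrightarrow> j \<noteq> l)"
   using dual[OF l] by metis
  note I = diagD(2)[OF D]
  have x: "x \<in> I \<rightarrow> K" using diagD(3)[OF D] by simp
  have mN: "submodule (cos g ` m) S (NN n)" using nN by (intro cos_m_submodule) simp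
  have cm: "cos g s \<in> cos g ` m \<longleftrightarrow> s \<in> m" if "s \<in> carrier S" for s
   using cos_in_cos_m[of n s] that n1 nN by simp
  obtain v where v: "v \<in> coords I" "z l = lin M2 I x v"
   using M2.gensD[OF diagD(1)[OF D], of "z l"] zK[OF l] by auto
  have "\<psi> (z l) \<notin> cos g ` m" using \<psi>z[OF l] cm by auto
  hence nm: "lin (NN n) I (\<lambda>i. \<psi> (x i)) v \<notin> cos g ` m" using v \<psi>lin[OF I x v(1)] by simp
  \<comment> \<open>Otherwise \<open>\<psi> (z l)\<close>, a combination of these terms, would be in \<open>m\<close> as well.\<close>
  have "\<exists>i\<in>I. v i \<odot>\<^bsub>NN n\<^esub> \<psi> (x i) \<notin> cos g ` m"
  proof (rule ccontr)
   assume "\<not> ?thesis"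
   hence a: "\<And>i. i \<in> I ==> v i \<odot>\<^bsub>NN n\<^esub> \<psi> (x i) \<in> cos g ` m" by blast
   have "lin (NN n) I (\<lambda>i. v i \<odot>\<^bsub>NN n\<^esub> \<psi> (x i)) (\<lambda>_. \<one>) \<in> cos g ` m"
    using I a by (intro Y.lin_submodule[OF mN]) auto
   moreover have "lin (NN n) I (\<lambda>i. v i \<odot>\<^bsub>NN n\<^esub> \<psi> (x i)) (\<lambda>_. \<one>) = lin (NN n) I (\<lambda>i. \<psi> (x i)) v"
    using v x \<psi> by (intro Y.lin_cong) (auto simp: Pi_iff)
   ultimately show False using nm by simp
  qed
  then obtain i where i: "i \<in> I" "v i \<odot>\<^bsub>NN n\<^esub> \<psi> (x i) \<notin> cos g ` m" by blast
  have xi: "x i \<in> K" "v i \<in> carrier S" using i x v by auto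
  obtain s where s: "s \<in> carrier S" "\<psi> (x i) = cos g s"
   using \<psi>[OF xi(1)] cyc_carrier[OF Fg(2)] by auto
  have vs: "v i \<otimes> s \<notin> m" using i(2) s xi cm[of "v i \<otimes> s"] by simp
  hence vi: "v i \<notin> m" and sm: "s \<notin> m" using s xi m_mult m_mult2 by blast+
  \<comment> \<open>The position is not occupied by an earlier \<open>z j\<close>, at which \<open>\<psi>\<close> is in \<open>m\<close>.\<close>
  have ik: "i \<notin> k ` J'"
  proof
   assume "i \<in> k ` J'"
   then obtain j where j: "j \<in> J'" "i = k j" by auto
   have "j \<in> J" "j \<noteq> l" using j insert by auto
   then obtain s' where "s' \<in> carrier S" "\<psi> (z j) = cos g s'" "s' \<in> m" using \<psi>z by blast
   hence "\<psi> (x i) \<in> cos g ` m" using xk j by auto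
   hence "s \<in> m" using s cm by simp
   thus False using sm by simp
  qed
  have din: "d i \<in> {1..n}" using diagD(4)[OF D] i by auto
  have gd: "gp 0 (d i) \<in> carrier S" using din nN by (intro gp_closed) auto
  \<comment> \<open>The class of a unit in \<open>S/g\<^sub>n\<close> is killed by no proper divisor of \<open>g\<^sub>n\<close>.\<close>
  have di: "d i = n"
  proof -
   have "\<psi> (lin M2 {0::nat} (\<lambda>_. x i) (\<lambda>_. gp 0 (d i))) = lin (NN n) {0::nat} (\<lambda>_. \<psi> (x i)) (\<lambda>_. gp 0 (d i))"
    using xi gd by (intro \<psi>lin) auto
   moreover have "lin M2 {0::nat} (\<lambda>_. x i) (\<lambda>_. gp 0 (d i)) = \<zero>\<^bsub>M\<^esub>"
    using diagD(5)[OF D i(1)] by (intro M2.lin_zero[of "{0::nat}", simplified]) auto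
   moreover have "lin (NN n) {0::nat} (\<lambda>_. \<psi> (x i)) (\<lambda>_. gp 0 (d i)) = cos g (gp 0 (d i) \<otimes> s)"
    using gd s \<psi>[OF xi(1)] by (subst Y.lin_insert) auto
   moreover have "\<psi> \<zero>\<^bsub>M\<^esub> = cos g \<zero>" using \<psi>lin[of "{}" x v] by (simp add: cos_zero)
   ultimately have "cos g (gp 0 (d i) \<otimes> s) = cos g \<zero>" by simp
   hence "g divides (gp 0 (d i) \<otimes> s)" using cos_eq_iff[OF Fg(2), of "gp 0 (d i) \<otimes> s" \<zero>] gd s by (simp add: a_minus_def)
   hence "g divides (gp 0 (d i) \<otimes> s \<otimes> inv s)"
    using gd s sm unit_outside by (intro dvd_mult2[OF Fg(2), of "gp 0 (d i) \<otimes> s"]) auto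
   hence "g divides gp 0 (d i)" using gd s sm unit_outside by (simp add: m_assoc)
   hence "n \<le> d i" using gp_dvd_gp_iff[of n "d i"] din nN by auto
   thus ?thesis using din by simp
  qed
  have "diag n M2 I (x(i := z l)) d"
   using di zK[OF l] v vi nN by (intro exchange[OF M2_module _ D i(1) v(1) vi]) (auto simp: K_def)
  moreover have "inj_on (k(l := i)) (insert l J')"
   using k ik insert(2) by (auto simp: inj_on_def image_iff)
  moreover have "k(l := i) \<in> insert l J' \<rightarrow> I" using k i by auto
  moreover have "\<forall>j\<in>insert l J'. (x(i := z l)) ((k(l := i)) j) = z j \<and> d ((k(l := i)) j) = n"
   using xk di ik insert(2) by auto
  ultimately show ?case by blast
 qed
qed

text \<open>In a diagonal basis of \<open>K\<close> that contains the \<open>z j\<close> replace each of them by \<open>y j\<close>, and its degree \<open>n\<close>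
 by \<open>n + 1\<close>. In a relation of the new family the coefficients of the \<open>y j\<close> are divisible by \<open>f\<^bsub>n+1\<^esub>\<close>,
 since \<open>M/K\<close> is free over \<open>S/f\<^bsub>n+1\<^esub>\<close>, so it comes from a relation of the old one.\<close>
lemma diag_up:
 assumes D: "diag n M2 (I :: nat set) x d" and k: "inj_on k J" "k \<in> J \<rightarrow> I"
  and xk: "\<And>j. j \<in> J ==> x (k j) = z j" and dk: "\<And>j. j \<in> J ==> d (k j) = n"
 shows "diag (Suc n) M I (\<lambda>i. if i \<in> k ` J then y (the_inv_into J k i) else x i)
      (\<lambda>i. if i \<in> k ` J then Suc n else d i)"
  (is "diag _ _ _ ?x ?d")
proof -
 note I = diagD(2)[OF D]
 have kI: "k ` J \<subseteq> I" using k by auto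
 have xK: "x \<in> I \<rightarrow> K" using diagD(3)[OF D] by simp
 have xM: "x \<in> I \<rightarrow> carrier M" using xK K_carrier by auto
 have x'k: "?x (k j) = y j" if "j \<in> J" for j using that k by (simp add: the_inv_into_f_f)
 have x': "?x \<in> I \<rightarrow> carrier M"
  using xM yc k by (auto simp: Pi_iff the_inv_into_f_f)
 have din: "d i \<in> {1..n}" if "i \<in> I" for i using diagD(4)[OF D] that by auto
 have sp: "submodule (module_span S M (?x ` I)) S M" by (intro M.span_submodule funcset_image[OF x'])
 have x'in: "?x i \<in> module_span S M (?x ` I)" if "i \<in> I" for i
  unfolding module_span_def using that by blast
 note spE = M.submoduleE[OF sp]
 show ?thesis unfolding diag_def
 proof (intro conjI ballI impI)
  have yin: "y j \<in> module_span S M (?x ` I)" if "j \<in> J" for j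
   using x'in[of "k j"] x'k[OF that] kI that by auto
  have xin: "x i \<in> module_span S M (?x ` I)" if i: "i \<in> I" for i
  proof (cases "i \<in> k ` J")
   case True
   then obtain j where j: "j \<in> J" "i = k j" by auto
   have "F \<odot>\<^bsub>M\<^esub> y j \<in> module_span S M (?x ` I)" using yin[OF j(1)] spE(4) by simp
   thus ?thesis using xk[OF j(1)] j by (simp add: z_def)
  next
   case False thus ?thesis using x'in[OF i] by simp
  qed
  have "u \<in> module_span S M (?x ` I)" if u: "u \<in> carrier M" for u
  proof -
   obtain s q where s: "s \<in> coords J" "q \<in> K" "u = q \<oplus>\<^bsub>M\<^esub> lin M J y s" using M_eq_sum[OF u] by blast
   obtain v where v: "v \<in> coords I" "q = lin M2 I x v"
    using M2.gensD[OF diagD(1)[OF D], of q] s by auto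
   have "q = lin M I x v" using v linK[OF I xK] by simp
   hence "q \<in> module_span S M (?x ` I)" using M.lin_submodule[OF sp I, of x v] xin v by auto
   moreover have "lin M J y s \<in> module_span S M (?x ` I)"
    using M.lin_submodule[OF sp finJ, of y s] yin s by auto
   ultimately show ?thesis using s(3) spE(5) by blast
  qed
  hence "module_span S M (?x ` I) = carrier M" using spE(1) by blast
  thus "gens S M I ?x" using M.gens_iff_span[OF I x'] by blast
 next
  show "?d \<in> I \<rightarrow> {1..Suc n}" using din by (auto intro!: le_SucI)
 next
  fix i assume i: "i \<in> I"
  show "gp 0 (?d i) \<odot>\<^bsub>M\<^esub> ?x i = \<zero>\<^bsub>M\<^esub>"
  proof (cases "i \<in> k ` J")
   case True
   then obtain j where j: "j \<in> J" "i = k j" by auto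
   thus ?thesis using x'k[OF j(1)] kill[OF yc[OF j(1)]] True by simp
  next
   case False thus ?thesis using diagD(5)[OF D i] by simp
  qed
 next
  fix v i assume v: "v \<in> coords I" and e: "lin M I ?x v = \<zero>\<^bsub>M\<^esub>" and i: "i \<in> I"
  have vk: "(\<lambda>j. v (k j)) \<in> coords J" using v k by auto
  have "lin M I ?x v = lin M ((I - k ` J) \<union> k ` J) ?x v" using kI by (simp add: Un_absorb2)
  also have "\<dots> = lin M (I - k ` J) ?x v \<oplus>\<^bsub>M\<^esub> lin M (k ` J) ?x v"
   using I finJ x' v kI by (intro M.lin_union) auto
  also have "lin M (k ` J) ?x v = lin M J (\<lambda>j. ?x (k j)) (\<lambda>j. v (k j))"
   using k x' v kI by (intro M.lin_reindex) auto
  also have "\<dots> = lin M J y (\<lambda>j. v (k j))"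
   using yJ vk x'k by (intro M.lin_cong) auto
  finally have e2: "lin M (I - k ` J) ?x v \<oplus>\<^bsub>M\<^esub> lin M J y (\<lambda>j. v (k j)) = \<zero>\<^bsub>M\<^esub>" using e by simp
  have l1: "lin M (I - k ` J) ?x v \<in> K"
   using I xK v by (intro M.lin_submodule[OF K_sub]) auto
  have l2: "lin M J y (\<lambda>j. v (k j)) \<in> carrier M" using yJ vk by auto
  have "\<ominus>\<^bsub>M\<^esub> lin M (I - k ` J) ?x v = lin M J y (\<lambda>j. v (k j))"
  proof (rule M.M.minus_equality)
   show "lin M J y (\<lambda>j. v (k j)) \<oplus>\<^bsub>M\<^esub> lin M (I - k ` J) ?x v = \<zero>\<^bsub>M\<^esub>"
    using e2 M.M.a_comm[OF l2, of "lin M (I - k ` J) ?x v"] l1 K_carrier by auto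
  qed (use l1 l2 K_carrier in auto)
  hence "lin M J y (\<lambda>j. v (k j)) \<in> K" using M.submoduleE(3)[OF K_sub l1] by simp
  hence "\<forall>j\<in>J. \<exists>s. s \<in> carrier S \<and> v (k j) = F \<otimes> s" using indepK[OF vk] by (auto simp: factor_def)
  then obtain s where s: "\<And>j. j \<in> J ==> s j \<in> carrier S \<and> v (k j) = F \<otimes> s j" by metis
  define v' where "v' i = (if i \<in> k ` J then s (the_inv_into J k i) else v i)" for i
  have v'k: "v' (k j) = s j" if "j \<in> J" for j using that k by (simp add: v'_def the_inv_into_f_f)
  have v': "v' \<in> coords I" using v s k by (auto simp: v'_def Pi_iff the_inv_into_f_f)
  have "lin M I x v' = lin M I ?x v"
  proof (rule M.lin_cong[OF x' v])
   fix i assume i: "i \<in> I"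
   show "v' i \<odot>\<^bsub>M\<^esub> x i = v i \<odot>\<^bsub>M\<^esub> ?x i"
   proof (cases "i \<in> k ` J")
    case True
    then obtain j where j: "j \<in> J" "i = k j" by auto
    have "v' i \<odot>\<^bsub>M\<^esub> x i = s j \<odot>\<^bsub>M\<^esub> (F \<odot>\<^bsub>M\<^esub> y j)" using j v'k xk by (simp add: z_def)
    also have "\<dots> = (s j \<otimes> F) \<odot>\<^bsub>M\<^esub> y j" using s[OF j(1)] yc[OF j(1)] by (simp add: M.smult_assoc1)
    also have "s j \<otimes> F = v i" using s[OF j(1)] j m_comm[of F "s j"] by simp
    finally show ?thesis using x'k[OF j(1)] j by simp
   next
    case False thus ?thesis by (simp add: v'_def)
   qed
  qed
  hence "lin M2 I x v' = \<zero>\<^bsub>M2\<^esub>" using e linK[OF I xK v'] by simp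
  hence dv: "gp 0 (d i) divides v' i" using diagD(6)[OF D v' _ i] by blast
  show "gp 0 (?d i) divides v i"
  proof (cases "i \<in> k ` J")
   case True
   then obtain j where j: "j \<in> J" "i = k j" by auto
   have "g divides s j" using dv v'k[OF j(1)] dk[OF j(1)] j by simp
   hence "F \<otimes> g divides F \<otimes> s j" by (intro divides_mult) auto
   thus ?thesis using True s[OF j(1)] j G by simp
  next
   case False thus ?thesis using dv by (simp add: v'_def)
  qed
 qed
qed

end

context branches
begin

text \<open>The induction hypothesis gives a diagonal basis of the annihilator of \<open>g\<^sub>n\<close>, and \<open>exchange_z\<close> and
 \<open>diag_up\<close> make it one of \<open>M\<close>. Both steps use generating families \<open>A\<close> adapted to this submodule, so
 the hypothesis speaks about all of them.\<close>
theorem ext_vanish_imp_diag: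
 fixes M :: "('a, 'x) module"
 assumes "module S M" "n \<le> N" "gens S M (I0 :: nat set) x0" "t \<in> m"
  and "\<And>y. y \<in> carrier M ==> t \<odot>\<^bsub>M\<^esub> y = \<zero>\<^bsub>M\<^esub> ==> y = \<zero>\<^bsub>M\<^esub>"
  and "\<And>y. y \<in> carrier M ==> gp 0 n \<odot>\<^bsub>M\<^esub> y = \<zero>\<^bsub>M\<^esub>"
  and "\<And>A i. gens S M A (\<lambda>a. a) ==> i \<in> {1..n} ==> ext_vanish S (gp 0 n) M A (\<lambda>a. a) (NN i)"
 shows "\<exists>(I :: nat set) x d. diag n M I x d"
 using assms
proof (induction n arbitrary: M I0 x0)
 case (0 M)
 interpret M: rmod S M using 0 by (intro rmod.intro)
 have "carrier M = {\<zero>\<^bsub>M\<^esub>}" using 0(6) by auto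
 hence "diag 0 M ({} :: nat set) (\<lambda>_. \<zero>\<^bsub>M\<^esub>) (\<lambda>_. 0)" by (auto simp: diag_def gens_def)
 thus ?case by blast
next
 case (Suc n M I0 x0)
 interpret M: rmod S M using Suc by (intro rmod.intro)
 have n: "Suc n \<in> {1..N}" using Suc by auto
 note reg = p_regular[OF Suc.prems(1) n Suc.prems(4,5)]
 let ?F = "f (Suc n)"
 have F: "?F \<in> carrier S" "gp 0 (Suc n) = gp 0 n \<otimes> ?F" using n by (auto simp: gp_Suc)
 show ?case
 proof (cases "n = 0")
  case True
  have kF: "?F \<odot>\<^bsub>M\<^esub> y = \<zero>\<^bsub>M\<^esub>" if "y \<in> carrier M" for y using Suc.prems(6)[OF that] F True by simp
  obtain J :: "nat set" and y where J: "gens S M J y"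
    "\<And>v i. v\<in> coords J ==> lin M J y v = \<zero>\<^bsub>M\<^esub> ==> i \<in> J ==> ?F divides v i"
   using free_over_branch[OF Suc.prems(1) n Suc.prems(3) kF] reg kF by blast
  have "diag (Suc n) M J y (\<lambda>_. 1)"
   unfolding diag_def using J kF F True by (auto simp: gens_def)
  thus ?thesis by blast
 next
  case False
  have n1: "n \<ge> 1" using False by simp
  have "\<exists>(J :: nat set) y. finite J \<and> y \<in> J \<rightarrow> carrier M \<and>
   (\<forall>x\<in>carrier M. \<exists>s\<in> coords J. gp 0 n \<odot>\<^bsub>M\<^esub> (x \<ominus>\<^bsub>M\<^esub> lin M J y s) = \<zero>\<^bsub>M\<^esub>) \<and>
   (\<forall>s\<in> coords J. gp 0 n \<odot>\<^bsub>M\<^esub> lin M J y s = \<zero>\<^bsub>M\<^esub> --> (\<forall>j\<in>J. ?F divides s j))"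
   by (rule ext_step_setup[OF Suc.prems(1) n1 Suc.prems(2-4)]) (erule (1) Suc.prems(5) | erule Suc.prems(6))+
  then obtain J :: "nat set" and y where J0: "finite J \<and> y \<in> J \<rightarrow> carrier M \<and>
   (\<forall>x\<in>carrier M. \<exists>s\<in> coords J. gp 0 n \<odot>\<^bsub>M\<^esub> (x \<ominus>\<^bsub>M\<^esub> lin M J y s) = \<zero>\<^bsub>M\<^esub>) \<and>
   (\<forall>s\<in> coords J. gp 0 n \<odot>\<^bsub>M\<^esub> lin M J y s = \<zero>\<^bsub>M\<^esub> --> (\<forall>j\<in>J. ?F divides s j))"
   by (elim exE)
  have J: "finite J" "y \<in> J \<rightarrow> carrier M" using J0 by simp_all
  have J3: "\<exists>s\<in> coords J. gp 0 n \<odot>\<^bsub>M\<^esub> (x \<ominus>\<^bsub>M\<^esub> lin M J y s) = \<zero>\<^bsub>M\<^esub>" if "x \<in> carrier M" for x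
   using J0 that by simp
  have J4: "?F divides s j"
   if "s \<in> coords J" "gp 0 n \<odot>\<^bsub>M\<^esub> lin M J y s = \<zero>\<^bsub>M\<^esub>" "j \<in> J" for s j
   using J0 that by simp
  interpret E: ext_step S m f p N M n J y I0 x0
   by unfold_locales (fact Suc.prems n1 J J3 | erule (2) J4 | erule J3 | erule Suc.prems)+
  have down: "ext_gens S m f p N M n J y I0 x0 A2 wz"
   if "gens S E.M2 A2 (\<lambda>a. a)" "\<And>j. j \<in> J ==> wz j \<in> coords A2 \<and> E.z j = lin E.M2 A2 (\<lambda>a. a) (wz j)" for A2 wz
   using that by unfold_locales auto
  have ex_wz: "\<exists>wz. \<forall>j\<in>J. wz j \<in> coords A2 \<and> E.z j = lin E.M2 A2 (\<lambda>a. a) (wz j)"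
   if "gens S E.M2 A2 (\<lambda>a. a)" for A2
  proof -
   have "\<forall>j\<in>J. \<exists>v. v \<in> coords A2 \<and> E.z j = lin E.M2 A2 (\<lambda>a. a) v"
   proof
    fix j assume "j \<in> J"
    thus "\<exists>v. v \<in> coords A2 \<and> E.z j = lin E.M2 A2 (\<lambda>a. a) v"
     using E.M2.gensD[OF that, of "E.z j"] E.zK[of j] by auto
   qed
   thus ?thesis by metis
  qed
  obtain I2 :: "nat set" and w where w: "gens S E.M2 I2 w" using E.M2_fin_gen by blast
  have "\<exists>(I :: nat set) x d. diag n E.M2 I x d"
  proof (rule Suc.IH[OF E.M2_module _ w Suc.prems(4)])
   show "y = \<zero>\<^bsub>E.M2\<^esub>" if "y \<in> carrier E.M2" "t \<odot>\<^bsub>E.M2\<^esub> y = \<zero>\<^bsub>E.M2\<^esub>" for y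
    using Suc.prems(5)[of y] that E.K_carrier by auto
   show "gp 0 n \<odot>\<^bsub>E.M2\<^esub> y = \<zero>\<^bsub>E.M2\<^esub>" if "y \<in> carrier E.M2" for y
    using that by (simp add: E.K_def)
   fix A2 i assume A2: "gens S E.M2 A2 (\<lambda>a. a)" and i: "i \<in> {1..n}"
   obtain wz where wz: "\<forall>j\<in>J. wz j \<in> coords A2 \<and> E.z j = lin E.M2 A2 (\<lambda>a. a) (wz j)"
    using ex_wz[OF A2] by blast
   interpret G: ext_gens S m f p N M n J y I0 x0 A2 wz using down[OF A2] wz by blast
   show "ext_vanish S (gp 0 n) E.M2 A2 (\<lambda>a. a) (NN i)"
    using i n Suc.prems(7)[OF G.A_gens, of i] by (intro G.ext_vanish_down cyc_module) auto
  qed (use n in auto)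
  then obtain I :: "nat set" and x d where D: "diag n E.M2 I x d" by blast
  let ?A2 = "x ` I"
  have A2: "gens S E.M2 ?A2 (\<lambda>a. a)" by (rule E.M2.gens_image[OF diagD(1)[OF D]])
  obtain wz where wz: "\<forall>j\<in>J. wz j \<in> coords ?A2 \<and> E.z j = lin E.M2 ?A2 (\<lambda>a. a) (wz j)"
   using ex_wz[OF A2] by blast
  interpret G: ext_gens S m f p N M n J y I0 x0 ?A2 wz using down[OF A2] wz by blast
  have "n \<in> {1..Suc n}" using False by simp
  note dual = G.dual_functional[OF Suc.prems(7)[OF G.A_gens this]]
  obtain x' k where "diag n E.M2 I x' d" "inj_on k J" "k \<in> J \<rightarrow> I" "\<And>j. j \<in> J ==> x' (k j) = E.z j \<and> d (k j) = n"
   using E.exchange_z[OF D dual order_refl] by blast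
  thus ?thesis using E.diag_up[of I x' d k] by blast
 qed
qed

end

section \<open>Extension problems for a module with a diagonal basis\<close>

context branches
begin

text \<open>The value of a homomorphism at the relation \<open>g\<^bsub>d i\<^esub> e\<^sub>i\<close> is killed by \<open>g\<^sub>n/g\<^bsub>d i\<^esub>\<close>, so by the annihilator
 condition it is \<open>g\<^bsub>d i\<^esub> c i\<close> for some \<open>c i\<close>. These relations span all others, and \<open>c\<close> is the
 extension.\<close>
lemma diag_imp_ext_vanish:
 fixes M :: "('a, 'x) module" and Y :: "('a, 'y) module"
 assumes M: "module S M" and n: "n \<le> N" and D: "diag n M I x d" and Y: "module S Y" and ann: "annc n Y"
 shows "ext_vanish S (gp 0 n) M I x Y"
 unfolding ext_vanish_def
proof (intro allI impI)
 fix \<phi> assume \<phi>: "rel_hom S M I x Y \<phi>" and z: "\<forall>i\<in>I. \<phi> (unit_vec S I (gp 0 n) i) = \<zero>\<^bsub>Y\<^esub>"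
 interpret M: rmod S M using M by (rule rmod.intro)
 interpret Y: rmod S Y using Y by (rule rmod.intro)
 note I = diagD(2,3)[OF D]
 have din: "d i \<in> {1..n}" if "i \<in> I" for i using diagD(4)[OF D] that by auto
 have gc: "gp 0 (d i) \<in> carrier S" "gp (d i) n \<in> carrier S" "gp 0 (d i) \<otimes> gp (d i) n = gp 0 n" if "i \<in> I" for i
  using din[OF that] n by (auto simp: gp_mult)
 have u: "unit_vec S I (gp 0 (d i)) i \<in> rel S M I x" if "i \<in> I" for i
  using I that gc diagD(5)[OF D that] by (intro M.unit_vec_rel) auto
 have "\<exists>y. y \<in> carrier Y \<and> \<phi> (unit_vec S I (gp 0 (d i)) i) = gp 0 (d i) \<odot>\<^bsub>Y\<^esub> y" if i: "i \<in> I" for i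
 proof -
  let ?u = "unit_vec S I (gp 0 (d i)) i"
  have c: "\<phi> ?u \<in> carrier Y" using \<phi> u[OF i] by (auto simp: rel_hom_def)
  have "gp (d i) n \<odot>\<^bsub>Y\<^esub> \<phi> ?u = \<phi> (\<lambda>j\<in>I. gp (d i) n \<otimes> ?u j)"
   using \<phi> u[OF i] gc[OF i] by (auto simp: rel_hom_def)
  also have "(\<lambda>j\<in>I. gp (d i) n \<otimes> ?u j) = unit_vec S I (gp 0 n) i"
   unfolding unit_vec_def using gc[OF i] m_comm[of "gp 0 (d i)" "gp (d i) n"] by (intro restrict_ext) auto
  also have "\<phi> \<dots> = \<zero>\<^bsub>Y\<^esub>" using z i by blast
  finally show ?thesis using ann din[OF i] c unfolding annc_def by blast
 qed
 then obtain c where c: "\<And>i. i \<in> I ==> c i \<in> carrier Y \<and> \<phi> (unit_vec S I (gp 0 (d i)) i) = gp 0 (d i) \<odot>\<^bsub>Y\<^esub> c i"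
  by metis
 have "\<phi> v = lin Y I c v" if v: "v \<in> rel S M I x" for v
 proof -
  have vc: "v \<in> coords I" "v \<in> extensional I" "lin M I x v = \<zero>\<^bsub>M\<^esub>" using v by (auto simp: rel_def PiE_def)
  have "\<forall>i\<in>I. \<exists>w. w \<in> carrier S \<and> v i = gp 0 (d i) \<otimes> w" using diagD(6)[OF D vc(1,3)] by (auto simp: factor_def)
  then obtain w where w: "\<And>i. i \<in> I ==> w i \<in> carrier S \<and> v i = gp 0 (d i) \<otimes> w i" by metis
  have "v = (\<lambda>i\<in>I. w i \<otimes> gp 0 (d i))"
  proof
   fix i show "v i = (\<lambda>i\<in>I. w i \<otimes> gp 0 (d i)) i"
    using w[of i] gc(1)[of i] m_comm[of "gp 0 (d i)" "w i"] vc(2) by (cases "i \<in> I") (auto simp: extensional_def)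
  qed
  hence "\<phi> v = lin Y I (\<lambda>i. \<phi> (unit_vec S I (gp 0 (d i)) i)) w"
   using M.rel_hom_expand[OF Y \<phi> I, of "\<lambda>i. gp 0 (d i)" w] gc diagD(5)[OF D] w by auto
  also have "\<dots> = lin Y I c v"
  proof (rule Y.lin_cong)
   fix i assume i: "i \<in> I"
   show "w i \<odot>\<^bsub>Y\<^esub> \<phi> (unit_vec S I (gp 0 (d i)) i) = v i \<odot>\<^bsub>Y\<^esub> c i"
    using c[OF i] w[OF i] gc(1)[OF i] m_comm[of "gp 0 (d i)" "w i"] by (simp add: Y.smult_assoc1)
  qed (use c vc in auto)
  finally show ?thesis .
 qed
 thus "\<exists>c\<in>I \<rightarrow> carrier Y. \<forall>v\<in>rel S M I x. \<phi> v = lin Y I c v" using c by auto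
qed

text \<open>The homomorphism that sends \<open>g\<^bsub>d i\<^esub> e\<^sub>i\<close> to \<open>y\<close> and the other basic relations to zero vanishes on
 \<open>g\<^sub>n e\<^sub>i\<close>. Its extension maps \<open>e\<^sub>i\<close> to some \<open>c i\<close>, and then \<open>y = g\<^bsub>d i\<^esub> c i\<close>.\<close>
lemma ext_vanish_imp_ann:
 fixes M :: "('a, 'x) module" and Y :: "('a, 'y) module" and i :: 'i
 assumes M: "module S M" and n: "n \<le> N" and D: "diag n M I x d" and Y: "module S Y"
  and E: "ext_vanish S (gp 0 n) M I x Y" and i: "i \<in> I" and y: "y \<in> carrier Y" "gp (d i) n \<odot>\<^bsub>Y\<^esub> y = \<zero>\<^bsub>Y\<^esub>"
 shows "\<exists>y'\<in>carrier Y. y = gp 0 (d i) \<odot>\<^bsub>Y\<^esub> y'"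
proof -
 interpret M: rmod S M using M by (rule rmod.intro)
 interpret Y: rmod S Y using Y by (rule rmod.intro)
 note I = diagD(2,3)[OF D]
 have din: "d i \<in> {1..n}" using diagD(4)[OF D] i by auto
 let ?g = "gp 0 (d i)"
 have g: "?g \<in> carrier S" "gp (d i) n \<in> carrier S" "?g \<otimes> gp (d i) n = gp 0 n" "?g \<noteq> \<zero>"
  using din n by (auto simp: gp_mult gp_nz)
 define r where "r v = (THE r. r \<in> carrier S \<and> v i = ?g \<otimes> r)" for v :: "'i => 'a"
 have r_eq: "r v = s" if "s \<in> carrier S" "v i = ?g \<otimes> s" for v s
  unfolding r_def using that m_lcancel[OF g(4,1)] by (intro the_equality) auto
 have r: "r v \<in> carrier S \<and> v i = ?g \<otimes> r v" if "v \<in> rel S M I x" for v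
 proof -
  have "?g divides v i" using that i by (intro diagD(6)[OF D]) (auto simp: rel_def)
  then obtain s where "s \<in> carrier S" "v i = ?g \<otimes> s" by (rule dvdE)
  thus ?thesis using r_eq[of s v] by simp
 qed
 have r_add: "r (\<lambda>i\<in>I. v i \<oplus> w i) = r v \<oplus> r w" if "v \<in> rel S M I x" "w \<in> rel S M I x" for v w
  using r[OF that(1)] r[OF that(2)] i g by (intro r_eq) (auto simp: r_distr)
 have r_smult: "r (\<lambda>i\<in>I. a \<otimes> v i) = a \<otimes> r v" if "v \<in> rel S M I x" "a \<in> carrier S" for v a
  using r[OF that(1)] that(2) i g by (intro r_eq) (auto simp: m_lcomm)
 have rh: "rel_hom S M I x Y (\<lambda>v. r v \<odot>\<^bsub>Y\<^esub> y)"
  unfolding rel_hom_def using r y by (auto simp: r_add r_smult Y.smult_l_distr Y.smult_assoc1)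
 have rz: "r (unit_vec S I (gp 0 n) j) \<odot>\<^bsub>Y\<^esub> y = \<zero>\<^bsub>Y\<^esub>" if "j \<in> I" for j
 proof (cases "j = i")
  case True
  have "r (unit_vec S I (gp 0 n) j) = gp (d i) n" using True i g by (intro r_eq) (auto simp: unit_vec_def)
  thus ?thesis using y by simp
 next
  case False
  have "r (unit_vec S I (gp 0 n) j) = \<zero>" using False i g by (intro r_eq) (auto simp: unit_vec_def)
  thus ?thesis using y by simp
 qed
 obtain c where c: "c \<in> I \<rightarrow> carrier Y" "\<And>v. v \<in> rel S M I x ==> r v \<odot>\<^bsub>Y\<^esub> y = lin Y I c v"
  using ext_vanishD[OF E rh rz] by blast
 have u: "unit_vec S I ?g i \<in> rel S M I x" using I i g diagD(5)[OF D i] by (intro M.unit_vec_rel) auto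
 have "r (unit_vec S I ?g i) = \<one>" using i g by (intro r_eq) (auto simp: unit_vec_def)
 hence "y = lin Y I c (unit_vec S I ?g i)" using c(2)[OF u] y by simp
 also have "\<dots> = ?g \<odot>\<^bsub>Y\<^esub> c i"
  unfolding unit_vec_def using I i g c(1) by (subst Y.lin_restrict) (auto simp: Y.lin_delta)
 finally show ?thesis using c(1) i by auto
qed

end

section \<open>Direct sums, homomorphisms and free modules\<close>

lemma direct_sum_simps [simp]:
 "\<zero>\<^bsub>direct_sum I M\<^esub> = (\<lambda>i\<in>I. \<zero>\<^bsub>M i\<^esub>)"
 "u \<oplus>\<^bsub>direct_sum I M\<^esub> v = (\<lambda>i\<in>I. u i \<oplus>\<^bsub>M i\<^esub> v i)"
 "r \<odot>\<^bsub>direct_sum I M\<^esub> u = (\<lambda>i\<in>I. r \<odot>\<^bsub>M i\<^esub> u i)"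
 by (simp_all add: direct_sum_def)

lemma direct_sum_carrier:
 "carrier (direct_sum I M) = {u \<in> (\<Pi>\<^sub>E i\<in>I. carrier (M i)). finite {i \<in> I. u i \<noteq> \<zero>\<^bsub>M i\<^esub>}}"
 by (simp add: direct_sum_def)

lemma direct_sum_carrier_finite:
 "finite I ==> carrier (direct_sum I M) = (\<Pi>\<^sub>E i\<in>I. carrier (M i))"
 by (auto simp: direct_sum_carrier)

lemma direct_sum_module:
 fixes M :: "'i => ('a, 'b) module"
 assumes R: "cring R" and M: "\<And>i. i \<in> I ==> module R (M i)"
 shows "module R (direct_sum I M)"
proof -
 have ag: "abelian_group (M i)" if "i \<in> I" for i using M[OF that] by (simp add: module_def)
 have am: "abelian_monoid (M i)" if "i \<in> I" for i using ag[OF that] by (simp add: abelian_group_def)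
 have sz: "r \<odot>\<^bsub>M i\<^esub> \<zero>\<^bsub>M i\<^esub> = \<zero>\<^bsub>M i\<^esub>" if "i \<in> I" "r \<in> carrier R" for i r
  using module.smult_r_null[OF M[OF that(1)] that(2)] .
 note az = abelian_monoid.zero_closed[OF am]
 have fin_add: "finite {i \<in> I. u i \<oplus>\<^bsub>M i\<^esub> v i \<noteq> \<zero>\<^bsub>M i\<^esub>}"
  if "finite {i \<in> I. u i \<noteq> \<zero>\<^bsub>M i\<^esub>}" "finite {i \<in> I. v i \<noteq> \<zero>\<^bsub>M i\<^esub>}" for u v
 proof (rule finite_subset[OF _ finite_UnI[OF that]], rule)
  fix i assume "i \<in> {i \<in> I. u i \<oplus>\<^bsub>M i\<^esub> v i \<noteq> \<zero>\<^bsub>M i\<^esub>}"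
  thus "i \<in> {i \<in> I. u i \<noteq> \<zero>\<^bsub>M i\<^esub>} \<union> {i \<in> I. v i \<noteq> \<zero>\<^bsub>M i\<^esub>}"
   using abelian_monoid.l_zero[OF am az] by auto
 qed
 have fin_sm: "finite {i \<in> I. r \<odot>\<^bsub>M i\<^esub> u i \<noteq> \<zero>\<^bsub>M i\<^esub>}"
  if "finite {i \<in> I. u i \<noteq> \<zero>\<^bsub>M i\<^esub>}" "r \<in> carrier R" for u r
  by (rule finite_subset[OF _ that(1)]) (use sz that(2) in auto)
 have cl: "u i \<in> carrier (M i)" if "u \<in> carrier (direct_sum I M)" "i \<in> I" for u i
  using that by (auto simp: direct_sum_carrier)
 have mem: "(\<lambda>i\<in>I. u i) \<in> carrier (direct_sum I M)"
  if "\<And>i. i \<in> I ==> u i \<in> carrier (M i)" "finite {i \<in> I. u i \<noteq> \<zero>\<^bsub>M i\<^esub>}" for u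
  using that by (auto simp: direct_sum_carrier cong: conj_cong)
 have fin: "finite {i \<in> I. u i \<noteq> \<zero>\<^bsub>M i\<^esub>}" if "u \<in> carrier (direct_sum I M)" for u
  using that by (auto simp: direct_sum_carrier)
 have ext: "u = (\<lambda>i\<in>I. u i)" if "u \<in> carrier (direct_sum I M)" for u
  using that by (auto simp: direct_sum_carrier PiE_def extensional_restrict)
 show ?thesis
 proof (rule moduleI[OF R])
  show "abelian_group (direct_sum I M)"
  proof (rule abelian_groupI)
   fix u v assume "u \<in> carrier (direct_sum I M)" "v \<in> carrier (direct_sum I M)"
   thus "u \<oplus>\<^bsub>direct_sum I M\<^esub> v \<in> carrier (direct_sum I M)"
    unfolding direct_sum_simps using cl fin by (intro mem fin_add) (auto intro: abelian_monoid.a_closed[OF am])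
  next
   show "\<zero>\<^bsub>direct_sum I M\<^esub> \<in> carrier (direct_sum I M)"
    unfolding direct_sum_simps using az by (intro mem) auto
  next
   fix u v w assume "u \<in> carrier (direct_sum I M)" "v \<in> carrier (direct_sum I M)" "w \<in> carrier (direct_sum I M)"
   thus "u \<oplus>\<^bsub>direct_sum I M\<^esub> v \<oplus>\<^bsub>direct_sum I M\<^esub> w = u \<oplus>\<^bsub>direct_sum I M\<^esub> (v \<oplus>\<^bsub>direct_sum I M\<^esub> w)"
    unfolding direct_sum_simps using cl by (intro restrict_ext) (auto intro: abelian_monoid.a_assoc[OF am])
  next
   fix u v assume "u \<in> carrier (direct_sum I M)" "v \<in> carrier (direct_sum I M)"
   thus "u \<oplus>\<^bsub>direct_sum I M\<^esub> v = v \<oplus>\<^bsub>direct_sum I M\<^esub> u"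
    unfolding direct_sum_simps using cl by (intro restrict_ext) (auto intro: abelian_monoid.a_comm[OF am])
  next
   fix u assume u: "u \<in> carrier (direct_sum I M)"
   have "(\<lambda>i\<in>I. (\<lambda>i\<in>I. \<zero>\<^bsub>M i\<^esub>) i \<oplus>\<^bsub>M i\<^esub> u i) = (\<lambda>i\<in>I. u i)"
    using cl[OF u] by (intro restrict_ext) (auto intro: abelian_monoid.l_zero[OF am])
   thus "\<zero>\<^bsub>direct_sum I M\<^esub> \<oplus>\<^bsub>direct_sum I M\<^esub> u = u" using ext[OF u] by simp
   have inv: "\<ominus>\<^bsub>M i\<^esub> u i \<in> carrier (M i)" "\<ominus>\<^bsub>M i\<^esub> u i \<oplus>\<^bsub>M i\<^esub> u i = \<zero>\<^bsub>M i\<^esub>" if "i \<in> I" for i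
    using abelian_group.a_inv_closed[OF ag[OF that] cl[OF u that]] abelian_group.l_neg[OF ag[OF that] cl[OF u that]] by auto
   have "(\<lambda>i\<in>I. \<ominus>\<^bsub>M i\<^esub> u i) \<in> carrier (direct_sum I M)"
   proof (rule mem)
    show "finite {i \<in> I. \<ominus>\<^bsub>M i\<^esub> u i \<noteq> \<zero>\<^bsub>M i\<^esub>}"
     by (rule finite_subset[OF _ fin[OF u]]) (auto simp: abelian_group.a_inv_closed[OF ag] intro!: abelian_group.minus_equality[OF ag] abelian_monoid.l_zero[OF am] az)
   qed (use inv in auto)
   moreover have "(\<lambda>i\<in>I. \<ominus>\<^bsub>M i\<^esub> u i) \<oplus>\<^bsub>direct_sum I M\<^esub> u = \<zero>\<^bsub>direct_sum I M\<^esub>"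
    unfolding direct_sum_simps using inv by (intro restrict_ext) auto
   ultimately show "\<exists>v\<in>carrier (direct_sum I M). v \<oplus>\<^bsub>direct_sum I M\<^esub> u = \<zero>\<^bsub>direct_sum I M\<^esub>" by blast
  qed
 next
  fix a u assume "a \<in> carrier R" "u \<in> carrier (direct_sum I M)"
  thus "a \<odot>\<^bsub>direct_sum I M\<^esub> u \<in> carrier (direct_sum I M)"
   unfolding direct_sum_simps using cl fin by (intro mem fin_sm) (auto intro: module.smult_closed[OF M])
 next
  fix u assume u: "u \<in> carrier (direct_sum I M)"
  have "(\<lambda>i\<in>I. \<one>\<^bsub>R\<^esub> \<odot>\<^bsub>M i\<^esub> u i) = (\<lambda>i\<in>I. u i)"
   using cl[OF u] by (intro restrict_ext) (auto intro: module.smult_one[OF M])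
  thus "\<one>\<^bsub>R\<^esub> \<odot>\<^bsub>direct_sum I M\<^esub> u = u" using ext[OF u] by simp
 qed (unfold direct_sum_simps, (intro restrict_ext, simp add: cl module.smult_l_distr[OF M] module.smult_r_distr[OF M] module.smult_assoc1[OF M])+)
qed

lemma lin_direct_sum:
 fixes M :: "'i => ('a, 'b) module"
 assumes R: "cring R" and M: "\<And>i. i \<in> I ==> module R (M i)"
  and K: "finite K" "x \<in> K \<rightarrow> carrier (direct_sum I M)" "v \<in> K \<rightarrow> carrier R" and i: "i \<in> I"
 shows "lin (direct_sum I M) K x v i = lin (M i) K (\<lambda>k. x k i) v"
proof -
 interpret D: rmod R "direct_sum I M" using direct_sum_module[OF R M] by (rule rmod.intro)
 interpret Mi: rmod R "M i" using M[OF i] by (rule rmod.intro)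
 show ?thesis using K
 proof (induction K)
  case empty thus ?case using i D.lin_empty[of x v] by simp
 next
  case (insert k K)
  have "(\<lambda>k. x k i) \<in> insert k K \<rightarrow> carrier (M i)" using insert.prems i by (auto simp: direct_sum_carrier)
  thus ?case using insert i D.lin_insert[OF insert(1,2) insert.prems] Mi.lin_insert[of K k "\<lambda>k. x k i" v] by simp
 qed
qed

text \<open>Homomorphisms without the extensionality that \<open>mod_hom\<close> requires, so that they can be written as
 plain abstractions and composed.\<close>
definition mhom :: "('a, 'r) ring_scheme => ('a, 'b) module => ('a, 'c) module => ('b => 'c) => bool" where
 "mhom R A B h \<longleftrightarrow> h \<in> carrier A \<rightarrow> carrier B \<and>
   (\<forall>x\<in>carrier A. \<forall>y\<in>carrier A. h (x \<oplus>\<^bsub>A\<^esub> y) = h x \<oplus>\<^bsub>B\<^esub> h y) \<and>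
   (\<forall>r\<in>carrier R. \<forall>x\<in>carrier A. h (r \<odot>\<^bsub>A\<^esub> x) = r \<odot>\<^bsub>B\<^esub> h x)"

lemma mhomD:
 assumes "mhom R A B h"
 shows "x \<in> carrier A ==> h x \<in> carrier B"
  "x \<in> carrier A ==> y \<in> carrier A ==> h (x \<oplus>\<^bsub>A\<^esub> y) = h x \<oplus>\<^bsub>B\<^esub> h y"
  "r \<in> carrier R ==> x \<in> carrier A ==> h (r \<odot>\<^bsub>A\<^esub> x) = r \<odot>\<^bsub>B\<^esub> h x"
 using assms by (auto simp: mhom_def)

lemma mod_hom_iff: "h \<in> mod_hom R A B \<longleftrightarrow> mhom R A B h \<and> h \<in> extensional (carrier A)"
 by (auto simp: mod_hom_def mhom_def PiE_def)

lemma mhom_cong: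
 assumes A: "module R A" and h: "mhom R A B h" and "\<And>x. x \<in> carrier A ==> h' x = h x"
 shows "mhom R A B h'"
proof -
 interpret A: rmod R A using A by (rule rmod.intro)
 show ?thesis unfolding mhom_def using assms(3) mhomD[OF h] by auto
qed

lemma mhom_compose:
 "mhom R A B h ==> mhom R B C k ==> mhom R A C (\<lambda>x. k (h x))"
 unfolding mhom_def by (auto simp: Pi_iff)

lemma mhom_zero:
 assumes "module R A" "module R B" "mhom R A B h" shows "h \<zero>\<^bsub>A\<^esub> = \<zero>\<^bsub>B\<^esub>"
proof -
 interpret A: rmod R A using assms(1) by (rule rmod.intro)
 interpret B: rmod R B using assms(2) by (rule rmod.intro)
 have "h (\<zero>\<^bsub>R\<^esub> \<odot>\<^bsub>A\<^esub> \<zero>\<^bsub>A\<^esub>) = \<zero>\<^bsub>R\<^esub> \<odot>\<^bsub>B\<^esub> h \<zero>\<^bsub>A\<^esub>"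
  by (rule mhomD(3)[OF assms(3)]) simp_all
 thus ?thesis using mhomD(1)[OF assms(3)] by simp
qed

lemma mhom_minus:
 assumes "module R A" "module R B" "mhom R A B h" "x \<in> carrier A" "y \<in> carrier A"
 shows "h (x \<ominus>\<^bsub>A\<^esub> y) = h x \<ominus>\<^bsub>B\<^esub> h y"
proof -
 interpret A: rmod R A using assms(1) by (rule rmod.intro)
 interpret B: rmod R B using assms(2) by (rule rmod.intro)
 have e: "x \<ominus>\<^bsub>A\<^esub> y = x \<oplus>\<^bsub>A\<^esub> (\<ominus>\<^bsub>R\<^esub> \<one>\<^bsub>R\<^esub>) \<odot>\<^bsub>A\<^esub> y" using assms by (simp add: A.smult_l_minus A.M.minus_eq)
 have "h (x \<oplus>\<^bsub>A\<^esub> (\<ominus>\<^bsub>R\<^esub> \<one>\<^bsub>R\<^esub>) \<odot>\<^bsub>A\<^esub> y) = h x \<oplus>\<^bsub>B\<^esub> (\<ominus>\<^bsub>R\<^esub> \<one>\<^bsub>R\<^esub>) \<odot>\<^bsub>B\<^esub> h y"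
  using assms mhomD(2)[OF assms(3), of x "(\<ominus>\<^bsub>R\<^esub> \<one>\<^bsub>R\<^esub>) \<odot>\<^bsub>A\<^esub> y"] mhomD(3)[OF assms(3), of "\<ominus>\<^bsub>R\<^esub> \<one>\<^bsub>R\<^esub>" y] by simp
 thus ?thesis unfolding e using assms mhomD(1)[OF assms(3)] by (simp add: B.smult_l_minus B.M.minus_eq)
qed

lemma mhom_lin:
 assumes A: "module R A" and B: "module R B" and h: "mhom R A B h"
  and K: "finite K" "x \<in> K \<rightarrow> carrier A" "v \<in> K \<rightarrow> carrier R"
 shows "h (lin A K x v) = lin B K (\<lambda>k. h (x k)) v"
proof -
 interpret A: rmod R A using A by (rule rmod.intro)
 interpret B: rmod R B using B by (rule rmod.intro)
 show ?thesis using K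
 proof (induction K)
  case empty thus ?case using mhom_zero[OF A B h] by simp
 next
  case (insert k K)
  have "(\<lambda>k. h (x k)) \<in> insert k K \<rightarrow> carrier B" using insert.prems mhomD(1)[OF h] by auto
  thus ?case using insert mhomD[OF h] by (simp add: A.lin_insert B.lin_insert Pi_iff)
 qed
qed

lemma ker_submodule:
 assumes A: "module R A" and B: "module R B" and h: "mhom R A B h"
 shows "submodule (mod_ker A B h) R A"
proof -
 interpret A: rmod R A using A by (rule rmod.intro)
 interpret B: rmod R B using B by (rule rmod.intro)
 show ?thesis
 proof (rule A.submoduleI)
  fix a assume a: "a \<in> mod_ker A B h"
  have "h (\<zero>\<^bsub>A\<^esub> \<ominus>\<^bsub>A\<^esub> a) = \<zero>\<^bsub>B\<^esub>"
   using a mhom_minus[OF A B h, of "\<zero>\<^bsub>A\<^esub>" a] mhom_zero[OF A B h] by (simp add: mod_ker_def B.M.minus_eq)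
  thus "\<ominus>\<^bsub>A\<^esub> a \<in> mod_ker A B h" using a by (auto simp: mod_ker_def A.M.minus_eq)
 qed (use mhomD[OF h] mhom_zero[OF A B h] in \<open>auto simp: mod_ker_def\<close>)
qed

lemma regular_module_simps [simp]:
 "carrier (regular_module R) = carrier R" "\<zero>\<^bsub>regular_module R\<^esub> = \<zero>\<^bsub>R\<^esub>"
 "x \<oplus>\<^bsub>regular_module R\<^esub> y = x \<oplus>\<^bsub>R\<^esub> y" "x \<odot>\<^bsub>regular_module R\<^esub> y = x \<otimes>\<^bsub>R\<^esub> y"
 by (simp_all add: regular_module_def)

context cring
begin

lemma regular_module_module: "module R (regular_module R)"
proof (rule moduleI[OF is_cring])
 show "abelian_group (regular_module R)"
  by (rule abelian_groupI) (auto simp: a_ac intro!: bexI[of _ "\<ominus> _"] l_neg)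
qed (auto simp: m_assoc l_distr r_distr)

lemma free_module_module: "module R (free_module R I)"
 unfolding free_module_def by (intro direct_sum_module is_cring regular_module_module)

lemma free_carrier: "carrier (free_module R I) = {u \<in> I \<rightarrow>\<^sub>E carrier R. finite {i \<in> I. u i \<noteq> \<zero>}}"
 by (simp add: free_module_def direct_sum_carrier)

lemma free_simps [simp]:
 "\<zero>\<^bsub>free_module R I\<^esub> = (\<lambda>i\<in>I. \<zero>)"
 "u \<oplus>\<^bsub>free_module R I\<^esub> v = (\<lambda>i\<in>I. u i \<oplus> v i)"
 "r \<odot>\<^bsub>free_module R I\<^esub> u = (\<lambda>i\<in>I. r \<otimes> u i)"
 by (simp_all add: free_module_def)

end

definition flin :: "('a, 'r) ring_scheme => ('a, 'b) module => 'i set => ('i => 'b) => ('i => 'a) => 'b" where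
 "flin R M I x u = lin M {i \<in> I. u i \<noteq> \<zero>\<^bsub>R\<^esub>} x u"

context rmod
begin

lemma flin_eq:
 assumes "finite J" "J \<subseteq> I" "\<And>i. i \<in> I ==> u i \<noteq> \<zero> ==> i \<in> J" "x \<in> J \<rightarrow> carrier M" "u \<in> J \<rightarrow> carrier R"
 shows "flin R M I x u = lin M J x u"
proof -
 let ?K = "{i \<in> I. u i \<noteq> \<zero>}"
 have "lin M J x u = lin M J x (\<lambda>i. if i \<in> ?K then u i else \<zero>)"
  using assms by (intro lin_cong) (auto simp: Pi_iff)
 also have "\<dots> = lin M ?K x u" using assms by (intro lin_extend) auto
 finally show ?thesis by (simp add: flin_def)
qed

lemma flin_hom:
 assumes x: "x \<in> I \<rightarrow> carrier M"
 shows "mhom R (free_module R I) M (flin R M I x)"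
 unfolding mhom_def
proof (intro conjI ballI)
 show "flin R M I x \<in> carrier (free_module R I) \<rightarrow> carrier M"
  using x by (auto simp: flin_def R.free_carrier intro!: lin_closed)
next
 fix u v assume u: "u \<in> carrier (free_module R I)" and v: "v \<in> carrier (free_module R I)"
 let ?J = "{i \<in> I. u i \<noteq> \<zero>} \<union> {i \<in> I. v i \<noteq> \<zero>}"
 have J: "finite ?J" "?J \<subseteq> I" using u v by (auto simp: R.free_carrier)
 have c: "u \<in> I \<rightarrow> carrier R" "v \<in> I \<rightarrow> carrier R" using u v by (auto simp: R.free_carrier)
 have "flin R M I x (\<lambda>i\<in>I. u i \<oplus> v i) = lin M ?J x (\<lambda>i\<in>I. u i \<oplus> v i)"
  using J c x by (intro flin_eq) (auto simp: Pi_iff)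
 also have "\<dots> = lin M ?J x (\<lambda>i. u i \<oplus> v i)" using J c x by (intro lin_cong) (auto simp: Pi_iff)
 also have "\<dots> = lin M ?J x u \<oplus>\<^bsub>M\<^esub> lin M ?J x v" using J c x by (intro lin_add) auto
 also have "lin M ?J x u = flin R M I x u" using J c x by (intro flin_eq[symmetric]) auto
 also have "lin M ?J x v = flin R M I x v" using J c x by (intro flin_eq[symmetric]) auto
 finally show "flin R M I x (u \<oplus>\<^bsub>free_module R I\<^esub> v) = flin R M I x u \<oplus>\<^bsub>M\<^esub> flin R M I x v"
  by (simp only: R.free_simps)
next
 fix r u assume r: "r \<in> carrier R" and u: "u \<in> carrier (free_module R I)"
 let ?J = "{i \<in> I. u i \<noteq> \<zero>}"
 have J: "finite ?J" "?J \<subseteq> I" using u by (auto simp: R.free_carrier)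
 have c: "u \<in> I \<rightarrow> carrier R" using u by (auto simp: R.free_carrier)
 have "flin R M I x (\<lambda>i\<in>I. r \<otimes> u i) = lin M ?J x (\<lambda>i\<in>I. r \<otimes> u i)"
  using J c x r by (intro flin_eq) (auto simp: Pi_iff)
 also have "\<dots> = lin M ?J x (\<lambda>i. r \<otimes> u i)" using J c x r by (intro lin_cong) (auto simp: Pi_iff)
 also have "\<dots> = r \<odot>\<^bsub>M\<^esub> lin M ?J x u" using J c x r by (intro lin_smult) auto
 finally show "flin R M I x (r \<odot>\<^bsub>free_module R I\<^esub> u) = r \<odot>\<^bsub>M\<^esub> flin R M I x u" by (simp add: flin_def)
qed

lemma unit_vec_free: "i \<in> I ==> unit_vec R I \<one> i \<in> carrier (free_module R I)"
proof -
 assume "i \<in> I"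
 have "{j \<in> I. unit_vec R I \<one> i j \<noteq> \<zero>} \<subseteq> {i}" by (auto simp: unit_vec_def)
 hence "finite {j \<in> I. unit_vec R I \<one> i j \<noteq> \<zero>}" using finite_subset by blast
 thus ?thesis by (auto simp: R.free_carrier unit_vec_def)
qed

lemma flin_unit: "i \<in> I ==> x \<in> I \<rightarrow> carrier M ==> flin R M I x (unit_vec R I \<one> i) = x i"
 by (subst flin_eq[of "{i}"]) (auto simp: unit_vec_def lin_insert Pi_iff split: if_splits)

lemma free_hom_eq:
 assumes h: "mhom R (free_module R I) M h" and u: "u \<in> carrier (free_module R I)"
 shows "h u = flin R M I (\<lambda>i. h (unit_vec R I \<one> i)) u"
proof -
 let ?K = "{i \<in> I. u i \<noteq> \<zero>}" and ?P = "free_module R I"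
 have P: "module R ?P" by (rule R.free_module_module)
 interpret P: rmod R ?P using P by (rule rmod.intro)
 interpret G: rmod R "regular_module R" using R.regular_module_module by (rule rmod.intro)
 have K: "finite ?K" "u \<in> ?K \<rightarrow> carrier R" using u by (auto simp: R.free_carrier)
 have d: "(\<lambda>i. unit_vec R I \<one> i) \<in> ?K \<rightarrow> carrier ?P" using unit_vec_free by auto
 have "lin ?P ?K (\<lambda>i. unit_vec R I \<one> i) u = u"
 proof
  fix j
  show "lin ?P ?K (\<lambda>i. unit_vec R I \<one> i) u j = u j"
  proof (cases "j \<in> I")
   case False
   have "lin ?P ?K (\<lambda>i. unit_vec R I \<one> i) u \<in> carrier ?P" using d K by auto
   thus ?thesis using u False by (auto simp: R.free_carrier PiE_def extensional_def)
  next
   case True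
   have "lin ?P ?K (\<lambda>i. unit_vec R I \<one> i) u j = lin (regular_module R) ?K (\<lambda>i. unit_vec R I \<one> i j) u"
    unfolding free_module_def
    by (rule lin_direct_sum[OF R.is_cring R.regular_module_module K(1) _ K(2) True]) (use d in \<open>simp add: free_module_def\<close>)
   also have "\<dots> = u j"
   proof (cases "j \<in> ?K")
    case False
    have "lin (regular_module R) ?K (\<lambda>i. unit_vec R I \<one> i j) u = \<zero>\<^bsub>regular_module R\<^esub>"
     using True False K by (intro G.lin_zero) (auto simp: unit_vec_def Pi_iff)
    thus ?thesis using True False by simp
   next
    case jK: True
    have x: "(\<lambda>i. unit_vec R I \<one> i j) \<in> ?K \<rightarrow> carrier (regular_module R)" using True by (auto simp: unit_vec_def)
    have "lin (regular_module R) (?K - {j}) (\<lambda>i. unit_vec R I \<one> i j) u = \<zero>\<^bsub>regular_module R\<^esub>"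
     using True K by (intro G.lin_zero) (auto simp: unit_vec_def Pi_iff)
    thus ?thesis using G.lin_split[OF K(1) jK x K(2)] True K jK by (auto simp: unit_vec_def Pi_iff)
   qed
   finally show ?thesis .
  qed
 qed
 hence "h u = h (lin ?P ?K (\<lambda>i. unit_vec R I \<one> i) u)" by simp
 also have "\<dots> = lin M ?K (\<lambda>i. h (unit_vec R I \<one> i)) u"
  by (rule mhom_lin[OF P module_axioms h K(1) d K(2)])
 finally show ?thesis by (simp add: flin_def)
qed

lemma free_hom_agree:
 assumes "mhom R (free_module R I) M h" "mhom R (free_module R I) M k"
  "\<And>i. i \<in> I ==> h (unit_vec R I \<one> i) = k (unit_vec R I \<one> i)" "u \<in> carrier (free_module R I)"
 shows "h u = k u"
proof -
 have u: "u \<in> {i \<in> I. u i \<noteq> \<zero>} \<rightarrow> carrier R" using assms(4) by (auto simp: R.free_carrier)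
 have k: "(\<lambda>i. k (unit_vec R I \<one> i)) \<in> {i \<in> I. u i \<noteq> \<zero>} \<rightarrow> carrier M"
  by (intro funcsetI mhomD(1)[OF assms(2)] unit_vec_free) auto
 show ?thesis unfolding free_hom_eq[OF assms(1,4)] free_hom_eq[OF assms(2,4)] flin_def
  using assms(3) by (intro lin_cong[OF k u]) auto
qed

end

section \<open>The first Ext module as an extension problem\<close>

text \<open>Homomorphisms from the kernel of \<open>p\<close> to \<open>M\<close> extend to \<open>P\<close>; for a free module \<open>P\<close> and surjective \<open>p\<close>
 this is the vanishing of \<open>Ext\<^sup>1(Y, M)\<close>.\<close>
definition extendable :: "('a, 'r) ring_scheme => ('a, 'p) module => ('a, 'y) module => ('p => 'y) => ('a, 'm) module => bool" where
 "extendable R P Y p M \<longleftrightarrow> (\<forall>\<phi>. mhom R (P\<lparr>carrier := mod_ker P Y p\<rparr>) M \<phi> -->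
   (\<exists>h. mhom R P M h \<and> (\<forall>u\<in>mod_ker P Y p. h u = \<phi> u)))"

text \<open>Schanuel's lemma for this property, with explicit formulas: if \<open>\<psi>\<close> extends \<open>\<phi> \<circ> b\<close> to \<open>P\<close>, then
 \<open>\<psi> (a u) - \<phi> (b (a u) - u)\<close> extends \<open>\<phi>\<close> to \<open>Q\<close>.\<close>
lemma extendable_transfer:
 assumes mods: "module R P" "module R Q" "module R Y" "module R M"
  and p: "mhom R P Y p" and q: "mhom R Q Y q" and a: "mhom R Q P a" and b: "mhom R P Q b"
  and pa: "\<And>u. u \<in> carrier Q ==> p (a u) = q u" and qb: "\<And>u. u \<in> carrier P ==> q (b u) = p u"
  and E: "extendable R P Y p M"
 shows "extendable R Q Y q M"
 unfolding extendable_def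
proof (intro allI impI)
 fix \<phi> assume \<phi>: "mhom R (Q\<lparr>carrier := mod_ker Q Y q\<rparr>) M \<phi>"
 interpret P: rmod R P using mods by (intro rmod.intro)
 interpret Q: rmod R Q using mods by (intro rmod.intro)
 interpret M: rmod R M using mods by (intro rmod.intro)
 interpret Y: rmod R Y using mods by (intro rmod.intro)
 have KQ: "submodule (mod_ker Q Y q) R Q" by (rule ker_submodule[OF mods(2,3) q])
 note KQE = Q.submoduleE[OF KQ]
 have KQm: "module R (Q\<lparr>carrier := mod_ker Q Y q\<rparr>)" by (rule submodule.submodule_is_module[OF KQ mods(2)])
 interpret KQ: rmod R "Q\<lparr>carrier := mod_ker Q Y q\<rparr>" using KQm by (rule rmod.intro)
 have \<phi>D: "x \<in> mod_ker Q Y q ==> \<phi> x \<in> carrier M"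
  "x \<in> mod_ker Q Y q ==> y \<in> mod_ker Q Y q ==> \<phi> (x \<oplus>\<^bsub>Q\<^esub> y) = \<phi> x \<oplus>\<^bsub>M\<^esub> \<phi> y"
  "r \<in> carrier R ==> x \<in> mod_ker Q Y q ==> \<phi> (r \<odot>\<^bsub>Q\<^esub> x) = r \<odot>\<^bsub>M\<^esub> \<phi> x" for x y r
  using mhomD[OF \<phi>] by auto
 have bK: "b u \<in> mod_ker Q Y q" if "u \<in> mod_ker P Y p" for u
  using that qb mhomD(1)[OF b] by (auto simp: mod_ker_def)
 have aK: "a u \<in> mod_ker P Y p" if "u \<in> mod_ker Q Y q" for u
  using that pa mhomD(1)[OF a] by (auto simp: mod_ker_def)
 have "mhom R (P\<lparr>carrier := mod_ker P Y p\<rparr>) M (\<lambda>u. \<phi> (b u))"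
  using bK \<phi>D mhomD[OF b] unfolding mhom_def by (auto simp: mod_ker_def)
 then obtain \<psi> where \<psi>: "mhom R P M \<psi>" "\<And>u. u \<in> mod_ker P Y p ==> \<psi> u = \<phi> (b u)"
  using E unfolding extendable_def by blast
 \<comment> \<open>Both \<open>b (a u)\<close> and \<open>u\<close> lie over the same element of \<open>Y\<close>.\<close>
 define k where "k u = b (a u) \<ominus>\<^bsub>Q\<^esub> u" for u
 have ba: "mhom R Q Q (\<lambda>u. b (a u))" by (rule mhom_compose[OF a b])
 have kK: "k u \<in> mod_ker Q Y q" if u: "u \<in> carrier Q" for u
 proof -
  have bau: "b (a u) \<in> carrier Q" using mhomD(1)[OF ba u] .
  have "q (b (a u) \<ominus>\<^bsub>Q\<^esub> u) = q (b (a u)) \<ominus>\<^bsub>Y\<^esub> q u" by (rule mhom_minus[OF mods(2,3) q bau u])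
  also have "\<dots> = \<zero>\<^bsub>Y\<^esub>" using qb[OF mhomD(1)[OF a u]] pa[OF u] mhomD(1)[OF q u] by (simp add: Y.diff_zero_iff)
  finally show ?thesis using bau u by (simp add: mod_ker_def k_def)
 qed
 have k_add: "k (u \<oplus>\<^bsub>Q\<^esub> v) = k u \<oplus>\<^bsub>Q\<^esub> k v" if "u \<in> carrier Q" "v \<in> carrier Q" for u v
  using that mhomD(1,2)[OF ba] by (simp add: k_def Q.M.minus_eq Q.M.minus_add Q.M.a_ac)
 have k_sm: "k (r \<odot>\<^bsub>Q\<^esub> u) = r \<odot>\<^bsub>Q\<^esub> k u" if "r \<in> carrier R" "u \<in> carrier Q" for u r
  using that mhomD(1,3)[OF ba] by (simp add: k_def Q.smult_r_diff)
 define h where "h u = \<psi> (a u) \<ominus>\<^bsub>M\<^esub> \<phi> (k u)" for u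
 have \<psi>a: "mhom R Q M (\<lambda>u. \<psi> (a u))" by (rule mhom_compose[OF a \<psi>(1)])
 note \<psi>aD = mhomD[OF \<psi>a]
 have "mhom R Q M h" unfolding mhom_def h_def
  using \<psi>aD \<phi>D kK by (auto simp: k_add k_sm M.M.minus_eq M.M.minus_add M.M.a_ac M.smult_r_distr M.smult_r_minus)
 moreover have "h u = \<phi> u" if u: "u \<in> mod_ker Q Y q" for u
 proof -
  have uQ: "u \<in> carrier Q" using u by (simp add: mod_ker_def)
  have bau: "b (a u) \<in> mod_ker Q Y q" using bK aK u by blast
  have "\<phi> (b (a u) \<ominus>\<^bsub>Q\<lparr>carrier := mod_ker Q Y q\<rparr>\<^esub> u) = \<phi> (b (a u)) \<ominus>\<^bsub>M\<^esub> \<phi> u"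
   using bau u by (intro mhom_minus[OF KQm mods(4) \<phi>]) auto
  moreover have "b (a u) \<ominus>\<^bsub>Q\<lparr>carrier := mod_ker Q Y q\<rparr>\<^esub> u = k u"
  proof -
   have "(b (a u) \<ominus>\<^bsub>Q\<lparr>carrier := mod_ker Q Y q\<rparr>\<^esub> u) \<oplus>\<^bsub>Q\<^esub> u = b (a u)"
    using KQ.diff_add_cancel[of "b (a u)" u] bau u by simp
   moreover have "k u \<oplus>\<^bsub>Q\<^esub> u = b (a u)" unfolding k_def using Q.diff_add_cancel[of "b (a u)" u] bau uQ KQE(1) by auto
   moreover have "b (a u) \<ominus>\<^bsub>Q\<lparr>carrier := mod_ker Q Y q\<rparr>\<^esub> u \<in> mod_ker Q Y q"
    using KQ.M.minus_closed[of "b (a u)" u] bau u by simp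
   ultimately show ?thesis
    using Q.M.add.r_cancel[of "b (a u) \<ominus>\<^bsub>Q\<lparr>carrier := mod_ker Q Y q\<rparr>\<^esub> u" u "k u"] uQ kK[OF uQ] KQE(1) by auto
  qed
  ultimately have "\<phi> (k u) = \<phi> (b (a u)) \<ominus>\<^bsub>M\<^esub> \<phi> u" by simp
  moreover have "\<psi> (a u) = \<phi> (b (a u))" using \<psi>(2) aK u by blast
  ultimately show ?thesis unfolding h_def using \<phi>D(1)[OF bau] \<phi>D(1)[OF u]
   by (simp add: M.M.minus_eq M.M.minus_add M.M.a_assoc[symmetric] M.M.r_neg)
 qed
 ultimately show "\<exists>h. mhom R Q M h \<and> (\<forall>u\<in>mod_ker Q Y q. h u = \<phi> u)" by blast
qed

context rmod
begin

text \<open>Projectivity of free modules.\<close>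
lemma free_lift:
 fixes P :: "('a, 'p) module"
 assumes P: "module R P" and p: "mhom R P M p" "\<And>y. y \<in> carrier M ==> \<exists>u\<in>carrier P. p u = y"
  and q: "mhom R (free_module R J) M q"
 shows "\<exists>a. mhom R (free_module R J) P a \<and> (\<forall>u\<in>carrier (free_module R J). p (a u) = q u)"
proof -
 interpret P: rmod R P using P by (rule rmod.intro)
 have "\<forall>j\<in>J. \<exists>u. u \<in> carrier P \<and> p u = q (unit_vec R J \<one> j)"
  using p(2) mhomD(1)[OF q] unit_vec_free by metis
 then obtain c where c: "\<And>j. j \<in> J ==> c j \<in> carrier P \<and> p (c j) = q (unit_vec R J \<one> j)" by metis
 have cP: "c \<in> J \<rightarrow> carrier P" using c by auto
 have a: "mhom R (free_module R J) P (flin R P J c)" by (rule P.flin_hom[OF cP])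
 have "p (flin R P J c u) = q u" if "u \<in> carrier (free_module R J)" for u
  using P.flin_unit[OF _ cP] c by (intro free_hom_agree[OF mhom_compose[OF a p(1)] q _ that]) auto
 thus ?thesis using a by blast
qed

lemma free_eval_eq: "free_eval R M A = (\<lambda>u\<in>carrier (free_module R A). flin R M A (\<lambda>a. a) u)"
 by (simp add: free_eval_def flin_def lin_def)

lemma free_eval_hom: "A \<subseteq> carrier M ==> mhom R (free_module R A) M (free_eval R M A)"
 unfolding free_eval_eq by (intro mhom_cong[OF R.free_module_module flin_hom]) auto

lemma free_eval_unit: "A \<subseteq> carrier M ==> a \<in> A ==> free_eval R M A (unit_vec R A \<one> a) = a"
 unfolding free_eval_eq using unit_vec_free[of a A] by (simp, subst flin_unit) auto

lemma free_eval_in: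
 assumes "submodule A R M" "u \<in> carrier (free_module R A)" shows "free_eval R M A u \<in> A"
 unfolding free_eval_eq flin_def using assms
 by (auto simp: R.free_carrier intro!: lin_submodule[OF assms(1)])

text \<open>Cocycles are the homomorphisms on \<open>F\<^sub>1\<close> which vanish on the kernel of the differential to \<open>F\<^sub>0\<close>, and
 the image of the differential is the first syzygy. So cocycles are the homomorphisms on the first
 syzygy, and coboundaries those that extend to \<open>F\<^sub>0\<close>.\<close>
lemma Ext1_zero_iff_extendable:
 fixes Y :: "('a, 'y) module"
 assumes Y: "module R Y"
 shows "zero_module (Ext1 R Y M) \<longleftrightarrow> extendable R (res0 R Y) Y (free_eval R Y (carrier Y)) M"
proof -
 interpret Y: rmod R Y using Y by (rule rmod.intro)
 let ?P0 = "res0 R Y" and ?P1 = "res1 R Y" and ?P2 = "res2 R Y"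
 let ?e0 = "free_eval R Y (carrier Y)" and ?e1 = "diff1 R Y" and ?e2 = "diff2 R Y"
 let ?K0 = "syz0 R Y" and ?K1 = "syz1 R Y"
 have P0: "module R ?P0" unfolding res0_def by (rule R.free_module_module)
 have P1: "module R ?P1" unfolding res1_def by (rule R.free_module_module)
 have P2: "module R ?P2" unfolding res2_def by (rule R.free_module_module)
 interpret P0: rmod R ?P0 using P0 by (rule rmod.intro)
 interpret P1: rmod R ?P1 using P1 by (rule rmod.intro)
 interpret P2: rmod R ?P2 using P2 by (rule rmod.intro)
 have e0: "mhom R ?P0 Y ?e0" unfolding res0_def by (rule Y.free_eval_hom) simp
 have K0: "submodule ?K0 R ?P0" unfolding syz0_def by (rule ker_submodule[OF P0 Y e0])
 note K0E = P0.submoduleE[OF K0]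
 have e1: "mhom R ?P1 ?P0 ?e1" unfolding res1_def diff1_def by (rule P0.free_eval_hom) (rule K0E(1))
 have K1: "submodule ?K1 R ?P1" unfolding syz1_def by (rule ker_submodule[OF P1 P0 e1])
 note K1E = P1.submoduleE[OF K1]
 have e2: "mhom R ?P2 ?P1 ?e2" unfolding res2_def diff2_def by (rule P1.free_eval_hom) (rule K1E(1))
 have e1K: "?e1 u \<in> ?K0" if "u \<in> carrier ?P1" for u
  using P0.free_eval_in[OF K0] that unfolding diff1_def res1_def .
 have e2K: "?e2 u \<in> ?K1" if "u \<in> carrier ?P2" for u
  using P1.free_eval_in[OF K1] that unfolding diff2_def res2_def .
 have d1: "unit_vec R ?K0 \<one> s \<in> carrier ?P1" "?e1 (unit_vec R ?K0 \<one> s) = s" if "s \<in> ?K0" for s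
  unfolding res1_def diff1_def using P0.free_eval_unit[OF K0E(1) that] unit_vec_free[OF that] by auto
 have d2: "unit_vec R ?K1 \<one> s \<in> carrier ?P2" "?e2 (unit_vec R ?K1 \<one> s) = s" if "s \<in> ?K1" for s
  unfolding res2_def diff2_def using P1.free_eval_unit[OF K1E(1) that] unit_vec_free[OF that] by auto
 define C where "C = ext1_cocycles R Y M"
 define B where "B = ext1_coboundaries R Y M"
 have C: "h \<in> C \<longleftrightarrow> h \<in> mod_hom R ?P1 M \<and> (\<forall>u\<in>?K1. h u = \<zero>\<^bsub>M\<^esub>)" for h
 proof -
  have "h \<in> C \<longleftrightarrow> h \<in> mod_hom R ?P1 M \<and> compose (carrier ?P2) h ?e2 = (\<lambda>x\<in>carrier ?P2. \<zero>\<^bsub>M\<^esub>)"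
   by (simp add: C_def ext1_cocycles_def mod_ker_def hom_module_def)
  also have "compose (carrier ?P2) h ?e2 = (\<lambda>x\<in>carrier ?P2. \<zero>\<^bsub>M\<^esub>) \<longleftrightarrow> (\<forall>u\<in>?K1. h u = \<zero>\<^bsub>M\<^esub>)"
  proof
   assume a: "compose (carrier ?P2) h ?e2 = (\<lambda>x\<in>carrier ?P2. \<zero>\<^bsub>M\<^esub>)"
   show "\<forall>u\<in>?K1. h u = \<zero>\<^bsub>M\<^esub>"
   proof
    fix s assume s: "s \<in> ?K1"
    from a have "compose (carrier ?P2) h ?e2 (unit_vec R ?K1 \<one> s) = \<zero>\<^bsub>M\<^esub>" using d2[OF s] by simp
    thus "h s = \<zero>\<^bsub>M\<^esub>" using d2[OF s] by (simp add: compose_def)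
   qed
  next
   assume "\<forall>u\<in>?K1. h u = \<zero>\<^bsub>M\<^esub>"
   thus "compose (carrier ?P2) h ?e2 = (\<lambda>x\<in>carrier ?P2. \<zero>\<^bsub>M\<^esub>)"
    unfolding compose_def using e2K by (intro restrict_ext) auto
  qed
  finally show ?thesis .
 qed
 have B: "h \<in> B \<longleftrightarrow> (\<exists>g. mhom R ?P0 M g \<and> h = (\<lambda>u\<in>carrier ?P1. g (?e1 u)))" for h
 proof
  assume "h \<in> B"
  then obtain g where "g \<in> mod_hom R ?P0 M" "h = compose (carrier ?P1) g ?e1"
   by (auto simp: B_def ext1_coboundaries_def)
  thus "\<exists>g. mhom R ?P0 M g \<and> h = (\<lambda>u\<in>carrier ?P1. g (?e1 u))"
   by (auto simp: mod_hom_iff compose_def)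
 next
  assume "\<exists>g. mhom R ?P0 M g \<and> h = (\<lambda>u\<in>carrier ?P1. g (?e1 u))"
  then obtain g where g: "mhom R ?P0 M g" "h = (\<lambda>u\<in>carrier ?P1. g (?e1 u))" by blast
  let ?g = "\<lambda>u\<in>carrier ?P0. g u"
  have "?g \<in> mod_hom R ?P0 M" unfolding mod_hom_iff using mhom_cong[OF P0 g(1), of ?g] by auto
  moreover have "h = compose (carrier ?P1) ?g ?e1"
   unfolding g(2) compose_def using mhomD(1)[OF e1] by (intro restrict_ext) auto
  ultimately show "h \<in> B" by (auto simp: B_def ext1_coboundaries_def)
 qed
 define pl where "pl h k = (\<lambda>x\<in>carrier ?P1. h x \<oplus>\<^bsub>M\<^esub> k x)" for h k :: "(('y => 'a) => 'a) => 'b"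
 have Ext: "zero_module (Ext1 R Y M) \<longleftrightarrow> (\<Union>k\<in>C. {\<Union>h\<in>B. {pl h k}}) = {B}"
  unfolding zero_module_def Ext1_def quot_module_def C_def[symmetric] B_def[symmetric]
  by (simp add: A_RCOSETS_def' a_r_coset_def' hom_module_def pl_def)
 show ?thesis
 proof
  assume z: "zero_module (Ext1 R Y M)"
  show "extendable R ?P0 Y ?e0 M" unfolding extendable_def
  proof (intro allI impI)
   fix \<phi> assume "mhom R (?P0\<lparr>carrier := mod_ker ?P0 Y ?e0\<rparr>) M \<phi>"
   hence \<phi>: "mhom R (?P0\<lparr>carrier := ?K0\<rparr>) M \<phi>" by (simp add: syz0_def)
   define h where "h = (\<lambda>u\<in>carrier ?P1. \<phi> (?e1 u))"
   have hh: "mhom R ?P1 M h"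
   proof (rule mhom_cong[OF P1, where h = "\<lambda>u. \<phi> (?e1 u)"])
    have "mhom R ?P1 (?P0\<lparr>carrier := ?K0\<rparr>) ?e1" using mhomD[OF e1] e1K by (simp add: mhom_def)
    thus "mhom R ?P1 M (\<lambda>u. \<phi> (?e1 u))" using \<phi> by (rule mhom_compose)
   qed (simp add: h_def)
   have z0: "\<phi> \<zero>\<^bsub>?P0\<^esub> = \<zero>\<^bsub>M\<^esub>"
    using mhom_zero[OF submodule.submodule_is_module[OF K0 P0] module_axioms \<phi>] by simp
   have "h u = \<zero>\<^bsub>M\<^esub>" if "u \<in> ?K1" for u using that z0 by (simp add: h_def syz1_def mod_ker_def)
   hence hC: "h \<in> C" using hh by (auto simp: C mod_hom_iff h_def)
   define oz where "oz = (\<lambda>u\<in>carrier ?P1. \<zero>\<^bsub>M\<^esub>)"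
   have "mhom R ?P0 M (\<lambda>_. \<zero>\<^bsub>M\<^esub>)" by (auto simp: mhom_def)
   hence "oz \<in> B" unfolding B oz_def by (intro exI[of _ "\<lambda>_. \<zero>\<^bsub>M\<^esub>"] conjI refl)
   hence "pl oz h \<in> (\<Union>h'\<in>B. {pl h' h})" by blast
   moreover have "(\<Union>h'\<in>B. {pl h' h}) = B"
   proof -
    have "(\<Union>h'\<in>B. {pl h' h}) \<in> (\<Union>k\<in>C. {\<Union>h\<in>B. {pl h k}})" by (rule UN_I[OF hC]) (rule singletonI)
    thus ?thesis using z[unfolded Ext] by (simp only: singleton_iff)
   qed
   moreover have "pl oz h = h"
    unfolding pl_def oz_def h_def using mhomD(1)[OF hh] by (intro restrict_ext) (auto simp: h_def)
   ultimately have "h \<in> B" by simp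
   then obtain g where g: "mhom R ?P0 M g" "h = (\<lambda>u\<in>carrier ?P1. g (?e1 u))" unfolding B by blast
   have "g s = \<phi> s" if s: "s \<in> ?K0" for s
   proof -
    have "h (unit_vec R ?K0 \<one> s) = \<phi> s" unfolding h_def using d1[OF s] by simp
    moreover have "h (unit_vec R ?K0 \<one> s) = g s" unfolding g(2) using d1[OF s] by simp
    ultimately show ?thesis by simp
   qed
   thus "\<exists>h. mhom R ?P0 M h \<and> (\<forall>u\<in>mod_ker ?P0 Y ?e0. h u = \<phi> u)" using g(1) by (auto simp: syz0_def)
  qed
 next
  assume E: "extendable R ?P0 Y ?e0 M"
  have CB: "h \<in> B" if h: "h \<in> C" for h
  proof -
   have hh: "mhom R ?P1 M h" "h \<in> extensional (carrier ?P1)" and hK: "\<And>u. u \<in> ?K1 ==> h u = \<zero>\<^bsub>M\<^esub>"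
    using h by (auto simp: C mod_hom_iff)
   \<comment> \<open>\<open>h\<close> only depends on the image under the differential\<close>
   have hdep: "h u = h v" if "u \<in> carrier ?P1" "v \<in> carrier ?P1" "?e1 u = ?e1 v" for u v
   proof -
    have "?e1 (u \<ominus>\<^bsub>?P1\<^esub> v) = ?e1 u \<ominus>\<^bsub>?P0\<^esub> ?e1 v" by (rule mhom_minus[OF P1 P0 e1 that(1,2)])
    also have "\<dots> = \<zero>\<^bsub>?P0\<^esub>" using that mhomD(1)[OF e1] by (simp add: P0.diff_zero_iff)
    finally have "u \<ominus>\<^bsub>?P1\<^esub> v \<in> ?K1" using that by (simp add: syz1_def mod_ker_def)
    hence "h u \<ominus>\<^bsub>M\<^esub> h v = \<zero>\<^bsub>M\<^esub>" using hK mhom_minus[OF P1 module_axioms hh(1) that(1,2)] by simp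
    thus ?thesis using diff_zero_iff mhomD(1)[OF hh(1)] that by blast
   qed
   let ?\<phi> = "\<lambda>s. h (unit_vec R ?K0 \<one> s)"
   have "mhom R (?P0\<lparr>carrier := ?K0\<rparr>) M ?\<phi>"
   proof (unfold mhom_def, intro conjI ballI)
    show "?\<phi> \<in> carrier (?P0\<lparr>carrier := ?K0\<rparr>) \<rightarrow> carrier M" using d1 mhomD(1)[OF hh(1)] by auto
   next
    fix s t assume "s \<in> carrier (?P0\<lparr>carrier := ?K0\<rparr>)" "t \<in> carrier (?P0\<lparr>carrier := ?K0\<rparr>)"
    hence st: "s \<in> ?K0" "t \<in> ?K0" "s \<oplus>\<^bsub>?P0\<^esub> t \<in> ?K0" using K0E(5) by auto
    have "?\<phi> (s \<oplus>\<^bsub>?P0\<^esub> t) = h (unit_vec R ?K0 \<one> s \<oplus>\<^bsub>?P1\<^esub> unit_vec R ?K0 \<one> t)"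
    proof (rule hdep[OF d1(1)[OF st(3)]])
     show "?e1 (unit_vec R ?K0 \<one> (s \<oplus>\<^bsub>?P0\<^esub> t)) = ?e1 (unit_vec R ?K0 \<one> s \<oplus>\<^bsub>?P1\<^esub> unit_vec R ?K0 \<one> t)"
      using d1(2)[OF st(3)] mhomD(2)[OF e1 d1(1)[OF st(1)] d1(1)[OF st(2)]] d1(2)[OF st(1)] d1(2)[OF st(2)] by metis
    qed (rule P1.M.a_closed[OF d1(1)[OF st(1)] d1(1)[OF st(2)]])
    also have "\<dots> = ?\<phi> s \<oplus>\<^bsub>M\<^esub> ?\<phi> t" by (rule mhomD(2)[OF hh(1) d1(1)[OF st(1)] d1(1)[OF st(2)]])
    finally show "?\<phi> (s \<oplus>\<^bsub>?P0\<lparr>carrier := ?K0\<rparr>\<^esub> t) = ?\<phi> s \<oplus>\<^bsub>M\<^esub> ?\<phi> t" by simp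
   next
    fix r s assume r: "r \<in> carrier R" and "s \<in> carrier (?P0\<lparr>carrier := ?K0\<rparr>)"
    hence st: "s \<in> ?K0" "r \<odot>\<^bsub>?P0\<^esub> s \<in> ?K0" using K0E(4) by auto
    have "?\<phi> (r \<odot>\<^bsub>?P0\<^esub> s) = h (r \<odot>\<^bsub>?P1\<^esub> unit_vec R ?K0 \<one> s)"
    proof (rule hdep[OF d1(1)[OF st(2)]])
     show "?e1 (unit_vec R ?K0 \<one> (r \<odot>\<^bsub>?P0\<^esub> s)) = ?e1 (r \<odot>\<^bsub>?P1\<^esub> unit_vec R ?K0 \<one> s)"
      using d1(2)[OF st(2)] mhomD(3)[OF e1 r d1(1)[OF st(1)]] d1(2)[OF st(1)] by metis
    qed (rule P1.smult_closed[OF r d1(1)[OF st(1)]])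
    also have "\<dots> = r \<odot>\<^bsub>M\<^esub> ?\<phi> s" by (rule mhomD(3)[OF hh(1) r d1(1)[OF st(1)]])
    finally show "?\<phi> (r \<odot>\<^bsub>?P0\<lparr>carrier := ?K0\<rparr>\<^esub> s) = r \<odot>\<^bsub>M\<^esub> ?\<phi> s" by simp
   qed
   then obtain g where g: "mhom R ?P0 M g" "\<And>s. s \<in> ?K0 ==> g s = ?\<phi> s"
    using E unfolding extendable_def syz0_def[symmetric] by blast
   have "h = (\<lambda>u\<in>carrier ?P1. g (?e1 u))"
   proof
    fix u show "h u = (\<lambda>u\<in>carrier ?P1. g (?e1 u)) u"
     using hdep[of u "unit_vec R ?K0 \<one> (?e1 u)"] d1[OF e1K] g(2)[OF e1K] hh(2)
     by (cases "u \<in> carrier ?P1") (auto simp: extensional_def)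
   qed
   thus ?thesis unfolding B using g(1) by blast
  qed
  have mB: "pl h k \<in> B" if hk: "h \<in> B" "k \<in> B" for h k
  proof -
   obtain g where g1: "mhom R ?P0 M g" "h = (\<lambda>u\<in>carrier ?P1. g (?e1 u))" using hk(1)[unfolded B] by (elim exE conjE) (rule that)
   obtain g' where g2: "mhom R ?P0 M g'" "k = (\<lambda>u\<in>carrier ?P1. g' (?e1 u))" using hk(2)[unfolded B] by (elim exE conjE) (rule that)
   note g = g1 g2
   have "mhom R ?P0 M (\<lambda>u. g u \<oplus>\<^bsub>M\<^esub> g' u)"
    using mhomD[OF g(1)] mhomD[OF g(3)] by (auto simp: mhom_def smult_r_distr M.a_ac)
   moreover have "pl h k = (\<lambda>u\<in>carrier ?P1. g (?e1 u) \<oplus>\<^bsub>M\<^esub> g' (?e1 u))"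
    unfolding pl_def g(2,4) by (intro restrict_ext) auto
   ultimately show ?thesis unfolding B by (intro exI conjI)
  qed
  have dB: "\<exists>h'\<in>B. h = pl h' k" if hk: "h \<in> B" "k \<in> B" for h k
  proof -
   obtain g where g1: "mhom R ?P0 M g" "h = (\<lambda>u\<in>carrier ?P1. g (?e1 u))" using hk(1)[unfolded B] by (elim exE conjE) (rule that)
   obtain g' where g2: "mhom R ?P0 M g'" "k = (\<lambda>u\<in>carrier ?P1. g' (?e1 u))" using hk(2)[unfolded B] by (elim exE conjE) (rule that)
   note g = g1 g2
   have gg: "mhom R ?P0 M (\<lambda>u. g u \<ominus>\<^bsub>M\<^esub> g' u)"
    using mhomD[OF g(1)] mhomD[OF g(3)] by (auto simp: mhom_def smult_r_diff M.minus_eq M.minus_add M.a_ac smult_r_distr smult_r_minus)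
   have "h = pl (\<lambda>u\<in>carrier ?P1. g (?e1 u) \<ominus>\<^bsub>M\<^esub> g' (?e1 u)) k"
    unfolding pl_def g(2,4) using mhomD(1)[OF g(1)] mhomD(1)[OF g(3)] mhomD(1)[OF e1]
    by (intro restrict_ext) (simp add: diff_add_cancel)
   moreover have "(\<lambda>u\<in>carrier ?P1. g (?e1 u) \<ominus>\<^bsub>M\<^esub> g' (?e1 u)) \<in> B"
    unfolding B using gg by (intro exI[of _ "\<lambda>u. g u \<ominus>\<^bsub>M\<^esub> g' u"] conjI refl)
   ultimately show ?thesis by blast
  qed
  have "(\<lambda>u\<in>carrier ?P1. \<zero>\<^bsub>M\<^esub>) \<in> C"
  proof -
   have "mhom R ?P1 M (\<lambda>_. \<zero>\<^bsub>M\<^esub>)" by (auto simp: mhom_def)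
   hence "mhom R ?P1 M (\<lambda>u\<in>carrier ?P1. \<zero>\<^bsub>M\<^esub>)" by (rule mhom_cong[OF P1]) simp
   thus ?thesis unfolding C mod_hom_iff using K1E(1) by auto
  qed
  hence "C \<noteq> {}" by blast
  moreover have "(\<Union>h\<in>B. {pl h k}) = B" if "k \<in> C" for k
   using mB dB CB[OF that] by blast
  ultimately show "zero_module (Ext1 R Y M)" unfolding Ext by auto
 qed
qed

end

section \<open>Restriction of scalars to the regular ring\<close>

text \<open>The standard resolution is infinitely generated even for a finitely generated module. By the
 transfer lemma it can be replaced by the free module on a finite generating family.\<close>
lemma Ext1_zero_iff_ext_vanish:
 fixes Y :: "('a, 'y) module" and M :: "('a, 'm) module"
 assumes Y: "module R Y" and M: "module R M" and g: "gens R Y I x"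
 shows "zero_module (Ext1 R Y M) \<longleftrightarrow> ext_vanish R \<zero>\<^bsub>R\<^esub> Y I x M"
proof -
 interpret Y: rmod R Y using Y by (rule rmod.intro)
 interpret M: rmod R M using M by (rule rmod.intro)
 have I: "finite I" "x \<in> I \<rightarrow> carrier Y" using g by (auto simp: gens_def)
 let ?P = "free_module R I" and ?p = "flin R Y I x" and ?Q = "res0 R Y" and ?q = "free_eval R Y (carrier Y)"
 have P: "module R ?P" by (rule Y.R.free_module_module)
 have Q: "module R ?Q" unfolding res0_def by (rule Y.R.free_module_module)
 interpret P: rmod R ?P using P by (rule rmod.intro)
 have Pc: "carrier ?P = I \<rightarrow>\<^sub>E carrier R" using I by (auto simp: Y.R.free_carrier)
 have fl: "flin R A I c u = lin A I c u" if "module R A" "c \<in> I \<rightarrow> carrier A" "u \<in> carrier ?P"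
  for A :: "('a, 'q) module" and c u
 proof -
  interpret A: rmod R A using that(1) by (rule rmod.intro)
  show ?thesis using that I by (intro A.flin_eq) (auto simp: Pc)
 qed
 have p: "mhom R ?P Y ?p" by (rule Y.flin_hom[OF I(2)])
 have q: "mhom R ?Q Y ?q" unfolding res0_def by (rule Y.free_eval_hom) simp
 have p_surj: "\<exists>u\<in>carrier ?P. ?p u = y" if y: "y \<in> carrier Y" for y
 proof -
  obtain v where v: "v \<in> I \<rightarrow> carrier R" "y = lin Y I x v" using Y.gensD[OF g y] by blast
  have "(\<lambda>i\<in>I. v i) \<in> carrier ?P" using v by (auto simp: Pc)
  moreover from this have "?p (\<lambda>i\<in>I. v i) = y" using fl[OF Y I(2)] Y.lin_restrict[OF I(2) v(1)] v(2) by simp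
  ultimately show ?thesis by blast
 qed
 have q_surj: "\<exists>u\<in>carrier ?Q. ?q u = y" if y: "y \<in> carrier Y" for y
  using Y.free_eval_unit[OF order_refl y] Y.unit_vec_free[OF y] unfolding res0_def by blast
 obtain a where a: "mhom R ?Q ?P a" "\<forall>u\<in>carrier ?Q. ?p (a u) = ?q u"
  using Y.free_lift[OF P p p_surj q[unfolded res0_def]] unfolding res0_def by blast
 obtain b where b: "mhom R ?P ?Q b" "\<forall>u\<in>carrier ?P. ?q (b u) = ?p u"
  using Y.free_lift[OF Q q q_surj p] by blast
 have "zero_module (Ext1 R Y M) \<longleftrightarrow> extendable R ?Q Y ?q M" by (rule M.Ext1_zero_iff_extendable[OF Y])
 also have "\<dots> \<longleftrightarrow> extendable R ?P Y ?p M"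
  using extendable_transfer[OF P Q Y M p q a(1) b(1)] extendable_transfer[OF Q P Y M q p b(1) a(1)] a(2) b(2) by blast
 also have "\<dots> \<longleftrightarrow> ext_vanish R \<zero>\<^bsub>R\<^esub> Y I x M"
 proof -
  have ker: "mod_ker ?P Y ?p = rel R Y I x"
   using fl[OF Y I(2)] by (auto simp: mod_ker_def rel_def Pc)
  have hom: "mhom R (?P\<lparr>carrier := rel R Y I x\<rparr>) M \<phi> \<longleftrightarrow> rel_hom R Y I x M \<phi>" for \<phi>
   by (auto simp: mhom_def rel_hom_def)
  have z: "\<phi> (unit_vec R I \<zero>\<^bsub>R\<^esub> i) = \<zero>\<^bsub>M\<^esub>" if \<phi>: "rel_hom R Y I x M \<phi>" for \<phi> i
  proof -
   have "unit_vec R I \<zero>\<^bsub>R\<^esub> i = \<zero>\<^bsub>?P\<lparr>carrier := rel R Y I x\<rparr>\<^esub>" by (auto simp: unit_vec_def)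
   moreover have "module R (?P\<lparr>carrier := rel R Y I x\<rparr>)"
    using submodule.submodule_is_module[OF ker_submodule[OF P Y p] P] unfolding ker .
   from mhom_zero[OF this M, of \<phi>] have "\<phi> \<zero>\<^bsub>?P\<lparr>carrier := rel R Y I x\<rparr>\<^esub> = \<zero>\<^bsub>M\<^esub>" using \<phi> hom by blast
   ultimately show ?thesis by (simp only:)
  qed
  show ?thesis unfolding extendable_def ext_vanish_def ker hom
  proof (intro iffI allI impI)
   fix \<phi> assume E: "\<forall>\<phi>. rel_hom R Y I x M \<phi> --> (\<exists>h. mhom R ?P M h \<and> (\<forall>u\<in>rel R Y I x. h u = \<phi> u))"
    and \<phi>: "rel_hom R Y I x M \<phi>"
   obtain h where h: "mhom R ?P M h" "\<forall>u\<in>rel R Y I x. h u = \<phi> u" using E \<phi> by blast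
   let ?c = "\<lambda>i. h (unit_vec R I \<one>\<^bsub>R\<^esub> i)"
   have c: "?c \<in> I \<rightarrow> carrier M" by (intro funcsetI mhomD(1)[OF h(1)] M.unit_vec_free)
   have "\<phi> v = lin M I ?c v" if v: "v \<in> rel R Y I x" for v
   proof -
    have vP: "v \<in> carrier ?P" using v by (auto simp: rel_def Pc)
    show ?thesis using M.free_hom_eq[OF h(1) vP] fl[OF M c vP] h(2) v by simp
   qed
   thus "\<exists>c\<in>I \<rightarrow> carrier M. \<forall>v\<in>rel R Y I x. \<phi> v = lin M I c v" using c by (intro bexI[of _ ?c]) auto
  next
   fix \<phi> assume E: "\<forall>\<phi>. rel_hom R Y I x M \<phi> --> (\<forall>i\<in>I. \<phi> (unit_vec R I \<zero>\<^bsub>R\<^esub> i) = \<zero>\<^bsub>M\<^esub>) -->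
     (\<exists>c\<in>I \<rightarrow> carrier M. \<forall>v\<in>rel R Y I x. \<phi> v = lin M I c v)"
    and \<phi>: "rel_hom R Y I x M \<phi>"
   obtain c where c: "c \<in> I \<rightarrow> carrier M" "\<forall>v\<in>rel R Y I x. \<phi> v = lin M I c v" using E \<phi> z[OF \<phi>] by blast
   have "flin R M I c v = \<phi> v" if v: "v \<in> rel R Y I x" for v
   proof -
    have vP: "v \<in> carrier ?P" using v by (auto simp: rel_def Pc)
    show ?thesis using fl[OF M c(1) vP] c(2) v by simp
   qed
   thus "\<exists>h. mhom R ?P M h \<and> (\<forall>u\<in>rel R Y I x. h u = \<phi> u)" using M.flin_hom[OF c(1)] by blast
  qed
 qed
 finally show ?thesis .
qed

text \<open>A module over \<open>S/F\<close> regarded as a module over \<open>S\<close>.\<close>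
definition pull :: "('a, 's) ring_scheme => 'a => ('a set, 'b) module => ('a, 'b) module" where
 "pull S F M = \<lparr>carrier = carrier M, monoid.mult = undefined, monoid.one = undefined,
   ring.zero = \<zero>\<^bsub>M\<^esub>, ring.add = ring.add M,
   module.smult = (\<lambda>s x. (PIdl\<^bsub>S\<^esub> F +>\<^bsub>S\<^esub> s) \<odot>\<^bsub>M\<^esub> x)\<rparr>"

lemma pull_simps [simp]:
 "carrier (pull S F M) = carrier M" "\<zero>\<^bsub>pull S F M\<^esub> = \<zero>\<^bsub>M\<^esub>"
 "x \<oplus>\<^bsub>pull S F M\<^esub> y = x \<oplus>\<^bsub>M\<^esub> y" "s \<odot>\<^bsub>pull S F M\<^esub> x = (PIdl\<^bsub>S\<^esub> F +>\<^bsub>S\<^esub> s) \<odot>\<^bsub>M\<^esub> x"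
 by (simp_all add: pull_def)

lemma pull_carrier_update: "pull S F (M\<lparr>carrier := N\<rparr>) = (pull S F M)\<lparr>carrier := N\<rparr>"
 by (simp add: pull_def)

locale quot = cring S for S :: "('a, 's) ring_scheme" (structure) +
 fixes F :: 'a
 assumes F_closed [simp, intro]: "F \<in> carrier S"
begin

abbreviation RR where "RR \<equiv> S Quot (PIdl F)"

abbreviation PS where "PS \<equiv> pull S F"

lemma F_ideal: "ideal (PIdl F) S" by (rule cgenideal_ideal) simp

lemma RR_cring: "cring RR" by (rule ideal.quotient_is_cring[OF F_ideal is_cring])

lemma RR_carrier: "carrier RR = cos F ` carrier S"
 using cyc_carrier[OF F_closed] by (simp add: cyc_def)

lemma cosF_closed [simp]: "s \<in> carrier S ==> cos F s \<in> carrier RR"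
 by (simp add: RR_carrier)

lemma cosF:
 "s \<in> carrier S ==> t \<in> carrier S ==> cos F (s \<oplus> t) = cos F s \<oplus>\<^bsub>RR\<^esub> cos F t"
 "s \<in> carrier S ==> t \<in> carrier S ==> cos F (s \<otimes> t) = cos F s \<otimes>\<^bsub>RR\<^esub> cos F t"
 "cos F \<zero> = \<zero>\<^bsub>RR\<^esub>" "cos F \<one> = \<one>\<^bsub>RR\<^esub>"
proof -
 have h: "ring_hom_ring S RR (cos F)" by (rule ideal.rcos_ring_hom_ring[OF F_ideal])
 show "s \<in> carrier S ==> t \<in> carrier S ==> cos F (s \<oplus> t) = cos F s \<oplus>\<^bsub>RR\<^esub> cos F t"
  "s \<in> carrier S ==> t \<in> carrier S ==> cos F (s \<otimes> t) = cos F s \<otimes>\<^bsub>RR\<^esub> cos F t"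
  "cos F \<zero> = \<zero>\<^bsub>RR\<^esub>" "cos F \<one> = \<one>\<^bsub>RR\<^esub>"
  using ring_hom_add[OF ring_hom_ring.homh[OF h]] ring_hom_mult[OF ring_hom_ring.homh[OF h]]
   ring_hom_zero[OF ring_hom_ring.homh[OF h]] ring_hom_one[OF ring_hom_ring.homh[OF h]]
   ring_axioms cring.axioms(1)[OF RR_cring] by blast+
qed

lemma cosF_F: "cos F F = \<zero>\<^bsub>RR\<^esub>"
 using cos_eq_iff[OF F_closed, of F \<zero>] cosF(3) by (simp add: a_minus_def dvd_refl)

lemma pull_module: assumes M: "module RR M" shows "module S (PS M)"
proof -
 interpret M: rmod RR M using M by (rule rmod.intro)
 show ?thesis
 proof (rule moduleI[OF is_cring])
  show "abelian_group (PS M)"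
   by (rule abelian_groupI) (auto simp: M.M.a_ac intro!: bexI[of _ "\<ominus>\<^bsub>M\<^esub> _"] M.M.l_neg)
 qed (simp_all add: cosF M.smult_l_distr M.smult_r_distr M.smult_assoc1)
qed

lemma pull_kill: "module RR M ==> x \<in> carrier M ==> F \<odot>\<^bsub>PS M\<^esub> x = \<zero>\<^bsub>M\<^esub>"
 using module.smult_l_null[of RR M x] by (simp add: cosF_F)

lemma lin_pull:
 assumes M: "module RR M" and I: "finite I" "x \<in> I \<rightarrow> carrier M" "v \<in> I \<rightarrow> carrier S"
 shows "lin (PS M) I x v = lin M I x (\<lambda>i. cos F (v i))"
proof -
 interpret M: rmod RR M using M by (rule rmod.intro)
 interpret P: rmod S "PS M" using pull_module[OF M] by (rule rmod.intro)
 show ?thesis using I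
 proof (induction I)
  case empty thus ?case using P.lin_empty M.lin_empty by simp
 next
  case (insert i I)
  thus ?case using P.lin_insert[of I i x v] M.lin_insert[of I i x "\<lambda>i. cos F (v i)"] by (simp add: Pi_iff)
 qed
qed

definition rep :: "'a set => 'a" where "rep c = (SOME s. s \<in> carrier S \<and> cos F s = c)"

lemma rep: "c \<in> carrier RR ==> rep c \<in> carrier S \<and> cos F (rep c) = c"
 unfolding rep_def RR_carrier by (rule someI_ex) auto

lemma gens_pull:
 assumes M: "module RR M" shows "gens S (PS M) I x \<longleftrightarrow> gens RR M I x"
proof -
 interpret M: rmod RR M using M by (rule rmod.intro)
 have "(\<exists>v\<in>I \<rightarrow> carrier S. y = lin (PS M) I x v) \<longleftrightarrow> (\<exists>v\<in>I \<rightarrow> carrier RR. y = lin M I x v)"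
  if I: "finite I" "x \<in> I \<rightarrow> carrier M" for y
 proof
  assume "\<exists>v\<in>I \<rightarrow> carrier S. y = lin (PS M) I x v"
  then obtain v where "v \<in> I \<rightarrow> carrier S" "y = lin (PS M) I x v" by blast
  thus "\<exists>v\<in>I \<rightarrow> carrier RR. y = lin M I x v"
   using lin_pull[OF M I, of v] by (intro bexI[of _ "\<lambda>i. cos F (v i)"]) (auto simp: Pi_iff)
 next
  assume "\<exists>v\<in>I \<rightarrow> carrier RR. y = lin M I x v"
  then obtain v where v: "v \<in> I \<rightarrow> carrier RR" "y = lin M I x v" by blast
  have r: "(\<lambda>i. rep (v i)) \<in> I \<rightarrow> carrier S" using rep v by auto
  have "lin (PS M) I x (\<lambda>i. rep (v i)) = lin M I x v"
   unfolding lin_pull[OF M I r] using I v rep by (intro M.lin_cong) (auto simp: Pi_iff)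
  thus "\<exists>v\<in>I \<rightarrow> carrier S. y = lin (PS M) I x v" using r v by (intro bexI[of _ "\<lambda>i. rep (v i)"]) auto
 qed
 thus ?thesis unfolding gens_def by auto
qed

text \<open>Relations over \<open>S/F\<close> are the classes of relations over \<open>S\<close>, and a homomorphism on the latter depends
 only on the classes if it vanishes on the \<open>F e\<^sub>i\<close>.\<close>
lemma ext_vanish_pull:
 assumes Y: "module RR Y" and M: "module RR M" and I: "finite I" "x \<in> I \<rightarrow> carrier Y"
 shows "ext_vanish RR \<zero>\<^bsub>RR\<^esub> Y I x M \<longleftrightarrow> ext_vanish S F (PS Y) I x (PS M)"
proof -
 interpret Y: rmod RR Y using Y by (rule rmod.intro)
 interpret M: rmod RR M using M by (rule rmod.intro)
 have Yp: "module S (PS Y)" and Mp: "module S (PS M)" using pull_module Y M by auto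
 interpret Yp: rmod S "PS Y" using Yp by (rule rmod.intro)
 interpret Mp: rmod S "PS M" using Mp by (rule rmod.intro)
 have xp: "x \<in> I \<rightarrow> carrier (PS Y)" using I by simp
 have relS: "(\<lambda>i\<in>I. cos F (v i)) \<in> rel RR Y I x" if v: "v \<in> rel S (PS Y) I x" for v
 proof (rule Y.relI[OF I(2)])
  have vc: "v \<in> I \<rightarrow> carrier S" "lin (PS Y) I x v = \<zero>\<^bsub>Y\<^esub>" using v by (auto simp: rel_def)
  show "(\<lambda>i. cos F (v i)) \<in> I \<rightarrow> carrier RR" using vc by (auto simp: Pi_iff)
  show "lin Y I x (\<lambda>i. cos F (v i)) = \<zero>\<^bsub>Y\<^esub>" using lin_pull[OF Y I vc(1)] vc(2) by simp
 qed
 have relR: "(\<lambda>i\<in>I. rep (u i)) \<in> rel S (PS Y) I x" if u: "u \<in> rel RR Y I x" for u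
 proof (rule Yp.relI[OF xp])
  show r: "(\<lambda>i. rep (u i)) \<in> I \<rightarrow> carrier S" using u rep by (auto simp: rel_def)
  have "lin Y I x (\<lambda>i. cos F (rep (u i))) = lin Y I x u"
  proof (rule Y.lin_cong[OF I(2)])
   show uc: "u \<in> I \<rightarrow> carrier RR" using u by (auto simp: rel_def)
   show "cos F (rep (u i)) \<odot>\<^bsub>Y\<^esub> x i = u i \<odot>\<^bsub>Y\<^esub> x i" if "i \<in> I" for i
    using rep[OF funcset_mem[OF uc that]] by simp
  qed
  thus "lin (PS Y) I x (\<lambda>i. rep (u i)) = \<zero>\<^bsub>PS Y\<^esub>"
   using lin_pull[OF Y I r] u by (simp add: rel_def)
 qed
 show ?thesis
 proof
  assume E: "ext_vanish RR \<zero>\<^bsub>RR\<^esub> Y I x M"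
  show "ext_vanish S F (PS Y) I x (PS M)" unfolding ext_vanish_def
  proof (intro allI impI)
   fix \<phi> assume \<phi>: "rel_hom S (PS Y) I x (PS M) \<phi>"
    and z: "\<forall>i\<in>I. \<phi> (unit_vec S I F i) = \<zero>\<^bsub>PS M\<^esub>"
   have \<phi>c: "\<phi> v \<in> carrier M" if "v \<in> rel S (PS Y) I x" for v using \<phi> that by (auto simp: rel_hom_def)
   have \<phi>a: "\<phi> (\<lambda>i\<in>I. v i \<oplus> w i) = \<phi> v \<oplus>\<^bsub>M\<^esub> \<phi> w"
    if "v \<in> rel S (PS Y) I x" "w \<in> rel S (PS Y) I x" for v w using \<phi> that by (auto simp: rel_hom_def)
   have \<phi>s: "\<phi> (\<lambda>i\<in>I. r \<otimes> v i) = cos F r \<odot>\<^bsub>M\<^esub> \<phi> v"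
    if "v \<in> rel S (PS Y) I x" "r \<in> carrier S" for v r using \<phi> that by (auto simp: rel_hom_def)
   have dep: "\<phi> v = \<phi> w" if v: "v \<in> rel S (PS Y) I x" and w: "w \<in> rel S (PS Y) I x"
    and e: "\<And>i. i \<in> I ==> cos F (v i) = cos F (w i)" for v w
   proof -
    have vc: "v i \<in> carrier S" "w i \<in> carrier S" if "i \<in> I" for i using v w that by (auto simp: rel_def)
    have "\<forall>i\<in>I. \<exists>t. t \<in> carrier S \<and> v i \<ominus> w i = F \<otimes> t"
    proof
     fix i assume i: "i \<in> I"
     have "F divides (v i \<ominus> w i)" using cos_eq_iff[OF F_closed vc[OF i]] e[OF i] by blast
     thus "\<exists>t. t \<in> carrier S \<and> v i \<ominus> w i = F \<otimes> t" by (rule dvdE) blast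
    qed
    then obtain t where t: "\<And>i. i \<in> I ==> t i \<in> carrier S \<and> v i \<ominus> w i = F \<otimes> t i" by metis
    have zt: "\<phi> (\<lambda>i\<in>I. F \<otimes> t i) = \<zero>\<^bsub>PS M\<^esub>"
     using I t z pull_kill[OF Y] by (intro Yp.rel_hom_multiple[OF Mp \<phi> I(1) xp]) (auto simp del: pull_simps(4))
    have rt: "(\<lambda>i\<in>I. F \<otimes> t i) \<in> rel S (PS Y) I x"
    proof (rule Yp.relI[OF xp _ Yp.lin_zero])
     fix i assume i: "i \<in> I"
     have "(F \<otimes> t i) \<odot>\<^bsub>PS Y\<^esub> x i = t i \<odot>\<^bsub>PS Y\<^esub> (F \<odot>\<^bsub>PS Y\<^esub> x i)"
      using i t I m_comm[of F "t i"] Yp.smult_assoc1[of "t i" F "x i"] by auto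
     also have "F \<odot>\<^bsub>PS Y\<^esub> x i = \<zero>\<^bsub>PS Y\<^esub>" using pull_kill[OF Y, of "x i"] i I by auto
     finally show "(F \<otimes> t i) \<odot>\<^bsub>PS Y\<^esub> x i = \<zero>\<^bsub>PS Y\<^esub>" using t[OF i] Yp.smult_r_null by simp
    qed (use t in auto)
    have "v i = w i \<oplus> F \<otimes> t i" if "i \<in> I" for i
    proof -
     have "v i = w i \<oplus> (v i \<ominus> w i)" using vc[OF that] by (simp add: a_minus_def a_lcomm r_neg)
     thus ?thesis using t[OF that] by simp
    qed
    hence "v = (\<lambda>i\<in>I. w i \<oplus> (\<lambda>i\<in>I. F \<otimes> t i) i)"
     using v by (auto simp: rel_def PiE_def extensional_def fun_eq_iff)
    hence "\<phi> v = \<phi> w \<oplus>\<^bsub>M\<^esub> \<phi> (\<lambda>i\<in>I. F \<otimes> t i)" using \<phi>a[OF w rt] by metis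
    thus ?thesis using zt \<phi>c[OF w] by simp
   qed
   let ?\<phi> = "\<lambda>u. \<phi> (\<lambda>i\<in>I. rep (u i))"
   have uc: "u i \<in> carrier RR" if "u \<in> rel RR Y I x" "i \<in> I" for u i using that by (auto simp: rel_def)
   have rh: "rel_hom RR Y I x M ?\<phi>"
    unfolding rel_hom_def
   proof (intro conjI ballI)
    fix u w assume u: "u \<in> rel RR Y I x" and w: "w \<in> rel RR Y I x"
    have uw: "(\<lambda>i\<in>I. u i \<oplus>\<^bsub>RR\<^esub> w i) \<in> rel RR Y I x" using Y.rel_add[OF I(2) u w] .
    have "?\<phi> (\<lambda>i\<in>I. u i \<oplus>\<^bsub>RR\<^esub> w i) = \<phi> (\<lambda>i\<in>I. (\<lambda>i\<in>I. rep (u i)) i \<oplus> (\<lambda>i\<in>I. rep (w i)) i)"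
    proof (rule dep[OF relR[OF uw] Yp.rel_add[OF xp relR[OF u] relR[OF w]]])
     fix i assume i: "i \<in> I"
     show "cos F ((\<lambda>i\<in>I. rep ((\<lambda>i\<in>I. u i \<oplus>\<^bsub>RR\<^esub> w i) i)) i)
      = cos F ((\<lambda>i\<in>I. (\<lambda>i\<in>I. rep (u i)) i \<oplus> (\<lambda>i\<in>I. rep (w i)) i) i)"
      using i rep[OF uc[OF u i]] rep[OF uc[OF w i]] rep[OF uc[OF uw i]] by (simp add: cosF)
    qed
    thus "?\<phi> (\<lambda>i\<in>I. u i \<oplus>\<^bsub>RR\<^esub> w i) = ?\<phi> u \<oplus>\<^bsub>M\<^esub> ?\<phi> w" using \<phi>a[OF relR[OF u] relR[OF w]] by simp
   next
    fix r u assume r: "r \<in> carrier RR" and u: "u \<in> rel RR Y I x"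
    have ru: "(\<lambda>i\<in>I. r \<otimes>\<^bsub>RR\<^esub> u i) \<in> rel RR Y I x" using Y.rel_smult[OF I u r] .
    have "?\<phi> (\<lambda>i\<in>I. r \<otimes>\<^bsub>RR\<^esub> u i) = \<phi> (\<lambda>i\<in>I. rep r \<otimes> (\<lambda>i\<in>I. rep (u i)) i)"
    proof (rule dep[OF relR[OF ru] Yp.rel_smult[OF I(1) xp relR[OF u]]])
     fix i assume i: "i \<in> I"
     show "cos F ((\<lambda>i\<in>I. rep ((\<lambda>i\<in>I. r \<otimes>\<^bsub>RR\<^esub> u i) i)) i) = cos F ((\<lambda>i\<in>I. rep r \<otimes> (\<lambda>i\<in>I. rep (u i)) i) i)"
      using i rep[OF uc[OF u i]] rep[OF r] rep[OF uc[OF ru i]] by (simp add: cosF)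
    qed (use rep[OF r] in simp)
    thus "?\<phi> (\<lambda>i\<in>I. r \<otimes>\<^bsub>RR\<^esub> u i) = r \<odot>\<^bsub>M\<^esub> ?\<phi> u" using \<phi>s[OF relR[OF u], of "rep r"] rep[OF r] by simp
   qed (use relR \<phi>c in auto)
   have zR: "?\<phi> (unit_vec RR I \<zero>\<^bsub>RR\<^esub> i) = \<zero>\<^bsub>M\<^esub>" if "i \<in> I" for i
   proof -
    have u: "unit_vec RR I \<zero>\<^bsub>RR\<^esub> i \<in> rel RR Y I x"
     using I that Y.smult_l_null[OF funcset_mem[OF I(2) that]] by (intro Y.unit_vec_rel) auto
    have e: "(\<lambda>j\<in>I. \<zero>\<^bsub>RR\<^esub> \<otimes>\<^bsub>RR\<^esub> unit_vec RR I \<zero>\<^bsub>RR\<^esub> i j) = unit_vec RR I \<zero>\<^bsub>RR\<^esub> i"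
     unfolding unit_vec_def by (intro restrict_ext) simp
    have "\<forall>r\<in>carrier RR. \<forall>v\<in>rel RR Y I x. ?\<phi> (\<lambda>i\<in>I. r \<otimes>\<^bsub>RR\<^esub> v i) = r \<odot>\<^bsub>M\<^esub> ?\<phi> v"
     using rh unfolding rel_hom_def by (elim conjE)
    from bspec[OF bspec[OF this Y.R.zero_closed] u]
    have "?\<phi> (unit_vec RR I \<zero>\<^bsub>RR\<^esub> i) = \<zero>\<^bsub>RR\<^esub> \<odot>\<^bsub>M\<^esub> ?\<phi> (unit_vec RR I \<zero>\<^bsub>RR\<^esub> i)"
     unfolding e .
    thus ?thesis using \<phi>c[OF relR[OF u]] by simp
   qed
   obtain c where c: "c \<in> I \<rightarrow> carrier M" "\<And>u. u \<in> rel RR Y I x ==> ?\<phi> u = lin M I c u"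
    using ext_vanishD[OF E rh zR] by blast
   have "\<phi> v = lin (PS M) I c v" if v: "v \<in> rel S (PS Y) I x" for v
   proof -
    have vc: "v \<in> I \<rightarrow> carrier S" using v by (auto simp: rel_def)
    have "\<phi> v = ?\<phi> (\<lambda>i\<in>I. cos F (v i))"
     using rep vc by (intro dep[OF v relR[OF relS[OF v]]]) (auto simp: Pi_iff)
    also have "\<dots> = lin M I c (\<lambda>i. cos F (v i))"
     unfolding c(2)[OF relS[OF v]] using c(1) vc by (intro M.lin_restrict) (auto simp: Pi_iff)
    finally show ?thesis using lin_pull[OF M I(1) c(1) vc] by simp
   qed
   thus "\<exists>c\<in>I \<rightarrow> carrier (PS M). \<forall>v\<in>rel S (PS Y) I x. \<phi> v = lin (PS M) I c v"
    using c(1) by auto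
  qed
 next
  assume E: "ext_vanish S F (PS Y) I x (PS M)"
  show "ext_vanish RR \<zero>\<^bsub>RR\<^esub> Y I x M" unfolding ext_vanish_def
  proof (intro allI impI)
   fix \<phi> assume \<phi>: "rel_hom RR Y I x M \<phi>" and z: "\<forall>i\<in>I. \<phi> (unit_vec RR I \<zero>\<^bsub>RR\<^esub> i) = \<zero>\<^bsub>M\<^esub>"
   let ?\<phi> = "\<lambda>v. \<phi> (\<lambda>i\<in>I. cos F (v i))"
   have vc: "v i \<in> carrier S" if "v \<in> rel S (PS Y) I x" "i \<in> I" for v i using that by (auto simp: rel_def)
   have \<phi>a: "\<phi> (\<lambda>i\<in>I. u i \<oplus>\<^bsub>RR\<^esub> w i) = \<phi> u \<oplus>\<^bsub>M\<^esub> \<phi> w"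
    if "u \<in> rel RR Y I x" "w \<in> rel RR Y I x" for u w using \<phi> that by (auto simp: rel_hom_def)
   have \<phi>s: "\<phi> (\<lambda>i\<in>I. r \<otimes>\<^bsub>RR\<^esub> u i) = r \<odot>\<^bsub>M\<^esub> \<phi> u"
    if "r \<in> carrier RR" "u \<in> rel RR Y I x" for u r using \<phi> that by (auto simp: rel_hom_def)
   have rh: "rel_hom S (PS Y) I x (PS M) ?\<phi>" unfolding rel_hom_def
   proof (intro conjI ballI)
    fix v w assume v: "v \<in> rel S (PS Y) I x" and w: "w \<in> rel S (PS Y) I x"
    have e: "(\<lambda>i\<in>I. cos F ((\<lambda>i\<in>I. v i \<oplus> w i) i)) = (\<lambda>i\<in>I. (\<lambda>i\<in>I. cos F (v i)) i \<oplus>\<^bsub>RR\<^esub> (\<lambda>i\<in>I. cos F (w i)) i)"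
     using vc[OF v] vc[OF w] by (intro restrict_ext) (simp add: cosF)
    show "?\<phi> (\<lambda>i\<in>I. v i \<oplus> w i) = ?\<phi> v \<oplus>\<^bsub>PS M\<^esub> ?\<phi> w"
     unfolding e pull_simps by (rule \<phi>a[OF relS[OF v] relS[OF w]])
   next
    fix r v assume r: "r \<in> carrier S" and v: "v \<in> rel S (PS Y) I x"
    have e: "(\<lambda>i\<in>I. cos F ((\<lambda>i\<in>I. r \<otimes> v i) i)) = (\<lambda>i\<in>I. cos F r \<otimes>\<^bsub>RR\<^esub> (\<lambda>i\<in>I. cos F (v i)) i)"
     using vc[OF v] r by (intro restrict_ext) (simp add: cosF)
    show "?\<phi> (\<lambda>i\<in>I. r \<otimes> v i) = r \<odot>\<^bsub>PS M\<^esub> ?\<phi> v"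
     unfolding e pull_simps by (rule \<phi>s[OF cosF_closed[OF r] relS[OF v]])
   qed (use \<phi> relS in \<open>auto simp: rel_hom_def\<close>)
   have zS: "?\<phi> (unit_vec S I F i) = \<zero>\<^bsub>PS M\<^esub>" if "i \<in> I" for i
   proof -
    have "(\<lambda>j\<in>I. cos F (unit_vec S I F i j)) = unit_vec RR I \<zero>\<^bsub>RR\<^esub> i"
     unfolding unit_vec_def by (intro restrict_ext) (auto simp: cosF_F cosF)
    thus ?thesis using z that by simp
   qed
   obtain c where c: "c \<in> I \<rightarrow> carrier (PS M)"
    "\<And>v. v \<in> rel S (PS Y) I x ==> ?\<phi> v = lin (PS M) I c v"
    using ext_vanishD[OF E rh zS] by blast
   have cM: "c \<in> I \<rightarrow> carrier M" using c(1) by simp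
   have "\<phi> u = lin M I c u" if u: "u \<in> rel RR Y I x" for u
   proof -
    have uc: "u \<in> I \<rightarrow> carrier RR" "u \<in> extensional I" using u by (auto simp: rel_def PiE_def)
    have rc: "(\<lambda>i. rep (u i)) \<in> I \<rightarrow> carrier S" using uc rep by auto
    have "(\<lambda>i\<in>I. cos F ((\<lambda>i\<in>I. rep (u i)) i)) = u"
     using uc rep by (auto simp: extensional_def fun_eq_iff Pi_iff)
    hence "\<phi> u = lin (PS M) I c (\<lambda>i\<in>I. rep (u i))" using c(2)[OF relR[OF u]] by simp
    also have "\<dots> = lin (PS M) I c (\<lambda>i. rep (u i))" by (rule Mp.lin_restrict[OF c(1) rc])
    also have "\<dots> = lin M I c (\<lambda>i. cos F (rep (u i)))" by (rule lin_pull[OF M I(1) cM rc])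
    also have "\<dots> = lin M I c u" using cM uc rep by (intro M.lin_cong) (auto simp: Pi_iff)
    finally show ?thesis .
   qed
   thus "\<exists>c\<in>I \<rightarrow> carrier M. \<forall>v\<in>rel RR Y I x. \<phi> v = lin M I c v" using cM by blast
  qed
 qed
qed

theorem Ext1_zero_iff_pull:
 assumes Y: "module RR Y" and M: "module RR M" and g: "gens S (PS Y) I x"
 shows "zero_module (Ext1 RR Y M) \<longleftrightarrow> ext_vanish S F (PS Y) I x (PS M)"
proof -
 have g': "gens RR Y I x" using gens_pull[OF Y] g by blast
 hence I: "finite I" "x \<in> I \<rightarrow> carrier Y" by (auto simp: gens_def)
 show ?thesis using Ext1_zero_iff_ext_vanish[OF Y M g'] ext_vanish_pull[OF Y M I] by simp
qed

end

section \<open>Summands, sums and the annihilator condition\<close>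

lemma mhom_inv_into:
 assumes A: "module R A" and h: "mhom R A B h" "bij_betw h (carrier A) (carrier B)"
 shows "mhom R B A (inv_into (carrier A) h)"
proof -
 interpret A: rmod R A using A by (rule rmod.intro)
 let ?k = "inv_into (carrier A) h"
 have k: "h (?k b) = b" "?k b \<in> carrier A" if "b \<in> carrier B" for b
  using that h(2) bij_betwE[OF bij_betw_inv_into[OF h(2)]] by (auto simp: bij_betw_def f_inv_into_f)
 have inv: "?k (h a) = a" if "a \<in> carrier A" for a using that h(2) by (simp add: bij_betw_def inv_into_f_f)
 show ?thesis unfolding mhom_def
 proof (intro conjI ballI)
  show "?k \<in> carrier B \<rightarrow> carrier A" using k by blast
  show "?k (x \<oplus>\<^bsub>B\<^esub> y) = ?k x \<oplus>\<^bsub>A\<^esub> ?k y" if "x \<in> carrier B" "y \<in> carrier B" for x y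
   using inv[of "?k x \<oplus>\<^bsub>A\<^esub> ?k y"] mhomD(2)[OF h(1), of "?k x" "?k y"] k[OF that(1)] k[OF that(2)] by simp
  show "?k (r \<odot>\<^bsub>B\<^esub> x) = r \<odot>\<^bsub>A\<^esub> ?k x" if "r \<in> carrier R" "x \<in> carrier B" for r x
   using inv[of "r \<odot>\<^bsub>A\<^esub> ?k x"] mhomD(3)[OF h(1) that(1), of "?k x"] k[OF that(2)] that(1) by simp
 qed
qed

text \<open>Both components of a decomposition are unique, so the projections are homomorphisms.\<close>
lemma (in rmod) direct_sum_projections:
 assumes D: "internal_direct_sum R M A B"
 obtains p q where "mhom R M (M\<lparr>carrier := A\<rparr>) p" "mhom R M (M\<lparr>carrier := B\<rparr>) q"
  "\<And>u. u \<in> carrier M ==> u = p u \<oplus>\<^bsub>M\<^esub> q u"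
  "\<And>a. a \<in> A ==> p a = a" "\<And>b. b \<in> B ==> p b = \<zero>\<^bsub>M\<^esub>" "\<And>b. b \<in> B ==> q b = b"
proof -
 have AB: "submodule A R M" "submodule B R M" "A <+>\<^bsub>M\<^esub> B = carrier M" "A \<inter> B = {\<zero>\<^bsub>M\<^esub>}"
  using D by (auto simp: internal_direct_sum_def)
 note AE = submoduleE[OF AB(1)] and BE = submoduleE[OF AB(2)]
 have uniq: "a = a' \<and> b = b'" if "a \<in> A" "a' \<in> A" "b \<in> B" "b' \<in> B" "a \<oplus>\<^bsub>M\<^esub> b = a' \<oplus>\<^bsub>M\<^esub> b'" for a a' b b'
 proof -
  have c: "a \<in> carrier M" "a' \<in> carrier M" "b \<in> carrier M" "b' \<in> carrier M" using that AE BE by auto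
  have gen: "(p \<oplus>\<^bsub>M\<^esub> q) \<ominus>\<^bsub>M\<^esub> (p' \<oplus>\<^bsub>M\<^esub> q') = (p \<ominus>\<^bsub>M\<^esub> p') \<oplus>\<^bsub>M\<^esub> (q \<ominus>\<^bsub>M\<^esub> q')"
   if "p \<in> carrier M" "q \<in> carrier M" "p' \<in> carrier M" "q' \<in> carrier M" for p q p' q'
   using that by (simp add: M.minus_eq M.minus_add M.a_ac)
  have "a \<ominus>\<^bsub>M\<^esub> a' = (a \<oplus>\<^bsub>M\<^esub> b) \<ominus>\<^bsub>M\<^esub> (a' \<oplus>\<^bsub>M\<^esub> b)" using c gen[of a b a' b] by (simp add: M.minus_eq M.r_neg)
  also have "\<dots> = (a' \<oplus>\<^bsub>M\<^esub> b') \<ominus>\<^bsub>M\<^esub> (a' \<oplus>\<^bsub>M\<^esub> b)" using that by simp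
  also have "\<dots> = b' \<ominus>\<^bsub>M\<^esub> b" using c gen[of a' b' a' b] by (simp add: M.minus_eq M.r_neg)
  finally have e: "a \<ominus>\<^bsub>M\<^esub> a' = b' \<ominus>\<^bsub>M\<^esub> b" .
  have "a \<ominus>\<^bsub>M\<^esub> a' \<in> A" "b' \<ominus>\<^bsub>M\<^esub> b \<in> B" using that AE BE by (auto simp: M.minus_eq)
  hence "a \<ominus>\<^bsub>M\<^esub> a' = \<zero>\<^bsub>M\<^esub>" "b' \<ominus>\<^bsub>M\<^esub> b = \<zero>\<^bsub>M\<^esub>" using e AB(4) by auto
  thus ?thesis using c by (simp add: diff_zero_iff)
 qed
 have "\<forall>u\<in>carrier M. \<exists>ab. fst ab \<in> A \<and> snd ab \<in> B \<and> u = fst ab \<oplus>\<^bsub>M\<^esub> snd ab"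
  unfolding AB(3)[symmetric] set_add_def' by force
 then obtain ab where ab: "\<And>u. u \<in> carrier M ==> fst (ab u) \<in> A \<and> snd (ab u) \<in> B \<and> u = fst (ab u) \<oplus>\<^bsub>M\<^esub> snd (ab u)"
  by metis
 define p q where "p u = fst (ab u)" and "q u = snd (ab u)" for u
 have pq: "p u \<in> A" "q u \<in> B" "u = p u \<oplus>\<^bsub>M\<^esub> q u" if "u \<in> carrier M" for u
  using ab[OF that] by (auto simp: p_def q_def)
 have eqI: "p u = a \<and> q u = b" if "a \<in> A" "b \<in> B" "u = a \<oplus>\<^bsub>M\<^esub> b" for u a b
 proof -
  have "u \<in> carrier M" using that AE BE by auto
  thus ?thesis using uniq[OF pq(1) that(1) pq(2) that(2)] pq(3) that(3) by metis
 qed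
 have z: "\<zero>\<^bsub>M\<^esub> \<in> A" "\<zero>\<^bsub>M\<^esub> \<in> B" using AB(4) by auto
 have add: "p (u \<oplus>\<^bsub>M\<^esub> v) = p u \<oplus>\<^bsub>M\<^esub> p v \<and> q (u \<oplus>\<^bsub>M\<^esub> v) = q u \<oplus>\<^bsub>M\<^esub> q v" if u: "u \<in> carrier M" and v: "v \<in> carrier M" for u v
 proof (rule eqI[OF AE(5)[OF pq(1)[OF u] pq(1)[OF v]] BE(5)[OF pq(2)[OF u] pq(2)[OF v]]])
  have c: "p u \<in> carrier M" "p v \<in> carrier M" "q u \<in> carrier M" "q v \<in> carrier M"
   using pq(1)[OF u] pq(1)[OF v] pq(2)[OF u] pq(2)[OF v] AE(1) BE(1) by blast+
  have "u \<oplus>\<^bsub>M\<^esub> v = (p u \<oplus>\<^bsub>M\<^esub> q u) \<oplus>\<^bsub>M\<^esub> (p v \<oplus>\<^bsub>M\<^esub> q v)" using pq(3)[OF u] pq(3)[OF v] by simp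
  also have "\<dots> = (p u \<oplus>\<^bsub>M\<^esub> p v) \<oplus>\<^bsub>M\<^esub> (q u \<oplus>\<^bsub>M\<^esub> q v)" using c by (simp add: M.a_ac)
  finally show "u \<oplus>\<^bsub>M\<^esub> v = (p u \<oplus>\<^bsub>M\<^esub> p v) \<oplus>\<^bsub>M\<^esub> (q u \<oplus>\<^bsub>M\<^esub> q v)" .
 qed
 have sm: "p (r \<odot>\<^bsub>M\<^esub> u) = r \<odot>\<^bsub>M\<^esub> p u \<and> q (r \<odot>\<^bsub>M\<^esub> u) = r \<odot>\<^bsub>M\<^esub> q u" if r: "r \<in> carrier R" and u: "u \<in> carrier M" for r u
 proof (rule eqI[OF AE(4)[OF r pq(1)[OF u]] BE(4)[OF r pq(2)[OF u]]])
  have c: "p u \<in> carrier M" "q u \<in> carrier M" using pq(1)[OF u] pq(2)[OF u] AE(1) BE(1) by blast+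
  have "r \<odot>\<^bsub>M\<^esub> u = r \<odot>\<^bsub>M\<^esub> (p u \<oplus>\<^bsub>M\<^esub> q u)" using pq(3)[OF u] by simp
  thus "r \<odot>\<^bsub>M\<^esub> u = r \<odot>\<^bsub>M\<^esub> p u \<oplus>\<^bsub>M\<^esub> r \<odot>\<^bsub>M\<^esub> q u" using c r by (simp add: smult_r_distr)
 qed
 show ?thesis
 proof (rule that[of p q])
  show "mhom R M (M\<lparr>carrier := A\<rparr>) p" "mhom R M (M\<lparr>carrier := B\<rparr>) q"
   unfolding mhom_def using pq(1,2) add sm by auto
  show "p a = a" if "a \<in> A" for a using eqI[OF that z(2), of a] that AE(1) by auto
  show "p b = \<zero>\<^bsub>M\<^esub>" "q b = b" if "b \<in> B" for b using eqI[OF z(1) that, of b] that BE(1) by auto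
 qed (rule pq(3))
qed

context branches
begin

text \<open>The properties of \<open>T\<close> that its sums and summands inherit. The element \<open>t\<close> is fixed so that the sum
 of modules with a regular element has one, too.\<close>
definition good :: "'a => nat => ('a, 'x) module => bool" where
 "good t n M \<longleftrightarrow> module S M \<and> fin_gen S M \<and> annc n M \<and>
   (\<forall>y\<in>carrier M. t \<odot>\<^bsub>M\<^esub> y = \<zero>\<^bsub>M\<^esub> --> y = \<zero>\<^bsub>M\<^esub>)"

lemma good_iso:
 fixes M :: "('a, 'x) module" and M' :: "('a, 'y) module"
 assumes G: "good t n M" and n: "n \<le> N" and t: "t \<in> carrier S" and M': "module S M'"
  and h: "mhom S M M' h" "bij_betw h (carrier M) (carrier M')"
 shows "good t n M'"
proof -
 have M: "module S M" using G by (simp add: good_def)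
 interpret M: rmod S M using M by (rule rmod.intro)
 interpret M': rmod S M' using M' by (rule rmod.intro)
 have surj: "\<exists>x\<in>carrier M. y = h x" if "y \<in> carrier M'" for y using h(2) that by (auto simp: bij_betw_def)
 have inj: "x = \<zero>\<^bsub>M\<^esub>" if "x \<in> carrier M" "h x = \<zero>\<^bsub>M'\<^esub>" for x
  using h(2) that mhom_zero[OF M M' h(1)] by (auto simp: bij_betw_def inj_on_def)
 obtain I :: "nat set" and x where g: "gens S M I x" using G M.fin_gen_iff by (auto simp: good_def)
 have I: "finite I" "x \<in> I \<rightarrow> carrier M" using g by (auto simp: gens_def)
 have "gens S M' I (\<lambda>i. h (x i))" unfolding gens_def
 proof (intro conjI ballI)
  fix y assume "y \<in> carrier M'"
  then obtain u where u: "u \<in> carrier M" "y = h u" using surj by blast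
  obtain v where v: "v \<in> coords I" "u = lin M I x v" using M.gensD[OF g u(1)] by blast
  have "y = lin M' I (\<lambda>i. h (x i)) v" unfolding u(2) v(2) by (rule mhom_lin[OF M M' h(1) I v(1)])
  thus "\<exists>v\<in> coords I. y = lin M' I (\<lambda>i. h (x i)) v" using v(1) by blast
 qed (use I mhomD(1)[OF h(1)] in auto)
 hence "fin_gen S M'" using M'.fin_gen_iff by blast
 moreover have "annc n M'" unfolding annc_def
 proof (intro ballI impI)
  fix i y assume i: "i \<in> {1..n}" and y: "y \<in> carrier M'" "gp i n \<odot>\<^bsub>M'\<^esub> y = \<zero>\<^bsub>M'\<^esub>"
  have gi: "gp i n \<in> carrier S" "gp 0 i \<in> carrier S" using i n by auto
  obtain u where u: "u \<in> carrier M" "y = h u" using surj y by blast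
  have "gp i n \<odot>\<^bsub>M\<^esub> u = \<zero>\<^bsub>M\<^esub>" using u y gi mhomD(3)[OF h(1) gi(1) u(1)] by (intro inj) auto
  then obtain w where w: "w \<in> carrier M" "u = gp 0 i \<odot>\<^bsub>M\<^esub> w" using G u i unfolding good_def annc_def by blast
  have "y = gp 0 i \<odot>\<^bsub>M'\<^esub> h w" unfolding u(2) w(2) by (rule mhomD(3)[OF h(1) gi(2) w(1)])
  thus "\<exists>z\<in>carrier M'. y = gp 0 i \<odot>\<^bsub>M'\<^esub> z" using mhomD(1)[OF h(1) w(1)] by blast
 qed
 moreover have "y = \<zero>\<^bsub>M'\<^esub>" if y: "y \<in> carrier M'" "t \<odot>\<^bsub>M'\<^esub> y = \<zero>\<^bsub>M'\<^esub>" for y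
 proof -
  obtain u where u: "u \<in> carrier M" "y = h u" using surj y by blast
  have "t \<odot>\<^bsub>M\<^esub> u = \<zero>\<^bsub>M\<^esub>" using u y t mhomD(3)[OF h(1) t u(1)] by (intro inj) auto
  hence "u = \<zero>\<^bsub>M\<^esub>" using G u by (simp add: good_def)
  thus ?thesis using u mhom_zero[OF M M' h(1)] by simp
 qed
 ultimately show ?thesis using M' unfolding good_def by blast
qed

lemma good_summand:
 fixes M :: "('a, 'x) module"
 assumes G: "good t n M" and n: "n \<le> N" and D: "internal_direct_sum S M A B"
 shows "good t n (M\<lparr>carrier := A\<rparr>)"
proof -
 have M: "module S M" using G by (simp add: good_def)
 interpret M: rmod S M using M by (rule rmod.intro)
 have A: "submodule A S M" using D by (simp add: internal_direct_sum_def)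
 note AE = M.submoduleE[OF A]
 let ?A = "M\<lparr>carrier := A\<rparr>"
 have Am: "module S ?A" by (rule submodule.submodule_is_module[OF A M])
 interpret A: rmod S ?A using Am by (rule rmod.intro)
 obtain p q where p: "mhom S M ?A p" and pA: "\<And>a. a \<in> A ==> p a = a"
  using M.direct_sum_projections[OF D] by metis
 obtain I :: "nat set" and x where g: "gens S M I x" using G M.fin_gen_iff by (auto simp: good_def)
 have I: "finite I" "x \<in> I \<rightarrow> carrier M" using g by (auto simp: gens_def)
 have "gens S ?A I (\<lambda>i. p (x i))" unfolding gens_def
 proof (intro conjI ballI)
  fix u assume u: "u \<in> carrier ?A"
  hence uA: "u \<in> A" "u \<in> carrier M" using AE by auto
  obtain v where v: "v \<in> coords I" "u = lin M I x v" using M.gensD[OF g uA(2)] by blast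
  have "p u = lin ?A I (\<lambda>i. p (x i)) v" unfolding v(2) by (rule mhom_lin[OF M Am p I v(1)])
  thus "\<exists>v\<in> coords I. u = lin ?A I (\<lambda>i. p (x i)) v" using v(1) pA[OF uA(1)] by auto
 qed (use I mhomD(1)[OF p] in auto)
 hence "fin_gen S ?A" using A.fin_gen_iff by blast
 moreover have "annc n ?A" unfolding annc_def
 proof (intro ballI impI)
  fix i y assume i: "i \<in> {1..n}" and y: "y \<in> carrier ?A" "gp i n \<odot>\<^bsub>?A\<^esub> y = \<zero>\<^bsub>?A\<^esub>"
  have gi: "gp 0 i \<in> carrier S" using i n by auto
  have yA: "y \<in> A" "y \<in> carrier M" using y AE by auto
  obtain w where w: "w \<in> carrier M" "y = gp 0 i \<odot>\<^bsub>M\<^esub> w" using G i y yA unfolding good_def annc_def by fastforce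
  have "p y = gp 0 i \<odot>\<^bsub>?A\<^esub> p w" unfolding w(2) by (rule mhomD(3)[OF p gi w(1)])
  thus "\<exists>z\<in>carrier ?A. y = gp 0 i \<odot>\<^bsub>?A\<^esub> z" using pA[OF yA(1)] mhomD(1)[OF p w(1)] by auto
 qed
 moreover have "\<forall>y\<in>carrier ?A. t \<odot>\<^bsub>?A\<^esub> y = \<zero>\<^bsub>?A\<^esub> --> y = \<zero>\<^bsub>?A\<^esub>"
  using G AE(1) unfolding good_def by auto
 ultimately show ?thesis using Am unfolding good_def by blast
qed

lemma good_direct_sum:
 fixes M :: "'i => ('a, 'x) module"
 assumes I: "finite I" and G: "\<And>i. i \<in> I ==> good t n (M i)" and n: "n \<le> N" and t: "t \<in> carrier S"
 shows "good t n (direct_sum I M)"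
proof -
 let ?D = "direct_sum I M"
 have Mi: "module S (M i)" if "i \<in> I" for i using G[OF that] by (simp add: good_def)
 have D: "module S ?D" by (rule direct_sum_module[OF is_cring Mi])
 interpret D: rmod S ?D using D by (rule rmod.intro)
 have Dc: "carrier ?D = (\<Pi>\<^sub>E i\<in>I. carrier (M i))" by (rule direct_sum_carrier_finite[OF I])
 have z: "\<zero>\<^bsub>M i\<^esub> \<in> carrier (M i)" if "i \<in> I" for i
  using Mi[OF that] by (simp add: module_def abelian_group_def abelian_monoid.zero_closed)
 have sz: "r \<odot>\<^bsub>M i\<^esub> \<zero>\<^bsub>M i\<^esub> = \<zero>\<^bsub>M i\<^esub>" if "i \<in> I" "r \<in> carrier S" for i r
  using module.smult_r_null[OF Mi[OF that(1)] that(2)] .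
 have az: "\<zero>\<^bsub>M i\<^esub> \<oplus>\<^bsub>M i\<^esub> y = y" "y \<oplus>\<^bsub>M i\<^esub> \<zero>\<^bsub>M i\<^esub> = y" if "i \<in> I" "y \<in> carrier (M i)" for i y
  using Mi[OF that(1)] that(2) by (simp_all add: module_def abelian_group_def abelian_monoid.l_zero abelian_monoid.r_zero)
 define e where "e i y = (\<lambda>j\<in>I. if j = i then y else \<zero>\<^bsub>M j\<^esub>)" for i y
 have e: "mhom S (M i) ?D (e i)" if i: "i \<in> I" for i
  unfolding mhom_def using i z sz az by (auto simp: Dc e_def fun_eq_iff)
 have fg: "\<exists>A. finite A \<and> A \<subseteq> carrier (M i) \<and> gens S (M i) A (\<lambda>a. a)" if i: "i \<in> I" for i
 proof -
  interpret Mi: rmod S "M i" using Mi[OF i] by (rule rmod.intro)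
  obtain K :: "nat set" and x where "gens S (M i) K x" using G[OF i] Mi.fin_gen_iff by (auto simp: good_def)
  hence "gens S (M i) (x ` K) (\<lambda>a. a)" by (rule Mi.gens_image)
  thus ?thesis by (intro exI[of _ "x ` K"]) (auto simp: gens_def)
 qed
 then obtain A where A: "\<And>i. i \<in> I ==> finite (A i) \<and> A i \<subseteq> carrier (M i) \<and> gens S (M i) (A i) (\<lambda>a. a)" by metis
 let ?X = "\<Union>i\<in>I. e i ` A i"
 have X: "finite ?X" "?X \<subseteq> carrier ?D" using I A mhomD(1)[OF e] by auto
 have sp: "submodule (module_span S ?D ?X) S ?D" by (rule D.span_submodule[OF X(2)])
 note spE = D.submoduleE[OF sp]
 have ein: "e i y \<in> module_span S ?D ?X" if i: "i \<in> I" and y: "y \<in> carrier (M i)" for i y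
 proof -
  obtain v where v: "v \<in> A i \<rightarrow> carrier S" "y = lin (M i) (A i) (\<lambda>a. a) v"
   using A[OF i] y unfolding gens_def by blast
  have "e i y = lin ?D (A i) (e i) v" unfolding v(2) using A[OF i] v
   by (intro mhom_lin[OF Mi[OF i] D e[OF i]]) auto
  moreover have "e i ` A i \<subseteq> module_span S ?D ?X" using i unfolding module_span_def by blast
  hence "lin ?D (A i) (e i) v \<in> module_span S ?D ?X"
   using A[OF i] v by (intro D.lin_submodule[OF sp]) auto
  ultimately show ?thesis by simp
 qed
 have "(\<lambda>i\<in>I. if i \<in> J then u i else \<zero>\<^bsub>M i\<^esub>) \<in> module_span S ?D ?X"
  if u: "u \<in> carrier ?D" and J: "finite J" "J \<subseteq> I" for u J
  using J
 proof (induction J)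
  case empty
  have "\<zero>\<^bsub>?D\<^esub> \<in> module_span S ?D ?X" using submodule.axioms(1)[OF sp] by (auto dest: subgroup.one_closed)
  thus ?case by (simp add: restrict_def)
 next
  case (insert j J)
  have uj: "u i \<in> carrier (M i)" if "i \<in> I" for i using u that by (auto simp: Dc)
  have ej: "(\<lambda>i\<in>I. if i \<in> insert j J then u i else \<zero>\<^bsub>M i\<^esub>) = e j (u j) \<oplus>\<^bsub>?D\<^esub> (\<lambda>i\<in>I. if i \<in> J then u i else \<zero>\<^bsub>M i\<^esub>)"
   using insert uj az z by (auto simp: e_def fun_eq_iff)
  have "j \<in> I" "J \<subseteq> I" using insert.prems by auto
  thus ?case unfolding ej by (intro spE(5) ein uj insert.IH)
 qed
 note span = this[OF _ I order_refl]
 have "module_span S ?D ?X = carrier ?D"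
 proof (rule antisym[OF spE(1)], rule)
  fix u assume u: "u \<in> carrier ?D"
  have "(\<lambda>i\<in>I. if i \<in> I then u i else \<zero>\<^bsub>M i\<^esub>) = u" using u by (auto simp: Dc fun_eq_iff PiE_def extensional_def)
  thus "u \<in> module_span S ?D ?X" using span[OF u] by simp
 qed
 hence "fin_gen S ?D" unfolding fin_gen_def using X by blast
 moreover have "annc n ?D" unfolding annc_def
 proof (intro ballI impI)
  fix i u assume i: "i \<in> {1..n}" and u: "u \<in> carrier ?D" "gp i n \<odot>\<^bsub>?D\<^esub> u = \<zero>\<^bsub>?D\<^esub>"
  have "\<exists>w. w \<in> carrier (M j) \<and> u j = gp 0 i \<odot>\<^bsub>M j\<^esub> w" if j: "j \<in> I" for j
  proof -
   have "gp i n \<odot>\<^bsub>M j\<^esub> u j = \<zero>\<^bsub>M j\<^esub>" using fun_cong[OF u(2), of j] j by simp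
   thus ?thesis using G[OF j] u(1) j i unfolding good_def annc_def Dc by blast
  qed
  then obtain w where w: "\<And>j. j \<in> I ==> w j \<in> carrier (M j) \<and> u j = gp 0 i \<odot>\<^bsub>M j\<^esub> w j" by metis
  have "u = gp 0 i \<odot>\<^bsub>?D\<^esub> (\<lambda>j\<in>I. w j)" using w u(1) by (auto simp: Dc fun_eq_iff PiE_def extensional_def)
  moreover have "(\<lambda>j\<in>I. w j) \<in> carrier ?D" using w by (simp add: Dc)
  ultimately show "\<exists>y\<in>carrier ?D. u = gp 0 i \<odot>\<^bsub>?D\<^esub> y" by blast
 qed
 moreover have "u = \<zero>\<^bsub>?D\<^esub>" if u: "u \<in> carrier ?D" "t \<odot>\<^bsub>?D\<^esub> u = \<zero>\<^bsub>?D\<^esub>" for u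
 proof -
  have "u j = \<zero>\<^bsub>M j\<^esub>" if j: "j \<in> I" for j
   using fun_cong[OF u(2), of j] j G[OF j] u(1) unfolding good_def by (auto simp: Dc)
  thus ?thesis using u(1) by (auto simp: Dc fun_eq_iff PiE_def extensional_def)
 qed
 ultimately show ?thesis using D unfolding good_def by blast
qed

lemma good_cyc:
 assumes i: "i \<in> {1..n}" and n: "n \<le> N" and t: "t \<in> carrier S" "\<And>j. j \<in> {1..n} ==> \<not> f j divides t"
 shows "good t n (NN i)"
proof -
 let ?g = "gp 0 i"
 have g: "?g \<in> carrier S" using i n by simp
 have M: "module S (NN i)" by (rule cyc_module[OF g])
 interpret M: rmod S "NN i" using M by (rule rmod.intro)
 note car = cyc_carrier[OF g] and cz = cos_zero[OF g]
 have zero_iff: "cos ?g s = \<zero>\<^bsub>NN i\<^esub> \<longleftrightarrow> ?g divides s" if "s \<in> carrier S" for s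
  unfolding cz using cos_eq_iff[OF g that zero_closed] that by (simp add: a_minus_def)
 have "gens S (NN i) {0::nat} (\<lambda>_. cos ?g \<one>)" unfolding gens_def
 proof (intro conjI ballI)
  fix y assume "y \<in> carrier (NN i)"
  then obtain s where s: "s \<in> carrier S" "y = cos ?g s" by (auto simp: car)
  have "lin (NN i) {0::nat} (\<lambda>_. cos ?g \<one>) (\<lambda>_. s) = y"
   using s g M.lin_insert[of "{}" "0::nat" "\<lambda>_. cos ?g \<one>" "\<lambda>_. s"] cos_smult[OF g s(1) one_closed] cos_closed[OF g] by auto
  thus "\<exists>v\<in>{0::nat} \<rightarrow> carrier S. y = lin (NN i) {0} (\<lambda>_. cos ?g \<one>) v" using s by auto
 qed (use g in auto)
 hence "fin_gen S (NN i)" using M.fin_gen_iff by blast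
 moreover have "annc n (NN i)" unfolding annc_def
 proof (intro ballI impI)
  fix k y assume k: "k \<in> {1..n}" and y: "y \<in> carrier (NN i)" "gp k n \<odot>\<^bsub>NN i\<^esub> y = \<zero>\<^bsub>NN i\<^esub>"
  have gk: "gp k n \<in> carrier S" "gp 0 k \<in> carrier S" using k n by auto
  obtain s where s: "s \<in> carrier S" "y = cos ?g s" using y by (auto simp: car)
  have "?g divides gp k n \<otimes> s" using y s gk cos_smult[OF g gk(1) s(1)] zero_iff[of "gp k n \<otimes> s"] by simp
  hence "?g divides s \<or> (k < i \<and> gp 0 k divides s)" using k i n s by (intro ann_cond_arith) auto
  thus "\<exists>z\<in>carrier (NN i). y = gp 0 k \<odot>\<^bsub>NN i\<^esub> z"
  proof
   assume "?g divides s"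
   hence "y = gp 0 k \<odot>\<^bsub>NN i\<^esub> \<zero>\<^bsub>NN i\<^esub>" using s zero_iff M.smult_r_null[OF gk(2)] by simp
   thus ?thesis using M.M.zero_closed by blast
  next
   assume "k < i \<and> gp 0 k divides s"
   then obtain r where "r \<in> carrier S" "s = gp 0 k \<otimes> r" by (auto elim: dvdE)
   thus ?thesis using s gk cos_smult[OF g gk(2)] cos_closed[OF g] by (intro bexI[of _ "cos ?g r"]) auto
  qed
 qed
 moreover have "y = \<zero>\<^bsub>NN i\<^esub>" if y: "y \<in> carrier (NN i)" "t \<odot>\<^bsub>NN i\<^esub> y = \<zero>\<^bsub>NN i\<^esub>" for y
 proof -
  obtain s where s: "s \<in> carrier S" "y = cos ?g s" using y by (auto simp: car)
  have "?g divides t \<otimes> s" using y s t cos_smult[OF g t(1) s(1)] zero_iff[of "t \<otimes> s"] by simp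
  hence "?g divides s" using i n t s by (intro coprime_cancel[of i t 0 s]) auto
  thus ?thesis using s zero_iff by simp
 qed
 ultimately show ?thesis using M unfolding good_def by blast
qed

end

section \<open>The tilting module\<close>

text \<open>If \<open>f j\<close> divided \<open>p j\<close>, then \<open>f j\<close> would generate \<open>m\<close> and \<open>S\<close> would have dimension one.\<close>
locale tilt = branches S m f p n for S :: "('a, 's) ring_scheme" (structure) and m f p n +
 assumes f_not_dvd_p: "j \<in> {1..n} ==> \<not> f j divides p j"
begin

abbreviation F where "F \<equiv> gp 0 n"

sublocale quot S "gp 0 n" by unfold_locales simp

abbreviation g where "g i \<equiv> gp 0 i"
definition Si where "Si i = coset_module S (PIdl (gp 0 i))"
definition T where "T = direct_sum {1..n} Si"

lemma g_closed: "i \<in> {1..n} ==> g i \<in> carrier S" by simp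

lemma g_dvd_F: "i \<in> {1..n} ==> g i divides F" by (intro gp_dvd_gp) auto

lemma Si_simps:
 "carrier (Si i) = carrier (NN i)" "\<zero>\<^bsub>Si i\<^esub> = \<zero>\<^bsub>NN i\<^esub>" "x \<oplus>\<^bsub>Si i\<^esub> y = x \<oplus>\<^bsub>NN i\<^esub> y"
 by (simp_all add: Si_def coset_module_def cyc_def)

lemma mem_cos: "h \<in> carrier S ==> s \<in> carrier S ==> a \<in> cos h s ==> a \<in> carrier S \<and> h divides (a \<ominus> s)"
proof -
 assume a: "h \<in> carrier S" "s \<in> carrier S" "a \<in> cos h s"
 then obtain x where x: "x \<in> PIdl h" "a = x \<oplus> s" by (auto simp: a_r_coset_def')
 have xc: "x \<in> carrier S" using ideal.Icarr[OF cgenideal_ideal[OF a(1)] x(1)] .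
 have "a \<ominus> s = x" using x xc a by (simp add: a_minus_def a_assoc r_neg)
 thus ?thesis using x xc a PIdl_iff_dvd[OF a(1)] by simp
qed

lemma self_cos: "h \<in> carrier S ==> s \<in> carrier S ==> s \<in> cos h s"
 using additive_subgroup.zero_closed[OF ideal.axioms(1)[OF cgenideal_ideal[of h]]]
 by (auto simp: a_r_coset_def' intro!: bexI[of _ \<zero>])

lemma Si_smult:
 assumes i: "i \<in> {1..n}" and s: "s \<in> carrier S" "t \<in> carrier S"
 shows "cos F s \<odot>\<^bsub>Si i\<^esub> cos (g i) t = cos (g i) (s \<otimes> t)"
proof -
 have gc: "g i \<in> carrier S" using i by simp
 have "cos (g i) (a \<otimes> b) = cos (g i) (s \<otimes> t)" if a: "a \<in> cos F s" and b: "b \<in> cos (g i) t" for a b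
 proof -
  have a': "a \<in> carrier S" "F divides (a \<ominus> s)" using mem_cos[OF F_closed s(1) a] by auto
  have b': "b \<in> carrier S" "g i divides (b \<ominus> t)" using mem_cos[OF gc s(2) b] by auto
  have "g i divides (a \<ominus> s)" using dvd_trans[OF gc g_dvd_F[OF i] a'(2)] .
  hence "g i divides (a \<otimes> (b \<ominus> t) \<oplus> (a \<ominus> s) \<otimes> t)"
   using a' b' s gc by (intro dvd_add dvd_mult dvd_mult2) auto
  moreover have "a \<otimes> (b \<ominus> t) \<oplus> (a \<ominus> s) \<otimes> t = a \<otimes> b \<ominus> s \<otimes> t" using a'(1) b'(1) s by algebra
  ultimately show ?thesis using a' b' s gc cos_eq_iff by simp
 qed
 hence "rcoset_mult S (PIdl (g i)) (cos F s) (cos (g i) t) = cos (g i) (s \<otimes> t)"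
  unfolding rcoset_mult_def using self_cos[OF F_closed s(1)] self_cos[OF gc s(2)] by blast
 thus ?thesis by (simp add: Si_def coset_module_def)
qed

lemma Si_module: assumes i: "i \<in> {1..n}" shows "module RR (Si i)"
proof -
 have gc: "g i \<in> carrier S" using i by simp
 interpret N: rmod S "NN i" using cyc_module[OF gc] by (rule rmod.intro)
 note car = cyc_carrier[OF gc]
 show ?thesis
 proof (rule moduleI[OF RR_cring])
  show "abelian_group (Si i)"
   by (rule abelian_groupI) (auto simp: Si_simps N.M.a_ac intro!: bexI[of _ "\<ominus>\<^bsub>NN i\<^esub> _"] N.M.l_neg)
 next
  fix r x assume "r \<in> carrier RR" "x \<in> carrier (Si i)"
  then obtain s t where "s \<in> carrier S" "t \<in> carrier S" "r = cos F s" "x = cos (g i) t"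
   by (auto simp: RR_carrier Si_simps car)
  thus "r \<odot>\<^bsub>Si i\<^esub> x \<in> carrier (Si i)" using Si_smult[OF i] gc by (simp add: Si_simps)
 next
  fix a b x assume "a \<in> carrier RR" "b \<in> carrier RR" "x \<in> carrier (Si i)"
  then obtain s u t where st: "s \<in> carrier S" "u \<in> carrier S" "t \<in> carrier S" "a = cos F s" "b = cos F u" "x = cos (g i) t"
   by (auto simp: RR_carrier Si_simps car)
  show "(a \<oplus>\<^bsub>RR\<^esub> b) \<odot>\<^bsub>Si i\<^esub> x = a \<odot>\<^bsub>Si i\<^esub> x \<oplus>\<^bsub>Si i\<^esub> b \<odot>\<^bsub>Si i\<^esub> x"
   using st Si_smult[OF i] gc by (simp add: Si_simps cosF(1)[symmetric] l_distr)
  show "(a \<otimes>\<^bsub>RR\<^esub> b) \<odot>\<^bsub>Si i\<^esub> x = a \<odot>\<^bsub>Si i\<^esub> (b \<odot>\<^bsub>Si i\<^esub> x)"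
   using st Si_smult[OF i] gc by (simp add: Si_simps cosF(2)[symmetric] m_assoc)
 next
  fix a x y assume "a \<in> carrier RR" "x \<in> carrier (Si i)" "y \<in> carrier (Si i)"
  then obtain s u t where st: "s \<in> carrier S" "u \<in> carrier S" "t \<in> carrier S" "a = cos F s" "x = cos (g i) u" "y = cos (g i) t"
   by (auto simp: RR_carrier Si_simps car)
  show "a \<odot>\<^bsub>Si i\<^esub> (x \<oplus>\<^bsub>Si i\<^esub> y) = a \<odot>\<^bsub>Si i\<^esub> x \<oplus>\<^bsub>Si i\<^esub> a \<odot>\<^bsub>Si i\<^esub> y"
   using st Si_smult[OF i] gc by (simp add: Si_simps r_distr)
 next
  fix x assume "x \<in> carrier (Si i)"
  then obtain t where "t \<in> carrier S" "x = cos (g i) t" by (auto simp: Si_simps car)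
  thus "\<one>\<^bsub>RR\<^esub> \<odot>\<^bsub>Si i\<^esub> x = x" using Si_smult[OF i one_closed] by (simp add: cosF(4)[symmetric])
 qed
qed

lemma T_module: "module RR T"
 unfolding T_def by (rule direct_sum_module[OF RR_cring Si_module])

lemma pull_direct_sum: "PS (direct_sum I M) = direct_sum I (\<lambda>i. PS (M i))"
 by (simp add: pull_def direct_sum_def)

lemma NN_pull_hom:
 assumes i: "i \<in> {1..n}" shows "mhom S (NN i) (PS (Si i)) (\<lambda>x. x)"
 unfolding mhom_def
proof (intro conjI ballI)
 have gc: "g i \<in> carrier S" using i by simp
 fix r x assume r: "r \<in> carrier S" and "x \<in> carrier (NN i)"
 then obtain t where "t \<in> carrier S" "x = cos (g i) t" by (auto simp: cyc_carrier[OF gc])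
 thus "r \<odot>\<^bsub>NN i\<^esub> x = r \<odot>\<^bsub>PS (Si i)\<^esub> x" using Si_smult[OF i r] r gc by simp
qed (auto simp: Si_simps)

lemma good_T:
 assumes t: "t \<in> carrier S" "\<And>j. j \<in> {1..n} ==> \<not> f j divides t" shows "good t n (PS T)"
 unfolding T_def pull_direct_sum
proof (rule good_direct_sum[OF _ _ order_refl t(1)])
 fix i assume i: "i \<in> {1..n}"
 show "good t n (PS (Si i))"
  by (rule good_iso[OF good_cyc[OF i order_refl t] order_refl t(1) pull_module[OF Si_module[OF i]] NN_pull_hom[OF i]])
    (auto simp: bij_betw_def Si_simps)
qed simp

lemma T_carrier: "carrier T = (\<Pi>\<^sub>E i\<in>{1..n}. carrier (NN i))"
 by (simp add: T_def direct_sum_carrier_finite Si_simps)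

definition vT :: "nat => nat => 'a set" where
 "vT i = (\<lambda>j\<in>{1..n}. if j = i then cos (g j) \<one> else cos (g j) \<zero>)"

lemma vT_closed: "vT i \<in> carrier T" by (auto simp: vT_def T_carrier)

lemma lin_T:
 assumes c: "c \<in> coords {1..n}"
 shows "lin (PS T) {1..n} vT c = (\<lambda>j\<in>{1..n}. cos (g j) (c j))"
proof
 fix j
 interpret T: rmod S "PS T" using pull_module[OF T_module] by (rule rmod.intro)
 have v: "vT \<in> {1..n} \<rightarrow> carrier (PS T)" using vT_closed by simp
 show "lin (PS T) {1..n} vT c j = (\<lambda>j\<in>{1..n}. cos (g j) (c j)) j"
 proof (cases "j \<in> {1..n}")
  case False
  have "lin (PS T) {1..n} vT c \<in> carrier (PS T)" by (rule T.lin_closed[OF v c])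
  thus ?thesis using False by (auto simp: T_carrier PiE_def extensional_def)
 next
  case True
  have gc: "g j \<in> carrier S" using True by simp
  have Pj: "module S (PS (Si j))" by (rule pull_module[OF Si_module[OF True]])
  interpret P: rmod S "PS (Si j)" using Pj by (rule rmod.intro)
  have "lin (PS T) {1..n} vT c j = lin (PS (Si j)) {1..n} (\<lambda>k. vT k j) c"
   unfolding T_def pull_direct_sum
   by (rule lin_direct_sum[OF is_cring pull_module[OF Si_module] _ _ c True])
     (use v in \<open>auto simp: T_def pull_direct_sum\<close>)
  also have "\<dots> = c j \<odot>\<^bsub>PS (Si j)\<^esub> vT j j \<oplus>\<^bsub>PS (Si j)\<^esub> lin (PS (Si j)) ({1..n} - {j}) (\<lambda>k. vT k j) c"
   using True c PiE_mem[OF vT_closed[unfolded T_carrier] True] by (intro P.lin_split) (auto simp: Si_simps)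
  also have "lin (PS (Si j)) ({1..n} - {j}) (\<lambda>k. vT k j) c = \<zero>\<^bsub>PS (Si j)\<^esub>"
  proof (rule P.lin_zero)
   fix i assume i: "i \<in> {1..n} - {j}"
   have "vT i j = \<zero>\<^bsub>PS (Si j)\<^esub>" using i True by (auto simp: vT_def Si_simps cos_zero[OF gc])
   thus "c i \<odot>\<^bsub>PS (Si j)\<^esub> vT i j = \<zero>\<^bsub>PS (Si j)\<^esub>" using i c P.smult_r_null[of "c i"] by (auto simp: Pi_iff)
  qed
  also have "c j \<odot>\<^bsub>PS (Si j)\<^esub> vT j j = cos (g j) (c j)"
   using True Si_smult[OF True _ one_closed, of "c j"] c by (auto simp: vT_def Pi_iff)
  finally show ?thesis using True c gc P.M.r_zero[of "cos (g j) (c j)"] by (simp add: Si_simps Pi_iff)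
 qed
qed

text \<open>The unit vectors form a diagonal basis of \<open>T\<close> in which every degree occurs once.\<close>
lemma diag_T: "diag n (PS T) {1..n} vT (\<lambda>i. i)"
 unfolding diag_def
proof (intro conjI ballI impI)
 have T: "module S (PS T)" by (rule pull_module[OF T_module])
 interpret T: rmod S "PS T" using T by (rule rmod.intro)
 show "gens S (PS T) {1..n} vT" unfolding gens_def
 proof (intro conjI ballI)
  fix u assume u: "u \<in> carrier (PS T)"
  have "\<forall>i\<in>{1..n}. \<exists>s. s \<in> carrier S \<and> u i = cos (g i) s"
  proof
   fix i assume i: "i \<in> {1..n}"
   hence "u i \<in> carrier (NN i)" using u by (auto simp: T_carrier)
   thus "\<exists>s. s \<in> carrier S \<and> u i = cos (g i) s" using cyc_carrier[OF g_closed[OF i]] by auto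
  qed
  then obtain c where c: "\<And>i. i \<in> {1..n} ==> c i \<in> carrier S \<and> u i = cos (g i) (c i)" by metis
  have "u = (\<lambda>j\<in>{1..n}. cos (g j) (c j))" using u c by (auto simp: T_carrier fun_eq_iff PiE_def extensional_def)
  thus "\<exists>v\<in> coords {1..n}. u = lin (PS T) {1..n} vT v" using c lin_T[of c] by (intro bexI[of _ c]) auto
 qed (use vT_closed in auto)
 show "g i \<odot>\<^bsub>PS T\<^esub> vT i = \<zero>\<^bsub>PS T\<^esub>" if i: "i \<in> {1..n}" for i
 proof -
  have gi: "g i \<in> carrier S" using i by simp
  let ?c = "\<lambda>j. if j = i then g i else \<zero>"
  have "g i \<odot>\<^bsub>PS T\<^esub> vT i = lin (PS T) {1..n} vT ?c"
   using i gi vT_closed by (intro T.lin_delta[symmetric]) auto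
  also have "\<dots> = (\<lambda>j\<in>{1..n}. cos (g j) (?c j))" using gi by (intro lin_T) auto
  also have "\<dots> = (\<lambda>j\<in>{1..n}. \<zero>\<^bsub>Si j\<^esub>)"
  proof (rule restrict_ext)
   fix j assume j: "j \<in> {1..n}"
   have "cos (g j) (g j) = cos (g j) \<zero>" using cos_eq_iff[OF g_closed[OF j]] g_closed[OF j] by (simp add: a_minus_def dvd_refl)
   thus "cos (g j) (?c j) = \<zero>\<^bsub>Si j\<^esub>" using cos_zero[OF g_closed[OF j]] by (auto simp: Si_simps)
  qed
  finally show ?thesis by (simp add: T_def)
 qed
 show "g i divides v i" if v: "v \<in> coords {1..n}" and z: "lin (PS T) {1..n} vT v = \<zero>\<^bsub>PS T\<^esub>" and i: "i \<in> {1..n}" for v i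
 proof -
  have "cos (g i) (v i) = \<zero>\<^bsub>Si i\<^esub>"
   using fun_cong[OF z, of i] i unfolding lin_T[OF v] by (simp add: T_def)
  hence "cos (g i) (v i) = cos (g i) \<zero>" using cos_zero[OF g_closed[OF i]] by (simp add: Si_simps)
  thus ?thesis using cos_eq_iff[OF g_closed[OF i]] v i by (auto simp: Pi_iff a_minus_def)
 qed
qed auto

text \<open>An extension problem with values in \<open>S/g\<^sub>i\<close> becomes one with values in \<open>T\<close> by putting zeros into the
 other coordinates.\<close>
lemma ext_vanish_component:
 assumes M: "module S M" and I: "finite I" "x \<in> I \<rightarrow> carrier M" and i: "i \<in> {1..n}"
  and E: "ext_vanish S F M I x (PS T)"
 shows "ext_vanish S F M I x (NN i)"
 unfolding ext_vanish_def
proof (intro allI impI)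
 fix \<phi> assume \<phi>: "rel_hom S M I x (NN i) \<phi>" and z: "\<forall>k\<in>I. \<phi> (unit_vec S I F k) = \<zero>\<^bsub>NN i\<^esub>"
 have gi: "g i \<in> carrier S" using i by simp
 have Pm: "module S (PS (Si j))" if "j \<in> {1..n}" for j by (rule pull_module[OF Si_module[OF that]])
 interpret T: rmod S "PS T" using pull_module[OF T_module] by (rule rmod.intro)
 let ?\<phi> = "\<lambda>v. (\<lambda>j\<in>{1..n}. if j = i then \<phi> v else \<zero>\<^bsub>Si j\<^esub>)"
 have \<phi>c: "\<phi> v \<in> carrier (NN i)" if "v \<in> rel S M I x" for v using \<phi> that by (auto simp: rel_hom_def)
 have zS: "\<zero>\<^bsub>Si j\<^esub> \<in> carrier (NN j)" "\<zero>\<^bsub>Si j\<^esub> \<oplus>\<^bsub>Si j\<^esub> \<zero>\<^bsub>Si j\<^esub> = \<zero>\<^bsub>Si j\<^esub>"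
  "r \<in> carrier S ==> cos F r \<odot>\<^bsub>Si j\<^esub> \<zero>\<^bsub>Si j\<^esub> = \<zero>\<^bsub>Si j\<^esub>" if j: "j \<in> {1..n}" for j r
 proof -
  interpret P: rmod RR "Si j" using Si_module[OF j] by (rule rmod.intro)
  show "\<zero>\<^bsub>Si j\<^esub> \<in> carrier (NN j)" "\<zero>\<^bsub>Si j\<^esub> \<oplus>\<^bsub>Si j\<^esub> \<zero>\<^bsub>Si j\<^esub> = \<zero>\<^bsub>Si j\<^esub>"
   "r \<in> carrier S ==> cos F r \<odot>\<^bsub>Si j\<^esub> \<zero>\<^bsub>Si j\<^esub> = \<zero>\<^bsub>Si j\<^esub>"
   using P.M.zero_closed P.M.l_zero P.smult_r_null by (auto simp: Si_simps)
 qed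
 have rh: "rel_hom S M I x (PS T) ?\<phi>" unfolding rel_hom_def
 proof (intro conjI ballI)
  fix v assume "v \<in> rel S M I x"
  thus "?\<phi> v \<in> carrier (PS T)" using \<phi>c zS(1) by (auto simp: T_carrier)
 next
  fix v w assume v: "v \<in> rel S M I x" and w: "w \<in> rel S M I x"
  have "\<phi> (\<lambda>i\<in>I. v i \<oplus> w i) = \<phi> v \<oplus>\<^bsub>NN i\<^esub> \<phi> w" using \<phi> v w by (auto simp: rel_hom_def)
  thus "?\<phi> (\<lambda>i\<in>I. v i \<oplus> w i) = ?\<phi> v \<oplus>\<^bsub>PS T\<^esub> ?\<phi> w"
   unfolding T_def pull_simps direct_sum_simps using zS(2) by (intro restrict_ext) (auto simp: Si_simps(3))
 next
  fix r v assume r: "r \<in> carrier S" and v: "v \<in> rel S M I x"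
  have "\<phi> (\<lambda>i\<in>I. r \<otimes> v i) = r \<odot>\<^bsub>NN i\<^esub> \<phi> v" using \<phi> v r by (auto simp: rel_hom_def)
  also have "\<dots> = cos F r \<odot>\<^bsub>Si i\<^esub> \<phi> v" using mhomD(3)[OF NN_pull_hom[OF i] r \<phi>c[OF v]] by simp
  finally show "?\<phi> (\<lambda>i\<in>I. r \<otimes> v i) = r \<odot>\<^bsub>PS T\<^esub> ?\<phi> v"
   unfolding T_def pull_simps direct_sum_simps using zS(3) r by (intro restrict_ext) auto
 qed
 have rz: "?\<phi> (unit_vec S I F k) = \<zero>\<^bsub>PS T\<^esub>" if "k \<in> I" for k
  unfolding T_def pull_simps direct_sum_simps using z that by (intro restrict_ext) (auto simp: Si_simps(2))
 obtain c where c: "c \<in> I \<rightarrow> carrier (PS T)" "\<And>v. v \<in> rel S M I x ==> ?\<phi> v = lin (PS T) I c v"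
  using ext_vanishD[OF E rh rz] by blast
 have ci: "(\<lambda>k. c k i) \<in> I \<rightarrow> carrier (NN i)"
 proof (rule funcsetI)
  fix k assume "k \<in> I"
  hence "c k \<in> (\<Pi>\<^sub>E i\<in>{1..n}. carrier (NN i))" using c(1) by (auto simp: T_carrier Pi_iff)
  thus "c k i \<in> carrier (NN i)" using i by (rule PiE_mem)
 qed
 have "\<phi> v = lin (NN i) I (\<lambda>k. c k i) v" if v: "v \<in> rel S M I x" for v
 proof -
  have vc: "v \<in> coords I" using v by (auto simp: rel_def)
  have "\<phi> v = ?\<phi> v i" using i by simp
  also have "\<dots> = lin (PS T) I c v i" using c(2)[OF v] by (rule fun_cong)
  also have "\<dots> = lin (PS (Si i)) I (\<lambda>k. c k i) v"
   unfolding T_def pull_direct_sum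
   by (rule lin_direct_sum[OF is_cring Pm I(1) _ vc i]) (use c(1) in \<open>auto simp: T_def pull_direct_sum\<close>)
  also have "\<dots> = lin (NN i) I (\<lambda>k. c k i) v"
   by (rule mhom_lin[OF cyc_module[OF gi] Pm[OF i] NN_pull_hom[OF i] I(1) ci vc, symmetric])
  finally show ?thesis .
 qed
 thus "\<exists>c\<in>I \<rightarrow> carrier (NN i). \<forall>v\<in>rel S M I x. \<phi> v = lin (NN i) I c v" using ci by blast
qed

lemma submodule_pull:
 assumes "module RR M" "submodule N RR M" shows "submodule N S (PS M)"
proof -
 interpret M: rmod RR M using assms(1) by (rule rmod.intro)
 interpret Pm: rmod S "PS M" using pull_module[OF assms(1)] by (rule rmod.intro)
 note N = M.submoduleE[OF assms(2)]
 have "PS (M\<lparr>carrier := N\<rparr>) = (PS M)\<lparr>carrier := N\<rparr>" by (rule pull_carrier_update)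
 moreover have "module S (PS (M\<lparr>carrier := N\<rparr>))"
  by (rule pull_module[OF submodule.submodule_is_module[OF assms(2,1)]])
 ultimately show ?thesis using N(1) by (intro Pm.module_incl_imp_submodule) auto
qed

lemma internal_direct_sum_pull:
 assumes "module RR M" "internal_direct_sum RR M A B" shows "internal_direct_sum S (PS M) A B"
 using assms submodule_pull by (auto simp: internal_direct_sum_def set_add_def set_mult_def pull_def)

text \<open>The properties of \<open>T\<close> pass to its powers, their summands and modules isomorphic to these.\<close>
lemma add_cat_good:
 fixes Y :: "('a set, 'x) module"
 assumes Y: "Y \<in> add_cat RR T" and t: "t \<in> carrier S" "\<And>j. j \<in> {1..n} ==> \<not> f j divides t"
 shows "good t n (PS Y)"
proof -
 obtain k :: nat and A B where Ym: "module RR Y" and AB: "internal_direct_sum RR (direct_sum {..<k} (\<lambda>_. T)) A B"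
  and iso: "mod_iso RR Y ((direct_sum {..<k} (\<lambda>_. T))\<lparr>carrier := A\<rparr>)"
  using Y by (auto simp: add_cat_def)
 let ?TT = "direct_sum {..<k} (\<lambda>_. T)"
 have TTm: "module RR ?TT" by (rule direct_sum_module[OF RR_cring T_module])
 have gTT: "good t n (PS ?TT)" unfolding pull_direct_sum
  by (rule good_direct_sum[OF _ good_T[OF t] order_refl t(1)]) simp
 have "internal_direct_sum S (PS ?TT) A B" by (rule internal_direct_sum_pull[OF TTm AB])
 hence gA: "good t n ((PS ?TT)\<lparr>carrier := A\<rparr>)" by (rule good_summand[OF gTT order_refl])
 obtain h where h: "h \<in> mod_hom RR Y (?TT\<lparr>carrier := A\<rparr>)" "bij_betw h (carrier Y) A"
  using iso by (auto simp: mod_iso_def)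
 have hm: "mhom RR Y (?TT\<lparr>carrier := A\<rparr>) h" using h(1) by (simp add: mod_hom_iff)
 have hS: "mhom S (PS Y) ((PS ?TT)\<lparr>carrier := A\<rparr>) h"
  using mhomD[OF hm] by (auto simp: mhom_def simp del: direct_sum_simps)
 let ?h = "inv_into (carrier (PS Y)) h"
 have "mhom S ((PS ?TT)\<lparr>carrier := A\<rparr>) (PS Y) ?h"
  by (rule mhom_inv_into[OF pull_module[OF Ym] hS]) (use h(2) in simp)
 moreover have "bij_betw ?h (carrier ((PS ?TT)\<lparr>carrier := A\<rparr>)) (carrier (PS Y))"
  using bij_betw_inv_into[OF h(2)] by simp
 ultimately show ?thesis by (intro good_iso[OF gA order_refl t(1) pull_module[OF Ym]])
qed

end

section \<open>Modules with a diagonal basis are summands\<close>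

context tilt
begin

text \<open>Put the basis element \<open>x l\<close> into the summand \<open>S/g\<^bsub>d l\<^esub>\<close> of the \<open>l\<close>-th copy of \<open>T\<close>. The module \<open>Y\<close> is
 isomorphic to the part \<open>A\<close> of the power of \<open>T\<close> supported on these coordinates, and the part \<open>B\<close>
 supported on the others is a complement.\<close>
lemma diag_add_cat:
 fixes Y :: "('a set, 'x) module"
 assumes Y: "module RR Y" and D: "diag n (PS Y) (I :: nat set) x d"
 shows "Y \<in> add_cat RR T"
proof -
 interpret Y: rmod RR Y using Y by (rule rmod.intro)
 interpret P: rmod S "PS Y" using pull_module[OF Y] by (rule rmod.intro)
 note I = diagD(2,3)[OF D]
 have xY: "x \<in> I \<rightarrow> carrier Y" using I(2) by simp
 have din: "d i \<in> {1..n}" if "i \<in> I" for i using diagD(4)[OF D] that by auto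
 obtain k where k: "I \<subseteq> {..<k}" using finite_nat_bounded[OF I(1)] by blast
 let ?TT = "direct_sum {..<k} (\<lambda>_. T)"
 have TTm: "module RR ?TT" by (rule direct_sum_module[OF RR_cring T_module])
 interpret TT: rmod RR ?TT using TTm by (rule rmod.intro)
 have TTc: "carrier ?TT = (\<Pi>\<^sub>E l\<in>{..<k}. \<Pi>\<^sub>E i\<in>{1..n}. carrier (NN i))"
  by (simp add: direct_sum_carrier_finite T_carrier)
 define Z where "Z i = cos (g i) \<zero>" for i
 have Z: "\<zero>\<^bsub>Si i\<^esub> = Z i" if "i \<in> {1..n}" for i using cos_zero[OF g_closed[OF that]] by (simp add: Z_def Si_simps)
 have TTz: "\<zero>\<^bsub>?TT\<^esub> = (\<lambda>l\<in>{..<k}. \<lambda>i\<in>{1..n}. Z i)"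
  using Z by (auto simp: T_def fun_eq_iff)
 have TTadd: "(u \<oplus>\<^bsub>?TT\<^esub> v) l i = u l i \<oplus>\<^bsub>Si i\<^esub> v l i" if "l < k" "i \<in> {1..n}" for u v l i
  using that by (simp add: T_def)
 have TTsm: "(r \<odot>\<^bsub>?TT\<^esub> u) l i = r \<odot>\<^bsub>Si i\<^esub> u l i" if "l < k" "i \<in> {1..n}" for r u l i
  using that by (simp add: T_def)
 have ZZ: "Z i \<in> carrier (Si i)" "y \<in> carrier (Si i) ==> Z i \<oplus>\<^bsub>Si i\<^esub> y = y" "y \<in> carrier (Si i) ==> y \<oplus>\<^bsub>Si i\<^esub> Z i = y"
   "r \<in> carrier RR ==> r \<odot>\<^bsub>Si i\<^esub> Z i = Z i" if i: "i \<in> {1..n}" for i y r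
 proof -
  interpret N: rmod RR "Si i" using Si_module[OF i] by (rule rmod.intro)
  show "Z i \<in> carrier (Si i)" "y \<in> carrier (Si i) ==> Z i \<oplus>\<^bsub>Si i\<^esub> y = y" "y \<in> carrier (Si i) ==> y \<oplus>\<^bsub>Si i\<^esub> Z i = y"
   "r \<in> carrier RR ==> r \<odot>\<^bsub>Si i\<^esub> Z i = Z i"
   using N.M.zero_closed N.M.l_zero N.M.r_zero N.smult_r_null by (auto simp flip: Z[OF i])
 qed
 define supp where "supp l i \<longleftrightarrow> l \<in> I \<and> i = d l" for l i
 have TTe: "u l i \<in> carrier (Si i)" if "u \<in> carrier ?TT" "l < k" "i \<in> {1..n}" for u l i
  using PiE_mem[OF PiE_mem[OF that(1)[unfolded TTc]], of l i] that by (simp add: Si_simps)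
 have TText: "u = v" if "u \<in> carrier ?TT" "v \<in> carrier ?TT" "\<And>l i. l < k ==> i \<in> {1..n} ==> u l i = v l i" for u v
 proof
  fix l show "u l = v l"
  proof (cases "l < k")
   case True
   show ?thesis
   proof
    fix i show "u l i = v l i"
     using that True unfolding TTc by (cases "i \<in> {1..n}") (auto simp: PiE_def extensional_def Pi_iff)
   qed
  qed (use that in \<open>auto simp: TTc PiE_def extensional_def\<close>)
 qed
 \<comment> \<open>the part of \<open>T\<^sup>k\<close> supported on a set of coordinates\<close>
 have sub: "submodule {u \<in> carrier ?TT. \<forall>l<k. \<forall>i\<in>{1..n}. Q l i --> u l i = Z i} RR ?TT" (is "submodule ?U RR _") for Q
 proof (rule TT.submoduleI)
  show "\<zero>\<^bsub>?TT\<^esub> \<in> ?U" using TT.M.zero_closed TTz by (simp del: direct_sum_simps)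
  show sm: "r \<odot>\<^bsub>?TT\<^esub> u \<in> ?U" if "r \<in> carrier RR" "u \<in> ?U" for r u
   using that TT.smult_closed ZZ(4) by (simp add: TTsm del: direct_sum_simps)
  show "u \<oplus>\<^bsub>?TT\<^esub> v \<in> ?U" if "u \<in> ?U" "v \<in> ?U" for u v
   using that TT.M.a_closed ZZ(1,2) by (simp add: TTadd del: direct_sum_simps)
  show "\<ominus>\<^bsub>?TT\<^esub> u \<in> ?U" if u: "u \<in> ?U" for u
  proof -
   have "(\<ominus>\<^bsub>RR\<^esub> \<one>\<^bsub>RR\<^esub>) \<odot>\<^bsub>?TT\<^esub> u = \<ominus>\<^bsub>?TT\<^esub> u"
    using TT.smult_l_minus[OF Y.R.one_closed, of u] TT.smult_one[of u] u by (simp del: direct_sum_simps)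
   thus ?thesis using sm[of "\<ominus>\<^bsub>RR\<^esub> \<one>\<^bsub>RR\<^esub>" u] u Y.R.a_inv_closed[OF Y.R.one_closed] by metis
  qed
 qed blast
 define A where "A = {u \<in> carrier ?TT. \<forall>l<k. \<forall>i\<in>{1..n}. \<not> supp l i --> u l i = Z i}"
 define B where "B = {u \<in> carrier ?TT. \<forall>l<k. \<forall>i\<in>{1..n}. supp l i --> u l i = Z i}"
 have As: "submodule A RR ?TT" and Bs: "submodule B RR ?TT" unfolding A_def B_def by (rule sub)+
 have AB: "internal_direct_sum RR ?TT A B" unfolding internal_direct_sum_def
 proof (intro conjI As Bs)
  show "A <+>\<^bsub>?TT\<^esub> B = carrier ?TT"
  proof
   show "A <+>\<^bsub>?TT\<^esub> B \<subseteq> carrier ?TT"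
    unfolding set_add_def' A_def B_def using TT.M.a_closed by (auto simp del: direct_sum_simps)
   show "carrier ?TT \<subseteq> A <+>\<^bsub>?TT\<^esub> B"
   proof
    fix u assume u: "u \<in> carrier ?TT"
    define a where "a = (\<lambda>l\<in>{..<k}. \<lambda>i\<in>{1..n}. if supp l i then u l i else Z i)"
    define b where "b = (\<lambda>l\<in>{..<k}. \<lambda>i\<in>{1..n}. if supp l i then Z i else u l i)"
    have a: "a \<in> carrier ?TT" and b: "b \<in> carrier ?TT"
     unfolding TTc a_def b_def using TTe[OF u] ZZ(1) by (auto simp: Si_simps)
    have "a \<in> A" "b \<in> B" using a b by (auto simp: A_def B_def a_def b_def)
    moreover have "u = a \<oplus>\<^bsub>?TT\<^esub> b"
    proof (rule TText[OF u TT.M.a_closed[OF a b]])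
     fix l i assume li: "l < k" "i \<in> {1..n}"
     show "u l i = (a \<oplus>\<^bsub>?TT\<^esub> b) l i" unfolding TTadd[OF li] using li TTe[OF u li] ZZ[OF li(2)]
      by (auto simp: a_def b_def)
    qed
    ultimately show "u \<in> A <+>\<^bsub>?TT\<^esub> B" unfolding set_add_def' by blast
   qed
  qed
  show "A \<inter> B = {\<zero>\<^bsub>?TT\<^esub>}"
  proof
   show "{\<zero>\<^bsub>?TT\<^esub>} \<subseteq> A \<inter> B" using As Bs submodule.axioms(1) subgroup.one_closed by fastforce
   show "A \<inter> B \<subseteq> {\<zero>\<^bsub>?TT\<^esub>}"
   proof
    fix u assume u: "u \<in> A \<inter> B"
    have "u = \<zero>\<^bsub>?TT\<^esub>"
    proof (rule TText)
     show "u l i = \<zero>\<^bsub>?TT\<^esub> l i" if "l < k" "i \<in> {1..n}" for l i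
      using u that unfolding TTz by (cases "supp l i") (auto simp: A_def B_def)
    qed (use u A_def TT.M.zero_closed in auto)
    thus "u \<in> {\<zero>\<^bsub>?TT\<^esub>}" by simp
   qed
  qed
 qed
 define emb where "emb v = (\<lambda>l\<in>{..<k}. \<lambda>i\<in>{1..n}. if supp l i then cos (g i) (v l) else Z i)" for v
 have embA: "emb v \<in> A" if v: "v \<in> coords I" for v
 proof -
  have "emb v \<in> carrier ?TT" unfolding TTc emb_def using v ZZ(1) by (auto simp: supp_def Pi_iff Si_simps)
  thus ?thesis by (auto simp: A_def emb_def)
 qed
 have ATT: "a \<in> carrier ?TT" if "a \<in> A" for a using that by (simp add: A_def)
 have emb_eq: "emb v = emb w \<longleftrightarrow> lin (PS Y) I x v = lin (PS Y) I x w"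
  if v: "v \<in> coords I" and w: "w \<in> coords I" for v w
 proof -
  have vw: "(\<lambda>i. v i \<ominus> w i) \<in> coords I" using v w by auto
  have "lin (PS Y) I x v = lin (PS Y) I x w \<longleftrightarrow> lin (PS Y) I x (\<lambda>i. v i \<ominus> w i) = \<zero>\<^bsub>PS Y\<^esub>"
   unfolding P.lin_diff[OF I v w] using P.diff_zero_iff[OF P.lin_closed[OF I(2) v] P.lin_closed[OF I(2) w]] by simp
  also have "\<dots> \<longleftrightarrow> (\<forall>l\<in>I. g (d l) divides (v l \<ominus> w l))"
  proof
   assume "lin (PS Y) I x (\<lambda>i. v i \<ominus> w i) = \<zero>\<^bsub>PS Y\<^esub>"
   thus "\<forall>l\<in>I. g (d l) divides (v l \<ominus> w l)" using diagD(6)[OF D vw] by blast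
  next
   assume a: "\<forall>l\<in>I. g (d l) divides (v l \<ominus> w l)"
   show "lin (PS Y) I x (\<lambda>i. v i \<ominus> w i) = \<zero>\<^bsub>PS Y\<^esub>"
   proof (rule P.lin_zero)
    fix l assume l: "l \<in> I"
    show "(v l \<ominus> w l) \<odot>\<^bsub>PS Y\<^esub> x l = \<zero>\<^bsub>PS Y\<^esub>"
     using dvd_kills[OF pull_module[OF Y] g_closed[OF din[OF l]] bspec[OF a l] funcset_mem[OF I(2) l] diagD(5)[OF D l]] .
   qed
  qed
  also have "\<dots> \<longleftrightarrow> (\<forall>l\<in>I. cos (g (d l)) (v l) = cos (g (d l)) (w l))"
   using cos_eq_iff[OF g_closed[OF din]] v w by (auto simp: Pi_iff)
  also have "\<dots> \<longleftrightarrow> emb v = emb w"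
  proof
   assume a: "\<forall>l\<in>I. cos (g (d l)) (v l) = cos (g (d l)) (w l)"
   show "emb v = emb w" unfolding emb_def supp_def using a by (intro restrict_ext) auto
  next
   assume e: "emb v = emb w"
   show "\<forall>l\<in>I. cos (g (d l)) (v l) = cos (g (d l)) (w l)"
   proof
    fix l assume l: "l \<in> I"
    have "emb v l (d l) = emb w l (d l)" using e by simp
    thus "cos (g (d l)) (v l) = cos (g (d l)) (w l)" using l k din[OF l] by (auto simp: emb_def supp_def)
   qed
  qed
  finally show ?thesis by blast
 qed
 have "\<forall>y\<in>carrier Y. \<exists>v. v \<in> coords I \<and> y = lin (PS Y) I x v"
  using P.gensD[OF diagD(1)[OF D]] by auto
 then obtain co where co: "\<And>y. y \<in> carrier Y ==> co y \<in> coords I \<and> y = lin (PS Y) I x (co y)" by metis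
 define h where "h = (\<lambda>y\<in>carrier Y. emb (co y))"
 have lY: "lin (PS Y) I x v \<in> carrier Y" if "v \<in> coords I" for v
  using P.lin_closed[OF I(2) that] by simp
 have h_lin: "h (lin (PS Y) I x v) = emb v" if v: "v \<in> coords I" for v
  using co[OF lY[OF v]] emb_eq[OF _ v] lY[OF v] by (auto simp: h_def)
 have hom: "h \<in> mod_hom RR Y (?TT\<lparr>carrier := A\<rparr>)"
  unfolding mod_hom_def
 proof (intro CollectI conjI ballI)
  show "h \<in> carrier Y \<rightarrow>\<^sub>E carrier (?TT\<lparr>carrier := A\<rparr>)" using embA co by (auto simp: h_def)
 next
  fix y z assume y: "y \<in> carrier Y" and z: "z \<in> carrier Y"
  note cy = co[OF y] and cz = co[OF z]
  have cyz: "(\<lambda>i. co y i \<oplus> co z i) \<in> coords I" using cy cz by auto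
  have "lin (PS Y) I x (\<lambda>i. co y i \<oplus> co z i) = y \<oplus>\<^bsub>PS Y\<^esub> z"
   using P.lin_add[OF I(2), of "co y" "co z"] cy cz by metis
  hence "h (y \<oplus>\<^bsub>Y\<^esub> z) = emb (\<lambda>i. co y i \<oplus> co z i)" using h_lin[OF cyz] by simp
  also have "\<dots> = emb (co y) \<oplus>\<^bsub>?TT\<^esub> emb (co z)"
  proof (rule TText[OF ATT[OF embA[OF cyz]] TT.M.a_closed[OF ATT[OF embA] ATT[OF embA]]])
   fix l i assume li: "l < k" "i \<in> {1..n}"
   show "emb (\<lambda>i. co y i \<oplus> co z i) l i = (emb (co y) \<oplus>\<^bsub>?TT\<^esub> emb (co z)) l i"
    unfolding TTadd[OF li]
   proof (cases "supp l i")
    case True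
    hence l: "l \<in> I" "co y l \<in> carrier S" "co z l \<in> carrier S" using cy cz by (auto simp: supp_def)
    show "emb (\<lambda>i. co y i \<oplus> co z i) l i = emb (co y) l i \<oplus>\<^bsub>Si i\<^esub> emb (co z) l i"
     using li True cos_add[OF g_closed[OF li(2)] l(2,3)] by (simp add: emb_def Si_simps)
   next
    case False
    show "emb (\<lambda>i. co y i \<oplus> co z i) l i = emb (co y) l i \<oplus>\<^bsub>Si i\<^esub> emb (co z) l i"
     using li False ZZ(2)[OF li(2) ZZ(1)[OF li(2)]] by (simp add: emb_def)
   qed
  qed (use cy cz in auto)
  finally show "h (y \<oplus>\<^bsub>Y\<^esub> z) = h y \<oplus>\<^bsub>?TT\<lparr>carrier := A\<rparr>\<^esub> h z" using y z by (simp add: h_def del: direct_sum_simps)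
 next
  fix r y assume "r \<in> carrier RR" and y: "y \<in> carrier Y"
  then obtain s where s: "s \<in> carrier S" "r = cos F s" by (auto simp: RR_carrier)
  note cy = co[OF y]
  have csy: "(\<lambda>i. s \<otimes> co y i) \<in> coords I" using cy s by auto
  have "lin (PS Y) I x (\<lambda>i. s \<otimes> co y i) = s \<odot>\<^bsub>PS Y\<^esub> y"
   using P.lin_smult[OF I, of "co y" s] cy s by metis
  hence "h (r \<odot>\<^bsub>Y\<^esub> y) = emb (\<lambda>i. s \<otimes> co y i)" using h_lin[OF csy] s by simp
  also have "\<dots> = r \<odot>\<^bsub>?TT\<^esub> emb (co y)"
  proof (rule TText[OF ATT[OF embA[OF csy]] TT.smult_closed[OF _ ATT[OF embA]]])
   fix l i assume li: "l < k" "i \<in> {1..n}"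
   show "emb (\<lambda>i. s \<otimes> co y i) l i = (r \<odot>\<^bsub>?TT\<^esub> emb (co y)) l i"
    unfolding TTsm[OF li]
   proof (cases "supp l i")
    case True
    hence l: "l \<in> I" "co y l \<in> carrier S" using cy by (auto simp: supp_def)
    show "emb (\<lambda>i. s \<otimes> co y i) l i = r \<odot>\<^bsub>Si i\<^esub> emb (co y) l i"
     using li True Si_smult[OF li(2) s(1) l(2)] s by (simp add: emb_def)
   next
    case False
    show "emb (\<lambda>i. s \<otimes> co y i) l i = r \<odot>\<^bsub>Si i\<^esub> emb (co y) l i"
     using li False ZZ(4)[OF li(2) cosF_closed[OF s(1)]] s by (simp add: emb_def)
   qed
  qed (use cy s in auto)
  finally show "h (r \<odot>\<^bsub>Y\<^esub> y) = r \<odot>\<^bsub>?TT\<lparr>carrier := A\<rparr>\<^esub> h y" using y by (simp add: h_def del: direct_sum_simps)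
 qed
 have bij: "bij_betw h (carrier Y) A" unfolding bij_betw_def
 proof
  show "inj_on h (carrier Y)"
  proof (rule inj_onI)
   fix y z assume y: "y \<in> carrier Y" and z: "z \<in> carrier Y" and "h y = h z"
   hence "emb (co y) = emb (co z)" by (simp add: h_def)
   thus "y = z" using emb_eq[of "co y" "co z"] co[OF y] co[OF z] by metis
  qed
  show "h ` carrier Y = A"
  proof
   show "h ` carrier Y \<subseteq> A" using embA co by (auto simp: h_def)
   show "A \<subseteq> h ` carrier Y"
   proof
    fix u assume u: "u \<in> A"
    have "\<forall>l\<in>I. \<exists>s. s \<in> carrier S \<and> u l (d l) = cos (g (d l)) s"
    proof
     fix l assume l: "l \<in> I"
     have "u l (d l) \<in> carrier (NN (d l))" using TTe[OF ATT[OF u], of l "d l"] l k din[OF l] by (auto simp: Si_simps)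
     thus "\<exists>s. s \<in> carrier S \<and> u l (d l) = cos (g (d l)) s" using cyc_carrier[OF g_closed[OF din[OF l]]] by auto
    qed
    then obtain v where v: "\<And>l. l \<in> I ==> v l \<in> carrier S \<and> u l (d l) = cos (g (d l)) (v l)" by metis
    have vI: "v \<in> coords I" using v by auto
    have "emb v = u"
    proof (rule TText[OF ATT[OF embA[OF vI]] ATT[OF u]])
     fix l i assume li: "l < k" "i \<in> {1..n}"
     show "emb v l i = u l i" using li u v by (auto simp: emb_def A_def supp_def)
    qed
    hence "u = h (lin (PS Y) I x v)" using h_lin[OF vI] by simp
    thus "u \<in> h ` carrier Y" using lY[OF vI] by blast
   qed
  qed
 qed
 have "mod_iso RR Y (?TT\<lparr>carrier := A\<rparr>)" unfolding mod_iso_def using hom bij by auto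
 thus ?thesis unfolding add_cat_def using Y AB by blast
qed

end

section \<open>The dimension of the quotient ring\<close>

context branches
begin

text \<open>This replaces dimension theory in the proof that the depth is at most one. Let \<open>f\<close> be the last of
 the primes. If it divides \<open>a\<close>, then \<open>M\<close> is killed by the product of the others because \<open>a\<close> is
 regular. Otherwise, modulo \<open>f\<close>, the element \<open>a\<close> is a unit times a power of the uniformizer and \<open>b\<close>
 is a multiple of the uniformizer, so a power of \<open>b\<close> is a multiple of \<open>a\<close> up to a multiple of \<open>f\<close>,
 and the induction hypothesis applies to \<open>f M\<close>.\<close>
lemma power_into_multiple:
 fixes M :: "('a, 'x) module"
 assumes "module S M" "k \<le> N" "\<And>y. y \<in> carrier M ==> gp 0 k \<odot>\<^bsub>M\<^esub> y = \<zero>\<^bsub>M\<^esub>"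
  and "\<And>y. y \<in> carrier M ==> a \<odot>\<^bsub>M\<^esub> y = \<zero>\<^bsub>M\<^esub> ==> y = \<zero>\<^bsub>M\<^esub>" and a: "a \<in> carrier S" and b: "b \<in> m"
 shows "\<exists>l::nat. \<forall>v\<in>carrier M. \<exists>w\<in>carrier M. b [^] l \<odot>\<^bsub>M\<^esub> v = a \<odot>\<^bsub>M\<^esub> w"
 using assms(1-4)
proof (induction k arbitrary: M)
 case (0 M)
 interpret M: rmod S M using 0 by (intro rmod.intro)
 have "v = \<zero>\<^bsub>M\<^esub>" if "v \<in> carrier M" for v using 0(3)[OF that] that by simp
 hence "\<forall>v\<in>carrier M. \<exists>w\<in>carrier M. b [^] (0::nat) \<odot>\<^bsub>M\<^esub> v = a \<odot>\<^bsub>M\<^esub> w"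
  using a M.smult_r_null[OF a] by (metis M.M.zero_closed M.smult_closed nat_pow_0 one_closed)
 thus ?case by blast
next
 case (Suc k M)
 interpret M: rmod S M using Suc by (intro rmod.intro)
 have kN: "Suc k \<in> {1..N}" using Suc by simp
 let ?f = "f (Suc k)" and ?p = "p (Suc k)"
 have f: "?f \<in> carrier S" "gp 0 k \<in> carrier S" "gp 0 (Suc k) = gp 0 k \<otimes> ?f" "?p \<in> carrier S"
  using kN by (auto simp: gp_Suc)
 have bS: "b \<in> carrier S" using b m_carr by blast
 have fk: "?f \<odot>\<^bsub>M\<^esub> (gp 0 k \<odot>\<^bsub>M\<^esub> v) = \<zero>\<^bsub>M\<^esub>" if v: "v \<in> carrier M" for v
  unfolding M.smult_comm[OF f(1,2) v] M.smult_assoc1[OF f(2,1) v, symmetric] f(3)[symmetric] by (rule Suc.prems(3)[OF v])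
 show ?case
 proof (cases "?f divides a")
  case True
  have g0: "gp 0 k \<odot>\<^bsub>M\<^esub> v = \<zero>\<^bsub>M\<^esub>" if v: "v \<in> carrier M" for v
   by (rule Suc.prems(4)[OF _ dvd_kills[OF Suc.prems(1) f(1) True _ fk[OF v]]]) (use f v in auto)
  show ?thesis
   by (rule Suc.IH[OF Suc.prems(1) _ g0 Suc.prems(4)]) (use Suc.prems(2) in auto)
 next
  case False
  obtain u and e :: nat where u: "u \<in> Units S" "?f divides (a \<ominus> u \<otimes> ?p [^] e)"
   using valuation[OF kN a False] by blast
  obtain r where r: "r \<in> carrier S" "a \<ominus> u \<otimes> ?p [^] e = ?f \<otimes> r" using u(2) by (rule dvdE)
  obtain c d where cd: "c \<in> carrier S" "d \<in> carrier S" "b = ?f \<otimes> c \<oplus> ?p \<otimes> d" using m_gen[OF kN b] by blast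
  have uS: "u \<in> carrier S" "inv u \<in> carrier S" "inv u \<otimes> u = \<one>" using u by auto
  have pe: "?p [^] j \<in> carrier S" "d [^] j \<in> carrier S" "b [^] j \<in> carrier S" for j :: nat using f cd bS by auto
  have bd: "?f divides (b [^] j \<ominus> ?p [^] j \<otimes> d [^] j)" for j :: nat
  proof (induction j)
   case 0 thus ?case using f by (simp add: a_minus_def r_neg dvd_zero)
  next
   case (Suc j)
   have "b \<ominus> ?p \<otimes> d = ?f \<otimes> c" unfolding cd(3) using cd f(1,4) by algebra
   hence "?f divides (b \<ominus> ?p \<otimes> d)" using f(1) cd(1) dvd_mult2 dvd_refl by metis
   hence "?f divides ((b [^] j \<ominus> ?p [^] j \<otimes> d [^] j) \<otimes> b \<oplus> (?p [^] j \<otimes> d [^] j) \<otimes> (b \<ominus> ?p \<otimes> d))"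
    using Suc f cd pe bS by (intro dvd_add dvd_mult dvd_mult2) auto
   moreover have "(b [^] j \<ominus> ?p [^] j \<otimes> d [^] j) \<otimes> b \<oplus> (?p [^] j \<otimes> d [^] j) \<otimes> (b \<ominus> ?p \<otimes> d)
     = b [^] j \<otimes> b \<ominus> (?p [^] j \<otimes> ?p) \<otimes> (d [^] j \<otimes> d)"
    using pe(1)[of j] pe(2)[of j] pe(3)[of j] bS cd(2) f(4) by algebra
   ultimately show ?case by simp
  qed
  obtain s where s: "s \<in> carrier S" "b [^] e \<ominus> ?p [^] e \<otimes> d [^] e = ?f \<otimes> s" using bd[of e] by (rule dvdE)
  define q where "q = inv u \<otimes> d [^] e"
  define s' where "s' = s \<ominus> q \<otimes> r"
  have qs: "q \<in> carrier S" "s' \<in> carrier S" using uS pe s r by (auto simp: q_def s'_def)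
  \<comment> \<open>Modulo \<open>f\<close>, \<open>a\<close> is a unit times \<open>p\<^sup>e\<close> and \<open>b\<close> is a multiple of \<open>p\<close>.\<close>
  have be: "b [^] e = q \<otimes> a \<oplus> s' \<otimes> ?f"
  proof -
   have 1: "b [^] e = ?p [^] e \<otimes> d [^] e \<oplus> ?f \<otimes> s"
    unfolding s(2)[symmetric] using pe by (simp add: a_minus_def a_lcomm r_neg)
   have "u \<otimes> ?p [^] e = a \<ominus> ?f \<otimes> r"
   proof -
    have "u \<otimes> ?p [^] e = a \<ominus> (a \<ominus> u \<otimes> ?p [^] e)" using a uS(1) pe(1)[of e] by algebra
    thus ?thesis unfolding r(2) .
   qed
   hence "inv u \<otimes> (u \<otimes> ?p [^] e) = inv u \<otimes> (a \<ominus> ?f \<otimes> r)" by simp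
   hence 2: "?p [^] e = inv u \<otimes> (a \<ominus> ?f \<otimes> r)" using uS pe by (simp flip: m_assoc)
   show ?thesis unfolding 1 s'_def q_def unfolding 2
    using uS(2) a f(1) r(1) s(1) pe(2)[of e] by algebra
  qed
  let ?K = "(\<lambda>x. ?f \<odot>\<^bsub>M\<^esub> x) ` carrier M"
  have K: "submodule ?K S M" using f by (intro M.image_smult_submodule)
  have "\<exists>l::nat. \<forall>v\<in>carrier (M\<lparr>carrier := ?K\<rparr>). \<exists>w\<in>carrier (M\<lparr>carrier := ?K\<rparr>).
    b [^] l \<odot>\<^bsub>M\<lparr>carrier := ?K\<rparr>\<^esub> v = a \<odot>\<^bsub>M\<lparr>carrier := ?K\<rparr>\<^esub> w"
  proof (rule Suc.IH[OF submodule.submodule_is_module[OF K Suc.prems(1)]])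
   show "k \<le> N" using Suc.prems by simp
   show "gp 0 k \<odot>\<^bsub>M\<lparr>carrier := ?K\<rparr>\<^esub> y = \<zero>\<^bsub>M\<lparr>carrier := ?K\<rparr>\<^esub>" if "y \<in> carrier (M\<lparr>carrier := ?K\<rparr>)" for y
    using that Suc.prems(3) f by (auto simp: M.smult_assoc1)
   show "y = \<zero>\<^bsub>M\<lparr>carrier := ?K\<rparr>\<^esub>" if "y \<in> carrier (M\<lparr>carrier := ?K\<rparr>)"
    "a \<odot>\<^bsub>M\<lparr>carrier := ?K\<rparr>\<^esub> y = \<zero>\<^bsub>M\<lparr>carrier := ?K\<rparr>\<^esub>" for y
    using that Suc.prems(4)[of y] f by auto
  qed
  then obtain l :: nat where l: "\<And>v. v \<in> carrier M ==> \<exists>w\<in>carrier M. b [^] l \<odot>\<^bsub>M\<^esub> (?f \<odot>\<^bsub>M\<^esub> v) = a \<odot>\<^bsub>M\<^esub> w"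
   using f by fastforce
  have "\<exists>w\<in>carrier M. b [^] (l + e) \<odot>\<^bsub>M\<^esub> v = a \<odot>\<^bsub>M\<^esub> w" if v: "v \<in> carrier M" for v
  proof -
   obtain w where w: "w \<in> carrier M" "b [^] l \<odot>\<^bsub>M\<^esub> (?f \<odot>\<^bsub>M\<^esub> v) = a \<odot>\<^bsub>M\<^esub> w" using l[OF v] by blast
   have bl: "b [^] l \<in> carrier S" by (rule pe)
   have "b [^] (l + e) = b [^] l \<otimes> (q \<otimes> a \<oplus> s' \<otimes> ?f)" using bS be by (simp flip: nat_pow_mult)
   also have "\<dots> = a \<otimes> (b [^] l \<otimes> q) \<oplus> s' \<otimes> (b [^] l \<otimes> ?f)" using bl qs a f(1) by algebra
   finally have "b [^] (l + e) \<odot>\<^bsub>M\<^esub> v = a \<odot>\<^bsub>M\<^esub> ((b [^] l \<otimes> q) \<odot>\<^bsub>M\<^esub> v) \<oplus>\<^bsub>M\<^esub> s' \<odot>\<^bsub>M\<^esub> (b [^] l \<odot>\<^bsub>M\<^esub> (?f \<odot>\<^bsub>M\<^esub> v))"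
    using v bl qs a f(1) by (simp add: M.smult_l_distr M.smult_assoc1)
   also have "\<dots> = a \<odot>\<^bsub>M\<^esub> ((b [^] l \<otimes> q) \<odot>\<^bsub>M\<^esub> v \<oplus>\<^bsub>M\<^esub> s' \<odot>\<^bsub>M\<^esub> w)"
    unfolding w(2) using w v bl qs a by (simp add: M.smult_r_distr M.smult_comm[of s' a w])
   finally show ?thesis using v w bl qs by (intro bexI[of _ "(b [^] l \<otimes> q) \<odot>\<^bsub>M\<^esub> v \<oplus>\<^bsub>M\<^esub> s' \<odot>\<^bsub>M\<^esub> w"]) auto
  qed
  thus ?thesis by blast
 qed
qed

end

context tilt
begin

text \<open>Prime avoidance: \<open>p\<^bsub>k+1\<^esub> g\<^sub>k\<close> is added to the element found so far if this is divisible by \<open>f\<^bsub>k+1\<^esub>\<close>.\<close>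
lemma exists_coprime: "\<exists>t\<in>m. \<forall>j\<in>{1..n}. \<not> f j divides t"
proof -
 have "\<exists>t\<in>m. \<forall>j\<in>{1..k}. \<not> f j divides t" if "k \<le> n" for k
  using that
 proof (induction k)
  case 0 thus ?case using m_zero by auto
 next
  case (Suc k)
  then obtain t where t: "t \<in> m" "\<And>j. j \<in> {1..k} ==> \<not> f j divides t" by auto
  have tS: "t \<in> carrier S" using t m_carr by blast
  have kn: "Suc k \<in> {1..n}" using Suc by simp
  show ?case
  proof (cases "f (Suc k) divides t")
   case False
   have "\<not> f j divides t" if "j \<in> {1..Suc k}" for j using that t(2)[of j] False by (cases "j = Suc k") auto
   thus ?thesis using t(1) by blast
  next
   case True
   \<comment> \<open>Divisible by the earlier primes, but not by \<open>f (Suc k)\<close>.\<close>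
   let ?y = "gp 0 k \<otimes> p (Suc k)"
   have c: "gp 0 k \<in> carrier S" "p (Suc k) \<in> carrier S" "f (Suc k) \<in> carrier S" using kn by auto
   have y: "?y \<in> m" using c p_m[OF kn] m_mult by blast
   have ny: "\<not> f (Suc k) divides ?y"
    using f_prime[OF kn c(1,2)] f_dvd_gp[OF kn, of k 0] f_not_dvd_p[OF kn] Suc.prems by auto
   have dy: "f j divides ?y" if j: "j \<in> {1..k}" for j
   proof -
    have jn: "j \<in> {1..n}" using j Suc.prems by auto
    obtain i where i: "j = Suc i" using j by (cases j) auto
    have "f j divides gp 0 j" using i jn dvd_mult[of "f j" "gp 0 i" "f j"] by (simp add: gp_Suc dvd_refl)
    moreover have "gp 0 j divides gp 0 k" using j Suc.prems by (intro gp_dvd_gp) auto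
    ultimately have "f j divides gp 0 k" using dvd_trans[OF f_closed[OF jn]] by blast
    thus ?thesis using c f_closed[OF jn] by (intro dvd_mult2)
   qed
   have e: "(t \<oplus> ?y) \<ominus> t = ?y" "(t \<oplus> ?y) \<ominus> ?y = t" using tS m_carr[OF y] by algebra+
   have "\<not> f j divides (t \<oplus> ?y)" if j: "j \<in> {1..Suc k}" for j
   proof
    assume a: "f j divides (t \<oplus> ?y)"
    have fj: "f j \<in> carrier S" using j Suc.prems by auto
    show False
    proof (cases "j = Suc k")
     case True': True
     have "f j divides ((t \<oplus> ?y) \<ominus> t)" using True True' by (intro dvd_diff[OF fj a]) simp
     thus False using ny True' e by simp
    next
     case False
     hence jk: "j \<in> {1..k}" using j by auto
     have "f j divides ((t \<oplus> ?y) \<ominus> ?y)" by (rule dvd_diff[OF fj a dy[OF jk]])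
     thus False using t(2)[OF jk] e by simp
    qed
   qed
   thus ?thesis using m_add[OF t(1) y] by blast
  qed
 qed
 thus ?thesis by blast
qed

lemma ideal_sub_m:
 assumes P: "ideal P S" "\<one> \<notin> P" shows "P \<subseteq> m"
proof
 fix x assume x: "x \<in> P"
 have xS: "x \<in> carrier S" using ideal.Icarr[OF P(1) x] .
 show "x \<in> m"
 proof (rule ccontr)
  assume "x \<notin> m"
  hence u: "x \<in> Units S" using unit_outside xS by blast
  have "inv x \<otimes> x \<in> P" by (rule ideal.I_l_closed[OF P(1) x Units_inv_closed[OF u]])
  hence "\<one> \<in> P" unfolding Units_l_inv[OF u] .
  thus False using P(2) by simp
 qed
qed

lemma F_m: "1 \<le> n ==> F \<in> m" by (intro gp_m) auto

lemma cosF_in_image: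
 assumes Q: "ideal Q S" "F \<in> Q" and r: "r \<in> carrier S"
 shows "cos F r \<in> cos F ` Q \<longleftrightarrow> r \<in> Q"
proof
 assume "cos F r \<in> cos F ` Q"
 then obtain s where s: "s \<in> Q" "cos F r = cos F s" by auto
 have sS: "s \<in> carrier S" using ideal.Icarr[OF Q(1) s(1)] .
 obtain c where c: "c \<in> carrier S" "r \<ominus> s = F \<otimes> c" using s cos_eq_iff[OF F_closed r sS] by (auto elim: dvdE)
 have "(r \<ominus> s) \<oplus> s \<in> Q" unfolding c(2)
  using ideal.I_r_closed[OF Q(1) Q(2) c(1)] s additive_subgroup.a_closed[OF ideal.axioms(1)[OF Q(1)]] by blast
 moreover have "(r \<ominus> s) \<oplus> s = r" using r sS by algebra
 ultimately show "r \<in> Q" by simp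
qed auto

lemma image_ideal: "ideal Q S ==> ideal (cos F ` Q) RR"
 by (rule ring_ideal_imp_quot_ideal[OF F_ideal])

lemma vimage_ideal:
 assumes J: "ideal J RR" shows "ideal {r \<in> carrier S. cos F r \<in> J} S"
 by (rule ring_hom_ring.ideal_vimage[OF ideal.rcos_ring_hom_ring[OF F_ideal] J])

lemma ideal_eq_image:
 assumes J: "ideal J RR" shows "J = cos F ` {r \<in> carrier S. cos F r \<in> J}"
 using ideal.Icarr[OF J] by (auto simp: RR_carrier)

lemma max_ideal_RR:
 assumes n: "1 \<le> n" shows "max_ideal RR = cos F ` m"
 unfolding max_ideal_def
proof (rule the_equality)
 have prp: "cos F \<one> \<notin> cos F ` m" using cosF_in_image[OF m_ideal F_m[OF n] one_closed] one_notin_m by simp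
 have sub: "J \<subseteq> cos F ` m" if J: "ideal J RR" "J \<noteq> carrier RR" for J
 proof -
  have "\<one> \<notin> {r \<in> carrier S. cos F r \<in> J}"
  proof
   assume "\<one> \<in> {r \<in> carrier S. cos F r \<in> J}"
   hence "\<one>\<^bsub>RR\<^esub> \<in> J" by (simp add: cosF(4))
   thus False using ideal.one_imp_carrier[OF J(1)] J(2) by simp
  qed
  hence "{r \<in> carrier S. cos F r \<in> J} \<subseteq> m" by (rule ideal_sub_m[OF vimage_ideal[OF J(1)]])
  thus ?thesis using ideal_eq_image[OF J(1)] by blast
 qed
 show "maximalideal (cos F ` m) RR"
 proof (rule maximalidealI)
  show "ideal (cos F ` m) RR" by (rule image_ideal[OF m_ideal])
  show "carrier RR \<noteq> cos F ` m" using prp cosF_closed[OF one_closed] by blast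
  fix J assume "ideal J RR" "cos F ` m \<subseteq> J" "J \<subseteq> carrier RR"
  thus "J = cos F ` m \<or> J = carrier RR" using sub by blast
 qed
 fix J assume J: "maximalideal J RR"
 have Ji: "ideal J RR" "carrier RR \<noteq> J" using J by (auto simp: maximalideal_def maximalideal_axioms_def)
 have "cos F ` m \<subseteq> carrier RR" using m_carr by auto
 hence "cos F ` m = J \<or> cos F ` m = carrier RR"
  using maximalideal.I_maximal[OF J image_ideal[OF m_ideal] sub[OF Ji(1)]] Ji by blast
 thus "J = cos F ` m" using prp cosF_closed[OF one_closed] by blast
qed

text \<open>A prime ideal which contains \<open>F\<close> contains some \<open>f i\<close>. If it contains more than the multiples of
 \<open>f i\<close>, then it contains a power of \<open>p i\<close>, hence all of \<open>m\<close>.\<close>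
lemma prime_over_F:
 assumes P: "primeideal P S" and FP: "F \<in> P"
 shows "(\<exists>i\<in>{1..n}. P = PIdl (f i)) \<or> P = m"
proof -
 interpret P: primeideal P S by fact
 have oneP: "\<one> \<notin> P" using P.one_imp_carrier P.I_notcarr by auto
 have Pm: "P \<subseteq> m" by (rule ideal_sub_m[OF P.is_ideal oneP])
 have "gp 0 k \<in> P ==> \<exists>i\<in>{1..n}. f i \<in> P" if "k \<le> n" for k
  using that
 proof (induction k)
  case 0 thus ?case using oneP by simp
 next
  case (Suc k)
  hence "gp 0 k \<in> P \<or> f (Suc k) \<in> P" using P.I_prime[of "gp 0 k" "f (Suc k)"] by (simp add: gp_Suc)
  thus ?case using Suc by auto
 qed
 then obtain i where i: "i \<in> {1..n}" "f i \<in> P" using FP by blast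
 have fi: "f i \<in> carrier S" "p i \<in> carrier S" using i by auto
 show ?thesis
 proof (cases "P \<subseteq> PIdl (f i)")
  case True
  have "PIdl (f i) \<subseteq> P" by (rule cgenideal_minimal[OF P.is_ideal i(2)])
  thus ?thesis using True i by blast
 next
  case False
  then obtain c where c: "c \<in> P" "\<not> f i divides c" using PIdl_iff_dvd[OF fi(1)] by blast
  have cS: "c \<in> carrier S" using P.Icarr[OF c(1)] .
  obtain u and e :: nat where u: "u \<in> Units S" "f i divides (c \<ominus> u \<otimes> p i [^] e)"
   using valuation[OF i(1) cS c(2)] by blast
  obtain r where r: "r \<in> carrier S" "c \<ominus> u \<otimes> p i [^] e = f i \<otimes> r" using u(2) by (rule dvdE)
  have uS: "u \<in> carrier S" "inv u \<in> carrier S" "inv u \<otimes> u = \<one>" using u by auto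
  have pe: "p i [^] j \<in> carrier S" for j :: nat using fi by auto
  have "u \<otimes> p i [^] e = c \<ominus> (c \<ominus> u \<otimes> p i [^] e)" using cS uS(1) pe[of e] by algebra
  hence "u \<otimes> p i [^] e \<in> P" using c i r P.I_r_closed[OF i(2) r(1)] by (simp add: a_minus_def)
  hence "inv u \<otimes> (u \<otimes> p i [^] e) \<in> P" using P.I_l_closed uS by blast
  hence "p i [^] e \<in> P" using uS pe by (simp flip: m_assoc)
  moreover have "p i [^] j \<in> P ==> p i \<in> P" for j :: nat
  proof (induction j)
   case (Suc j) thus ?case using P.I_prime[of "p i [^] j" "p i"] pe fi by auto
  qed (use oneP in simp)
  ultimately have pP: "p i \<in> P" by blast
  have "m \<subseteq> P"
  proof
   fix x assume "x \<in> m"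
   then obtain a b where "a \<in> carrier S" "b \<in> carrier S" "x = f i \<otimes> a \<oplus> p i \<otimes> b" using m_gen[OF i(1)] by blast
   thus "x \<in> P" using i pP P.I_r_closed P.a_closed by auto
  qed
  thus ?thesis using Pm by blast
 qed
qed

lemma image_prime:
 assumes Q: "primeideal Q S" "F \<in> Q" shows "primeideal (cos F ` Q) RR"
proof (rule primeidealI)
 interpret Q: primeideal Q S by fact
 note im = cosF_in_image[OF Q.is_ideal Q(2)]
 show "ideal (cos F ` Q) RR" by (rule image_ideal[OF Q.is_ideal])
 show "cring RR" by (rule RR_cring)
 have "\<one> \<notin> Q" using Q.one_imp_carrier Q.I_notcarr by auto
 hence "cos F \<one> \<notin> cos F ` Q" using im by simp
 thus "carrier RR \<noteq> cos F ` Q" using cosF_closed[OF one_closed] by blast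
 fix a b assume "a \<in> carrier RR" "b \<in> carrier RR" and ab: "a \<otimes>\<^bsub>RR\<^esub> b \<in> cos F ` Q"
 then obtain r s where r: "r \<in> carrier S" "a = cos F r" "s \<in> carrier S" "b = cos F s" by (auto simp: RR_carrier)
 have "r \<otimes> s \<in> Q" using ab r im[of "r \<otimes> s"] by (simp add: cosF(2)[symmetric])
 thus "a \<in> cos F ` Q \<or> b \<in> cos F ` Q" using Q.I_prime r by blast
qed

text \<open>Chains of primes in the quotient ring are chains of primes of \<open>S\<close> over \<open>F\<close>, and these are at most
 \<open>(f i) \<subset> m\<close>.\<close>
lemma krull_dim_RR:
 assumes n: "1 \<le> n" shows "krull_dim RR = 1"
proof -
 let ?C = "\<lambda>l. \<exists>P :: nat => 'a set set. (\<forall>i\<le>l. primeideal (P i) RR) \<and> (\<forall>i<l. P i \<subset> P (Suc i))"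
 have one: "1 \<in> {1..n}" using n by simp
 have f1: "f 1 \<in> carrier S" using one by simp
 have p1: "primeideal (PIdl (f 1)) S"
 proof (rule primeidealI[OF cgenideal_ideal[OF f1] is_cring])
  have "\<one> \<notin> PIdl (f 1)" using PIdl_iff_dvd[OF f1] m_not_dvd_one[OF f_m[OF one]] by simp
  thus "carrier S \<noteq> PIdl (f 1)" using one_closed by blast
  fix a b assume "a \<in> carrier S" "b \<in> carrier S" "a \<otimes> b \<in> PIdl (f 1)"
  thus "a \<in> PIdl (f 1) \<or> b \<in> PIdl (f 1)"
   unfolding PIdl_iff_dvd[OF f1] by (intro f_prime[OF one])
 qed
 have p2: "primeideal m S"
  by (rule primeidealI[OF m_ideal is_cring]) (use one_notin_m one_closed m_prime in blast)+
 have "gp 0 1 = f 1" using gp_Suc[of 0 0] n f1 by simp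
 hence "f 1 divides F" using g_dvd_F[OF one] by simp
 hence F1: "F \<in> PIdl (f 1)" using PIdl_iff_dvd[OF f1] by simp
 let ?A = "cos F ` (PIdl (f 1))" and ?B = "cos F ` m"
 have lower: "?C 1"
 proof (intro exI[of _ "\<lambda>i. if i = 0 then ?A else ?B"] conjI allI impI)
  fix i :: nat assume "i \<le> 1"
  show "primeideal (if i = 0 then ?A else ?B) RR"
   using image_prime[OF p1 F1] image_prime[OF p2 F_m[OF n]] by simp
 next
  fix i :: nat assume i: "i < 1"
  have "PIdl (f 1) \<subseteq> m" by (rule cgenideal_minimal[OF m_ideal f_m[OF one]])
  moreover have "cos F (p 1) \<in> ?B" using p_m[OF one] by blast
  moreover have "cos F (p 1) \<notin> ?A"
   using cosF_in_image[OF cgenideal_ideal[OF f1] F1, of "p 1"] f_not_dvd_p[OF one] PIdl_iff_dvd[OF f1] p_closed[OF one] by simp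
  ultimately show "(if i = 0 then ?A else ?B) \<subset> (if Suc i = 0 then ?A else ?B)"
   using i by auto
 qed
 have upper: "l \<le> 1" if l: "?C l" for l
 proof (rule ccontr)
  assume "\<not> l \<le> 1"
  obtain P :: "nat => 'a set set" where P: "\<And>i. i \<le> l ==> primeideal (P i) RR" "\<And>i. i < l ==> P i \<subset> P (Suc i)"
   using l by meson
  define Q where "Q i = {r \<in> carrier S. cos F r \<in> P i}" for i
  have PQ: "P i = cos F ` Q i" if "i \<le> l" for i
   unfolding Q_def using P(1)[OF that] by (intro ideal_eq_image) (simp add: primeideal_def)
  have Qp: "primeideal (Q i) S" if "i \<le> l" for i
   unfolding Q_def by (rule ring_hom_ring.primeideal_vimage[OF ideal.rcos_ring_hom_ring[OF F_ideal] is_cring P(1)[OF that]])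
  have FQ: "F \<in> Q i" if "i \<le> l" for i
   using additive_subgroup.zero_closed[of "P i" RR] P(1)[OF that]
   by (simp add: Q_def cosF_F primeideal_def ideal_def)
  have strict: "Q i \<subset> Q (Suc i)" if "i < l" for i
  proof
   show "Q i \<subseteq> Q (Suc i)" using P(2)[OF that] unfolding Q_def by blast
   show "Q i \<noteq> Q (Suc i)" using P(2)[OF that] PQ[of i] PQ[of "Suc i"] that by auto
  qed
  have l2: "0 \<le> l" "1 \<le> l" "2 \<le> l" "0 < l" "1 < l" using \<open>\<not> l \<le> 1\<close> by auto
  have Qm: "Q i \<subseteq> m" if "i \<le> l" for i
  proof -
   interpret Qi: primeideal "Q i" S by (rule Qp[OF that])
   show ?thesis using Qi.one_imp_carrier Qi.I_notcarr by (intro ideal_sub_m[OF Qi.is_ideal]) auto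
  qed
  have c01: "Q 0 \<subset> Q 1" "Q 1 \<subset> Q 2" using strict[of 0] strict[of 1] l2 by (auto simp: numeral_2_eq_2)
  have "Q 1 \<noteq> m" "Q 0 \<noteq> m" using c01 Qm[OF l2(3)] Qm[OF l2(2)] by auto
  obtain i where i: "i \<in> {1..n}" "Q 1 = PIdl (f i)"
   using prime_over_F[OF Qp[OF l2(2)] FQ[OF l2(2)]] \<open>Q 1 \<noteq> m\<close> by (elim disjE bexE) simp_all
  obtain j where j: "j \<in> {1..n}" "Q 0 = PIdl (f j)"
   using prime_over_F[OF Qp[OF l2(1)] FQ[OF l2(1)]] \<open>Q 0 \<noteq> m\<close> by (elim disjE bexE) simp_all
  have "f j \<in> PIdl (f i)" using c01 i j cgenideal_self[OF f_closed[OF j(1)]] by auto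
  hence "f i divides f j" using PIdl_iff_dvd[OF f_closed[OF i(1)]] by blast
  hence "i = j" using f_coprime i j by blast
  thus False using c01 i j by simp
 qed
 have "krull_dim RR = Sup {enat l | l. ?C l}" by (simp add: krull_dim_def)
 also have "\<dots> = enat 1"
 proof (rule antisym)
  show "Sup {enat l | l. ?C l} \<le> enat 1"
  proof (rule Sup_least)
   fix y assume "y \<in> {enat l | l. ?C l}"
   then obtain l where "y = enat l" "?C l" by blast
   thus "y \<le> enat 1" using upper[of l] by simp
  qed
  show "enat 1 \<le> Sup {enat l | l. ?C l}" using lower by (intro Sup_upper) blast
 qed
 finally show ?thesis by (simp add: one_enat_def)
qed

end

section \<open>Maximal Cohen-Macaulay modules and cluster tilting\<close>

context rmod
begin

lemma seq_submodule_Nil: "seq_submodule R M [] = {\<zero>\<^bsub>M\<^esub>}"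
proof -
 have "seq_submodule R M [] = module_span R M ((\<lambda>i. i) ` {})" by (simp add: seq_submodule_def)
 also have "\<dots> = {\<zero>\<^bsub>M\<^esub>}" by (subst span_eq_lin) auto
 finally show ?thesis .
qed

lemma zero_submodule: "submodule {\<zero>\<^bsub>M\<^esub>} R M"
 using span_submodule[of "{}"] seq_submodule_Nil by (simp add: seq_submodule_def)

lemma seq_submodule_single:
 assumes a: "a \<in> carrier R" shows "seq_submodule R M [a] = (\<lambda>v. a \<odot>\<^bsub>M\<^esub> v) ` carrier M"
proof -
 have "{x \<odot>\<^bsub>M\<^esub> v | x v. x \<in> set [a] \<and> v \<in> carrier M} = (\<lambda>v. a \<odot>\<^bsub>M\<^esub> v) ` carrier M" by auto
 thus ?thesis unfolding seq_submodule_def module_span_def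
  using image_smult_submodule[OF a] by auto
qed

lemma seq_submodule_sub:
 assumes "set xs \<subseteq> set ys" shows "seq_submodule R M xs \<subseteq> seq_submodule R M ys"
 unfolding seq_submodule_def module_span_def using assms by blast

lemma seq_submodule_carrier:
 assumes "set xs \<subseteq> carrier R" shows "seq_submodule R M xs \<subseteq> carrier M"
 unfolding seq_submodule_def module_span_def
 using carrier_is_submodule assms by blast

end

context tilt
begin

lemma fin_gen_pull:
 assumes M: "module RR M" shows "fin_gen S (PS M) \<longleftrightarrow> fin_gen RR M"
proof -
 interpret M: rmod RR M using M by (rule rmod.intro)
 interpret Pm: rmod S "PS M" using pull_module[OF M] by (rule rmod.intro)
 have "gens S (PS M) I = gens RR M I" for I :: "nat set" by (intro ext gens_pull[OF M])
 thus ?thesis unfolding M.fin_gen_iff Pm.fin_gen_iff by simp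
qed

text \<open>The first member of a regular sequence of length one. On the zero module every element is regular.\<close>
lemma MCM_D:
 assumes n: "1 \<le> n" and M: "M \<in> MCM RR"
 shows "\<exists>t\<in>m. \<forall>y\<in>carrier M. t \<odot>\<^bsub>PS M\<^esub> y = \<zero>\<^bsub>M\<^esub> --> y = \<zero>\<^bsub>M\<^esub>"
proof -
 have Mm: "module RR M" using M by (simp add: MCM_def)
 interpret M: rmod RR M using Mm by (rule rmod.intro)
 show ?thesis
 proof (cases "zero_module M")
  case True thus ?thesis using m_zero by (auto simp: zero_module_def)
 next
  case False
  hence d: "depth RR M = 1" using M krull_dim_RR[OF n] by (simp add: MCM_def)
  have "\<exists>xs. set xs \<subseteq> max_ideal RR \<and> regular_seq RR M xs \<and> xs \<noteq> []"
  proof (rule ccontr)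
   assume c: "\<not> ?thesis"
   have "depth RR M \<le> 0" unfolding depth_def using c by (intro Sup_least) (auto simp: zero_enat_def)
   thus False using d by simp
  qed
  then obtain a xs where xs: "set (a # xs) \<subseteq> max_ideal RR" "regular_seq RR M (a # xs)" by (auto simp: neq_Nil_conv)
  obtain t where t: "t \<in> m" "a = cos F t" using xs(1) max_ideal_RR[OF n] by auto
  have "y = \<zero>\<^bsub>M\<^esub>" if y: "y \<in> carrier M" "t \<odot>\<^bsub>PS M\<^esub> y = \<zero>\<^bsub>M\<^esub>" for y
  proof -
   have "(a # xs) ! 0 \<odot>\<^bsub>M\<^esub> y \<in> seq_submodule RR M (take 0 (a # xs))"
    using y t by (simp add: M.seq_submodule_Nil)
   hence "y \<in> seq_submodule RR M (take 0 (a # xs))"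
    using xs(2) y(1) unfolding regular_seq_def by (metis length_greater_0_conv list.distinct(1))
   thus ?thesis by (simp add: M.seq_submodule_Nil)
  qed
  thus ?thesis using t(1) by blast
 qed
qed

text \<open>A regular element in \<open>m\<close> gives depth at least one by Nakayama's lemma. If \<open>a, b\<close> began a regular
 sequence, then a power of \<open>b\<close> would map \<open>M\<close> into \<open>a M\<close> by \<open>power_into_multiple\<close>, although \<open>b\<close> is
 regular on \<open>M/a M\<close>; so \<open>M = a M\<close>, which regular sequences exclude.\<close>
lemma MCM_I:
 fixes M :: "('a set, 'x) module"
 assumes n: "1 \<le> n" and Mm: "module RR M" and fg: "fin_gen RR M" and t: "t \<in> m"
  and reg: "\<And>y. y \<in> carrier M ==> t \<odot>\<^bsub>PS M\<^esub> y = \<zero>\<^bsub>M\<^esub> ==> y = \<zero>\<^bsub>M\<^esub>"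
 shows "M \<in> MCM RR"
proof (cases "zero_module M")
 case True thus ?thesis using Mm fg by (simp add: MCM_def)
next
 case False
 interpret M: rmod RR M using Mm by (rule rmod.intro)
 have PM: "module S (PS M)" by (rule pull_module[OF Mm])
 interpret Pm: rmod S "PS M" using PM by (rule rmod.intro)
 have tS: "t \<in> carrier S" using t by (rule m_carr)
 let ?t = "cos F t"
 have tR: "?t \<in> carrier RR" using tS by simp
 have rs: "regular_seq RR M [?t]" unfolding regular_seq_def
 proof (intro conjI allI impI ballI)
  show "set [?t] \<subseteq> carrier RR" using tR by simp
  fix i v assume i: "i < length [?t]" and v: "v \<in> carrier M"
   and e: "[?t] ! i \<odot>\<^bsub>M\<^esub> v \<in> seq_submodule RR M (take i [?t])"
  thus "v \<in> seq_submodule RR M (take i [?t])" using reg[OF v] by (simp add: M.seq_submodule_Nil)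
 next
  show "seq_submodule RR M [?t] \<noteq> carrier M"
  proof
   assume "seq_submodule RR M [?t] = carrier M"
   hence sur: "carrier M = (\<lambda>v. ?t \<odot>\<^bsub>M\<^esub> v) ` carrier M" using M.seq_submodule_single[OF tR] by simp
   obtain I :: "nat set" and x where g: "gens S (PS M) I x" using fg fin_gen_pull[OF Mm] Pm.fin_gen_iff by blast
   have "{\<zero>\<^bsub>PS M\<^esub>} = carrier (PS M)"
   proof (rule nakayama_mult[OF PM _ g t])
    show "submodule {\<zero>\<^bsub>PS M\<^esub>} S (PS M)" by (rule Pm.zero_submodule)
    fix y assume y: "y \<in> carrier (PS M)"
    then obtain z where "z \<in> carrier M" "y = ?t \<odot>\<^bsub>M\<^esub> z" using sur by auto
    thus "\<exists>k\<in>{\<zero>\<^bsub>PS M\<^esub>}. \<exists>z\<in>carrier (PS M). y = k \<oplus>\<^bsub>PS M\<^esub> t \<odot>\<^bsub>PS M\<^esub> z"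
     using tR by auto
   qed
   thus False using False by (simp add: zero_module_def)
  qed
 qed
 have up: "length xs \<le> 1" if xs: "set xs \<subseteq> max_ideal RR" "regular_seq RR M xs" for xs
 proof (rule ccontr)
  assume "\<not> length xs \<le> 1"
  then obtain a b ys where e: "xs = a # b # ys" by (cases xs; cases "tl xs") auto
  have "a \<in> cos F ` m" "b \<in> cos F ` m" using xs(1) e max_ideal_RR[OF n] by auto
  then obtain a' b' where a: "a' \<in> m" "a = cos F a'" and b: "b' \<in> m" "b = cos F b'" by auto
  have c: "a' \<in> carrier S" "b' \<in> carrier S" "a \<in> carrier RR" "b \<in> carrier RR" using a b m_carr by auto
  have step: "xs ! i \<odot>\<^bsub>M\<^esub> v \<in> seq_submodule RR M (take i xs) ==> v \<in> seq_submodule RR M (take i xs)"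
   if "i < length xs" "v \<in> carrier M" for i v using xs(2) that by (simp add: regular_seq_def)
  have r0: "y = \<zero>\<^bsub>PS M\<^esub>" if y: "y \<in> carrier (PS M)" "a' \<odot>\<^bsub>PS M\<^esub> y = \<zero>\<^bsub>PS M\<^esub>" for y
   using step[of 0 y] y a e by (simp add: M.seq_submodule_Nil)
  have r1: "v \<in> (\<lambda>v. a \<odot>\<^bsub>M\<^esub> v) ` carrier M" if "v \<in> carrier M" "b \<odot>\<^bsub>M\<^esub> v \<in> (\<lambda>v. a \<odot>\<^bsub>M\<^esub> v) ` carrier M" for v
   using step[of 1 v] that e M.seq_submodule_single[OF c(3)] by simp
  have kill: "gp 0 n \<odot>\<^bsub>PS M\<^esub> y = \<zero>\<^bsub>PS M\<^esub>" if "y \<in> carrier (PS M)" for y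
   using pull_kill[OF Mm, of y] that by simp
  obtain l :: nat where l: "\<forall>v\<in>carrier (PS M). \<exists>w\<in>carrier (PS M). b' [^] l \<odot>\<^bsub>PS M\<^esub> v = a' \<odot>\<^bsub>PS M\<^esub> w"
   using power_into_multiple[OF PM order_refl kill r0 c(1) b(1)] by blast
  \<comment> \<open>Powers of \<open>b\<close> are regular on \<open>M/a M\<close>, too.\<close>
  have "b' [^] k \<odot>\<^bsub>PS M\<^esub> v \<in> (\<lambda>v. a \<odot>\<^bsub>M\<^esub> v) ` carrier M ==> v \<in> (\<lambda>v. a \<odot>\<^bsub>M\<^esub> v) ` carrier M"
   if "v \<in> carrier M" for v and k :: nat using that
  proof (induction k arbitrary: v)
   case 0
   have "b' [^] (0::nat) \<odot>\<^bsub>PS M\<^esub> v = v" using Pm.smult_one[of v] 0(2) by (simp del: pull_simps(4))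
   thus ?case using 0 by (simp del: pull_simps(4))
  next
   case (Suc k)
   have "b' [^] Suc k \<odot>\<^bsub>PS M\<^esub> v = b' [^] k \<odot>\<^bsub>PS M\<^esub> (b' \<odot>\<^bsub>PS M\<^esub> v)"
    using Pm.smult_assoc1[of "b' [^] k" b' v] Suc.prems c by (simp del: pull_simps(4))
   hence "b \<odot>\<^bsub>M\<^esub> v \<in> (\<lambda>v. a \<odot>\<^bsub>M\<^esub> v) ` carrier M"
    using Suc.IH[of "b \<odot>\<^bsub>M\<^esub> v"] Suc.prems c b by simp
   thus ?case using r1 Suc.prems by blast
  qed
  hence "carrier M \<subseteq> (\<lambda>v. a \<odot>\<^bsub>M\<^esub> v) ` carrier M" using l a by fastforce
  also have "\<dots> \<subseteq> seq_submodule RR M xs"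
   using M.seq_submodule_single[OF c(3)] M.seq_submodule_sub[of "[a]" xs] e by simp
  finally show False
   using xs(2) M.seq_submodule_carrier[of xs] unfolding regular_seq_def by blast
 qed
 have "depth RR M = enat 1" unfolding depth_def
 proof (rule antisym)
  show "Sup {enat (length xs) |xs. set xs \<subseteq> max_ideal RR \<and> regular_seq RR M xs} \<le> enat 1"
   by (rule Sup_least) (use up in auto)
  show "enat 1 \<le> Sup {enat (length xs) |xs. set xs \<subseteq> max_ideal RR \<and> regular_seq RR M xs}"
   by (rule Sup_upper) (use rs t max_ideal_RR[OF n] in \<open>auto intro!: exI[of _ "[?t]"]\<close>)
 qed
 thus ?thesis using Mm fg krull_dim_RR[OF n] by (simp add: MCM_def one_enat_def)
qed

lemma good_MCM:
 fixes M :: "('a set, 'x) module"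
 assumes "1 \<le> n" "module RR M" "good t n (PS M)" "t \<in> m" shows "M \<in> MCM RR"
 using assms fin_gen_pull[of M] by (intro MCM_I[OF _ _ _ assms(4)]) (auto simp: good_def)

lemma annc_diag:
 fixes M :: "('a set, 'x) module"
 assumes n: "1 \<le> n" and M: "M \<in> MCM RR" and ann: "annc n (PS M)"
 shows "\<exists>(I :: nat set) x d. diag n (PS M) I x d"
proof -
 have Mm: "module RR M" and fg: "fin_gen RR M" using M by (auto simp: MCM_def)
 have PM: "module S (PS M)" by (rule pull_module[OF Mm])
 interpret Pm: rmod S "PS M" using PM by (rule rmod.intro)
 obtain I :: "nat set" and x where g: "gens S (PS M) I x" using fg fin_gen_pull[OF Mm] Pm.fin_gen_iff by blast
 obtain t where t: "t \<in> m" "\<forall>y\<in>carrier M. t \<odot>\<^bsub>PS M\<^esub> y = \<zero>\<^bsub>M\<^esub> --> y = \<zero>\<^bsub>M\<^esub>" using MCM_D[OF n M] by blast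
 show ?thesis
  by (rule ann_condition_imp_diag[OF PM order_refl g t(1) _ _ ann])
    (use t(2) pull_kill[OF Mm] in auto)
qed

lemma annc_T: "annc n (PS T)"
proof -
 obtain t where t: "t \<in> m" "\<And>j. j \<in> {1..n} ==> \<not> f j divides t" using exists_coprime by blast
 show ?thesis using good_T[OF m_carr[OF t(1)] t(2)] by (simp add: good_def)
qed

lemma add_cat_MCM:
 fixes M :: "('a set, 'x) module"
 assumes n: "1 \<le> n" and M: "M \<in> add_cat RR T" shows "M \<in> MCM RR" "annc n (PS M)"
proof -
 obtain t where t: "t \<in> m" "\<And>j. j \<in> {1..n} ==> \<not> f j divides t" using exists_coprime by blast
 have G: "good t n (PS M)" using add_cat_good[OF M m_carr[OF t(1)] t(2)] .
 have Mm: "module RR M" using M by (simp add: add_cat_def)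
 show "M \<in> MCM RR" by (rule good_MCM[OF n Mm G t(1)])
 show "annc n (PS M)" using G by (simp add: good_def)
qed

lemma T_MCM: assumes n: "1 \<le> n" shows "T \<in> MCM RR"
proof -
 obtain t where t: "t \<in> m" "\<And>j. j \<in> {1..n} ==> \<not> f j divides t" using exists_coprime by blast
 show ?thesis by (rule good_MCM[OF n T_module good_T[OF m_carr[OF t(1)] t(2)] t(1)])
qed

lemma add_cat_eq_left:
 assumes n: "1 \<le> n"
 shows "(add_cat RR T :: ('a set, 'x) module set) = {M \<in> MCM RR. zero_module (Ext1 RR M T)}"
proof (intro equalityI subsetI CollectI conjI)
 fix M :: "('a set, 'x) module" assume M: "M \<in> add_cat RR T"
 show MC: "M \<in> MCM RR" by (rule add_cat_MCM(1)[OF n M])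
 have Mm: "module RR M" using MC by (simp add: MCM_def)
 obtain I :: "nat set" and x d where D: "diag n (PS M) I x d" using annc_diag[OF n MC add_cat_MCM(2)[OF n M]] by blast
 have "ext_vanish S F (PS M) I x (PS T)"
  by (rule diag_imp_ext_vanish[OF pull_module[OF Mm] order_refl D pull_module[OF T_module] annc_T])
 thus "zero_module (Ext1 RR M T)" using Ext1_zero_iff_pull[OF Mm T_module diagD(1)[OF D]] by blast
next
 fix M :: "('a set, 'x) module" assume "M \<in> {M \<in> MCM RR. zero_module (Ext1 RR M T)}"
 hence MC: "M \<in> MCM RR" and E: "zero_module (Ext1 RR M T)" by auto
 have Mm: "module RR M" and fg: "fin_gen RR M" using MC by (auto simp: MCM_def)
 have PM: "module S (PS M)" by (rule pull_module[OF Mm])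
 interpret Pm: rmod S "PS M" using PM by (rule rmod.intro)
 obtain I :: "nat set" and x where g: "gens S (PS M) I x" using fg fin_gen_pull[OF Mm] Pm.fin_gen_iff by blast
 obtain t where t: "t \<in> m" "\<forall>y\<in>carrier M. t \<odot>\<^bsub>PS M\<^esub> y = \<zero>\<^bsub>M\<^esub> --> y = \<zero>\<^bsub>M\<^esub>" using MCM_D[OF n MC] by blast
 have ev: "ext_vanish S F (PS M) A (\<lambda>a. a) (NN i)" if A: "gens S (PS M) A (\<lambda>a. a)" and i: "i \<in> {1..n}" for A i
 proof -
  have "ext_vanish S F (PS M) A (\<lambda>a. a) (PS T)" using Ext1_zero_iff_pull[OF Mm T_module A] E by blast
  thus ?thesis using A by (intro ext_vanish_component[OF PM _ _ i]) (auto simp: gens_def)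
 qed
 have "\<exists>(I :: nat set) x d. diag n (PS M) I x d"
  by (rule ext_vanish_imp_diag[OF PM order_refl g t(1) _ _ ev])
    (use t(2) pull_kill[OF Mm] in auto)
 thus "M \<in> add_cat RR T" using diag_add_cat[OF Mm] by blast
qed

lemma add_cat_eq_right:
 assumes n: "1 \<le> n"
 shows "(add_cat RR T :: ('a set, 'x) module set) = {M \<in> MCM RR. zero_module (Ext1 RR T M)}"
proof (intro equalityI subsetI CollectI conjI)
 fix M :: "('a set, 'x) module" assume M: "M \<in> add_cat RR T"
 show MC: "M \<in> MCM RR" by (rule add_cat_MCM(1)[OF n M])
 have Mm: "module RR M" using MC by (simp add: MCM_def)
 have "ext_vanish S F (PS T) {1..n} vT (PS M)"
  by (rule diag_imp_ext_vanish[OF pull_module[OF T_module] order_refl diag_T pull_module[OF Mm] add_cat_MCM(2)[OF n M]])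
 thus "zero_module (Ext1 RR T M)" using Ext1_zero_iff_pull[OF T_module Mm diagD(1)[OF diag_T]] by blast
next
 fix M :: "('a set, 'x) module" assume "M \<in> {M \<in> MCM RR. zero_module (Ext1 RR T M)}"
 hence MC: "M \<in> MCM RR" and E: "zero_module (Ext1 RR T M)" by auto
 have Mm: "module RR M" using MC by (auto simp: MCM_def)
 have ev: "ext_vanish S F (PS T) {1..n} vT (PS M)" using Ext1_zero_iff_pull[OF T_module Mm diagD(1)[OF diag_T]] E by blast
 have "annc n (PS M)" unfolding annc_def
 proof (intro ballI impI)
  fix i y assume "i \<in> {1..n}" "y \<in> carrier (PS M)" "gp i n \<odot>\<^bsub>PS M\<^esub> y = \<zero>\<^bsub>PS M\<^esub>"
  thus "\<exists>y'\<in>carrier (PS M). y = gp 0 i \<odot>\<^bsub>PS M\<^esub> y'"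
   by (rule ext_vanish_imp_ann[OF pull_module[OF T_module] order_refl diag_T pull_module[OF Mm] ev])
 qed
 thus "M \<in> add_cat RR T" using diag_add_cat[OF Mm] annc_diag[OF n MC] by blast
qed

lemma cluster_tilting_T:
 assumes n: "1 \<le> n" shows "cluster_tilting TYPE('x) RR T"
 unfolding cluster_tilting_def using T_MCM[OF n] add_cat_eq_left[OF n] add_cat_eq_right[OF n] by blast

end

section \<open>The tilting module is basic\<close>

context branches
begin

text \<open>Square matrices which are triangular modulo \<open>m\<close>.\<close>
definition tri :: "nat => (nat => nat => 'a) => bool" where
 "tri n w \<longleftrightarrow> (\<forall>j\<in>{1..n}. \<forall>l\<in>{1..n}. w j l \<in> carrier S \<and> (j < l --> w j l \<in> m))"

lemma triD:
 assumes "tri n w" "j \<in> {1..n}" "l \<in> {1..n}" shows "w j l \<in> carrier S" "j < l ==> w j l \<in> m"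
 using assms unfolding tri_def by blast+

definition mat_mult :: "nat => (nat => nat => 'a) => (nat => nat => 'a) => nat => nat => 'a" where
 "mat_mult n v w j l = (\<Oplus>k\<in>{1..n}. v j k \<otimes> w k l)"

lemma tri_diagonal:
 assumes v: "tri n v" and w: "tri n w" and i: "i \<in> {1..n}"
 shows "mat_mult n v w i i \<in> m \<longleftrightarrow> v i i \<in> m \<or> w i i \<in> m"
proof -
 have c: "v j l \<in> carrier S" "w j l \<in> carrier S" if "j \<in> {1..n}" "l \<in> {1..n}" for j l
  using v w that by (auto simp: tri_def)
 let ?s = "\<Oplus>k\<in>{1..n} - {i}. v i k \<otimes> w k i"
 have s: "?s \<in> m"
 proof (rule m_finsum)
  fix k assume k: "k \<in> {1..n} - {i}"
  hence "i < k \<or> k < i" by auto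
  hence "v i k \<in> m \<or> w k i \<in> m" using triD(2)[OF v i, of k] triD(2)[OF w _ i, of k] k by blast
  moreover have "v i k \<in> carrier S" "w k i \<in> carrier S" using c i k by auto
  ultimately show "v i k \<otimes> w k i \<in> m" using m_mult m_mult2 by blast
 qed simp
 have ins: "insert i ({1..n} - {i}) = {1..n}" using i by auto
 have e: "mat_mult n v w i i = v i i \<otimes> w i i \<oplus> ?s"
  unfolding mat_mult_def using finsum_insert[of "{1..n} - {i}" i "\<lambda>k. v i k \<otimes> w k i"] c i unfolding ins by (auto simp: Pi_iff)
 have vw: "v i i \<in> carrier S" "w i i \<in> carrier S" using c i by auto
 have "mat_mult n v w i i \<in> m \<longleftrightarrow> v i i \<otimes> w i i \<in> m"
 proof
  assume "mat_mult n v w i i \<in> m"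
  hence "(v i i \<otimes> w i i \<oplus> ?s) \<ominus> ?s \<in> m" unfolding e using s by (rule m_diff)
  moreover have "(v i i \<otimes> w i i \<oplus> ?s) \<ominus> ?s = v i i \<otimes> w i i"
   using vw m_carr[OF s] by (simp add: a_minus_def a_assoc r_neg)
  ultimately show "v i i \<otimes> w i i \<in> m" by simp
 next
  assume "v i i \<otimes> w i i \<in> m"
  thus "mat_mult n v w i i \<in> m" unfolding e using s by (rule m_add)
 qed
 thus ?thesis using m_prime[OF vw] m_mult[OF vw(1)] m_mult2[OF vw(2)] by blast
qed

lemma mat_mult_closed:
 assumes "tri n v" "tri n w" "j \<in> {1..n}" "l \<in> {1..n}"
 shows "mat_mult n v w j l \<in> carrier S"
 unfolding mat_mult_def using assms by (intro finsum_closed) (auto simp: tri_def)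

lemma tri_mat_mult:
 assumes v: "tri n v" and w: "tri n w" shows "tri n (mat_mult n v w)"
proof -
 have c: "v j l \<in> carrier S" "w j l \<in> carrier S" if "j \<in> {1..n}" "l \<in> {1..n}" for j l
  using v w that by (auto simp: tri_def)
 have "mat_mult n v w j l \<in> m" if jl: "j \<in> {1..n}" "l \<in> {1..n}" "j < l" for j l
  unfolding mat_mult_def
 proof (rule m_finsum)
  fix k assume k: "k \<in> {1..n}"
  have "j < k \<or> k < l" using jl(3) by auto
  hence "v j k \<in> m \<or> w k l \<in> m" using triD(2)[OF v jl(1) k] triD(2)[OF w k jl(2)] by blast
  moreover have "v j k \<in> carrier S" "w k l \<in> carrier S" using c jl k by auto
  ultimately show "v j k \<otimes> w k l \<in> m" using m_mult m_mult2 by blast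
 qed simp
 thus ?thesis unfolding tri_def[of n "mat_mult n v w"] using mat_mult_closed[OF v w] by blast
qed

end

context tilt
begin

abbreviation endo where "endo h \<equiv> mhom S (PS T) (PS T) h"
abbreviation comb where "comb c \<equiv> lin (PS T) {1..n} vT c"

text \<open>The rows of \<open>w\<close> are the coordinates of the images of the unit vectors. These are only determined
 modulo the \<open>g\<^sub>l\<close>, hence modulo \<open>m\<close>, but that suffices.\<close>
definition represents where
 "represents w h \<longleftrightarrow> tri n w \<and> (\<forall>j\<in>{1..n}. h (vT j) = comb (w j))"

lemma comb_surj: "u \<in> carrier T ==> \<exists>c\<in> coords {1..n}. u = comb c"
 using diagD(1)[OF diag_T] unfolding gens_def by simp

text \<open>The image of the \<open>j\<close>-th unit vector is killed by \<open>g\<^sub>j\<close>, so for \<open>j < l\<close> its \<open>l\<close>-th coordinate is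
 divisible by \<open>g\<^sub>l/g\<^sub>j\<close>, which is in \<open>m\<close>.\<close>
lemma endo_represented:
 assumes h: "endo h" shows "\<exists>w. represents w h"
proof -
 have PT: "module S (PS T)" by (rule pull_module[OF T_module])
 interpret PT: rmod S "PS T" using PT by (rule rmod.intro)
 have vTc: "vT \<in> {1..n} \<rightarrow> carrier (PS T)" using vT_closed by simp
 have "\<forall>j\<in>{1..n}. \<exists>c\<in> coords {1..n}. h (vT j) = comb c"
 proof
  fix j assume "j \<in> {1..n}"
  have "h (vT j) \<in> carrier T" using mhomD(1)[OF h, of "vT j"] vT_closed by simp
  thus "\<exists>c\<in> coords {1..n}. h (vT j) = comb c" by (rule comb_surj)
 qed
 then obtain w where w: "\<And>j. j \<in> {1..n} ==> w j \<in> coords {1..n} \<and> h (vT j) = comb (w j)" by metis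
 have "w j l \<in> m" if j: "j \<in> {1..n}" and l: "l \<in> {1..n}" and jl: "j < l" for j l
 proof -
  have c: "w j l \<in> carrier S" "gp 0 j \<in> carrier S" "gp j l \<in> carrier S" using w[OF j] l j by auto
  have z: "gp 0 j \<odot>\<^bsub>PS T\<^esub> vT j = \<zero>\<^bsub>PS T\<^esub>" using diagD(5)[OF diag_T j] .
  have "gp 0 j \<odot>\<^bsub>PS T\<^esub> h (vT j) = h \<zero>\<^bsub>PS T\<^esub>"
   using mhomD(3)[OF h c(2), of "vT j"] z vT_closed by (simp del: pull_simps(2,4))
  also have "\<dots> = \<zero>\<^bsub>PS T\<^esub>" by (rule mhom_zero[OF PT PT h])
  finally have "comb (\<lambda>l. gp 0 j \<otimes> w j l) = \<zero>\<^bsub>PS T\<^esub>"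
   using w[OF j] c vTc by (simp del: pull_simps add: PT.lin_smult)
  hence "gp 0 l divides gp 0 j \<otimes> w j l"
   using diagD(6)[OF diag_T _ _ l, of "\<lambda>l. gp 0 j \<otimes> w j l"] w[OF j] c by (auto simp: Pi_iff)
  moreover have "gp 0 l = gp 0 j \<otimes> gp j l" using gp_mult[of 0 j l] jl l by simp
  ultimately have "gp j l divides w j l" using dvd_cancel[of "gp j l" "w j l" "gp 0 j"] c gp_nz[of j 0] j by simp
  thus ?thesis using m_dvd[OF gp_m[OF jl]] l by simp
 qed
 thus ?thesis using w unfolding represents_def tri_def by (intro exI[of _ w]) (auto simp: Pi_iff)
qed

lemma endo_comb:
 assumes h: "endo h" and r: "represents w h" and c: "c \<in> coords {1..n}"
 shows "h (comb c) = comb (\<lambda>l. \<Oplus>k\<in>{1..n}. c k \<otimes> w k l)"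
proof -
 have PT: "module S (PS T)" by (rule pull_module[OF T_module])
 interpret PT: rmod S "PS T" using PT by (rule rmod.intro)
 have vTc: "vT \<in> {1..n} \<rightarrow> carrier (PS T)" using vT_closed by simp
 have w: "w \<in> {1..n} \<rightarrow> {1..n} \<rightarrow> carrier S" using r by (auto simp: represents_def tri_def)
 have "h (comb c) = lin (PS T) {1..n} (\<lambda>k. h (vT k)) c" by (rule mhom_lin[OF PT PT h _ vTc c]) simp
 also have "\<dots> = lin (PS T) {1..n} (\<lambda>k. comb (w k)) c"
 proof (rule PT.lin_cong[OF _ c])
  show "(\<lambda>k. comb (w k)) \<in> {1..n} \<rightarrow> carrier (PS T)"
   by (intro funcsetI PT.lin_closed[OF vTc] funcset_mem[OF w])
  fix k assume "k \<in> {1..n}"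
  hence "h (vT k) = comb (w k)" using r by (simp add: represents_def)
  thus "c k \<odot>\<^bsub>PS T\<^esub> h (vT k) = c k \<odot>\<^bsub>PS T\<^esub> comb (w k)" by simp
 qed
 also have "\<dots> = comb (\<lambda>l. \<Oplus>k\<in>{1..n}. c k \<otimes> w k l)" by (rule PT.lin_lin) (use vTc w c in auto)
 finally show ?thesis .
qed

lemma represents_compose:
 assumes h: "endo h" "represents w h" and k: "represents v k"
 shows "represents (mat_mult n v w) (\<lambda>u. h (k u))"
proof -
 have "h (k (vT j)) = comb (mat_mult n v w j)" if j: "j \<in> {1..n}" for j
 proof -
  have "v j \<in> coords {1..n}" using k j by (auto simp: represents_def tri_def)
  from endo_comb[OF h this] show ?thesis using k j by (simp add: represents_def mat_mult_def[abs_def])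
 qed
 thus ?thesis using tri_mat_mult h(2) k by (auto simp: represents_def)
qed

lemma represents_zero:
 assumes r: "represents w h" and z: "\<And>j. j \<in> {1..n} ==> h (vT j) = \<zero>\<^bsub>PS T\<^esub>" and i: "i \<in> {1..n}"
 shows "w i i \<in> m"
proof -
 have "w i \<in> coords {1..n}" "comb (w i) = \<zero>\<^bsub>PS T\<^esub>" using r z[OF i] i by (auto simp: represents_def tri_def)
 hence "gp 0 i divides w i i" using diagD(6)[OF diag_T _ _ i] by blast
 thus ?thesis using m_dvd[OF gp_m[of 0 i]] i by auto
qed

text \<open>The matrix of \<open>e\<close> is strictly triangular modulo \<open>m\<close>, so \<open>e = e\<^sup>n\<close> maps \<open>T\<close> into \<open>m T\<close>. Applying \<open>e\<close>
 once more shows that \<open>e T\<close> is contained in \<open>m e T\<close>.\<close>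
lemma idempotent_in_radical:
 assumes e: "endo e" "\<And>u. u \<in> carrier T ==> e (e u) = e u"
  and r: "represents w e" and d: "\<And>i. i \<in> {1..n} ==> w i i \<in> m"
  and u: "u \<in> carrier T"
 shows "e u = \<zero>\<^bsub>PS T\<^esub>"
proof -
 have PT: "module S (PS T)" by (rule pull_module[OF T_module])
 interpret PT: rmod S "PS T" using PT by (rule rmod.intro)
 have vTc: "vT \<in> {1..n} \<rightarrow> carrier (PS T)" using vT_closed by simp
 have ec: "e u \<in> carrier T" if "u \<in> carrier T" for u using mhomD(1)[OF e(1), of u] that by simp
 have wm: "w j l \<in> m" if "j \<in> {1..n}" "l \<in> {1..n}" "j \<le> l" for j l
  using r d[of j] that by (cases "j = l") (auto simp: represents_def tri_def)
 have wc: "w j l \<in> carrier S" if "j \<in> {1..n}" "l \<in> {1..n}" for j l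
  using r that by (auto simp: represents_def tri_def)
 \<comment> \<open>Each application of \<open>e\<close> moves one more coordinate into \<open>m\<close>.\<close>
 have filt: "\<exists>c\<in> coords {1..n}. e u = comb c \<and> (\<forall>l\<in>{1..n}. n < l + k --> c l \<in> m)"
  if "u \<in> carrier T" for u k
 proof (induction k)
  case 0 thus ?case using comb_surj[OF ec[OF that]] by auto
 next
  case (Suc k)
  then obtain c where c: "c \<in> coords {1..n}" "e u = comb c" "\<And>l. l \<in> {1..n} ==> n < l + k ==> c l \<in> m" by blast
  let ?c = "\<lambda>l. \<Oplus>j\<in>{1..n}. c j \<otimes> w j l"
  have "e u = e (comb c)" using e(2)[OF that] c(2) by simp
  also have "\<dots> = comb ?c" by (rule endo_comb[OF e(1) r c(1)])
  finally have "e u = comb ?c" .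
  moreover have "?c \<in> coords {1..n}" using c(1) wc by (auto simp: Pi_iff intro!: finsum_closed)
  moreover have "?c l \<in> m" if l: "l \<in> {1..n}" "n < l + Suc k" for l
  proof (rule m_finsum)
   fix j assume j: "j \<in> {1..n}"
   have cj: "c j \<in> carrier S" using c(1) j by auto
   show "c j \<otimes> w j l \<in> m"
   proof (cases "j \<le> l")
    case True thus ?thesis using wm[OF j l(1)] m_mult[OF cj] by blast
   next
    case False
    hence "c j \<in> m" using c(3)[OF j] l(2) by simp
    thus ?thesis using m_mult2[OF wc[OF j l(1)]] by blast
   qed
  qed simp
  ultimately show ?case by blast
 qed
 have "(\<lambda>i. e (vT i)) ` {1..n} \<subseteq> {\<zero>\<^bsub>PS T\<^esub>}"
 proof (rule nakayama[OF PT PT.zero_submodule])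
  show "(\<lambda>i. e (vT i)) \<in> {1..n} \<rightarrow> carrier (PS T)" using ec vT_closed by simp
  fix i assume i: "i \<in> {1..n}"
  obtain c where c: "c \<in> coords {1..n}" "e (vT i) = comb c" "\<forall>l\<in>{1..n}. n < l + n --> c l \<in> m"
   using filt[OF vT_closed, of i n] by blast
  have cm: "c \<in> {1..n} \<rightarrow> m" using c(3) by auto
  have "e (vT i) = e (comb c)" using e(2)[OF vT_closed, of i] c(2) by simp
  also have "\<dots> = lin (PS T) {1..n} (\<lambda>i. e (vT i)) c" by (rule mhom_lin[OF PT PT e(1) _ vTc c(1)]) simp
  finally have eq: "e (vT i) = lin (PS T) {1..n} (\<lambda>i. e (vT i)) c" .
  have "lin (PS T) {1..n} (\<lambda>i. e (vT i)) c \<in> carrier (PS T)" using c(1) ec vT_closed by (intro PT.lin_closed) auto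
  hence "e (vT i) = \<zero>\<^bsub>PS T\<^esub> \<oplus>\<^bsub>PS T\<^esub> lin (PS T) {1..n} (\<lambda>i. e (vT i)) c" using eq PT.M.l_zero by metis
  thus "\<exists>k\<in>{\<zero>\<^bsub>PS T\<^esub>}. \<exists>v\<in>{1..n} \<rightarrow> m. e (vT i) = k \<oplus>\<^bsub>PS T\<^esub> lin (PS T) {1..n} (\<lambda>i. e (vT i)) v"
   using cm by blast
 qed simp
 hence z: "e (vT i) = \<zero>\<^bsub>PS T\<^esub>" if "i \<in> {1..n}" for i using that by blast
 obtain c where c: "c \<in> coords {1..n}" "u = comb c" using comb_surj[OF u] by blast
 have "e u = lin (PS T) {1..n} (\<lambda>i. e (vT i)) c" unfolding c(2) by (rule mhom_lin[OF PT PT e(1) _ vTc c(1)]) simp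
 also have "\<dots> = \<zero>\<^bsub>PS T\<^esub>"
 proof (rule PT.lin_zero)
  fix i assume i: "i \<in> {1..n}"
  have "c i \<odot>\<^bsub>PS T\<^esub> \<zero>\<^bsub>PS T\<^esub> = \<zero>\<^bsub>PS T\<^esub>" by (rule PT.smult_r_null[OF funcset_mem[OF c(1) i]])
  thus "c i \<odot>\<^bsub>PS T\<^esub> e (vT i) = \<zero>\<^bsub>PS T\<^esub>" using z[OF i] by simp
 qed
 finally show ?thesis .
qed

text \<open>The idempotents \<open>b a\<close> and \<open>a b\<close> have the same diagonal modulo \<open>m\<close>, and their product vanishes; as
 \<open>m\<close> is prime, this diagonal is zero.\<close>
lemma swap_idempotents_trivial:
 assumes a: "endo a" and b: "endo b" and id: "\<And>u. u \<in> carrier T ==> b (a (b (a u))) = b (a u)"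
  and ortho: "\<And>u. u \<in> carrier T ==> b (a (a (b u))) = \<zero>\<^bsub>PS T\<^esub>" and u: "u \<in> carrier T"
 shows "b (a u) = \<zero>\<^bsub>PS T\<^esub>"
proof -
 obtain v where v: "represents v a" using endo_represented[OF a] by blast
 obtain w where w: "represents w b" using endo_represented[OF b] by blast
 have e: "endo (\<lambda>u. b (a u))" "endo (\<lambda>u. a (b u))" using mhom_compose[OF a b] mhom_compose[OF b a] by auto
 have re: "represents (mat_mult n v w) (\<lambda>u. b (a u))" by (rule represents_compose[OF b w v])
 have re': "represents (mat_mult n w v) (\<lambda>u. a (b u))" by (rule represents_compose[OF a v w])
 have ree: "represents (mat_mult n (mat_mult n w v) (mat_mult n v w)) (\<lambda>u. b (a (a (b u))))"
  by (rule represents_compose[OF e(1) re re'])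
 have t: "tri n v" "tri n w" "tri n (mat_mult n v w)" "tri n (mat_mult n w v)"
  using v w re re' by (simp_all add: represents_def)
 have "mat_mult n v w i i \<in> m" if i: "i \<in> {1..n}" for i
 proof -
  have "mat_mult n (mat_mult n w v) (mat_mult n v w) i i \<in> m"
   by (rule represents_zero[OF ree _ i]) (rule ortho[OF vT_closed])
  thus ?thesis using tri_diagonal[OF t(4,3) i] tri_diagonal[OF t(1,2) i] tri_diagonal[OF t(2,1) i] by blast
 qed
 from idempotent_in_radical[OF e(1) _ re this u] id show ?thesis by simp
qed

text \<open>For isomorphic summands \<open>A\<close> and \<open>B\<close>, the isomorphism and its inverse extend by zero to endomorphisms
 of \<open>T\<close> whose two products are the projections onto \<open>A\<close> and \<open>B\<close>.\<close>
lemma basic_T: "basic_module RR T"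
 unfolding basic_module_def
proof (intro allI impI notI)
 fix N L A B
 assume D1: "internal_direct_sum RR T N L" and D2: "internal_direct_sum RR (T\<lparr>carrier := N\<rparr>) A B"
  and ind: "indecomposable RR (T\<lparr>carrier := A\<rparr>)" and iso: "mod_iso RR (T\<lparr>carrier := A\<rparr>) (T\<lparr>carrier := B\<rparr>)"
 have Nsub: "submodule N RR T" using D1 by (simp add: internal_direct_sum_def)
 have Nm: "module RR (T\<lparr>carrier := N\<rparr>)" by (rule submodule.submodule_is_module[OF Nsub T_module])
 have PT: "module S (PS T)" by (rule pull_module[OF T_module])
 interpret PT: rmod S "PS T" using PT by (rule rmod.intro)
 have PN: "PS (T\<lparr>carrier := N\<rparr>) = (PS T)\<lparr>carrier := N\<rparr>" by (rule pull_carrier_update)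
 have PNm: "module S ((PS T)\<lparr>carrier := N\<rparr>)" using pull_module[OF Nm] by (simp add: PN)
 interpret PN: rmod S "(PS T)\<lparr>carrier := N\<rparr>" using PNm by (rule rmod.intro)
 have D1': "internal_direct_sum S (PS T) N L" by (rule internal_direct_sum_pull[OF T_module D1])
 have D2': "internal_direct_sum S ((PS T)\<lparr>carrier := N\<rparr>) A B" using internal_direct_sum_pull[OF Nm D2] by (simp add: PN)
 obtain p where p: "mhom S (PS T) ((PS T)\<lparr>carrier := N\<rparr>) p" "\<And>a. a \<in> N ==> p a = a"
  by (rule PT.direct_sum_projections[OF D1'], rule that)
 obtain q r where q: "mhom S ((PS T)\<lparr>carrier := N\<rparr>) ((PS T)\<lparr>carrier := N\<rparr>\<lparr>carrier := A\<rparr>) q"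
  and r: "mhom S ((PS T)\<lparr>carrier := N\<rparr>) ((PS T)\<lparr>carrier := N\<rparr>\<lparr>carrier := B\<rparr>) r"
  and qA: "\<And>a. a \<in> A ==> q a = a" and qB: "\<And>b. b \<in> B ==> q b = \<zero>\<^bsub>(PS T)\<lparr>carrier := N\<rparr>\<^esub>" and rB: "\<And>b. b \<in> B ==> r b = b"
  by (rule PN.direct_sum_projections[OF D2'], rule that)
 have sub: "A \<subseteq> N" "B \<subseteq> N" "N \<subseteq> carrier T"
  using D1' D2' PT.submoduleE(1)[of N] PN.submoduleE(1)[of A] PN.submoduleE(1)[of B] by (auto simp: internal_direct_sum_def)
 obtain h where h: "h \<in> mod_hom RR (T\<lparr>carrier := A\<rparr>) (T\<lparr>carrier := B\<rparr>)" "bij_betw h A B"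
  using iso by (auto simp: mod_iso_def)
 have hm: "mhom S ((PS T)\<lparr>carrier := A\<rparr>) ((PS T)\<lparr>carrier := B\<rparr>) h"
  using h(1) by (auto simp: mod_hom_def mhom_def PiE_def)
 have Am: "module S ((PS T)\<lparr>carrier := A\<rparr>)"
  using submodule.submodule_is_module[OF _ PNm, of A] D2' by (simp add: internal_direct_sum_def)
 let ?k = "inv_into A h"
 have k: "mhom S ((PS T)\<lparr>carrier := B\<rparr>) ((PS T)\<lparr>carrier := A\<rparr>) ?k"
  using mhom_inv_into[OF Am hm] h(2) by simp
 have hc: "h x \<in> B" "?k (h x) = x" if "x \<in> A" for x
  using h(2) that by (auto simp: bij_betw_def inv_into_f_f)
 have kc: "?k y \<in> A" "h (?k y) = y" if "y \<in> B" for y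
  using h(2) that by (auto simp: bij_betw_def inv_into_into f_inv_into_f)
 have pc: "p u \<in> N" if "u \<in> carrier T" for u using mhomD(1)[OF p(1), of u] that by simp
 have qc: "q u \<in> A" and rc: "r u \<in> B" if "u \<in> N" for u using mhomD(1)[OF q, of u] mhomD(1)[OF r, of u] that by simp_all
 let ?a = "\<lambda>u. h (q (p u))" and ?b = "\<lambda>u. ?k (r (p u))"
 have lift: "endo h'" if "mhom S (PS T) ((PS T)\<lparr>carrier := C\<rparr>) h'" "C \<subseteq> carrier T" for h' C
  using that by (auto simp: mhom_def)
 have "mhom S (PS T) ((PS T)\<lparr>carrier := B\<rparr>) ?a"
  using mhom_compose[OF mhom_compose[OF p(1) q]] hm by simp
 hence a: "endo ?a" by (rule lift) (use sub in auto)
 have "mhom S (PS T) ((PS T)\<lparr>carrier := A\<rparr>) ?b"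
  using mhom_compose[OF mhom_compose[OF p(1) r]] k by simp
 hence b: "endo ?b" by (rule lift) (use sub in auto)
 have ba: "?b (?a u) = q (p u)" if u: "u \<in> carrier T" for u
 proof -
  have "h (q (p u)) \<in> B" using hc(1) qc pc u by blast
  thus ?thesis using hc(2)[OF qc[OF pc[OF u]]] p(2)[of "h (q (p u))"] rB sub by auto
 qed
 have ab: "?a (?b u) = r (p u)" if u: "u \<in> carrier T" for u
 proof -
  have "?k (r (p u)) \<in> A" using kc(1) rc pc u by blast
  thus ?thesis using kc(2)[OF rc[OF pc[OF u]]] p(2)[of "?k (r (p u))"] qA sub by auto
 qed
 have z: "?b (?a u) = \<zero>\<^bsub>PS T\<^esub>" if u: "u \<in> carrier T" for u
 proof (rule swap_idempotents_trivial[OF a b _ _ u])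
  fix u assume u: "u \<in> carrier T"
  have c: "q (p u) \<in> A" "q (p u) \<in> N" "q (p u) \<in> carrier T" "r (p u) \<in> B" "r (p u) \<in> N" "r (p u) \<in> carrier T"
   using qc[OF pc[OF u]] rc[OF pc[OF u]] sub by auto
  show "?b (?a (?b (?a u))) = ?b (?a u)"
   unfolding ba[OF u] ba[OF c(3)] unfolding p(2)[OF c(2)] by (rule qA[OF c(1)])
  show "?b (?a (?a (?b u))) = \<zero>\<^bsub>PS T\<^esub>"
   unfolding ab[OF u] ba[OF c(6)] unfolding p(2)[OF c(5)] using qB[OF c(4)] by simp
 qed
 have "a = \<zero>\<^bsub>T\<^esub>" if a: "a \<in> A" for a
 proof -
  have c: "a \<in> N" "a \<in> carrier T" using a sub by auto
  have "a = q (p a)" unfolding p(2)[OF c(1)] by (rule qA[OF a, symmetric])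
  also have "\<dots> = \<zero>\<^bsub>PS T\<^esub>" using z[OF c(2)] unfolding ba[OF c(2)] .
  finally show ?thesis by simp
 qed
 moreover have "\<zero>\<^bsub>T\<^esub> \<in> A" using D2 by (auto simp: internal_direct_sum_def)
 ultimately have "A = {\<zero>\<^bsub>T\<^esub>}" by blast
 thus False using ind by (simp add: indecomposable_def zero_module_def)
qed

end

section \<open>The zero ring\<close>

lemma (in rmod) zero_module_if_one_zero:
 assumes "\<one> = \<zero>" shows "zero_module M"
proof -
 have "x = \<zero>\<^bsub>M\<^esub>" if "x \<in> carrier M" for x using smult_one[OF that] smult_l_null[OF that] assms by simp
 thus ?thesis by (auto simp: zero_module_def)
qed

text \<open>The case of the empty product. The zero ring has no maximal ideal, so depth and dimension say
 nothing about its modules; but all of them are zero.\<close>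
lemma zero_ring_case:
 fixes M :: "('a, 'm) module" and R :: "('a, 'r) ring_scheme"
 assumes one: "\<one>\<^bsub>R\<^esub> = \<zero>\<^bsub>R\<^esub>" and M: "module R M"
 shows "cluster_tilting TYPE('x) R M \<and> basic_module R M"
proof
 have zero: "zero_module Y" if "module R Y" for Y :: "('a, 'y) module"
  by (rule rmod.zero_module_if_one_zero[OF rmod.intro[OF that] one])
 have gens: "gens R Y ({} :: nat set) x" if "module R Y" for Y :: "('a, 'y) module" and x
  using zero[OF that] by (auto simp: gens_def zero_module_def rmod.lin_empty[OF rmod.intro[OF that]])
 have mcm: "Y \<in> MCM R" if Y: "module R Y" for Y :: "('a, 'y) module"
  using Y zero[OF Y] gens[OF Y] rmod.fin_gen_iff[OF rmod.intro[OF Y]] unfolding MCM_def by blast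
 have ext: "zero_module (Ext1 R Y Z)" if Y: "module R Y" and Z: "module R Z"
  for Y :: "('a, 'y) module" and Z :: "('a, 'z) module"
 proof -
  have "ext_vanish R \<zero>\<^bsub>R\<^esub> Y ({} :: nat set) x Z" for x
   using zero[OF Z] by (auto simp: ext_vanish_def rel_hom_def zero_module_def rmod.lin_empty[OF rmod.intro[OF Z]])
  thus ?thesis using Ext1_zero_iff_ext_vanish[OF Y Z gens[OF Y]] by blast
 qed
 have add: "Y \<in> add_cat R M" if Y: "module R Y" for Y :: "('a, 'x) module"
 proof -
  let ?D = "direct_sum {..<0::nat} (\<lambda>_. M)"
  have D: "module R ?D" using M by (intro direct_sum_module) (auto simp: module_def)
  interpret D: rmod R ?D using D by (rule rmod.intro)
  have zD: "carrier ?D = {\<zero>\<^bsub>?D\<^esub>}" using zero[OF D] by (simp add: zero_module_def)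
  have sub: "submodule {\<zero>\<^bsub>?D\<^esub>} R ?D" by (rule D.zero_submodule)
  have zz: "\<zero>\<^bsub>?D\<^esub> \<oplus>\<^bsub>?D\<^esub> \<zero>\<^bsub>?D\<^esub> = \<zero>\<^bsub>?D\<^esub>" by (rule D.M.l_zero[OF D.M.zero_closed])
  have "internal_direct_sum R ?D {\<zero>\<^bsub>?D\<^esub>} {\<zero>\<^bsub>?D\<^esub>}"
   unfolding internal_direct_sum_def set_add_def' zD using sub zz by (simp del: direct_sum_simps)
  moreover have "mod_iso R Y (?D\<lparr>carrier := {\<zero>\<^bsub>?D\<^esub>}\<rparr>)"
  proof -
   have zY: "carrier Y = {\<zero>\<^bsub>Y\<^esub>}" using zero[OF Y] by (simp add: zero_module_def)
   interpret Y: rmod R Y using Y by (rule rmod.intro)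
   let ?h = "\<lambda>y\<in>carrier Y. \<zero>\<^bsub>?D\<^esub>"
   have "?h \<in> mod_hom R Y (?D\<lparr>carrier := {\<zero>\<^bsub>?D\<^esub>}\<rparr>)"
    using zz D.smult_r_null by (simp add: mod_hom_def del: direct_sum_simps)
   moreover have "bij_betw ?h (carrier Y) {\<zero>\<^bsub>?D\<^esub>}" unfolding zY by (auto simp: bij_betw_def)
   ultimately show ?thesis unfolding mod_iso_def by (intro bexI[of _ ?h]) simp_all
  qed
  ultimately show ?thesis using Y unfolding add_cat_def by blast
 qed
 have mod: "module R Y" if "Y \<in> MCM R \<or> Y \<in> add_cat R M" for Y :: "('a, 'x) module"
  using that by (auto simp: MCM_def add_cat_def)
 have all: "Y \<in> add_cat R M \<longleftrightarrow> module R Y" for Y :: "('a, 'x) module"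
  using add mod by blast
 have all_left: "Y \<in> MCM R \<and> zero_module (Ext1 R Y M) \<longleftrightarrow> module R Y" for Y :: "('a, 'x) module"
  using mod mcm[of Y] ext[of Y M] M by blast
 have all_right: "Y \<in> MCM R \<and> zero_module (Ext1 R M Y) \<longleftrightarrow> module R Y" for Y :: "('a, 'x) module"
  using mod mcm[of Y] ext[of M Y] M by blast
 show "cluster_tilting TYPE('x) R M" unfolding cluster_tilting_def all_left all_right
  using mcm[OF M] all by blast
 show "basic_module R M" unfolding basic_module_def
 proof (intro allI impI notI)
  fix N L A B assume D1: "internal_direct_sum R M N L" and D2: "internal_direct_sum R (M\<lparr>carrier := N\<rparr>) A B"
   and ind: "indecomposable R (M\<lparr>carrier := A\<rparr>)"
  have N: "module R (M\<lparr>carrier := N\<rparr>)"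
   using submodule.submodule_is_module[OF _ M, of N] D1 by (simp add: internal_direct_sum_def)
  have "module R (M\<lparr>carrier := A\<rparr>)"
   using submodule.submodule_is_module[OF _ N, of A] D2 by (simp add: internal_direct_sum_def)
  thus False using zero ind by (auto simp: indecomposable_def)
 qed
qed

section \<open>Regular local rings of dimension two\<close>

locale noetherian_local = cring S for S (structure) +
 fixes m :: "'a set"
 assumes noetherian: "noetherian_ring S"
  and m_max: "maximalideal m S"
  and m_unique: "maximalideal I S ==> I = m"
begin

text \<open>The maximum condition for ideals.\<close>
lemma exists_maximal_ideal_in:
 assumes "\<A> \<noteq> {}" "\<And>I. I \<in> \<A> ==> ideal I S"
 shows "\<exists>M\<in>\<A>. \<forall>J\<in>\<A>. M \<subseteq> J --> J = M"
proof (rule subset_Zorn_nonempty[OF assms(1)])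
 fix C assume C: "C \<noteq> {}" "subset.chain \<A> C"
 have "subset.chain {I. ideal I S} C" using C(2) assms(2) unfolding pred_on.chain_def by blast
 hence "\<Union>C \<in> C" by (rule noetherian_ring.ideal_chain_is_trivial[OF noetherian C(1)])
 thus "\<Union>C \<in> \<A>" using C(2) unfolding pred_on.chain_def by blast
qed

lemma m_ideal: "ideal m S" using m_max by (simp add: maximalideal_def)

lemma one_notin_m: "\<one> \<notin> m"
 using ideal.one_imp_carrier[OF m_ideal] m_max by (auto simp: maximalideal_def maximalideal_axioms_def)

lemma m_carr: "x \<in> m ==> x \<in> carrier S" using ideal.Icarr[OF m_ideal] .

lemma proper_ideal_sub_m:
 assumes I: "ideal I S" "\<one> \<notin> I" shows "I \<subseteq> m"
proof -
 let ?A = "{J. ideal J S \<and> I \<subseteq> J \<and> \<one> \<notin> J}"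
 obtain M where M: "M \<in> ?A" "\<forall>J\<in>?A. M \<subseteq> J --> J = M" using exists_maximal_ideal_in[of ?A] I by blast
 have "maximalideal M S"
 proof (rule maximalidealI)
  show "ideal M S" using M by blast
  show "carrier S \<noteq> M" using M(1) one_closed by blast
  fix J assume J: "ideal J S" "M \<subseteq> J" "J \<subseteq> carrier S"
  show "J = M \<or> J = carrier S"
  proof (cases "\<one> \<in> J")
   case True thus ?thesis using ideal.one_imp_carrier[OF J(1)] by blast
  next
   case False thus ?thesis using M J by blast
  qed
 qed
 thus ?thesis using M(1) m_unique by blast
qed

lemma unit_outside: assumes "x \<in> carrier S" "x \<notin> m" shows "x \<in> Units S"
proof -
 have "\<one> \<in> PIdl x" using proper_ideal_sub_m[OF cgenideal_ideal[OF assms(1)]] cgenideal_self[OF assms(1)] assms(2) by blast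
 then obtain y where "y \<in> carrier S" "\<one> = x \<otimes> y" using PIdl_iff_dvd[OF assms(1)] by (auto elim: dvdE)
 thus ?thesis using assms(1) m_comm[of x y] unfolding Units_def by auto
qed

lemma m_mult: "x \<in> m ==> r \<in> carrier S ==> x \<otimes> r \<in> m" using ideal.I_r_closed[OF m_ideal] .

lemma cancel_one_minus:
 assumes I: "ideal I S" and t: "t \<in> m" and y: "y \<in> carrier S" "y \<ominus> t \<otimes> y \<in> I" shows "y \<in> I"
proof -
 have tS: "t \<in> carrier S" using t m_carr by blast
 have "\<one> \<ominus> t \<notin> m"
 proof
  assume "\<one> \<ominus> t \<in> m"
  hence "(\<one> \<ominus> t) \<oplus> t \<in> m" using t additive_subgroup.a_closed[OF ideal.axioms(1)[OF m_ideal]] by blast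
  moreover have "(\<one> \<ominus> t) \<oplus> t = \<one>" using tS by algebra
  ultimately show False using one_notin_m by simp
 qed
 hence u: "\<one> \<ominus> t \<in> Units S" using tS by (intro unit_outside) auto
 have e: "y \<ominus> t \<otimes> y = (\<one> \<ominus> t) \<otimes> y" using y tS by algebra
 have "inv (\<one> \<ominus> t) \<otimes> (y \<ominus> t \<otimes> y) \<in> I" by (rule ideal.I_l_closed[OF I y(2) Units_inv_closed[OF u]])
 moreover have "inv (\<one> \<ominus> t) \<otimes> (y \<ominus> t \<otimes> y) = y"
  unfolding e using Units_l_inv[OF u] Units_inv_closed[OF u] y(1) tS by (simp flip: m_assoc)
 ultimately show ?thesis by simp
qed

definition ideal_with :: "'a set => 'a => 'a set" where "ideal_with B x = B <+> PIdl x"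

lemma ideal_with_ideal: "ideal B S ==> x \<in> carrier S ==> ideal (ideal_with B x) S"
 unfolding ideal_with_def by (intro add_ideals cgenideal_ideal)

lemma mem_ideal_with:
 assumes "x \<in> carrier S"
 shows "y \<in> ideal_with B x \<longleftrightarrow> (\<exists>b\<in>B. \<exists>r\<in>carrier S. y = b \<oplus> r \<otimes> x)"
 unfolding ideal_with_def set_add_def' cgenideal_def by blast

lemma ideal_with_mono:
 assumes B: "ideal B S" and y: "y \<in> carrier S" and b: "b \<in> B" and r: "r \<in> carrier S"
 shows "ideal_with B (b \<oplus> r \<otimes> y) \<subseteq> ideal_with B y"
proof
 have bS: "b' \<in> carrier S" if "b' \<in> B" for b' using ideal.Icarr[OF B that] .
 have x: "b \<oplus> r \<otimes> y \<in> carrier S" using bS b r y by simp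
 fix z assume "z \<in> ideal_with B (b \<oplus> r \<otimes> y)"
 then obtain b' s where s: "b' \<in> B" "s \<in> carrier S" "z = b' \<oplus> s \<otimes> (b \<oplus> r \<otimes> y)" using mem_ideal_with[OF x] by blast
 have "z = (b' \<oplus> s \<otimes> b) \<oplus> (s \<otimes> r) \<otimes> y" unfolding s(3) using bS[OF b] bS[OF s(1)] s(2) r y by algebra
 moreover have "b' \<oplus> s \<otimes> b \<in> B"
  using additive_subgroup.a_closed[OF ideal.axioms(1)[OF B] s(1)] ideal.I_l_closed[OF B b s(2)] by blast
 ultimately show "z \<in> ideal_with B y" using mem_ideal_with[OF y] s(2) r by blast
qed

text \<open>A form of Nakayama's lemma that follows from the maximum condition, for a set \<open>I\<close> that is not
 assumed to be an ideal: choose \<open>x\<close> such that \<open>B + (x)\<close> is maximal and write \<open>x = b + t y\<close>. By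
 maximality \<open>y \<in> B + (x)\<close>, so \<open>(1 - t r) y \<in> B\<close> for some \<open>r\<close>.\<close>
lemma ideal_nakayama:
 assumes I: "I \<subseteq> carrier S" and B: "ideal B S" and t: "t \<in> m"
  and step: "\<And>x. x \<in> I ==> x \<notin> B ==> \<exists>b\<in>B. \<exists>y\<in>I. y \<notin> B \<and> x = b \<oplus> t \<otimes> y"
 shows "I \<subseteq> B"
proof (rule ccontr)
 assume "\<not> I \<subseteq> B"
 let ?A = "ideal_with B ` (I - B)"
 have tS: "t \<in> carrier S" using t m_carr by blast
 have "\<exists>M\<in>?A. \<forall>J\<in>?A. M \<subseteq> J --> J = M"
  by (rule exists_maximal_ideal_in) (use \<open>\<not> I \<subseteq> B\<close> I B ideal_with_ideal in auto)
 then obtain M where M: "M \<in> ?A" "\<forall>J\<in>?A. M \<subseteq> J --> J = M" by blast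
 then obtain x where x: "x \<in> I" "x \<notin> B" "M = ideal_with B x" by blast
 have mx: "ideal_with B y = ideal_with B x" if "y \<in> I" "y \<notin> B" "ideal_with B x \<subseteq> ideal_with B y" for y
  using M(2) x(3) that by blast
 obtain b y where y: "b \<in> B" "y \<in> I" "y \<notin> B" "x = b \<oplus> t \<otimes> y" using step[OF x(1,2)] by blast
 have c: "x \<in> carrier S" "y \<in> carrier S" "b \<in> carrier S" using x(1) y(1,2) I ideal.Icarr[OF B] by blast+
 have "ideal_with B y = ideal_with B x" using mx[OF y(2,3)] ideal_with_mono[OF B c(2) y(1) tS] y(4) by simp
 moreover have "y \<in> ideal_with B y"
 proof -
  have "y = \<zero> \<oplus> \<one> \<otimes> y" using c by simp
  thus ?thesis using mem_ideal_with[OF c(2)] additive_subgroup.zero_closed[OF ideal.axioms(1)[OF B]] one_closed by blast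
 qed
 ultimately obtain b' r where r: "b' \<in> B" "r \<in> carrier S" "y = b' \<oplus> r \<otimes> x" using mem_ideal_with[OF c(1)] by blast
 have b': "b' \<in> carrier S" using r ideal.Icarr[OF B] by auto
 have tr: "t \<otimes> r \<in> m" by (rule m_mult[OF t r(2)])
 have "y = b' \<oplus> r \<otimes> (b \<oplus> t \<otimes> y)" using r(3) y(4) by simp
 hence "y \<ominus> (t \<otimes> r) \<otimes> y = (b' \<oplus> r \<otimes> (b \<oplus> t \<otimes> y)) \<ominus> (t \<otimes> r) \<otimes> y" by simp
 also have "\<dots> = b' \<oplus> r \<otimes> b" using c b' r(2) tS by algebra
 finally have "y \<ominus> (t \<otimes> r) \<otimes> y \<in> B"
  using additive_subgroup.a_closed[OF ideal.axioms(1)[OF B] r(1)] ideal.I_l_closed[OF B y(1) r(2)] by simp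
 thus False using cancel_one_minus[OF B tr c(2)] y(3) by blast
qed

text \<open>An element of \<open>m\<close> which is not divisible by \<open>f\<close> is \<open>q c\<^sub>1\<close> modulo \<open>f\<close>, and if \<open>c\<^sub>1\<close> has the required
 form, so has the element. Hence the set of counterexamples satisfies the hypothesis of
 \<open>ideal_nakayama\<close> with \<open>B = (f)\<close>.\<close>
lemma valuation_step:
 assumes f: "f \<in> carrier S" and q: "q \<in> m" and gen: "\<And>x. x \<in> m ==> \<exists>a\<in>carrier S. \<exists>b\<in>carrier S. x = f \<otimes> a \<oplus> q \<otimes> b"
  and c: "c \<in> carrier S" "\<not> f divides c"
 shows "\<exists>u\<in>Units S. \<exists>e::nat. f divides (c \<ominus> u \<otimes> q [^] e)"
proof -
 let ?bad = "{c \<in> carrier S. \<not> (\<exists>u\<in>Units S. \<exists>e::nat. f divides (c \<ominus> u \<otimes> q [^] e))}"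
 have qS: "q \<in> carrier S" using q m_carr by blast
 have "{c \<in> ?bad. \<not> f divides c} \<subseteq> PIdl f"
 proof (rule ideal_nakayama[OF _ cgenideal_ideal[OF f] q])
  fix x assume x: "x \<in> {c \<in> ?bad. \<not> f divides c}" "x \<notin> PIdl f"
  have xS: "x \<in> carrier S" using x by blast
  have "x \<in> m"
  proof (rule ccontr)
   assume "x \<notin> m"
   hence "x \<in> Units S" by (rule unit_outside[OF xS])
   moreover have "f divides (x \<ominus> x \<otimes> q [^] (0::nat))" using xS dvd_zero[OF f] by (simp add: a_minus_def r_neg)
   ultimately show False using x by blast
  qed
  then obtain a b where ab: "a \<in> carrier S" "b \<in> carrier S" "x = f \<otimes> a \<oplus> q \<otimes> b" using gen by blast
  have fa: "f divides f \<otimes> a" using ab(1) by (rule dvdI) simp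
  have nb: "\<not> f divides b"
  proof
   assume "f divides b"
   hence "f divides x" unfolding ab(3) using dvd_add[OF f fa] dvd_mult[OF f qS] by blast
   thus False using x by blast
  qed
  have "b \<in> ?bad"
  proof (intro CollectI conjI ab(2) notI)
   assume "\<exists>u\<in>Units S. \<exists>e::nat. f divides (b \<ominus> u \<otimes> q [^] e)"
   then obtain u and e :: nat where u: "u \<in> Units S" "f divides (b \<ominus> u \<otimes> q [^] e)" by blast
   have pS: "q [^] e \<in> carrier S" "u \<in> carrier S" using qS u by auto
   have "x \<ominus> u \<otimes> q [^] Suc e = f \<otimes> a \<oplus> q \<otimes> (b \<ominus> u \<otimes> q [^] e)"
    unfolding ab(3) nat_pow_Suc using f ab pS qS by algebra
   hence "f divides (x \<ominus> u \<otimes> q [^] Suc e)" using dvd_add[OF f fa dvd_mult[OF f qS u(2)]] by simp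
   thus False using x u(1) by blast
  qed
  moreover have "f \<otimes> a \<in> PIdl f" using PIdl_iff_dvd[OF f] fa by blast
  ultimately show "\<exists>b\<in>PIdl f. \<exists>y\<in>{c \<in> ?bad. \<not> f divides c}. y \<notin> PIdl f \<and> x = b \<oplus> q \<otimes> y"
   using ab(3) nb PIdl_iff_dvd[OF f] by blast
 qed blast
 thus ?thesis using c PIdl_iff_dvd[OF f] by blast
qed

end

context noetherian_local
begin

lemma prime_ideal_sub_m: "primeideal P S ==> P \<subseteq> m"
 by (rule proper_ideal_sub_m) (use primeideal.axioms(1) primeideal.I_notcarr ideal.one_imp_carrier in metis)+

lemma ideal_mult_stable_zero:
 assumes I: "ideal I S" and t: "t \<in> m" and step: "\<And>x. x \<in> I ==> \<exists>y\<in>I. x = t \<otimes> y"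
 shows "I = {\<zero>}"
proof -
 have Ic: "x \<in> carrier S" if "x \<in> I" for x using ideal.Icarr[OF I that] .
 have tS: "t \<in> carrier S" using t m_carr by blast
 have "I \<subseteq> {\<zero>}"
 proof (rule ideal_nakayama[OF _ zeroideal t])
  fix x assume x: "x \<in> I" "x \<notin> {\<zero>}"
  obtain y where y: "y \<in> I" "x = t \<otimes> y" using step[OF x(1)] by blast
  hence "y \<noteq> \<zero>" using x(2) tS by auto
  moreover have "x = \<zero> \<oplus> t \<otimes> y" using y Ic tS by simp
  ultimately show "\<exists>b\<in>{\<zero>}. \<exists>y\<in>I. y \<notin> {\<zero>} \<and> x = b \<oplus> t \<otimes> y" using y(1) by blast
 qed (use Ic in blast)
 thus ?thesis using additive_subgroup.zero_closed[OF ideal.axioms(1)[OF I]] by blast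
qed

text \<open>If \<open>x = a y\<close> is in \<open>P\<close>, then so is \<open>y\<close>; hence \<open>P = a P\<close>, and Nakayama's lemma applies.\<close>
lemma prime_ideal_in_principal:
 assumes P: "primeideal P S" and a: "a \<in> m" "a \<notin> P" and sub: "\<And>x. x \<in> P ==> a divides x"
 shows "P = {\<zero>}"
proof (rule ideal_mult_stable_zero[OF primeideal.axioms(1)[OF P] a(1)])
 fix x assume x: "x \<in> P"
 obtain y where y: "y \<in> carrier S" "x = a \<otimes> y" using sub[OF x] by (rule dvdE)
 hence "y \<in> P" using primeideal.I_prime[OF P m_carr[OF a(1)] y(1)] x a(2) by blast
 thus "\<exists>y\<in>P. x = a \<otimes> y" using y by blast
qed

text \<open>Write \<open>f = p a + q b\<close> with the given generators. One of \<open>a\<close> and \<open>b\<close> is a unit since \<open>f\<close> is not in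
 the square of the maximal ideal, so \<open>f\<close> can replace one of the generators.\<close>
lemma second_generator:
 assumes A: "A \<subseteq> carrier S" "card A = 2" "m = Idl A"
  and f: "f \<in> m" "f \<notin> ideal_pow S m 2"
 shows "\<exists>q\<in>m. \<forall>x\<in>m. \<exists>a\<in>carrier S. \<exists>b\<in>carrier S. x = f \<otimes> a \<oplus> q \<otimes> b"
proof -
 obtain p q where pq: "A = {p, q}" using A(2) by (auto simp: card_2_iff)
 have c: "p \<in> carrier S" "q \<in> carrier S" using A(1) pq by auto
 have pqm: "p \<in> m" "q \<in> m" using genideal_self[OF A(1)] A(3) pq by auto
 have gen: "\<exists>a\<in>carrier S. \<exists>b\<in>carrier S. x = p \<otimes> a \<oplus> q \<otimes> b" if x: "x \<in> m" for x
 proof -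
  have "m \<subseteq> PIdl p <+> PIdl q" unfolding A(3)
  proof (rule genideal_minimal)
   show "ideal (PIdl p <+> PIdl q) S" using c by (intro add_ideals cgenideal_ideal)
   have "p = p \<oplus> \<zero>" "q = \<zero> \<oplus> q" "p \<in> PIdl p" "q \<in> PIdl q" "\<zero> \<in> PIdl p" "\<zero> \<in> PIdl q"
    using c cgenideal_self additive_subgroup.zero_closed[OF ideal.axioms(1)[OF cgenideal_ideal]] by auto
   thus "A \<subseteq> PIdl p <+> PIdl q" unfolding pq set_add_def' by blast
  qed
  then obtain y z where "y \<in> PIdl p" "z \<in> PIdl q" "x = y \<oplus> z" using x unfolding set_add_def' by blast
  thus ?thesis using PIdl_iff_dvd c by (metis dvdE)
 qed
 have sq: "a \<otimes> b \<in> ideal_pow S m 2" if "a \<in> m" "b \<in> m" for a b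
 proof -
  have "\<one> \<otimes> a \<otimes> b \<in> (carrier S \<cdot> m) \<cdot> m" using that by (intro ideal_prod.prod) auto
  thus ?thesis using m_carr that by (simp add: ideal_pow_def nat_pow_def ideals_set_def numeral_2_eq_2)
 qed
 have sqa: "a \<oplus> b \<in> ideal_pow S m 2" if "a \<in> ideal_pow S m 2" "b \<in> ideal_pow S m 2" for a b
  using that ideal_prod.sum by (simp add: ideal_pow_def nat_pow_def ideals_set_def numeral_2_eq_2)
 have main: "\<exists>q\<in>m. \<forall>x\<in>m. \<exists>a\<in>carrier S. \<exists>b\<in>carrier S. x = f \<otimes> a \<oplus> q \<otimes> b"
  if p: "p \<in> m" and q: "q \<in> m" and f: "f = p \<otimes> a \<oplus> q \<otimes> b" and ab: "a \<in> Units S" "b \<in> carrier S"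
   and gen: "\<And>x. x \<in> m ==> \<exists>c\<in>carrier S. \<exists>d\<in>carrier S. x = p \<otimes> c \<oplus> q \<otimes> d" for p q a b
 proof (rule bexI[OF _ q], rule ballI)
  fix x assume "x \<in> m"
  then obtain c d where cd: "c \<in> carrier S" "d \<in> carrier S" "x = p \<otimes> c \<oplus> q \<otimes> d" using gen by blast
  have S: "p \<in> carrier S" "q \<in> carrier S" "a \<in> carrier S" "inv a \<in> carrier S" using p q m_carr ab by auto
  have ai: "inv a \<otimes> a = \<one>" by (rule Units_l_inv[OF ab(1)])
  have "f \<otimes> (inv a \<otimes> c) \<oplus> q \<otimes> (d \<ominus> b \<otimes> (inv a \<otimes> c)) = p \<otimes> c \<otimes> (inv a \<otimes> a) \<oplus> q \<otimes> d"
   unfolding f using S cd(1,2) ab(2) by algebra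
  also have "\<dots> = x" unfolding ai cd(3) using S cd by simp
  finally have "x = f \<otimes> (inv a \<otimes> c) \<oplus> q \<otimes> (d \<ominus> b \<otimes> (inv a \<otimes> c))" by simp
  moreover have "inv a \<otimes> c \<in> carrier S" "d \<ominus> b \<otimes> (inv a \<otimes> c) \<in> carrier S" using S cd ab by auto
  ultimately show "\<exists>a\<in>carrier S. \<exists>b\<in>carrier S. x = f \<otimes> a \<oplus> q \<otimes> b" by blast
 qed
 obtain a b where ab: "a \<in> carrier S" "b \<in> carrier S" "f = p \<otimes> a \<oplus> q \<otimes> b" using gen[OF f(1)] by blast
 have "a \<notin> m \<or> b \<notin> m" using sq[OF pqm(1)] sq[OF pqm(2)] sqa ab(3) f(2) by blast
 thus ?thesis
 proof
  assume "a \<notin> m"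
  thus ?thesis by (intro main[OF pqm ab(3) _ ab(2) gen] unit_outside ab(1))
 next
  assume "b \<notin> m"
  hence b: "b \<in> Units S" by (rule unit_outside[OF ab(2)])
  have e: "f = q \<otimes> b \<oplus> p \<otimes> a" using ab c by (simp add: a_comm)
  have gen': "\<exists>c\<in>carrier S. \<exists>d\<in>carrier S. x = q \<otimes> c \<oplus> p \<otimes> d" if x: "x \<in> m" for x
  proof -
   obtain u v where u: "u \<in> carrier S" "v \<in> carrier S" "x = p \<otimes> u \<oplus> q \<otimes> v" using gen[OF x] by blast
   hence "x = q \<otimes> v \<oplus> p \<otimes> u" using c by (simp add: a_comm)
   thus ?thesis using u by blast
  qed
  show ?thesis by (rule main[OF pqm(2,1) e b ab(1) gen'])
 qed
qed

lemma chain_of_primes: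
 assumes "krull_dim S = 2"
 obtains P0 P1 P2 where "primeideal P0 S" "primeideal P1 S" "primeideal P2 S" "P0 \<subset> P1" "P1 \<subset> P2"
proof -
 let ?C = "\<lambda>l. \<exists>P :: nat => 'a set. (\<forall>i\<le>l. primeideal (P i) S) \<and> (\<forall>i<l. P i \<subset> P (Suc i))"
 have "\<exists>l\<ge>2. ?C l"
 proof (rule ccontr)
  assume c: "\<not> ?thesis"
  have "krull_dim S \<le> enat 1" unfolding krull_dim_def
  proof (rule Sup_least)
   fix y assume "y \<in> {enat l | l. ?C l}"
   then obtain l where l: "y = enat l" "?C l" by blast
   hence "\<not> 2 \<le> l" using c by meson
   thus "y \<le> enat 1" using l(1) by simp
  qed
  thus False using assms by (simp add: numeral_eq_enat)
 qed
 then obtain l and P :: "nat => 'a set" where l: "2 \<le> l" "\<forall>i\<le>l. primeideal (P i) S" "\<forall>i<l. P i \<subset> P (Suc i)" by blast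
 show thesis
  by (rule that[of "P 0" "P 1" "P 2"]) (use l in \<open>auto simp: numeral_2_eq_2\<close>)
qed

text \<open>Take a chain of primes \<open>P\<^sub>0 \<subset> P\<^sub>1 \<subset> P\<^sub>2\<close>. The prime \<open>P\<^sub>1\<close> is principal: it is \<open>(f)\<close> if it contains \<open>f\<close>,
 and otherwise it is generated by an element \<open>u q\<^sup>e + f s\<close> with the least exponent \<open>e\<close>. Its generator
 is not in \<open>P\<^sub>0\<close>, so \<open>P\<^sub>0 = 0\<close> by the preceding lemmas. If \<open>f\<close> divided \<open>q\<close>, then \<open>f\<close> would divide every
 element of \<open>P\<^sub>1\<close>, and \<open>P\<^sub>1\<close> would be zero.\<close>
lemma domain_if_dim_two:
 assumes dim: "krull_dim S = 2" and f: "f \<in> m" and q: "q \<in> m"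
  and gen: "\<And>x. x \<in> m ==> \<exists>a\<in>carrier S. \<exists>b\<in>carrier S. x = f \<otimes> a \<oplus> q \<otimes> b"
 shows "domain S" "\<not> f divides q"
proof -
 obtain P0 P1 P2 where P: "primeideal P0 S" "primeideal P1 S" "primeideal P2 S" "P0 \<subset> P1" "P1 \<subset> P2"
  using chain_of_primes[OF dim] .
 interpret P0: primeideal P0 S by (rule P)
 interpret P1: primeideal P1 S by (rule P)
 have fS: "f \<in> carrier S" and qS: "q \<in> carrier S" using f q m_carr by auto
 have P1m: "P1 \<subset> m" using P(5) prime_ideal_sub_m[OF P(3)] by blast
 have not_both: "\<not> (f \<in> P1 \<and> q \<in> P1)"
 proof
  assume fq: "f \<in> P1 \<and> q \<in> P1"
  have "m \<subseteq> P1"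
  proof
   fix x assume "x \<in> m"
   then obtain a b where "a \<in> carrier S" "b \<in> carrier S" "x = f \<otimes> a \<oplus> q \<otimes> b" using gen by blast
   thus "x \<in> P1" using fq P1.I_r_closed P1.a_closed by auto
  qed
  thus False using P1m by blast
 qed
 have P1z: "P1 \<noteq> {\<zero>}" using P(4) P0.zero_closed by blast
 show "\<not> f divides q"
 proof
  assume d: "f divides q"
  have "f \<notin> P1"
  proof
   assume fP: "f \<in> P1"
   obtain c where c: "c \<in> carrier S" "q = f \<otimes> c" using d by (rule dvdE)
   have "q \<in> P1" unfolding c(2) by (rule P1.I_r_closed[OF fP c(1)])
   thus False using fP not_both by blast
  qed
  moreover have "f divides x" if x: "x \<in> P1" for x
  proof -
   have "x \<in> m" using x P1m by blast
   then obtain a b where ab: "a \<in> carrier S" "b \<in> carrier S" "x = f \<otimes> a \<oplus> q \<otimes> b" using gen by blast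
   show ?thesis unfolding ab(3)
    using dvd_add[OF fS dvd_mult2[OF fS fS ab(1) dvd_refl[OF fS]] dvd_mult2[OF fS qS ab(2) d]] .
  qed
  ultimately show False using prime_ideal_in_principal[OF P(2) f] P1z by blast
 qed
 have q_P1: "q \<in> P1" if "q [^] e \<in> P1" for e :: nat using that
 proof (induction e)
  case 0
  hence "P1 = carrier S" using P1.one_imp_carrier by simp
  thus ?case using P1.I_notcarr by simp
 next
  case (Suc e) thus ?case using P1.I_prime[of "q [^] e" q] qS by auto
 qed
 have val: "\<exists>u\<in>Units S. \<exists>e::nat. \<exists>s\<in>carrier S. c = u \<otimes> q [^] e \<oplus> f \<otimes> s"
  if c: "c \<in> carrier S" "\<not> f divides c" for c
 proof -
  obtain u and e :: nat where u: "u \<in> Units S" "f divides (c \<ominus> u \<otimes> q [^] e)" using valuation_step[OF fS q gen c] by blast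
  obtain s where s: "s \<in> carrier S" "c \<ominus> u \<otimes> q [^] e = f \<otimes> s" using u(2) by (rule dvdE)
  have "u \<otimes> q [^] e \<in> carrier S" using u(1) qS by auto
  hence "c = u \<otimes> q [^] e \<oplus> (c \<ominus> u \<otimes> q [^] e)" using c(1) by (simp add: a_minus_def a_ac r_neg1 r_neg)
  thus ?thesis using s u(1) by metis
 qed
 have "\<exists>a\<in>P1. \<forall>x\<in>P1. a divides x"
 proof (cases "f \<in> P1")
  case True
  have "f divides x" if x: "x \<in> P1" for x
  proof (rule ccontr)
   assume "\<not> f divides x"
   then obtain u s and e :: nat where u: "u \<in> Units S" "s \<in> carrier S" "x = u \<otimes> q [^] e \<oplus> f \<otimes> s"
    using val P1.Icarr[OF x] by blast
   have uS: "u \<in> carrier S" "inv u \<in> carrier S" "inv u \<otimes> u = \<one>" "q [^] e \<in> carrier S" using u(1) qS by auto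
   have fs: "f \<otimes> s \<in> P1" by (rule P1.I_r_closed[OF True u(2)])
   have "u \<otimes> q [^] e = x \<ominus> f \<otimes> s" unfolding u(3) using uS fS u(2) by (simp add: a_minus_def a_assoc r_neg)
   also have "\<dots> \<in> P1" unfolding a_minus_def by (rule P1.a_closed[OF x P1.a_inv_closed[OF fs]])
   finally have "inv u \<otimes> (u \<otimes> q [^] e) \<in> P1" by (rule P1.I_l_closed[OF _ uS(2)])
   hence "q [^] e \<in> P1" using uS by (simp flip: m_assoc)
   thus False using q_P1 True not_both by blast
  qed
  thus ?thesis using True by blast
 next
  case False
  have "\<exists>x\<in>P1. \<not> f divides x" using prime_ideal_in_principal[OF P(2) f False] P1z by blast
  then obtain x0 where x0: "x0 \<in> P1" "\<not> f divides x0" by blast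
  \<comment> \<open>The exponents of the elements of \<open>P\<^sub>1\<close> that \<open>f\<close> does not divide.\<close>
  define E where "E e \<longleftrightarrow> (\<exists>u\<in>Units S. \<exists>s\<in>carrier S. u \<otimes> q [^] e \<oplus> f \<otimes> s \<in> P1)" for e :: nat
  have "\<exists>e. E e" using val[OF P1.Icarr[OF x0(1)] x0(2)] x0(1) unfolding E_def by metis
  define e where "e = (LEAST e. E e)"
  have Ee: "E e" and least: "\<And>k. E k ==> e \<le> k" unfolding e_def using \<open>\<exists>e. E e\<close> by (auto intro: LeastI_ex Least_le)
  obtain u s where u: "u \<in> Units S" "s \<in> carrier S" "u \<otimes> q [^] e \<oplus> f \<otimes> s \<in> P1" using Ee unfolding E_def by blast
  let ?a = "u \<otimes> q [^] e \<oplus> f \<otimes> s"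
  have uS: "u \<in> carrier S" "inv u \<in> carrier S" "inv u \<otimes> u = \<one>" "q [^] e \<in> carrier S" using u(1) qS by auto
  have aS: "?a \<in> carrier S" using P1.Icarr[OF u(3)] .
  \<comment> \<open>Subtracting a multiple of \<open>?a\<close> makes an element of \<open>P\<^sub>1\<close> divisible by \<open>f\<close>, and the quotient
    is in \<open>P\<^sub>1\<close> again. So \<open>P\<^sub>1 = (?a) + f P\<^sub>1\<close>, and Nakayama's lemma applies.\<close>
  have red: "\<exists>b\<in>PIdl ?a. \<exists>y\<in>P1. x = b \<oplus> f \<otimes> y" if x: "x \<in> P1" for x
  proof -
   have xS: "x \<in> carrier S" using P1.Icarr[OF x] .
   have "\<exists>r\<in>carrier S. f divides (x \<ominus> r \<otimes> ?a)"
   proof (cases "f divides x")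
    case True thus ?thesis using xS aS by (intro bexI[of _ \<zero>]) (auto simp: a_minus_def)
   next
    case False
    then obtain v t and k :: nat where v: "v \<in> Units S" "t \<in> carrier S" "x = v \<otimes> q [^] k \<oplus> f \<otimes> t"
     using val[OF xS] by blast
    have ek: "e \<le> k" using least[of k] x v unfolding E_def by blast
    let ?r = "v \<otimes> inv u \<otimes> q [^] (k - e)"
    have vS: "v \<in> carrier S" "q [^] (k - e) \<in> carrier S" using v(1) qS by auto
    have "q [^] k = q [^] (k - e) \<otimes> q [^] e" using ek qS by (simp add: nat_pow_mult)
    hence xe: "x = v \<otimes> (q [^] (k - e) \<otimes> q [^] e) \<oplus> f \<otimes> t" using v(3) by simp
    have "?r \<otimes> ?a = v \<otimes> (inv u \<otimes> u) \<otimes> (q [^] (k - e) \<otimes> q [^] e) \<oplus> f \<otimes> (?r \<otimes> s)"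
     using vS uS(1,2,4) fS u(2) by algebra
    hence rae: "?r \<otimes> ?a = v \<otimes> (q [^] (k - e) \<otimes> q [^] e) \<oplus> f \<otimes> (?r \<otimes> s)"
     unfolding uS(3) using vS(1) by simp
    have "x \<ominus> ?r \<otimes> ?a = (v \<otimes> (q [^] (k - e) \<otimes> q [^] e) \<oplus> f \<otimes> t)
      \<ominus> (v \<otimes> (q [^] (k - e) \<otimes> q [^] e) \<oplus> f \<otimes> (?r \<otimes> s))" unfolding rae unfolding xe ..
    also have "\<dots> = f \<otimes> (t \<ominus> ?r \<otimes> s)" using vS uS(1,2,4) fS u(2) v(2) by algebra
    finally have "f divides (x \<ominus> ?r \<otimes> ?a)" using vS uS u(2) v(2) by (intro dvdI) auto
    moreover have "?r \<in> carrier S" using vS uS by simp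
    ultimately show ?thesis by blast
   qed
   then obtain r where r: "r \<in> carrier S" "f divides (x \<ominus> r \<otimes> ?a)" by blast
   obtain y where y: "y \<in> carrier S" "x \<ominus> r \<otimes> ?a = f \<otimes> y" using r(2) by (rule dvdE)
   have ra: "r \<otimes> ?a \<in> P1" by (rule P1.I_l_closed[OF u(3) r(1)])
   have "x \<ominus> r \<otimes> ?a \<in> P1" unfolding a_minus_def by (rule P1.a_closed[OF x P1.a_inv_closed[OF ra]])
   hence "y \<in> P1" using P1.I_prime[OF fS y(1)] y(2) False by simp
   moreover have "x = r \<otimes> ?a \<oplus> (x \<ominus> r \<otimes> ?a)"
    using xS P1.Icarr[OF ra] by (simp add: a_minus_def a_ac r_neg1 r_neg)
   hence "x = r \<otimes> ?a \<oplus> f \<otimes> y" using y(2) by simp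
   moreover have "r \<otimes> ?a \<in> PIdl ?a" unfolding cgenideal_def using r(1) by blast
   ultimately show ?thesis by blast
  qed
  have "P1 \<subseteq> PIdl ?a"
  proof (rule ideal_nakayama[OF _ cgenideal_ideal[OF aS] f])
   fix x assume x: "x \<in> P1" "x \<notin> PIdl ?a"
   obtain b y where y: "b \<in> PIdl ?a" "y \<in> P1" "x = b \<oplus> f \<otimes> y" using red[OF x(1)] by blast
   have "y \<notin> PIdl ?a"
   proof
    assume "y \<in> PIdl ?a"
    hence "x \<in> PIdl ?a" unfolding y(3)
     using additive_subgroup.a_closed[OF ideal.axioms(1)[OF cgenideal_ideal[OF aS]] y(1)]
      ideal.I_l_closed[OF cgenideal_ideal[OF aS] _ fS] by blast
    thus False using x(2) by blast
   qed
   thus "\<exists>b\<in>PIdl ?a. \<exists>y\<in>P1. y \<notin> PIdl ?a \<and> x = b \<oplus> f \<otimes> y" using y by blast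
  qed (use P1.Icarr in blast)
  thus ?thesis using u(3) PIdl_iff_dvd[OF aS] by blast
 qed
 then obtain a where a: "a \<in> P1" "\<forall>x\<in>P1. a divides x" by blast
 have "a \<notin> P0"
 proof
  assume aP: "a \<in> P0"
  have "x \<in> P0" if x: "x \<in> P1" for x
  proof -
   obtain c where c: "c \<in> carrier S" "x = a \<otimes> c" using a(2) x by (auto elim: dvdE)
   show ?thesis unfolding c(2) by (rule P0.I_r_closed[OF aP c(1)])
  qed
  thus False using P(4) by blast
 qed
 hence "P0 = {\<zero>}" using prime_ideal_in_principal[OF P(1), of a] a P(4) P1m by blast
 hence "primeideal {\<zero>} S" using P(1) by simp
 thus "domain S" by (rule zeroprimeideal_domainI)
qed

end

section \<open>The theorem\<close>

lemma (in domain) finprod_nonzero: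
 "finite I ==> (\<And>i. i \<in> I ==> h i \<in> carrier R \<and> h i \<noteq> \<zero>) ==> (\<Otimes>i\<in>I. h i) \<noteq> \<zero>"
proof (induction I rule: finite_induct)
 case (insert i I)
 have c: "h \<in> I \<rightarrow> carrier R" "h i \<in> carrier R" using insert.prems by auto
 have "(\<Otimes>i\<in>insert i I. h i) = h i \<otimes> (\<Otimes>i\<in>I. h i)" by (rule finprod_insert[OF insert.hyps c])
 moreover have "h i \<noteq> \<zero>" "(\<Otimes>i\<in>I. h i) \<noteq> \<zero>" using insert by auto
 ultimately show ?case using c(2) finprod_closed[OF c(1)] by (simp add: integral_iff)
qed simp

lemma (in cring) reduced_quotientD:
 assumes F: "F \<in> carrier R" and red: "reduced_ring (R Quot PIdl F)"
  and x: "x \<in> carrier R" "F divides x \<otimes> x"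
 shows "F divides x"
proof -
 interpret quot R F using F by unfold_locales
 have "cos F x [^]\<^bsub>RR\<^esub> (2::nat) = cos F (x \<otimes> x)"
  using cring.axioms(1)[OF RR_cring] x(1) by (simp add: numeral_2_eq_2 monoid.nat_pow_Suc ring.is_monoid cosF(2) monoid.l_one monoid.nat_pow_0)
 also have "\<dots> = cos F \<zero>" using cos_eq_iff[OF F, of "x \<otimes> x" \<zero>] x by (simp add: a_minus_def)
 finally have "cos F x [^]\<^bsub>RR\<^esub> (2::nat) = \<zero>\<^bsub>RR\<^esub>" using cosF(3) by simp
 hence "cos F x = \<zero>\<^bsub>RR\<^esub>" using red cosF_closed[OF x(1)] unfolding reduced_ring_def by blast
 hence "cos F x = cos F \<zero>" using cosF(3) by simp
 thus ?thesis using cos_eq_iff[OF F x(1), of \<zero>] x by (simp add: a_minus_def)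
qed

text \<open>If \<open>f i\<close> divides \<open>f j\<close>, then these primes are associated, so the square of \<open>x = F/f j\<close> is divisible
 by \<open>F\<close>, although \<open>x\<close> is not.\<close>
lemma (in noetherian_local) reduced_imp_coprime:
 assumes dom: "domain S" and I: "finite I" and fm: "\<And>i. i \<in> I ==> f i \<in> m"
  and prime: "\<And>i. i \<in> I ==> ring_prime (f i)"
  and red: "reduced_ring (S Quot PIdl (\<Otimes>i\<in>I. f i))"
  and ij: "i \<in> I" "j \<in> I" "i \<noteq> j"
 shows "\<not> f i divides f j"
proof
 assume d: "f i divides f j"
 interpret dom: domain S by (rule dom)
 have fS: "f k \<in> carrier S" if "k \<in> I" for k using fm m_carr that by blast
 have nz: "f k \<noteq> \<zero>" if "k \<in> I" for k using prime[OF that] by (simp add: ring_prime_def)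
 obtain r where r: "r \<in> carrier S" "f j = f i \<otimes> r" using d by (rule dvdE)
 have one_case: False if s: "s \<in> carrier S" and t: "t \<in> m" and y: "y \<in> carrier S" "y \<noteq> \<zero>" "y = y \<otimes> (t \<otimes> s)" for s t y
 proof -
  have ts: "t \<otimes> s \<in> m" by (rule m_mult[OF t s])
  have "y \<ominus> (t \<otimes> s) \<otimes> y = y \<otimes> (t \<otimes> s) \<ominus> (t \<otimes> s) \<otimes> y" using y(3) by simp
  also have "\<dots> = \<zero>" using y(1) m_carr[OF t] s by algebra
  finally have "y \<in> {\<zero>}" using cancel_one_minus[OF zeroideal ts y(1)] by simp
  thus False using y(2) by simp
 qed
 have "f j divides f i"
 proof -
  have "f j divides f i \<otimes> r" using r dvd_refl[OF fS[OF ij(2)]] by simp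
  hence "f j divides f i \<or> f j divides r" using prime[OF ij(2)] fS[OF ij(1)] r(1) by (auto simp: ring_prime_def prime_def)
  moreover have False if "f j divides r"
  proof -
   obtain s where s: "s \<in> carrier S" "r = f j \<otimes> s" using \<open>f j divides r\<close> by (rule dvdE)
   have "f j = f j \<otimes> (f i \<otimes> s)" using r(2) unfolding s(2) using fS[OF ij(1)] fS[OF ij(2)] s(1) m_lcomm[of "f i" "f j" s] by simp
   thus False using one_case[OF s(1) fm[OF ij(1)] fS[OF ij(2)] nz[OF ij(2)]] by blast
  qed
  ultimately show ?thesis by blast
 qed
 then obtain s where s: "s \<in> carrier S" "f i = f j \<otimes> s" by (rule dvdE)
 let ?J = "I - {i} - {j}" and ?F = "\<Otimes>k\<in>I. f k"
 define h where "h = (\<Otimes>k\<in>?J. f k)"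
 have hS: "h \<in> carrier S" unfolding h_def by (rule finprod_closed) (use fS in auto)
 have hz: "h \<noteq> \<zero>" unfolding h_def by (rule dom.finprod_nonzero) (use I fS nz in auto)
 have "?F = f i \<otimes> (\<Otimes>k\<in>I - {i}. f k)"
  using finprod_insert[of "I - {i}" i f] I fS ij(1) by (simp add: insert_absorb Pi_iff)
 also have "(\<Otimes>k\<in>I - {i}. f k) = f j \<otimes> h"
  unfolding h_def using finprod_insert[of ?J j f] I fS ij by (simp add: insert_absorb Pi_iff)
 finally have F: "?F = f i \<otimes> (f j \<otimes> h)" .
 have c: "f i \<in> carrier S" "f j \<in> carrier S" using fS ij by auto
 let ?x = "f i \<otimes> h"
 have FS: "?F \<in> carrier S" unfolding F using c hS by simp
 have xS: "?x \<in> carrier S" using c hS by simp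
 have "?x \<otimes> ?x = ?F \<otimes> (s \<otimes> h)"
 proof -
  have "?x \<otimes> ?x = f i \<otimes> h \<otimes> (f j \<otimes> s \<otimes> h)" using s(2) by simp
  also have "\<dots> = ?F \<otimes> (s \<otimes> h)" unfolding F using c hS s(1) by algebra
  finally show ?thesis .
 qed
 hence "?F divides ?x \<otimes> ?x" using s(1) hS by (intro dvdI) auto
 hence "?F divides ?x" by (rule reduced_quotientD[OF FS red xS])
 then obtain y where y: "y \<in> carrier S" "?x = ?F \<otimes> y" by (rule dvdE)
 have "?F \<otimes> y = ?x \<otimes> (f j \<otimes> y)" unfolding F using c hS y(1) by algebra
 hence "?x = ?x \<otimes> (f j \<otimes> y)" using y(2) by metis
 moreover have "?x \<noteq> \<zero>" using hz nz[OF ij(1)] c hS by (simp add: dom.integral_iff)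
 ultimately show False using one_case[OF y(1) fm[OF ij(2)] xS] by blast
qed

theorem theorem4p7:
 fixes S :: "('a, 's) ring_scheme" and R :: "'a set ring"
  and n :: nat and f :: "nat \<Rightarrow> 'a" and \<omega> :: "nat \<Rightarrow> nat"
 assumes "regular_local_ring S"
  and "complete_local_ring S"
  and "krull_dim S = 2"
  and "\<And>i. i \<in> {1..n} \<Longrightarrow> f i \<in> carrier S"
  and "\<And>i. i \<in> {1..n} \<Longrightarrow> ring_prime\<^bsub>S\<^esub> (f i)"
  and "\<And>i. i \<in> {1..n} \<Longrightarrow> f i \<notin> ideal_pow S (max_ideal S) 2"
  and "R = S Quot (PIdl\<^bsub>S\<^esub> (\<Otimes>\<^bsub>S\<^esub>i\<in>{1..n}. f i))"
  and "reduced_ring R"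
  and "\<omega> permutes {1..n}"
 shows "cluster_tilting TYPE('x) R (S_perm S n f \<omega>) \<and> basic_module R (S_perm S n f \<omega>)"
proof -
 let ?m = "max_ideal S"
 have loc: "cring S" "\<exists>!I. maximalideal I S" and noeth: "noetherian_ring S"
  using assms(1) by (auto simp: regular_local_ring_def local_ring_def)
 have max: "maximalideal ?m S" unfolding max_ideal_def by (rule theI'[OF loc(2)])
 interpret noetherian_local S ?m
  by (intro noetherian_local.intro noetherian_local_axioms.intro loc noeth max) (use loc(2) max in blast)
 show ?thesis
 proof (cases "n = 0")
  case True
  have R: "R = S Quot (PIdl\<^bsub>S\<^esub> \<one>\<^bsub>S\<^esub>)" using assms(7) True by simp
  interpret quot S "\<one>\<^bsub>S\<^esub>" by unfold_locales simp
  have "\<one>\<^bsub>R\<^esub> = \<zero>\<^bsub>R\<^esub>" unfolding R using cosF_F cosF(4) by simp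
  moreover have "module R (S_perm S n f \<omega>)" unfolding S_perm_def R
   by (rule direct_sum_module[OF RR_cring]) (use True in simp)
  ultimately show ?thesis by (rule zero_ring_case)
 next
  case False
  hence n: "1 \<le> n" by simp
  have fm: "f i \<in> ?m" if "i \<in> {1..n}" for i
   using unit_outside[OF assms(4)[OF that]] assms(5)[OF that] by (auto simp: ring_prime_def prime_def)
  obtain A where A: "A \<subseteq> carrier S" "finite A" "enat (card A) = krull_dim S" "?m = Idl\<^bsub>S\<^esub> A"
   using assms(1) by (auto simp: regular_local_ring_def)
  have A2: "card A = 2" using A(3) assms(3) by (simp add: numeral_eq_enat)
  have "\<forall>i\<in>{1..n}. \<exists>q\<in>?m. \<forall>x\<in>?m. \<exists>a\<in>carrier S. \<exists>b\<in>carrier S. x = f i \<otimes>\<^bsub>S\<^esub> a \<oplus>\<^bsub>S\<^esub> q \<otimes>\<^bsub>S\<^esub> b"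
   using second_generator[OF A(1) A2 A(4) fm assms(6)] by blast
  then obtain q where q: "\<And>i. i \<in> {1..n} ==> q i \<in> ?m"
   and gen: "\<And>i x. i \<in> {1..n} ==> x \<in> ?m ==> \<exists>a\<in>carrier S. \<exists>b\<in>carrier S. x = f i \<otimes>\<^bsub>S\<^esub> a \<oplus>\<^bsub>S\<^esub> q i \<otimes>\<^bsub>S\<^esub> b"
   by metis
  have one: "1 \<in> {1..n}" using n by simp
  have dom: "domain S" using domain_if_dim_two(1)[OF assms(3) fm[OF one] q[OF one] gen[OF one]] .
  have red: "reduced_ring (S Quot PIdl\<^bsub>S\<^esub> (\<Otimes>\<^bsub>S\<^esub>i\<in>{1..n}. f i))" using assms(7,8) by simp
  have \<omega>: "\<omega> j \<in> {1..n}" if "j \<in> {1..n}" for j using permutes_in_image[OF assms(9)] that by blast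
  have \<omega>_inj: "\<omega> i = \<omega> j \<longleftrightarrow> i = j" for i j using permutes_inj[OF assms(9)] by (simp add: inj_eq)
  interpret tilt S ?m "\<lambda>j. f (\<omega> j)" "\<lambda>j. q (\<omega> j)" n
  proof (intro tilt.intro tilt_axioms.intro branches.intro branches_axioms.intro)
   show "domain S" by (rule dom)
   show "ideal ?m S" by (rule m_ideal)
   show "\<one>\<^bsub>S\<^esub> \<notin> ?m" by (rule one_notin_m)
   fix x assume "x \<in> carrier S" "x \<notin> ?m" thus "x \<in> Units S" by (rule unit_outside)
  next
   fix j assume j: "j \<in> {1..n}"
   note wj = \<omega>[OF j]
   show "f (\<omega> j) \<in> ?m" by (rule fm[OF wj])
   show "q (\<omega> j) \<in> ?m" by (rule q[OF wj])
   show "f (\<omega> j) \<noteq> \<zero>\<^bsub>S\<^esub>" using assms(5)[OF wj] by (simp add: ring_prime_def)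
   show "\<not> f (\<omega> j) divides\<^bsub>S\<^esub> q (\<omega> j)" using domain_if_dim_two(2)[OF assms(3) fm[OF wj] q[OF wj] gen[OF wj]] .
   show "f (\<omega> j) divides\<^bsub>S\<^esub> a \<or> f (\<omega> j) divides\<^bsub>S\<^esub> b"
    if "a \<in> carrier S" "b \<in> carrier S" "f (\<omega> j) divides\<^bsub>S\<^esub> a \<otimes>\<^bsub>S\<^esub> b" for a b
    using assms(5)[OF wj] that by (auto simp: ring_prime_def prime_def)
   show "\<exists>a\<in>carrier S. \<exists>b\<in>carrier S. x = f (\<omega> j) \<otimes>\<^bsub>S\<^esub> a \<oplus>\<^bsub>S\<^esub> q (\<omega> j) \<otimes>\<^bsub>S\<^esub> b" if "x \<in> ?m" for x
    by (rule gen[OF wj that])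
   show "\<exists>u\<in>Units S. \<exists>e::nat. f (\<omega> j) divides\<^bsub>S\<^esub> (c \<ominus>\<^bsub>S\<^esub> u \<otimes>\<^bsub>S\<^esub> q (\<omega> j) [^]\<^bsub>S\<^esub> e)"
    if "c \<in> carrier S" "\<not> f (\<omega> j) divides\<^bsub>S\<^esub> c" for c
    by (rule valuation_step[OF assms(4)[OF wj] q[OF wj] gen[OF wj] that])
  next
   fix i j assume "i \<in> {1..n}" "j \<in> {1..n}" "i \<noteq> j"
   thus "\<not> f (\<omega> i) divides\<^bsub>S\<^esub> f (\<omega> j)"
    using reduced_imp_coprime[OF dom _ fm assms(5) red \<omega>[of i] \<omega>[of j]] \<omega>_inj by simp
  qed
  have ivl: "{0<..k} = {1..k}" for k :: nat by auto
  have img: "\<omega> ` {1..n} = {1..n}" by (rule permutes_image[OF assms(9)])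
  have "(\<Otimes>\<^bsub>S\<^esub>i\<in>\<omega> ` {1..n}. f i) = (\<Otimes>\<^bsub>S\<^esub>j\<in>{1..n}. f (\<omega> j))"
   by (rule finprod_reindex) (use img assms(4) permutes_inj_on[OF assms(9)] in auto)
  hence R: "R = S Quot (PIdl\<^bsub>S\<^esub> (gp 0 n))" unfolding assms(7) gp_def ivl img by simp
  have "S_perm_i S f \<omega> = Si" by (intro ext) (simp add: S_perm_i_def Si_def gp_def ivl)
  hence T: "S_perm S n f \<omega> = T" by (simp add: S_perm_def T_def)
  show ?thesis unfolding R T using cluster_tilting_T[OF n] basic_T by blast
 qed
qed

end
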